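(* Let $(\mathcal{L},\Delta,S)$ be a locality (for a prime $p$) over $\mathcal{F}$ and $Q\leq S$. (a) Assume that $Q$ is large in $(\mathcal{L},\Delta,S)$ and $(\mathcal{L},\Delta,S)$ is $Q$-replete. Then $Q$ is large in $\mathcal{F}$, we have $\mathcal{F}^c\subseteq\Delta$, and $\mathcal{F}$ is saturated. (b) Suppose $(\mathcal{L},\Delta,S)$ is $Q$-replete and of objective characteristic $p$. Then $Q$ is large in $(\mathcal{L},\Delta,S)$ if and only if $Q$ is large in $\mathcal{F}$. Moreover, if so, then $\mathcal{F}$ is saturated and $(\mathcal{L},\Delta,S)$ is a linking locality over $\mathcal{F}$. (c) If $\mathcal{F}$ is saturated and $Q$ is large in $\mathcal{F}$, then $Q$ is large in any linking locality over $\mathcal{F}$.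
   Context: Partial groups. For a set $\mathcal{L}$ let $\mathbf{W}(\mathcal{L})$ be the set of finite words in $\mathcal{L}$, $\emptyset$ the empty word, $\circ$ concatenation; elements are identified with words of length one. A partial group is a non-empty set $\mathcal{L}$ with a set $\mathbf{D}\subseteq\mathbf{W}(\mathcal{L})$, a map $\Pi\colon\mathbf{D}\to\mathcal{L}$ and an involutory bijection $f\mapsto f^{-1}$ on $\mathcal{L}$, extended to words by $(g_1,\dots,g_k)^{-1}=(g_k^{-1},\dots,g_1^{-1})$, such that for all words $u,v,w$: $\mathcal{L}\subseteq\mathbf{D}$, and $u\circ v\in\mathbf{D}$ implies $u,v\in\mathbf{D}$; $\Pi$ is the identity on $\mathcal{L}$; $u\circ v\circ w\in\mathbf{D}$ implies $u\circ(\Pi(v))\circ w\in\mathbf{D}$ and $\Pi(u\circ v\circ w)=\Pi(u\circ(\Pi(v))\circ w)$; $w\in\mathbf{D}$ implies $w^{-1}\circ w\in\mathbf{D}$ and $\Pi(w^{-1}\circ w)=\mathbf{1}:=\Pi(\emptyset)$. For $f\in\mathcal{L}$ put $\mathbf{D}(f)=\{x\in\mathcal{L}:(f^{-1},x,f)\in\mathbf{D}\}$ and $x^f=\Pi(f^{-1},x,f)$ for $x\in\mathbf{D}(f)$; $X^f=\{x^f:x\in X\}$ for $X\subseteq\mathbf{D}(f)$. A subgroup of $\mathcal{L}$ is a non-empty subset $\mathcal{H}$ closed under inversion with $\mathbf{W}(\mathcal{H})\subseteq\mathbf{D}$ and $\Pi(\mathbf{W}(\mathcal{H}))\subseteq\mathcal{H}$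 (it is then a group); a $p$-subgroup is a subgroup of $p$-power order. Localities. A locality (for a prime $p$) is a triple $(\mathcal{L},\Delta,S)$ with $\mathcal{L}$ a finite partial group, $S$ a $p$-subgroup of $\mathcal{L}$, $\Delta$ a non-empty set of subgroups of $S$, such that: (L1) $S$ is maximal among the $p$-subgroups of $\mathcal{L}$; (L2) $(f_1,\dots,f_n)\in\mathbf{D}$ iff there are $P_0,\dots,P_n\in\Delta$ with $P_{i-1}\subseteq\mathbf{D}(f_i)$ and $P_{i-1}^{f_i}=P_i$ for all $i$; (L3) $\Delta$ is closed under passing to $\mathcal{L}$-conjugates in $S$ and overgroups in $S$. For $g\in\mathcal{L}$, $S_g=\{x\in S: x\in\mathbf{D}(g),\ x^g\in S\}$. For $X\subseteq\mathcal{L}$, $N_{\mathcal{L}}(X)=\{f\in\mathcal{L}:X\subseteq\mathbf{D}(f),\ X^f=X\}$ and $C_{\mathcal{L}}(X)=\{f\in\mathcal{L}:X\subseteq\mathbf{D}(f),\ x^f=x\ \forall x\in X\}$. For $P\in\Delta$, $N_{\mathcal{L}}(P)$ is a subgroup of $\mathcal{L}$. $\mathcal{F}_S(\mathcal{L})$ is the fusion system over $S$ generated by the conjugation maps $c_g\colon S_g\to S$, $g\in\mathcal{L}$; $(\mathcal{L},\Delta,S)$ is a locality over $\mathcal{F}$ if $\mathcal{F}=\mathcal{F}_S(\mathcal{L})$. A finite group $G$ is of characteristic $p$ if $C_G(O_p(G))\leq O_p(G)$. $(\mathcal{L},\Delta,S)$ is of objective characteristic $p$ if $N_{\mathcal{L}}(P)$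 is of characteristic $p$ for every $P\in\Delta$. $\mathcal{F}^c$ is the set of $\mathcal{F}$-centric subgroups ($P\leq S$ with $C_S(P')\leq P'$ for all $\mathcal{F}$-conjugates $P'$ of $P$), and $\mathcal{F}^{cr}$ the set of those $P\in\mathcal{F}^c$ that are $\mathcal{F}$-radical, i.e. $O_p(\mathrm{Aut}_{\mathcal{F}}(P))=\mathrm{Inn}(P)$. A linking locality is a locality $(\mathcal{L},\Delta,S)$ of objective characteristic $p$ such that $\mathcal{F}_S(\mathcal{L})$ is saturated and $\mathcal{F}_S(\mathcal{L})^{cr}\subseteq\Delta$. For $Q\leq S$, $(\mathcal{L},\Delta,S)$ is $Q$-replete if every non-trivial subgroup $P\leq S$ with $Q\leq N_S(P)$ lies in $\Delta$. $Q\leq S$ is large in a locality $(\mathcal{L},\Delta,S)$ if $C_{\mathcal{L}}(Q)\subseteq Q$ and $N_{\mathcal{L}}(U)\subseteq N_{\mathcal{L}}(Q)$ for all $1\neq U\leq Z(Q)$. $Q\leq S$ is large in a fusion system $\mathcal{F}$ over $S$ if $C_S(Q)\leq Q$ and $N_{\mathcal{F}}(U)\subseteq N_{\mathcal{F}}(Q)$ for all $1\neq U\leq Z(Q)$; here $N_{\mathcal{F}}(P)$ is the fusion system over $N_S(P)$ whose morphisms are the $\mathcal{F}$-morphisms $\phi\colon X\to Y$ ($X,Y\leq N_S(P)$) extending to some $\hat\phi\in\mathrm{Hom}_{\mathcal{F}}(XP,YP)$ with $P\hat\phi=P$. *)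

theory Defs
  imports "HOL-Algebra.Group_Action" "HOL-Algebra.Generated_Groups" "HOL-Computational_Algebra.Primes"
begin

section \<open>Finite groups\<close>

text \<open>Subgroups of a group \<open>G\<close> are sets \<open>H\<close> with \<open>subgroup H G\<close>; such a set becomes a group as
  \<open>G\<lparr>carrier := H\<rparr>\<close>. Conjugation acts from the right, \<open>x\<^sup>g = g\<^sup>-\<^sup>1 x g\<close>. Homomorphisms between
  subgroups are extensional functions (undefined off the domain), so that a restriction of a map
  is determined by its values.\<close>

definition gconj :: "('a, 'b) monoid_scheme \<Rightarrow> 'a \<Rightarrow> 'a \<Rightarrow> 'a" where
  "gconj G x g = inv\<^bsub>G\<^esub> g \<otimes>\<^bsub>G\<^esub> x \<otimes>\<^bsub>G\<^esub> g"

definition gcentralizer :: "('a, 'b) monoid_scheme \<Rightarrow> 'a set \<Rightarrow> 'a set" where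
  "gcentralizer G X = {g \<in> carrier G. \<forall>x\<in>X. g \<otimes>\<^bsub>G\<^esub> x = x \<otimes>\<^bsub>G\<^esub> g}"

definition center_of :: "('a, 'b) monoid_scheme \<Rightarrow> 'a set \<Rightarrow> 'a set" where
  "center_of G H = H \<inter> gcentralizer G H"

text \<open>The largest normal \<open>p\<close>-subgroup, as the join of all normal \<open>p\<close>-subgroups.\<close>

definition p_core :: "nat \<Rightarrow> ('a, 'b) monoid_scheme \<Rightarrow> 'a set" where
  "p_core p G = generate G (\<Union>{N. N \<lhd> G \<and> (\<exists>n. card N = p ^ n)})"

definition characteristic_p :: "nat \<Rightarrow> ('a, 'b) monoid_scheme \<Rightarrow> bool" where
  "characteristic_p p G \<longleftrightarrow>
     group G \<and> finite (carrier G) \<and> gcentralizer G (p_core p G) \<subseteq> p_core p G"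

definition sylow_subgroup :: "nat \<Rightarrow> ('a, 'b) monoid_scheme \<Rightarrow> 'a set \<Rightarrow> bool" where
  "sylow_subgroup p G H \<longleftrightarrow> subgroup H G \<and> card H = p ^ multiplicity p (order G)"


section \<open>Fusion systems\<close>

text \<open>A fusion system carries the group \<open>S\<close> it lives over (including its multiplication), and
  \<open>fhom F P R\<close> is the set of morphisms from \<open>P\<close> to \<open>R\<close>, empty unless \<open>P\<close> and \<open>R\<close> are subgroups
  of \<open>S\<close>.\<close>

record 'a fusion =
  fgrp :: "'a monoid"
  fhom :: "'a set \<Rightarrow> 'a set \<Rightarrow> ('a \<Rightarrow> 'a) set"

text \<open>In \<open>isos\<close> the inverse isomorphism is taken from the image; together with inclusions (which
  are instances of \<open>inner\<close> with \<open>g = 1\<close>) this says that every morphism is an isomorphism of the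
  fusion system followed by an inclusion.\<close>

locale fusion_system =
  fixes p :: nat and F :: "'a fusion"
  assumes prime_p: "prime p"
    and group_S: "group (fgrp F)"
    and finite_S: "finite (carrier (fgrp F))"
    and p_group_S: "\<exists>n. order (fgrp F) = p ^ n"
    and objects: "\<phi> \<in> fhom F P R \<Longrightarrow> subgroup P (fgrp F) \<and> subgroup R (fgrp F)"
    and maps: "\<phi> \<in> fhom F P R \<Longrightarrow>
          \<phi> \<in> extensional P \<and> \<phi> \<in> hom (fgrp F\<lparr>carrier := P\<rparr>) (fgrp F\<lparr>carrier := R\<rparr>) \<and> inj_on \<phi> P"
    and inner: "subgroup P (fgrp F) \<Longrightarrow> subgroup R (fgrp F) \<Longrightarrow> g \<in> carrier (fgrp F) \<Longrightarrow>
          (\<forall>x\<in>P. gconj (fgrp F) x g \<in> R) \<Longrightarrow> (\<lambda>x\<in>P. gconj (fgrp F) x g) \<in> fhom F P R"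
    and comp: "\<phi> \<in> fhom F P R \<Longrightarrow> \<psi> \<in> fhom F R T \<Longrightarrow> compose P \<psi> \<phi> \<in> fhom F P T"
    and isos: "\<phi> \<in> fhom F P R \<Longrightarrow>
          \<phi> \<in> fhom F P (\<phi> ` P) \<and> (\<lambda>y\<in>\<phi> ` P. inv_into P \<phi> y) \<in> fhom F (\<phi> ` P) P"

definition fiso :: "'a fusion \<Rightarrow> 'a set \<Rightarrow> 'a set \<Rightarrow> ('a \<Rightarrow> 'a) set" where
  "fiso F P R = {\<phi> \<in> fhom F P R. \<phi> ` P = R}"

definition fconjugate :: "'a fusion \<Rightarrow> 'a set \<Rightarrow> 'a set \<Rightarrow> bool" where
  "fconjugate F P R \<longleftrightarrow> fiso F P R \<noteq> {}"

text \<open>The multiplication of \<open>BijGroup\<close> is composition of left maps, so for right maps the groups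
  below are the opposite groups; Sylow subgroups and \<open>p_core\<close> are unaffected.\<close>

definition Aut_F :: "'a fusion \<Rightarrow> 'a set \<Rightarrow> ('a \<Rightarrow> 'a) monoid" where
  "Aut_F F P = (BijGroup P)\<lparr>carrier := fiso F P P\<rparr>"

definition Aut_S :: "'a fusion \<Rightarrow> 'a set \<Rightarrow> ('a \<Rightarrow> 'a) set" where
  "Aut_S F P = (\<lambda>g. \<lambda>x\<in>P. gconj (fgrp F) x g) ` normalizer (fgrp F) P"

definition Inn :: "'a fusion \<Rightarrow> 'a set \<Rightarrow> ('a \<Rightarrow> 'a) set" where
  "Inn F P = (\<lambda>g. \<lambda>x\<in>P. gconj (fgrp F) x g) ` P"

definition fully_automized :: "nat \<Rightarrow> 'a fusion \<Rightarrow> 'a set \<Rightarrow> bool" where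
  "fully_automized p F P \<longleftrightarrow> sylow_subgroup p (Aut_F F P) (Aut_S F P)"

definition extension_group :: "'a fusion \<Rightarrow> 'a set \<Rightarrow> 'a set \<Rightarrow> ('a \<Rightarrow> 'a) \<Rightarrow> 'a set" where
  "extension_group F R P \<phi> =
     {g \<in> normalizer (fgrp F) R. (\<lambda>y\<in>P. \<phi> (gconj (fgrp F) (inv_into R \<phi> y) g)) \<in> Aut_S F P}"

definition receptive :: "'a fusion \<Rightarrow> 'a set \<Rightarrow> bool" where
  "receptive F P \<longleftrightarrow>
     (\<forall>R \<phi>. subgroup R (fgrp F) \<and> \<phi> \<in> fiso F R P \<longrightarrow>
        (\<exists>\<psi> \<in> fhom F (extension_group F R P \<phi>) (carrier (fgrp F)). restrict \<psi> R = \<phi>))"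

text \<open>Saturation in the form of Aschbacher, Kessar and Oliver.\<close>

definition saturated :: "nat \<Rightarrow> 'a fusion \<Rightarrow> bool" where
  "saturated p F \<longleftrightarrow> fusion_system p F \<and>
     (\<forall>P. subgroup P (fgrp F) \<longrightarrow>
        (\<exists>R. fconjugate F P R \<and> fully_automized p F R \<and> receptive F R))"

definition centric_subgroups :: "'a fusion \<Rightarrow> 'a set set" where
  "centric_subgroups F =
     {P. subgroup P (fgrp F) \<and> (\<forall>R. fconjugate F P R \<longrightarrow> gcentralizer (fgrp F) R \<subseteq> R)}"

definition centric_radical_subgroups :: "nat \<Rightarrow> 'a fusion \<Rightarrow> 'a set set" where
  "centric_radical_subgroups p F =
     {P \<in> centric_subgroups F. p_core p (Aut_F F P) = Inn F P}"

definition normalizer_fusion :: "'a fusion \<Rightarrow> 'a set \<Rightarrow> 'a fusion" where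
  "normalizer_fusion F P =
     \<lparr>fgrp = fgrp F\<lparr>carrier := normalizer (fgrp F) P\<rparr>,
      fhom = (\<lambda>X Y. {\<phi> \<in> fhom F X Y.
        X \<subseteq> normalizer (fgrp F) P \<and> Y \<subseteq> normalizer (fgrp F) P \<and>
        (\<exists>\<psi> \<in> fhom F (X <#>\<^bsub>fgrp F\<^esub> P) (Y <#>\<^bsub>fgrp F\<^esub> P). restrict \<psi> X = \<phi> \<and> \<psi> ` P = P)})\<rparr>"

definition subfusion :: "'a fusion \<Rightarrow> 'a fusion \<Rightarrow> bool" where
  "subfusion E F \<longleftrightarrow>
     carrier (fgrp E) \<subseteq> carrier (fgrp F) \<and> (\<forall>X Y. fhom E X Y \<subseteq> fhom F X Y)"

definition large_in_fusion :: "'a fusion \<Rightarrow> 'a set \<Rightarrow> bool" where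
  "large_in_fusion F Q \<longleftrightarrow>
     subgroup Q (fgrp F) \<and> gcentralizer (fgrp F) Q \<subseteq> Q \<and>
     (\<forall>U. subgroup U (fgrp F) \<and> U \<subseteq> center_of (fgrp F) Q \<and> U \<noteq> {\<one>\<^bsub>fgrp F\<^esub>} \<longrightarrow>
        subfusion (normalizer_fusion F U) (normalizer_fusion F Q))"


section \<open>Partial groups\<close>

record 'a pgroup = "'a partial_object" +
  wdom :: "'a list set"
  wprod :: "'a list \<Rightarrow> 'a"
  pinv :: "'a \<Rightarrow> 'a"

definition word_inv :: "'a pgroup \<Rightarrow> 'a list \<Rightarrow> 'a list" where
  "word_inv L w = rev (map (pinv L) w)"

locale partial_group =
  fixes L :: "'a pgroup"
  assumes nonempty: "carrier L \<noteq> {}"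
    and dom_words: "wdom L \<subseteq> lists (carrier L)"
    and prod_closed: "w \<in> wdom L \<Longrightarrow> wprod L w \<in> carrier L"
    and inv_closed: "f \<in> carrier L \<Longrightarrow> pinv L f \<in> carrier L"
    and inv_inv: "f \<in> carrier L \<Longrightarrow> pinv L (pinv L f) = f"
    and dom_single: "f \<in> carrier L \<Longrightarrow> [f] \<in> wdom L"
    and dom_append: "u @ v \<in> wdom L \<Longrightarrow> u \<in> wdom L \<and> v \<in> wdom L"
    and prod_single: "f \<in> carrier L \<Longrightarrow> wprod L [f] = f"
    and prod_append: "u @ v @ w \<in> wdom L \<Longrightarrow>
          u @ [wprod L v] @ w \<in> wdom L \<and> wprod L (u @ v @ w) = wprod L (u @ [wprod L v] @ w)"
    and prod_inv: "w \<in> wdom L \<Longrightarrow>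
          word_inv L w @ w \<in> wdom L \<and> wprod L (word_inv L w @ w) = wprod L []"

definition conj_dom :: "'a pgroup \<Rightarrow> 'a \<Rightarrow> 'a set" where
  "conj_dom L f = {x \<in> carrier L. [pinv L f, x, f] \<in> wdom L}"

definition pconj :: "'a pgroup \<Rightarrow> 'a \<Rightarrow> 'a \<Rightarrow> 'a" where
  "pconj L x f = wprod L [pinv L f, x, f]"

definition pconj_set :: "'a pgroup \<Rightarrow> 'a set \<Rightarrow> 'a \<Rightarrow> 'a set" where
  "pconj_set L X f = (\<lambda>x. pconj L x f) ` X"

definition partial_subgroup :: "'a pgroup \<Rightarrow> 'a set \<Rightarrow> bool" where
  "partial_subgroup L H \<longleftrightarrow>
     H \<subseteq> carrier L \<and> H \<noteq> {} \<and> (\<forall>h\<in>H. pinv L h \<in> H) \<and>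
     lists H \<subseteq> wdom L \<and> wprod L ` lists H \<subseteq> H"

text \<open>The multiplication is restricted to \<open>H\<close>, so that two partial groups inducing the same group
  structure on \<open>H\<close> give literally equal records.\<close>

definition grp_on :: "'a pgroup \<Rightarrow> 'a set \<Rightarrow> 'a monoid" where
  "grp_on L H = \<lparr>carrier = H, monoid.mult = (\<lambda>x\<in>H. \<lambda>y\<in>H. wprod L [x, y]), one = wprod L []\<rparr>"

definition p_subgroup :: "nat \<Rightarrow> 'a pgroup \<Rightarrow> 'a set \<Rightarrow> bool" where
  "p_subgroup p L H \<longleftrightarrow> partial_subgroup L H \<and> (\<exists>n. card H = p ^ n)"

definition pnormalizer :: "'a pgroup \<Rightarrow> 'a set \<Rightarrow> 'a set" where
  "pnormalizer L X = {f \<in> carrier L. X \<subseteq> conj_dom L f \<and> pconj_set L X f = X}"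

definition pcentralizer :: "'a pgroup \<Rightarrow> 'a set \<Rightarrow> 'a set" where
  "pcentralizer L X = {f \<in> carrier L. X \<subseteq> conj_dom L f \<and> (\<forall>x\<in>X. pconj L x f = x)}"


section \<open>Localities\<close>

text \<open>In \<open>dom_iff\<close> the list \<open>Ps\<close> is \<open>P\<^sub>0, \<dots>, P\<^sub>n\<close>, with indices of \<open>w\<close> starting at \<open>0\<close>.\<close>

locale locality = partial_group L
  for p :: nat and L :: "'a pgroup" and \<Delta> :: "'a set set" and S :: "'a set" +
  assumes prime_p: "prime p"
    and finite_L: "finite (carrier L)"
    and S_p_subgroup: "p_subgroup p L S"
    and objects_nonempty: "\<Delta> \<noteq> {}"
    and objects: "P \<in> \<Delta> \<Longrightarrow> subgroup P (grp_on L S)"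
    and S_maximal: "p_subgroup p L T \<Longrightarrow> S \<subseteq> T \<Longrightarrow> T = S"
    and dom_iff: "w \<in> lists (carrier L) \<Longrightarrow> w \<in> wdom L \<longleftrightarrow>
          (\<exists>Ps. length Ps = Suc (length w) \<and> set Ps \<subseteq> \<Delta> \<and>
             (\<forall>i<length w. Ps ! i \<subseteq> conj_dom L (w ! i) \<and>
                pconj_set L (Ps ! i) (w ! i) = Ps ! Suc i))"
    and conj_closed: "P \<in> \<Delta> \<Longrightarrow> f \<in> carrier L \<Longrightarrow> P \<subseteq> conj_dom L f \<Longrightarrow>
          subgroup (pconj_set L P f) (grp_on L S) \<Longrightarrow> pconj_set L P f \<in> \<Delta>"
    and overgroup_closed: "P \<in> \<Delta> \<Longrightarrow> subgroup R (grp_on L S) \<Longrightarrow> P \<subseteq> R \<Longrightarrow> R \<in> \<Delta>"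

definition S_sub :: "'a pgroup \<Rightarrow> 'a set \<Rightarrow> 'a \<Rightarrow> 'a set" where
  "S_sub L S g = {x \<in> S. x \<in> conj_dom L g \<and> pconj L x g \<in> S}"

text \<open>The fusion system generated by the conjugation maps \<open>S\<^sub>g \<rightarrow> S\<close>, i.e. the intersection of all
  fusion systems over \<open>S\<close> containing them.\<close>

definition locality_fusion :: "nat \<Rightarrow> 'a pgroup \<Rightarrow> 'a set \<Rightarrow> 'a fusion" where
  "locality_fusion p L S =
     \<lparr>fgrp = grp_on L S,
      fhom = (\<lambda>P R. \<Inter>{fhom E P R | E. fusion_system p E \<and> fgrp E = grp_on L S \<and>
        (\<forall>g\<in>carrier L. (\<lambda>x\<in>S_sub L S g. pconj L x g) \<in> fhom E (S_sub L S g) S)})\<rparr>"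

definition locality_over ::
    "nat \<Rightarrow> 'a pgroup \<Rightarrow> 'a set set \<Rightarrow> 'a set \<Rightarrow> 'a fusion \<Rightarrow> bool" where
  "locality_over p L \<Delta> S F \<longleftrightarrow> locality p L \<Delta> S \<and> F = locality_fusion p L S"

definition objective_characteristic_p :: "nat \<Rightarrow> 'a pgroup \<Rightarrow> 'a set set \<Rightarrow> bool" where
  "objective_characteristic_p p L \<Delta> \<longleftrightarrow>
     (\<forall>P\<in>\<Delta>. characteristic_p p (grp_on L (pnormalizer L P)))"

definition linking_locality :: "nat \<Rightarrow> 'a pgroup \<Rightarrow> 'a set set \<Rightarrow> 'a set \<Rightarrow> bool" where
  "linking_locality p L \<Delta> S \<longleftrightarrow>
     locality p L \<Delta> S \<and> objective_characteristic_p p L \<Delta> \<and>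
     saturated p (locality_fusion p L S) \<and>
     centric_radical_subgroups p (locality_fusion p L S) \<subseteq> \<Delta>"

definition replete :: "'a pgroup \<Rightarrow> 'a set set \<Rightarrow> 'a set \<Rightarrow> 'a set \<Rightarrow> bool" where
  "replete L \<Delta> S Q \<longleftrightarrow>
     (\<forall>P. subgroup P (grp_on L S) \<and> P \<noteq> {\<one>\<^bsub>grp_on L S\<^esub>} \<and> Q \<subseteq> normalizer (grp_on L S) P \<longrightarrow> P \<in> \<Delta>)"

definition large_in_locality :: "'a pgroup \<Rightarrow> 'a set \<Rightarrow> 'a set \<Rightarrow> bool" where
  "large_in_locality L S Q \<longleftrightarrow>
     subgroup Q (grp_on L S) \<and> pcentralizer L Q \<subseteq> Q \<and>
     (\<forall>U. subgroup U (grp_on L S) \<and> U \<subseteq> center_of (grp_on L S) Q \<and> U \<noteq> {\<one>\<^bsub>grp_on L S\<^esub>} \<longrightarrow>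
        pnormalizer L U \<subseteq> pnormalizer L Q)"

end

theory Submission
  imports Defs "HOL-Algebra.Multiplicative_Group" "HOL-Algebra.Sylow"
begin

text \<open>In a replete locality every centric subgroup contains the object \<open>Z(S)\<close> (or \<open>S = 1\<close>), so all
  centric subgroups are objects. Normalizers of objects are honest groups with Sylow subgroups, which
  makes every object conjugate to a fully automized and receptive one. Saturation at the objects
  propagates downwards one conjugacy class \<open>P\<^sup>F\<close> at a time: every morphism between members of a
  noncentric class is a composite of restrictions from proper overgroups, hence extends to
  \<open>P C\<^sub>S(P)\<close>, where induction applies.

  If \<open>Q\<close> is large in the saturated system, it is weakly closed, and a maximal subgroup \<open>T\<close> containing
  \<open>Q\<close> to which all morphisms defined above \<open>Q\<close> extend is centric radical, so \<open>M = N\<^sub>L(T)\<close> is a group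
  inside every linking locality. For \<open>1 \<noteq> U \<le> Z(Q)\<close> and \<open>f \<in> N\<^sub>L(U)\<close>, climbing from \<open>U\<close> to \<open>S\<^sub>f\<close>
  through normalizers shows that \<open>f\<close> acts on \<open>P = S\<^sub>f\<close> like an element of \<open>M\<close>, and characteristic \<open>p\<close>
  forces \<open>C\<^sub>L(P) \<le> M\<close>. Hence \<open>f \<in> M\<close>, and \<open>M\<close> normalizes \<open>Q\<close>.\<close>

section \<open>Sylow theory\<close>

text \<open>A morphism extends over a normalizer only after a correction: receptivity extends
  \<open>c\<close> after \<open>f\<close> rather than \<open>f\<close>, where \<open>c\<close> is an
  automorphism of the target. The recurring device is a Sylow argument that places \<open>c\<close>
  in a prescribed normal subgroup \<open>C\<close> of a stabilizer; if \<open>C\<close> fixes a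
  subgroup pointwise, the correction is invisible there. Noncentric classes become accessible
  because \<open>C_S(P)\<close> acts trivially on \<open>P\<close>, so growing a domain by elements
  of \<open>C_S(P)\<close> costs only invisible corrections. In a linking locality neither
  \<open>Q\<close> nor the subgroups \<open>U\<close> of \<open>Z(Q)\<close> need be objects, so
  \<open>NL U\<close> is not known to be a group, and the fusion system sees an element
  \<open>f\<close> only through its action on \<open>S_f\<close>, that is, up to the centralizer of
  \<open>S_f\<close>. The inclusion of \<open>NL U\<close> in \<open>M\<close> therefore splits into
  matching an action and bounding a centralizer. \<open>T\<close> is made centric radical because
  those subgroups are the ones a linking locality is required to contain. The backward implication
  of (b) is an instance of (c): repleteness makes all centric subgroups objects, and with objective
  characteristic \<open>p\<close> the locality is then linking.\<close>

definition psubgroup :: "('a, 'b) monoid_scheme \<Rightarrow> nat \<Rightarrow> 'a set \<Rightarrow> bool" where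
  "psubgroup G p H \<longleftrightarrow> subgroup H G \<and> (\<exists>n. card H = p ^ n)"

text \<open>Stated relative to a subgroup \<open>K\<close> of an ambient group, so that normalizers,
  stabilizers and centralizers can be handled without changing the group record. Conjugacy of all
  \<open>p\<close>-subgroups into \<open>T\<close> by elements of \<open>K\<close> is built in
  because the extension arguments consume exactly that; \<open>sylow_in_card\<close> and
  \<open>sylow_inI_card\<close> translate to and from the description by order.\<close>

definition sylow_in :: "('a, 'b) monoid_scheme \<Rightarrow> nat \<Rightarrow> 'a set \<Rightarrow> 'a set \<Rightarrow> bool" where
  "sylow_in G p K T \<longleftrightarrow> psubgroup G p T \<and> T \<subseteq> K \<and>
     (\<forall>A. psubgroup G p A \<and> A \<subseteq> K \<longrightarrow> (\<exists>k\<in>K. \<forall>a\<in>A. gconj G a k \<in> T))"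

lemma sylow_inD:
  assumes "sylow_in G p K T"
  shows "psubgroup G p T" "T \<subseteq> K" "subgroup T G"
    and "psubgroup G p A \<Longrightarrow> A \<subseteq> K \<Longrightarrow> \<exists>k\<in>K. \<forall>a\<in>A. gconj G a k \<in> T"
  using assms by (auto simp: sylow_in_def psubgroup_def)

lemma mem_set_mult_iff: "x \<in> A <#>\<^bsub>G\<^esub> B \<longleftrightarrow> (\<exists>a\<in>A. \<exists>b\<in>B. x = a \<otimes>\<^bsub>G\<^esub> b)"
  by (auto simp: set_mult_def)

context group
begin

lemma inv_cancel_left [simp]:
  "g \<in> carrier G \<Longrightarrow> x \<in> carrier G \<Longrightarrow> inv g \<otimes> (g \<otimes> x) = x"
  "g \<in> carrier G \<Longrightarrow> x \<in> carrier G \<Longrightarrow> g \<otimes> (inv g \<otimes> x) = x"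
  by (simp_all flip: m_assoc)

lemma gconj_closed [simp]: "x \<in> carrier G \<Longrightarrow> g \<in> carrier G \<Longrightarrow> gconj G x g \<in> carrier G"
  by (simp add: gconj_def)

lemma gconj_one [simp]: "x \<in> carrier G \<Longrightarrow> gconj G x \<one> = x"
  by (simp add: gconj_def)

lemma one_gconj [simp]: "g \<in> carrier G \<Longrightarrow> gconj G \<one> g = \<one>"
  by (simp add: gconj_def)

lemma gconj_mult: "x \<in> carrier G \<Longrightarrow> y \<in> carrier G \<Longrightarrow> g \<in> carrier G \<Longrightarrow>
    gconj G (x \<otimes> y) g = gconj G x g \<otimes> gconj G y g"
  by (simp add: gconj_def m_assoc)

lemma gconj_inv: "x \<in> carrier G \<Longrightarrow> g \<in> carrier G \<Longrightarrow> gconj G (inv x) g = inv (gconj G x g)"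
  by (simp add: gconj_def m_assoc inv_mult_group)

lemma gconj_comp: "x \<in> carrier G \<Longrightarrow> g \<in> carrier G \<Longrightarrow> h \<in> carrier G \<Longrightarrow>
    gconj G (gconj G x g) h = gconj G x (g \<otimes> h)"
  by (simp add: gconj_def m_assoc inv_mult_group)

lemma gconj_cancel [simp]: "x \<in> carrier G \<Longrightarrow> g \<in> carrier G \<Longrightarrow> gconj G (gconj G x g) (inv g) = x"
  "x \<in> carrier G \<Longrightarrow> g \<in> carrier G \<Longrightarrow> gconj G (gconj G x (inv g)) g = x"
  by (simp_all add: gconj_comp)

lemma gconj_gconj: "x \<in> carrier G \<Longrightarrow> g \<in> carrier G \<Longrightarrow> h \<in> carrier G \<Longrightarrow>
    gconj G (gconj G x g) (gconj G h g) = gconj G (gconj G x h) g"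
  by (simp add: gconj_def m_assoc inv_mult_group)

lemma gconj_inj: "x \<in> carrier G \<Longrightarrow> y \<in> carrier G \<Longrightarrow> g \<in> carrier G \<Longrightarrow>
    gconj G x g = gconj G y g \<longleftrightarrow> x = y"
  using gconj_cancel(1) by metis

lemma gconj_eq_self_iff: "x \<in> carrier G \<Longrightarrow> g \<in> carrier G \<Longrightarrow> gconj G x g = x \<longleftrightarrow> x \<otimes> g = g \<otimes> x"
  by (metis gconj_def inv_solve_left m_assoc m_closed inv_closed)

lemma gconj_inj_on: "A \<subseteq> carrier G \<Longrightarrow> g \<in> carrier G \<Longrightarrow> inj_on (\<lambda>x. gconj G x g) A"
  by (auto simp: inj_on_def gconj_inj subset_iff)

lemma subgroup_gconj_closed:
  assumes "subgroup H G" "x \<in> H" "g \<in> H" shows "gconj G x g \<in> H"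
  using assms by (simp add: gconj_def subgroup.m_closed subgroup.m_inv_closed)

lemma subgroup_gconj_image:
  assumes "subgroup H G" "g \<in> carrier G"
  shows "subgroup ((\<lambda>x. gconj G x g) ` H) G"
proof
  have *: "\<And>x. x \<in> H \<Longrightarrow> x \<in> carrier G" using assms(1) by (rule subgroup.mem_carrier)
  show "(\<lambda>x. gconj G x g) ` H \<subseteq> carrier G" using * assms(2) by auto
  show "\<one> \<in> (\<lambda>x. gconj G x g) ` H"
    using assms by (metis imageI one_gconj subgroup.one_closed)
  show "x \<otimes> y \<in> (\<lambda>x. gconj G x g) ` H"
    if "x \<in> (\<lambda>x. gconj G x g) ` H" "y \<in> (\<lambda>x. gconj G x g) ` H" for x y
    using that assms * by (auto simp flip: gconj_mult intro!: imageI subgroup.m_closed[OF assms(1)])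
  show "inv x \<in> (\<lambda>x. gconj G x g) ` H" if "x \<in> (\<lambda>x. gconj G x g) ` H" for x
    using that assms * by (auto simp flip: gconj_inv intro!: imageI subgroup.m_inv_closed[OF assms(1)])
qed

lemma card_gconj_image:
  "A \<subseteq> carrier G \<Longrightarrow> g \<in> carrier G \<Longrightarrow> card ((\<lambda>x. gconj G x g) ` A) = card A"
  by (simp add: card_image gconj_inj_on)

lemma gconj_restrict:
  assumes "subgroup K G" "x \<in> K" "k \<in> K"
  shows "gconj (G\<lparr>carrier := K\<rparr>) x k = gconj G x k"
  using assms by (simp add: gconj_def m_inv_consistent)

lemma card_subgroup_dvd:
  assumes "subgroup K G" "subgroup H G" "K \<subseteq> H"
  shows "card K dvd card H"
proof -
  interpret H: group "G\<lparr>carrier := H\<rparr>" using assms(2) by (rule subgroup_imp_group)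
  have "card (rcosets\<^bsub>G\<lparr>carrier := H\<rparr>\<^esub> K) * card K = card H"
    using H.lagrange[OF subgroup_incl[OF assms]] by (simp add: order_def)
  then show ?thesis by (metis dvd_triv_right)
qed

text \<open>\<open>normalizer\<close> is a stabilizer for conjugation \<open>g H g^-1\<close>,
  whereas \<open>gconj\<close> conjugates from the right. Finiteness lets an inclusion replace
  equality, which also absorbs the change of side.\<close>

lemma mem_normalizer_iff:
  assumes "H \<subseteq> carrier G" "finite H"
  shows "g \<in> normalizer G H \<longleftrightarrow> g \<in> carrier G \<and> (\<forall>x\<in>H. gconj G x g \<in> H)"
proof -
  have c: "g <# H #> inv g = (\<lambda>x. gconj G x (inv g)) ` H" if "g \<in> carrier G"
    using that by (auto simp: l_coset_def r_coset_def gconj_def)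
  have e: "(\<lambda>x. gconj G x (inv g)) ` H = H \<longleftrightarrow> (\<forall>x\<in>H. gconj G x g \<in> H)" if g: "g \<in> carrier G"
  proof
    assume *: "(\<lambda>x. gconj G x (inv g)) ` H = H"
    show "\<forall>x\<in>H. gconj G x g \<in> H"
    proof
      fix x assume "x \<in> H"
      then obtain y where "y \<in> H" "x = gconj G y (inv g)" using * by blast
      then show "gconj G x g \<in> H" using g assms(1) by auto
    qed
  next
    assume *: "\<forall>x\<in>H. gconj G x g \<in> H"
    then have "(\<lambda>x. gconj G x g) ` H = H"
      using assms g by (intro card_subset_eq) (auto simp: card_gconj_image)
    then have "(\<lambda>x. gconj G x (inv g)) ` H = (\<lambda>x. gconj G x (inv g)) ` (\<lambda>x. gconj G x g) ` H"
      by simp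
    also have "\<dots> = H"
      using assms(1) g by (auto simp: image_image subset_iff intro!: image_eqI[where f = "\<lambda>x. gconj G (gconj G x g) (inv g)"])
    finally show "(\<lambda>x. gconj G x (inv g)) ` H = H" .
  qed
  show ?thesis
    using assms(1) c e by (auto simp: normalizer_def stabilizer_def)
qed

end

subsection \<open>Actions of p-groups\<close>

text \<open>Orbits have \<open>p\<close>-power length: those of length one are the fixed points, all
  others contribute a multiple of \<open>p\<close>.\<close>

lemma (in group_action) card_fixed_points_cong:
  assumes p: "prime p" and ord: "order G = p ^ n" and fin: "finite E"
  shows "int p dvd int (card E) - int (card {x \<in> E. \<forall>g\<in>carrier G. \<phi> g x = x})"
proof -
  interpret group_hom G "BijGroup E" \<phi> by (rule group_hom)
  define F where "F = {x \<in> E. \<forall>g\<in>carrier G. \<phi> g x = x}"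
  have orb: "orbit G \<phi> x \<subseteq> E" if "x \<in> E" for x
    using that orbits_coverture by (auto simp: orbits_def)
  have self: "x \<in> orbit G \<phi> x" if "x \<in> E" for x
    using that by (rule orbit_refl)
  have fixed: "orbit G \<phi> x = {x}" if "x \<in> F" for x
    using that self[of x] by (auto simp: F_def orbit_def)
  have "int (card E) = (\<Sum>x\<in>E. 1)" by simp
  have "card E = (\<Sum>O'\<in>orbits G E \<phi>. card O')"
    using disjoint_sum[OF fin, of "\<lambda>_. 1::nat"] by simp
  moreover have "card F = (\<Sum>O'\<in>orbits G E \<phi>. if O' \<in> (\<lambda>x. {x}) ` F then 1 else 0)"
  proof -
    have "(\<lambda>x. {x}) ` F \<subseteq> orbits G E \<phi>"
    proof
      fix O' assume "O' \<in> (\<lambda>x. {x}) ` F"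
      then obtain x where "x \<in> F" "O' = {x}" by auto
      then show "O' \<in> orbits G E \<phi>"
        using fixed[of x] by (auto simp: orbits_def F_def)
    qed
    moreover have "finite (orbits G E \<phi>)" using fin by (simp add: orbits_def)
    ultimately have "(\<Sum>O'\<in>orbits G E \<phi>. if O' \<in> (\<lambda>x. {x}) ` F then 1 else 0) = card ((\<lambda>x. {x}) ` F)"
      by (simp add: sum.If_cases Int_absorb1)
    then show ?thesis by (simp add: card_image)
  qed
  ultimately have "int (card E) - int (card F) =
      (\<Sum>O'\<in>orbits G E \<phi>. int (card O') - (if O' \<in> (\<lambda>x. {x}) ` F then 1 else 0))"
    unfolding sum_subtractf by (simp add: if_distrib[of int] cong: if_cong)
  moreover have "int p dvd int (card O') - (if O' \<in> (\<lambda>x. {x}) ` F then 1 else 0)"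
    if "O' \<in> orbits G E \<phi>" for O'
  proof -
    obtain x where x: "x \<in> E" "O' = orbit G \<phi> x" using \<open>O' \<in> orbits G E \<phi>\<close> by (auto simp: orbits_def)
    have "card O' dvd p ^ n"
      using orbit_stabilizer_theorem[OF x(1)] x(2) ord by (metis dvd_triv_left)
    then obtain k where k: "card O' = p ^ k" using divides_primepow_nat[OF p] by blast
    show ?thesis
    proof (cases "O' \<in> (\<lambda>x. {x}) ` F")
      case True then show ?thesis by auto
    next
      case False
      have "k \<noteq> 0"
      proof
        assume "k = 0"
        then have "card O' = 1" using k by simp
        then have O: "O' = {x}" using self[OF x(1)] x(2) by (metis card_1_singletonE singletonD)
        then have "x \<in> F" using x unfolding F_def orbit_def by blast
        then show False using False O by blast
      qed
      then show ?thesis using False k by (simp add: dvd_power)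
    qed
  qed
  ultimately show ?thesis unfolding F_def by (simp add: dvd_sum)
qed

context group
begin

text \<open>Taking the inverse turns multiplication on the right into a left action, as required by
  \<open>BijGroup\<close>.\<close>

lemma rcoset_action:
  assumes T: "subgroup T G" and H: "subgroup H G"
  shows "group_action (G\<lparr>carrier := H\<rparr>) (rcosets T) (\<lambda>h. \<lambda>X\<in>rcosets T. X #> inv h)"
proof -
  have H': "\<And>x. x \<in> H \<Longrightarrow> x \<in> carrier G" using H by (rule subgroup.mem_carrier)
  have T': "T \<subseteq> carrier G" using T by (rule subgroup.subset)
  have cl: "X #> g \<in> rcosets T" if "X \<in> rcosets T" "g \<in> carrier G" for X g
    using that T' by (auto simp: RCOSETS_def coset_mult_assoc)
  have sub: "X \<subseteq> carrier G" if "X \<in> rcosets T" for X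
    using that T' by (auto simp: RCOSETS_def r_coset_def)
  have bij: "bij_betw (\<lambda>X\<in>rcosets T. X #> inv h) (rcosets T) (rcosets T)" if "h \<in> carrier G" for h
    using that cl sub
    by (intro bij_betw_byWitness[where f' = "\<lambda>X. X #> h"]) (auto simp: coset_mult_assoc)
  interpret H: group "G\<lparr>carrier := H\<rparr>" using H by (rule subgroup_imp_group)
  show ?thesis
    unfolding group_action_def group_hom_def group_hom_axioms_def
  proof (intro conjI homI)
    show "group (G\<lparr>carrier := H\<rparr>)" by (rule H.is_group)
    show "group (BijGroup (rcosets T))" by (rule group_BijGroup)
    show "(\<lambda>X\<in>rcosets T. X #> inv h) \<in> carrier (BijGroup (rcosets T))"
      if "h \<in> carrier (G\<lparr>carrier := H\<rparr>)" for h
      using that H' bij by (simp add: BijGroup_def Bij_def)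
    show "(\<lambda>X\<in>rcosets T. X #> inv (x \<otimes>\<^bsub>G\<lparr>carrier := H\<rparr>\<^esub> y)) =
       (\<lambda>X\<in>rcosets T. X #> inv x) \<otimes>\<^bsub>BijGroup (rcosets T)\<^esub> (\<lambda>X\<in>rcosets T. X #> inv y)"
      if "x \<in> carrier (G\<lparr>carrier := H\<rparr>)" "y \<in> carrier (G\<lparr>carrier := H\<rparr>)" for x y
      using that H' bij cl sub
      by (auto simp: BijGroup_def Bij_def compose_def coset_mult_assoc inv_mult_group intro!: ext)
  qed
qed

lemma card_fixed_rcosets_cong:
  assumes p: "prime p" and fin: "finite (carrier G)" and T: "subgroup T G" and H: "psubgroup G p H"
  shows "int p dvd int (card (rcosets T)) -
    int (card {X \<in> rcosets T. \<forall>h\<in>H. X #> inv h = X})"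
proof -
  have Hs: "subgroup H G" using H by (simp add: psubgroup_def)
  obtain n where n: "card H = p ^ n" using H by (auto simp: psubgroup_def)
  have f: "finite (rcosets T)" using fin by (simp add: RCOSETS_def)
  have "{X \<in> rcosets T. \<forall>h\<in>H. X #> inv h = X} =
    {x \<in> rcosets T. \<forall>g\<in>carrier (G\<lparr>carrier := H\<rparr>). (\<lambda>X\<in>rcosets T. X #> inv g) x = x}"
    by auto
  then show ?thesis
    using group_action.card_fixed_points_cong[OF rcoset_action[OF T Hs] p, of n] n f
    by (simp add: order_def)
qed

text \<open>Turns fixed cosets into conjugating elements: if a coset with representative
  \<open>g\<close> is fixed by all of a subgroup, then \<open>inv g\<close> conjugates that subgroup
  into \<open>T\<close>.\<close>

lemma fixed_rcoset_gconj:
  assumes T: "subgroup T G" and g: "g \<in> carrier G" and h: "h \<in> carrier G"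
    and eq: "(T #> g) #> inv h = T #> g"
  shows "gconj G h (inv g) \<in> T"
proof -
  have T': "T \<subseteq> carrier G" using T by (rule subgroup.subset)
  have "T #> (g \<otimes> inv h) = T #> g" using eq g h T' by (simp add: coset_mult_assoc)
  then have "T #> (g \<otimes> inv h \<otimes> inv g) = T"
    using g h T' coset_mult_inv1 by (metis coset_mult_assoc coset_mult_one inv_closed m_closed r_inv)
  then have "g \<otimes> inv h \<otimes> inv g \<in> T"
    using g h T by (metis coset_join1 inv_closed m_closed subgroup.subset)
  then have "inv (g \<otimes> inv h \<otimes> inv g) \<in> T" using T by (rule subgroup.m_inv_closed[rotated])
  then show ?thesis using g h by (simp add: gconj_def inv_mult_group m_assoc)
qed

end

section \<open>Sylow theory for subgroups of a finite group\<close>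

locale finite_group = group G for G (structure) and p :: nat +
  assumes fin [simp]: "finite (carrier G)" and prime_p: "prime p"
begin

lemma finite_subgroup: "subgroup H G \<Longrightarrow> finite H"
  using fin finite_subset subgroup.subset by blast

lemma restrict_finite_group: "subgroup K G \<Longrightarrow> finite_group (G\<lparr>carrier := K\<rparr>) p"
  by (simp add: finite_group_def finite_group_axioms_def subgroup_imp_group prime_p finite_subgroup)

lemma psubgroup_subgroup: "psubgroup G p H \<Longrightarrow> subgroup H G"
  by (simp add: psubgroup_def)

lemma psubgroup_gconj: "psubgroup G p H \<Longrightarrow> g \<in> carrier G \<Longrightarrow> psubgroup G p ((\<lambda>x. gconj G x g) ` H)"
  by (auto simp: psubgroup_def subgroup_gconj_image card_gconj_image subgroup.subset)

lemma psubgroup_subset: assumes "psubgroup G p H" "subgroup K G" "K \<subseteq> H" shows "psubgroup G p K"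
proof -
  have "card K dvd card H" using assms by (auto simp: psubgroup_def intro: card_subgroup_dvd)
  then show ?thesis using assms divides_primepow_nat[OF prime_p] by (auto simp: psubgroup_def)
qed

lemma psubgroup_restrict:
  assumes "subgroup K G" "H \<subseteq> K"
  shows "psubgroup (G\<lparr>carrier := K\<rparr>) p H \<longleftrightarrow> psubgroup G p H"
  using assms incl_subgroup[of K H] subgroup_incl[of H K] by (auto simp: psubgroup_def)

lemma sylow_exists_card:
  assumes K: "subgroup K G"
  shows "\<exists>T. sylow_in G p K T \<and> card T = p ^ multiplicity p (card K)"
proof -
  interpret K: finite_group "G\<lparr>carrier := K\<rparr>" p using K by (rule restrict_finite_group)
  let ?a = "multiplicity p (card K)"
  have K0: "card K \<noteq> 0" using subgroup.one_closed[OF K] finite_subgroup[OF K] by auto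
  obtain m where m: "card K = p ^ ?a * m" "\<not> p dvd m"
    using multiplicity_decompose'[of "card K" p] K0 prime_p not_prime_unit by blast
  obtain T where T: "subgroup T (G\<lparr>carrier := K\<rparr>)" "card T = p ^ ?a"
    using sylow_thm[OF prime_p K.is_group, of ?a m] m K.fin by (auto simp: order_def)
  have TK: "T \<subseteq> K" using subgroup.subset[OF T(1)] by simp
  have TG: "psubgroup G p T" using T K TK by (auto simp: psubgroup_def intro: incl_subgroup)
  have "card (rcosets\<^bsub>G\<lparr>carrier := K\<rparr>\<^esub> T) * p ^ ?a = card K"
    using K.lagrange[OF T(1)] T(2) by (simp add: order_def)
  then have ind: "card (rcosets\<^bsub>G\<lparr>carrier := K\<rparr>\<^esub> T) = m"
    using m(1) prime_gt_0_nat[OF prime_p] by (metis mult.commute mult_left_cancel power_eq_0_iff less_irrefl)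
  \<comment> \<open>The index \<open>m\<close> of \<open>T\<close> is prime to \<open>p\<close>, so
    a \<open>p\<close>-subgroup acting on the cosets of \<open>T\<close> fixes one of them.\<close>
  have "\<exists>k\<in>K. \<forall>a\<in>A. gconj G a k \<in> T" if A: "psubgroup G p A" "A \<subseteq> K" for A
  proof -
    have A': "psubgroup (G\<lparr>carrier := K\<rparr>) p A" using A K by (simp add: psubgroup_restrict)
    have "{X \<in> rcosets\<^bsub>G\<lparr>carrier := K\<rparr>\<^esub> T. \<forall>h\<in>A. X #>\<^bsub>G\<lparr>carrier := K\<rparr>\<^esub> inv\<^bsub>G\<lparr>carrier := K\<rparr>\<^esub> h = X} \<noteq> {}"
    proof
      assume *: "{X \<in> rcosets\<^bsub>G\<lparr>carrier := K\<rparr>\<^esub> T. \<forall>h\<in>A. X #>\<^bsub>G\<lparr>carrier := K\<rparr>\<^esub> inv\<^bsub>G\<lparr>carrier := K\<rparr>\<^esub> h = X} = {}"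
      have "int p dvd int m"
        using K.card_fixed_rcosets_cong[OF prime_p K.fin T(1) A'] unfolding * ind by simp
      then show False using m(2) by simp
    qed
    then obtain X where X: "X \<in> rcosets\<^bsub>G\<lparr>carrier := K\<rparr>\<^esub> T"
        "\<forall>h\<in>A. X #>\<^bsub>G\<lparr>carrier := K\<rparr>\<^esub> inv\<^bsub>G\<lparr>carrier := K\<rparr>\<^esub> h = X" by blast
    then obtain g where g: "g \<in> K" "X = T #>\<^bsub>G\<lparr>carrier := K\<rparr>\<^esub> g" by (auto simp: RCOSETS_def)
    have ig: "inv\<^bsub>G\<lparr>carrier := K\<rparr>\<^esub> g \<in> K" using K.inv_closed g by simp
    have "gconj G a (inv\<^bsub>G\<lparr>carrier := K\<rparr>\<^esub> g) \<in> T" if "a \<in> A" for a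
    proof -
      have "gconj (G\<lparr>carrier := K\<rparr>) a (inv\<^bsub>G\<lparr>carrier := K\<rparr>\<^esub> g) \<in> T"
        using that g X A(2) by (intro K.fixed_rcoset_gconj[OF T(1)]) auto
      then show ?thesis using that A(2) ig K by (simp add: gconj_restrict subset_iff)
    qed
    then show ?thesis using ig by blast
  qed
  then have "sylow_in G p K T" using TG TK by (auto simp: sylow_in_def)
  then show ?thesis using T(2) by blast
qed

lemma sylow_in_gconj_card_le:
  assumes "sylow_in G p K T" "psubgroup G p A" "A \<subseteq> K" "K \<subseteq> carrier G"
  shows "card A \<le> card T"
proof -
  obtain k where k: "k \<in> K" "\<forall>a\<in>A. gconj G a k \<in> T" using assms by (auto simp: sylow_in_def)
  have "card ((\<lambda>a. gconj G a k) ` A) = card A" using assms k by (intro card_gconj_image) auto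
  moreover have "(\<lambda>a. gconj G a k) ` A \<subseteq> T" using k by auto
  moreover have "finite T" using assms finite_subgroup by (auto simp: sylow_in_def psubgroup_def)
  ultimately show ?thesis by (metis card_mono)
qed

lemma sylow_in_card:
  assumes "subgroup K G" "sylow_in G p K T"
  shows "card T = p ^ multiplicity p (card K)"
proof -
  obtain T' where T': "sylow_in G p K T'" "card T' = p ^ multiplicity p (card K)"
    using sylow_exists_card assms(1) by blast
  have "card T = card T'"
    using sylow_in_gconj_card_le[OF assms(2), of T'] sylow_in_gconj_card_le[OF T'(1), of T]
      assms T' subgroup.subset by (intro antisym) (auto simp: sylow_in_def)
  then show ?thesis using T' by simp
qed

lemma sylow_in_maximal:
  assumes "sylow_in G p K T" "psubgroup G p A" "T \<subseteq> A" "A \<subseteq> K" "subgroup K G"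
  shows "A = T"
  using sylow_in_gconj_card_le[OF assms(1,2,4) subgroup.subset[OF assms(5)]] assms(3)
    card_seteq[OF finite_subgroup[OF psubgroup_subgroup[OF assms(2)]] assms(3)] by simp

lemma sylow_in_conj:
  assumes "sylow_in G p K T" "subgroup K G" "k \<in> K"
  shows "sylow_in G p K ((\<lambda>x. gconj G x k) ` T)"
proof -
  have T: "psubgroup G p T" "T \<subseteq> K" using assms by (auto simp: sylow_in_def)
  have kc: "k \<in> carrier G" using assms(2,3) by (rule subgroup.mem_carrier)
  have "(\<lambda>x. gconj G x k) ` T \<subseteq> K" using T subgroup_gconj_closed[OF assms(2) _ assms(3)] by auto
  moreover have "\<exists>j\<in>K. \<forall>a\<in>A. gconj G a j \<in> (\<lambda>x. gconj G x k) ` T"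
    if A: "psubgroup G p A" "A \<subseteq> K" for A
  proof -
    obtain j where j: "j \<in> K" "\<forall>a\<in>A. gconj G a j \<in> T" using A assms by (auto simp: sylow_in_def)
    have "gconj G a (j \<otimes> k) \<in> (\<lambda>x. gconj G x k) ` T" if "a \<in> A" for a
    proof -
      have "a \<in> carrier G" "j \<in> carrier G"
        using that A(2) j(1) subgroup.mem_carrier[OF assms(2)] by auto
      then show ?thesis using j that kc by (simp flip: gconj_comp)
    qed
    then show ?thesis using subgroup.m_closed[OF assms(2) j(1) assms(3)] by blast
  qed
  ultimately show ?thesis using psubgroup_gconj[OF T(1) kc] by (simp add: sylow_in_def)
qed

lemma sylow_in_extends:
  assumes K: "subgroup K G" and A: "psubgroup G p A" "A \<subseteq> K"
  shows "\<exists>T. sylow_in G p K T \<and> A \<subseteq> T"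
proof -
  obtain T where T: "sylow_in G p K T" using sylow_exists_card K by blast
  then obtain k where k: "k \<in> K" "\<forall>a\<in>A. gconj G a k \<in> T" using A by (auto simp: sylow_in_def)
  have kc: "k \<in> carrier G" "A \<subseteq> carrier G" using k(1) A(2) subgroup.mem_carrier[OF K] by auto
  have "inv k \<in> K" using k K by (simp add: subgroup.m_inv_closed)
  moreover have "A \<subseteq> (\<lambda>x. gconj G x (inv k)) ` T"
  proof
    fix a assume "a \<in> A"
    then show "a \<in> (\<lambda>x. gconj G x (inv k)) ` T"
      using k kc by (intro image_eqI[of _ _ "gconj G a k"]) auto
  qed
  ultimately show ?thesis using sylow_in_conj[OF T K] by blast
qed

lemma sylow_inI_card:
  assumes K: "subgroup K G" and T: "subgroup T G" "T \<subseteq> K" "card T = p ^ multiplicity p (card K)"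
  shows "sylow_in G p K T"
proof -
  have "psubgroup G p T" using T by (auto simp: psubgroup_def)
  then obtain T' where T': "sylow_in G p K T'" "T \<subseteq> T'" using sylow_in_extends[OF K] T by blast
  then have "card T' = card T" using sylow_in_card[OF K] T by metis
  then have "T' = T" using T'
    by (metis card_subset_eq finite_subgroup psubgroup_subgroup sylow_in_def)
  then show ?thesis using T' by simp
qed

lemma sylow_in_subset:
  assumes "sylow_in G p K T" "subgroup K G" "subgroup K' G" "T \<subseteq> K'" "K' \<subseteq> K"
  shows "sylow_in G p K' T"
proof -
  obtain T' where T': "sylow_in G p K' T'" "T \<subseteq> T'"
    using sylow_in_extends[OF assms(3) sylow_inD(1)[OF assms(1)] assms(4)] by auto
  then have "T' = T" using sylow_in_maximal[OF assms(1) sylow_inD(1)[OF T'(1)] T'(2) _ assms(2)] sylow_inD(2)[OF T'(1)] assms(5) by auto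
  then show ?thesis using T' by simp
qed

lemma subgroup_mult_normal:
  assumes K: "subgroup K G" and C: "subgroup C G" and T: "subgroup T G"
    and TC: "\<And>t c. t \<in> T \<Longrightarrow> c \<in> C \<Longrightarrow> gconj G c t \<in> C"
  shows "subgroup (C <#> T) G"
proof
  have C': "\<And>x. x \<in> C \<Longrightarrow> x \<in> carrier G" and T': "\<And>x. x \<in> T \<Longrightarrow> x \<in> carrier G"
    using subgroup.mem_carrier[OF C] subgroup.mem_carrier[OF T] by auto
  show "C <#> T \<subseteq> carrier G" using C' T' by (auto simp: set_mult_def)
  show "\<one> \<in> C <#> T" using subgroup.one_closed[OF C] subgroup.one_closed[OF T]
    by (force simp: set_mult_def)
  have TC': "gconj G c (inv t) \<in> C" if "t \<in> T" "c \<in> C" for t c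
    using TC that T by (simp add: subgroup.m_inv_closed)
  show "x \<otimes> y \<in> C <#> T" if xy: "x \<in> C <#> T" "y \<in> C <#> T" for x y
  proof -
    obtain c t c' t' where x: "x = c \<otimes> t" "c \<in> C" "t \<in> T" and y: "y = c' \<otimes> t'" "c' \<in> C" "t' \<in> T"
      using xy unfolding mem_set_mult_iff by blast
    have "x \<otimes> y = (c \<otimes> gconj G c' (inv t)) \<otimes> (t \<otimes> t')"
      using x y C' T' by (simp add: gconj_def m_assoc)
    moreover have "c \<otimes> gconj G c' (inv t) \<in> C" "t \<otimes> t' \<in> T"
      using x y C T TC' by (auto intro: subgroup.m_closed)
    ultimately show ?thesis by (auto simp: set_mult_def)
  qed
  show "inv x \<in> C <#> T" if xy: "x \<in> C <#> T" for x
  proof -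
    obtain c t where x: "x = c \<otimes> t" "c \<in> C" "t \<in> T" using xy unfolding mem_set_mult_iff by blast
    have "inv x = gconj G (inv c) t \<otimes> inv t"
      using x C' T' by (simp add: gconj_def m_assoc inv_mult_group)
    moreover have "gconj G (inv c) t \<in> C" "inv t \<in> T"
      using x C T TC by (auto intro: subgroup.m_inv_closed)
    ultimately show ?thesis by (auto simp: set_mult_def)
  qed
qed

text \<open>\<open>T\<close> is also Sylow in the product \<open>C T\<close>, so some
  \<open>c t\<close> conjugates \<open>A\<close> into \<open>T\<close>, and undoing the factor
  \<open>t\<close> stays inside \<open>T\<close>. Having the conjugating element in \<open>C\<close>
  is what later keeps correcting automorphisms and correcting group elements under control.\<close>

lemma sylow_in_conj_normal:
  assumes T: "sylow_in G p K T" and K: "subgroup K G"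
    and C: "subgroup C G" "C \<subseteq> K" and n: "\<And>k c. k \<in> K \<Longrightarrow> c \<in> C \<Longrightarrow> gconj G c k \<in> C"
    and A: "psubgroup G p A" and AC: "\<And>a. a \<in> A \<Longrightarrow> \<exists>c\<in>C. \<exists>t\<in>T. a = c \<otimes> t"
  shows "\<exists>c\<in>C. \<forall>a\<in>A. gconj G a c \<in> T"
proof -
  have Ts: "subgroup T G" "T \<subseteq> K" using T by (auto simp: sylow_in_def psubgroup_def)
  have sub: "subgroup (C <#> T) G" using subgroup_mult_normal[OF K C(1) Ts(1)] n Ts(2) by auto
  have "C <#> T \<subseteq> K" using C Ts K by (auto simp: set_mult_def subgroup.m_closed subset_iff)
  moreover have "T \<subseteq> C <#> T"
  proof
    fix t assume "t \<in> T"
    then have "t = \<one> \<otimes> t" using Ts(1) subgroup.mem_carrier by fastforce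
    then show "t \<in> C <#> T" using subgroup.one_closed[OF C(1)] \<open>t \<in> T\<close> unfolding set_mult_def by blast
  qed
  ultimately have "sylow_in G p (C <#> T) T" using sylow_in_subset[OF T K sub] by blast
  moreover have "A \<subseteq> C <#> T" using AC by (fastforce simp: set_mult_def)
  ultimately obtain k where k: "k \<in> C <#> T" "\<forall>a\<in>A. gconj G a k \<in> T"
    using A by (auto simp: sylow_in_def)
  then obtain c t where c: "k = c \<otimes> t" "c \<in> C" "t \<in> T" by (auto simp: set_mult_def)
  have "gconj G a c \<in> T" if "a \<in> A" for a
  proof -
    have cc: "a \<in> carrier G" "c \<in> carrier G" "t \<in> carrier G"
      using that c subgroup.mem_carrier[OF psubgroup_subgroup[OF A]] subgroup.mem_carrier[OF C(1)]
        subgroup.mem_carrier[OF Ts(1)] by auto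
    then have "gconj G (gconj G a k) (inv t) = gconj G a c"
      using c by (simp flip: gconj_comp)
    moreover have "gconj G (gconj G a k) (inv t) \<in> T"
      using subgroup_gconj_closed[OF Ts(1) _ subgroup.m_inv_closed[OF Ts(1) c(3)]] k(2) that by auto
    ultimately show ?thesis by simp
  qed
  then show ?thesis using c by blast
qed

lemma subgroup_Int: "subgroup H G \<Longrightarrow> subgroup K G \<Longrightarrow> subgroup (H \<inter> K) G"
  by (rule subgroups_Inter_pair)

text \<open>A Sylow subgroup of \<open>C\<close> above \<open>T \<inter> C\<close> is conjugate into
  \<open>T\<close> by an element of \<open>K\<close>, and normality keeps the conjugate in
  \<open>C\<close>; comparing orders gives equality.\<close>

lemma sylow_in_normal:
  assumes T: "sylow_in G p K T" and K: "subgroup K G"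
    and C: "subgroup C G" "C \<subseteq> K" and n: "\<And>k c. k \<in> K \<Longrightarrow> c \<in> C \<Longrightarrow> gconj G c k \<in> C"
  shows "sylow_in G p C (T \<inter> C)"
proof -
  have Ts: "psubgroup G p T" "T \<subseteq> K" using T by (auto simp: sylow_in_def)
  have TC: "psubgroup G p (T \<inter> C)"
    using psubgroup_subset[OF Ts(1)] C Ts subgroup_Int psubgroup_subgroup by auto
  obtain T' where T': "sylow_in G p C T'" "T \<inter> C \<subseteq> T'" using sylow_in_extends[OF C(1) TC] by blast
  have T's: "psubgroup G p T'" "T' \<subseteq> C" using T' by (auto simp: sylow_in_def)
  then obtain k where k: "k \<in> K" "\<forall>a\<in>T'. gconj G a k \<in> T"
    using sylow_inD(4)[OF T T's(1)] C(2) by auto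
  have kc: "k \<in> carrier G" "T' \<subseteq> carrier G"
    using subgroup.mem_carrier[OF K k(1)] subgroup.subset[OF psubgroup_subgroup[OF T's(1)]] by auto
  have "(\<lambda>a. gconj G a k) ` T' \<subseteq> T \<inter> C" using k n T's by auto
  then have "card T' \<le> card (T \<inter> C)"
    using card_gconj_image[OF kc(2,1)] finite_subgroup[OF psubgroup_subgroup[OF TC]] by (metis card_mono)
  then have "T' = T \<inter> C"
    using T' finite_subgroup[OF psubgroup_subgroup[OF T's(1)]] by (metis card_seteq)
  then show ?thesis using T' by simp
qed

text \<open>\<open>A\<close> acts on its own cosets in \<open>B\<close>. Their number is a multiple
  of \<open>p\<close>, so besides \<open>A\<close> another coset is fixed, and the inverse of a
  representative normalizes \<open>A\<close>.\<close>

lemma normalizer_grows: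
  assumes B: "psubgroup G p B" and A: "subgroup A G" "A \<subset> B"
  shows "\<exists>b\<in>B - A. \<forall>a\<in>A. gconj G a b \<in> A"
proof -
  have AB: "A \<subseteq> B" using A(2) by auto
  have Bs: "subgroup B G" using B by (rule psubgroup_subgroup)
  interpret B: finite_group "G\<lparr>carrier := B\<rparr>" p using Bs by (rule restrict_finite_group)
  obtain n where n: "card B = p ^ n" using B by (auto simp: psubgroup_def)
  have Ap: "psubgroup G p A" using psubgroup_subset[OF B A(1)] A(2) by auto
  have A': "psubgroup (G\<lparr>carrier := B\<rparr>) p A" using psubgroup_restrict[OF Bs AB] Ap by auto
  have As: "subgroup A (G\<lparr>carrier := B\<rparr>)" using A' by (simp add: psubgroup_def)
  let ?R = "rcosets\<^bsub>G\<lparr>carrier := B\<rparr>\<^esub> A"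
  let ?N = "{X \<in> ?R. \<forall>h\<in>A. X #>\<^bsub>G\<lparr>carrier := B\<rparr>\<^esub> inv\<^bsub>G\<lparr>carrier := B\<rparr>\<^esub> h = X}"
  have eq: "card ?R * card A = p ^ n"
    using B.lagrange[OF As] n by (simp add: order_def)
  have "card ?R \<noteq> 1"
  proof
    assume "card ?R = 1"
    then have "card A = card B" using eq n by simp
    then have "A = B" using card_subset_eq[OF finite_subgroup[OF Bs] AB] by simp
    then show False using A by simp
  qed
  moreover have "card ?R dvd p ^ n" using eq by (metis dvd_triv_left)
  ultimately have pd: "p dvd card ?R" using divides_primepow_nat[OF prime_p] by (metis dvd_power neq0_conv power_0)
  have "int p dvd int (card ?N)"
    using B.card_fixed_rcosets_cong[OF prime_p B.fin As A'] dvd_diff_right_iff pd int_dvd_int_iff by meson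
  then have pN: "p dvd card ?N" by simp
  have AN: "A \<in> ?N"
  proof -
    have "A #>\<^bsub>G\<lparr>carrier := B\<rparr>\<^esub> h = A" if "h \<in> A" for h
      using B.coset_join2[OF _ As that] that A by auto
    moreover have "inv\<^bsub>G\<lparr>carrier := B\<rparr>\<^esub> h \<in> A" if "h \<in> A" for h
      using subgroup.m_inv_closed[OF As that] .
    moreover have "A \<in> ?R" using B.group_axioms As by (simp add: subgroup.subgroup_in_rcosets)
    ultimately show ?thesis by auto
  qed
  have finN: "finite ?N" using B.fin by (auto simp: RCOSETS_def)
  have "\<not> ?N \<subseteq> {A}"
  proof
    assume "?N \<subseteq> {A}"
    then have "?N = {A}" using AN by blast
    then have "card ?N = 1" by simp
    then show False using pN prime_p by simp
  qed
  then obtain X where X: "X \<in> ?N" "X \<noteq> A" by blast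
  then obtain g where g: "g \<in> B" "X = A #>\<^bsub>G\<lparr>carrier := B\<rparr>\<^esub> g" by (auto simp: RCOSETS_def)
  have gA: "g \<notin> A" using X g B.coset_join2[OF _ As, of g] by auto
  define b where "b = inv\<^bsub>G\<lparr>carrier := B\<rparr>\<^esub> g"
  have b: "b \<in> B" using B.inv_closed g by (simp add: b_def)
  have "b \<notin> A"
    using gA subgroup.m_inv_closed[OF As, of b] B.inv_inv[of g] g unfolding b_def by auto
  moreover have "gconj G a b \<in> A" if "a \<in> A" for a
  proof -
    have "gconj (G\<lparr>carrier := B\<rparr>) a (inv\<^bsub>G\<lparr>carrier := B\<rparr>\<^esub> g) \<in> A"
      using that g X AB by (intro B.fixed_rcoset_gconj[OF As]) auto
    then show ?thesis using that AB b Bs unfolding b_def by (simp add: gconj_restrict subset_iff)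
  qed
  ultimately show ?thesis using b by blast
qed

lemma psubgroup_center_nontrivial:
  assumes B: "psubgroup G p B" "B \<noteq> {\<one>}"
  shows "\<exists>z\<in>B. z \<noteq> \<one> \<and> (\<forall>b\<in>B. b \<otimes> z = z \<otimes> b)"
proof -
  have Bs: "subgroup B G" using B by (simp add: psubgroup_def)
  interpret B: finite_group "G\<lparr>carrier := B\<rparr>" p using Bs by (rule restrict_finite_group)
  obtain n where n: "card B = p ^ n" using B by (auto simp: psubgroup_def)
  let ?Z = "{x \<in> B. \<forall>g\<in>B. (g \<otimes> x \<otimes> inv\<^bsub>G\<lparr>carrier := B\<rparr>\<^esub> g) = x}"
  have "n \<noteq> 0"
  proof
    assume "n = 0"
    then have "card B = 1" using n by simp
    then obtain b where "B = {b}" by (rule card_1_singletonE)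
    then show False using B(2) subgroup.one_closed[OF Bs] by auto
  qed
  then have pd: "p dvd card B" using n by (simp add: dvd_power)
  have eqZ: "{x \<in> B. \<forall>g\<in>carrier (G\<lparr>carrier := B\<rparr>). (\<lambda>h\<in>carrier (G\<lparr>carrier := B\<rparr>). g \<otimes>\<^bsub>G\<lparr>carrier := B\<rparr>\<^esub> h \<otimes>\<^bsub>G\<lparr>carrier := B\<rparr>\<^esub> inv\<^bsub>G\<lparr>carrier := B\<rparr>\<^esub> g) x = x} = ?Z"
    by auto
  have "int p dvd int (card B) - int (card ?Z)"
    using group_action.card_fixed_points_cong[OF B.action_by_conjugation prime_p, of n] n B.fin eqZ
    by (simp add: order_def)
  then have "p dvd card ?Z" using pd dvd_diff_right_iff int_dvd_int_iff by meson
  moreover have one: "\<one> \<in> ?Z"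
  proof -
    have "\<one> \<in> B" using Bs by (rule subgroup.one_closed)
    moreover have "g \<otimes> \<one> \<otimes> inv\<^bsub>G\<lparr>carrier := B\<rparr>\<^esub> g = \<one>" if "g \<in> B" for g
      using B.r_inv[of g] B.r_one[of g] that by simp
    ultimately show ?thesis by blast
  qed
  ultimately have "\<not> ?Z \<subseteq> {\<one>}"
  proof -
    have "\<not> p dvd card {\<one>}" using prime_p by auto
    moreover have "?Z = {\<one>}" if "?Z \<subseteq> {\<one>}" using that one by (rule subset_antisym[OF _ insert_subsetI]) simp
    ultimately show ?thesis using \<open>p dvd card ?Z\<close> by auto
  qed
  then obtain z where z: "z \<in> ?Z" "z \<noteq> \<one>" by blast
  have "b \<otimes> z = z \<otimes> b" if "b \<in> B" for b
  proof -
    have c: "b \<in> carrier G" "z \<in> carrier G" using that z subgroup.mem_carrier[OF Bs] by auto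
    have "b \<otimes> z \<otimes> inv b = z" using z that m_inv_consistent[OF Bs] by auto
    then have "b \<otimes> z \<otimes> inv b \<otimes> b = z \<otimes> b" by simp
    then show ?thesis using c by (simp add: m_assoc)
  qed
  then show ?thesis using z by blast
qed

lemma sylow_contains_normal:
  assumes T: "sylow_in G p K T" and K: "subgroup K G" and N: "psubgroup G p N" "N \<subseteq> K"
    and n: "\<And>k x. k \<in> K \<Longrightarrow> x \<in> N \<Longrightarrow> gconj G x k \<in> N"
  shows "N \<subseteq> T"
proof -
  have "sylow_in G p N (T \<inter> N)"
    using sylow_in_normal[OF T K psubgroup_subgroup[OF N(1)] N(2)] n by blast
  then have "N = T \<inter> N"
    using sylow_in_maximal[of N "T \<inter> N" N] N psubgroup_subgroup by blast
  then show ?thesis by blast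
qed

text \<open>Avoids an order formula for products: a Sylow subgroup of the product containing
  \<open>A\<close> also contains the normal subgroup \<open>B\<close>, hence everything.\<close>

lemma psubgroup_mult:
  assumes A: "psubgroup G p A" and B: "psubgroup G p B"
    and n: "\<And>a b. a \<in> A \<Longrightarrow> b \<in> B \<Longrightarrow> gconj G b a \<in> B"
  shows "psubgroup G p (B <#> A)"
proof -
  have s: "subgroup A G" "subgroup B G" using psubgroup_subgroup[OF A] psubgroup_subgroup[OF B] .
  have sub: "subgroup (B <#> A) G" using subgroup_mult_normal[OF s(1) s(2) s(1)] n by auto
  have cc: "\<And>a. a \<in> A \<Longrightarrow> a \<in> carrier G" "\<And>b. b \<in> B \<Longrightarrow> b \<in> carrier G"
    using subgroup.mem_carrier[OF s(1)] subgroup.mem_carrier[OF s(2)] by auto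
  have A1: "A \<subseteq> B <#> A"
  proof
    fix a assume "a \<in> A"
    then have "a = \<one> \<otimes> a" using cc by simp
    then show "a \<in> B <#> A" using \<open>a \<in> A\<close> subgroup.one_closed[OF s(2)] unfolding set_mult_def by blast
  qed
  have B1: "B \<subseteq> B <#> A"
  proof
    fix b assume "b \<in> B"
    then have "b = b \<otimes> \<one>" using cc by simp
    then show "b \<in> B <#> A" using \<open>b \<in> B\<close> subgroup.one_closed[OF s(1)] unfolding set_mult_def by blast
  qed
  obtain T where T: "sylow_in G p (B <#> A) T" "A \<subseteq> T" using sylow_in_extends[OF sub A A1] by blast
  have "gconj G x k \<in> B" if xk: "k \<in> B <#> A" "x \<in> B" for k x
  proof -
    obtain b a where k: "k = b \<otimes> a" "b \<in> B" "a \<in> A" using xk unfolding mem_set_mult_iff by blast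
    have "gconj G x k = gconj G (gconj G x b) a" using k xk cc by (simp add: gconj_comp)
    then show ?thesis using n[OF k(3)] subgroup_gconj_closed[OF s(2) xk(2) k(2)] by simp
  qed
  then have "B \<subseteq> T" using sylow_contains_normal[OF T(1) sub B B1] by blast
  then have "B <#> A \<subseteq> T"
    using T by (auto simp: set_mult_def sylow_in_def psubgroup_def subgroup.m_closed subset_iff)
  then show ?thesis using T psubgroup_subset sub by (auto simp: sylow_in_def)
qed

end

section \<open>Sylow subgroups under homomorphisms\<close>

lemma (in group_hom) card_image_kernel:
  assumes "finite (carrier G)" and K: "subgroup K G"
  shows "card (h ` K) * card {x \<in> K. h x = \<one>\<^bsub>H\<^esub>} = card K"
proof -
  interpret K: group "G\<lparr>carrier := K\<rparr>" using K by (rule G.subgroup_imp_group)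
  have Kc: "K \<subseteq> carrier G" using K by (rule subgroup.subset)
  have img: "subgroup (h ` K) H" using K by (rule subgroup_img_is_subgroup)
  interpret I: group "H\<lparr>carrier := h ` K\<rparr>" using img by (rule H.subgroup_imp_group)
  interpret r: group_hom "G\<lparr>carrier := K\<rparr>" "H\<lparr>carrier := h ` K\<rparr>" h
    by unfold_locales (use Kc in \<open>auto simp: hom_def subset_iff\<close>)
  have "bij_betw (\<lambda>X. the_elem (h ` X)) (carrier (G\<lparr>carrier := K\<rparr> Mod kernel (G\<lparr>carrier := K\<rparr>) (H\<lparr>carrier := h ` K\<rparr>) h))
      (carrier (H\<lparr>carrier := h ` K\<rparr>))"
    using r.FactGroup_iso_set by (simp add: iso_def)
  then have "card (rcosets\<^bsub>G\<lparr>carrier := K\<rparr>\<^esub> (kernel (G\<lparr>carrier := K\<rparr>) (H\<lparr>carrier := h ` K\<rparr>) h)) = card (h ` K)"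
    by (simp add: FactGroup_def bij_betw_same_card)
  moreover have "kernel (G\<lparr>carrier := K\<rparr>) (H\<lparr>carrier := h ` K\<rparr>) h = {x \<in> K. h x = \<one>\<^bsub>H\<^esub>}"
    by (simp add: kernel_def)
  ultimately show ?thesis
    using K.lagrange[OF r.subgroup_kernel] by (simp add: order_def)
qed

lemma (in group_hom) psubgroup_image:
  assumes "finite (carrier G)" "prime p" "psubgroup G p K"
  shows "psubgroup H p (h ` K)"
proof -
  have K: "subgroup K G" using assms by (simp add: psubgroup_def)
  obtain n where "card K = p ^ n" using assms by (auto simp: psubgroup_def)
  then have "card (h ` K) dvd p ^ n" using card_image_kernel[OF assms(1) K] by (metis dvd_triv_left)
  then show ?thesis
    using divides_primepow_nat[OF assms(2)] subgroup_img_is_subgroup[OF K] by (auto simp: psubgroup_def)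
qed

text \<open>The orders of \<open>K\<close> and of \<open>T\<close> both split into image times
  kernel. In each factor the contribution of \<open>T\<close> is at most the \<open>p\<close>-part
  of that of \<open>K\<close>, and since the products agree, both bounds are attained.\<close>

lemma (in group_hom) sylow_card_image:
  assumes fin: "finite (carrier G)" and p: "prime p" and K: "subgroup K G" and T: "subgroup T G" "T \<subseteq> K"
    and c: "card T = p ^ multiplicity p (card K)"
  shows "card (h ` T) = p ^ multiplicity p (card (h ` K))"
proof -
  have p1: "\<not> is_unit p" "p \<noteq> 0" using p by auto
  have finK: "finite K" "finite T" using K T fin by (auto intro: finite_subset dest: subgroup.subset)
  let ?kK = "{x \<in> K. h x = \<one>\<^bsub>H\<^esub>}" and ?kT = "{x \<in> T. h x = \<one>\<^bsub>H\<^esub>}"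
  have eK: "card (h ` K) * card ?kK = card K" by (rule card_image_kernel[OF fin K])
  have eT: "card (h ` T) * card ?kT = card T" by (rule card_image_kernel[OF fin T(1)])
  have hT: "psubgroup H p (h ` T)" using psubgroup_image[OF fin p, of T] T c by (auto simp: psubgroup_def)
  then obtain b where b: "card (h ` T) = p ^ b" by (auto simp: psubgroup_def)
  have Ks: "subgroup (h ` K) H" using K by (rule subgroup_img_is_subgroup)
  have dv: "p ^ b dvd card (h ` K)"
    using H.card_subgroup_dvd[OF _ Ks, of "h ` T"] hT T b by (auto simp: psubgroup_def)
  have "card K \<noteq> 0" using subgroup.one_closed[OF K] finK(1) by auto
  then have nz: "card (h ` K) \<noteq> 0" "card ?kK \<noteq> 0" using eK by (auto intro: gr0I)
  have le: "b \<le> multiplicity p (card (h ` K))" using dv nz p1 by (simp add: power_dvd_iff_le_multiplicity)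
  obtain d where d: "card ?kT = p ^ d"
    using eT c divides_primepow_nat[OF p] by (metis dvd_triv_right)
  have "p ^ (b + d) = p ^ multiplicity p (card K)" using eT c b d by (simp add: power_add)
  then have "b + d = multiplicity p (card K)" using prime_gt_1_nat[OF p] power_inject_exp by blast
  also have "\<dots> = multiplicity p (card (h ` K)) + multiplicity p (card ?kK)"
    using eK nz p by (metis prime_elem_multiplicity_mult_distrib prime_imp_prime_elem)
  finally have sum: "b + d = multiplicity p (card (h ` K)) + multiplicity p (card ?kK)" .
  have "?kK = K \<inter> kernel G H h" "?kT = T \<inter> kernel G H h"
    using subgroup.subset[OF K] subgroup.subset[OF T(1)] by (auto simp: kernel_def)
  then have "subgroup ?kK G" "subgroup ?kT G"
    using G.subgroups_Inter_pair[OF K subgroup_kernel] G.subgroups_Inter_pair[OF T(1) subgroup_kernel]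
    by auto
  then have "card ?kT dvd card ?kK" using G.card_subgroup_dvd T(2) by auto
  then have "d \<le> multiplicity p (card ?kK)" using d nz p1 by (simp add: power_dvd_iff_le_multiplicity)
  then have "b = multiplicity p (card (h ` K))" using sum le by linarith
  then show ?thesis using b by simp
qed

context finite_group
begin

lemma normalizer_gconj:
  assumes A: "A \<subseteq> carrier G" and g: "g \<in> carrier G"
  shows "(\<lambda>x. gconj G x g) ` normalizer G A = normalizer G ((\<lambda>x. gconj G x g) ` A)"
proof -
  have sub: "(\<lambda>x. gconj G x g) ` normalizer G A \<subseteq> normalizer G ((\<lambda>x. gconj G x g) ` A)"
    if A: "A \<subseteq> carrier G" and g: "g \<in> carrier G" for A g
  proof -
    have f: "finite A" "finite ((\<lambda>x. gconj G x g) ` A)" using finite_subset[OF A fin] by simp_all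
    have c: "(\<lambda>x. gconj G x g) ` A \<subseteq> carrier G" using A g by auto
    have "gconj G (gconj G a g) (gconj G x g) \<in> (\<lambda>x. gconj G x g) ` A"
      if x: "x \<in> carrier G" "gconj G a x \<in> A" and a: "a \<in> A" for x a
      using gconj_gconj[of a g x] x subsetD[OF A a] g by auto
    then show ?thesis using g by (auto simp: mem_normalizer_iff[OF A f(1)] mem_normalizer_iff[OF c f(2)])
  qed
  let ?B = "(\<lambda>x. gconj G x g) ` A"
  have B: "?B \<subseteq> carrier G" using A g by auto
  have NB: "normalizer G ?B \<subseteq> carrier G" using subgroup.subset[OF normalizer_imp_subgroup[OF B]] .
  have "(\<lambda>x. gconj G x (inv g)) ` ?B = (\<lambda>x. x) ` A"
    unfolding image_image using A g by (intro image_cong) auto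
  then have inv_sub: "(\<lambda>x. gconj G x (inv g)) ` normalizer G ?B \<subseteq> normalizer G A"
    using sub[OF B, of "inv g"] g by simp
  have "normalizer G ?B \<subseteq> (\<lambda>x. gconj G x g) ` normalizer G A"
  proof
    fix y assume y: "y \<in> normalizer G ?B"
    then have "y = gconj G (gconj G y (inv g)) g" using NB g by auto
    then show "y \<in> (\<lambda>x. gconj G x g) ` normalizer G A" using inv_sub y by blast
  qed
  then show ?thesis using sub[OF A g] by blast
qed

text \<open>The pointwise centralizer, written through \<open>gconj\<close> and with the facts
  needed to use it as the normal subgroup \<open>C\<close> in
  \<open>sylow_in_conj_normal\<close>.\<close>

lemma
  fixes A defines "C \<equiv> {c \<in> carrier G. \<forall>a\<in>A. gconj G a c = a}"
  assumes A: "A \<subseteq> carrier G"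
  shows subgroup_fixing: "subgroup C G"
    and fixing_sub_normalizer: "C \<subseteq> normalizer G A"
    and fixing_normal: "\<And>k c. k \<in> normalizer G A \<Longrightarrow> c \<in> C \<Longrightarrow> gconj G c k \<in> C"
proof -
  note Ac = subsetD[OF A]
  have f: "finite A" using finite_subset[OF A fin] .
  show "subgroup C G"
  proof
    show "x \<otimes> y \<in> C" if "x \<in> C" "y \<in> C" for x y
    proof -
      have "gconj G a (x \<otimes> y) = a" if "a \<in> A" for a
        using gconj_comp[of a x y] \<open>x \<in> C\<close> \<open>y \<in> C\<close> Ac[OF that] that by (simp add: C_def)
      then show ?thesis using that by (simp add: C_def)
    qed
    show "inv x \<in> C" if "x \<in> C" for x
    proof -
      have "gconj G a (inv x) = a" if "a \<in> A" for a
      proof -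
        have "gconj G a x = a" "x \<in> carrier G" using \<open>x \<in> C\<close> that by (simp_all add: C_def)
        then show ?thesis using gconj_cancel(1)[of a x] Ac[OF that] by simp
      qed
      then show ?thesis using that by (simp add: C_def)
    qed
  qed (use Ac in \<open>auto simp: C_def\<close>)
  show "C \<subseteq> normalizer G A" by (auto simp: C_def mem_normalizer_iff[OF A f])
  fix k c assume k: "k \<in> normalizer G A" and c: "c \<in> C"
  have kc: "k \<in> carrier G" "inv k \<in> normalizer G A"
    using k subgroup.m_inv_closed[OF normalizer_imp_subgroup[OF A] k] by (auto simp: mem_normalizer_iff[OF A f])
  have "gconj G a (gconj G c k) = a" if a: "a \<in> A" for a
  proof -
    let ?b = "gconj G a (inv k)"
    have b: "?b \<in> A" using kc(2) a by (simp add: mem_normalizer_iff[OF A f])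
    have "gconj G (gconj G ?b k) (gconj G c k) = gconj G (gconj G ?b c) k"
      using Ac[OF b] kc c by (intro gconj_gconj) (auto simp: C_def)
    then show ?thesis using b c Ac[OF a] kc(1) by (simp add: C_def)
  qed
  then show "gconj G c k \<in> C" using kc(1) c by (simp add: C_def)
qed

end

subsection \<open>Groups of characteristic p\<close>

context finite_group
begin

lemma restrict_pow: "x [^]\<^bsub>G\<lparr>carrier := K\<rparr>\<^esub> (n::nat) = x [^] n"
  by (induction n) (simp_all add: nat_pow_def)

lemma pow_card_subgroup:
  assumes "subgroup H G" "x \<in> H" shows "x [^] card H = \<one>"
proof -
  interpret H: group "G\<lparr>carrier := H\<rparr>" using assms(1) by (rule subgroup_imp_group)
  show ?thesis using H.pow_order_eq_1[of x] assms(2) by (simp add: order_def restrict_pow)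
qed

lemma psubgroup_generate:
  assumes x: "x \<in> carrier G" and k: "x [^] (p ^ k :: nat) = \<one>"
  shows "psubgroup G p (generate G {x})"
proof -
  have "ord x dvd p ^ k" using x k pow_eq_id by blast
  then have "card (generate G {x}) dvd p ^ k" using generate_pow_card[OF x] by simp
  then show ?thesis
    using divides_primepow_nat[OF prime_p] generate_is_subgroup[of "{x}"] x by (auto simp: psubgroup_def)
qed

text \<open>Cauchy's argument: for another prime divisor \<open>q\<close> of the order, a subgroup
  of order \<open>q\<close> would contain a nontrivial element whose order divides both
  \<open>q\<close> and a power of \<open>p\<close>.\<close>

lemma psubgroupI_elements:
  assumes D: "subgroup D G" and el: "\<And>x. x \<in> D \<Longrightarrow> \<exists>k. x [^] (p ^ k :: nat) = \<one>"
  shows "psubgroup G p D"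
proof -
  interpret D: finite_group "G\<lparr>carrier := D\<rparr>" p using D by (rule restrict_finite_group)
  have D0: "card D \<noteq> 0" using subgroup.one_closed[OF D] finite_subgroup[OF D] by auto
  have only_p: "q = p" if q: "prime q" "q dvd card D" for q
  proof (rule ccontr)
    assume "q \<noteq> p"
    obtain m where m: "card D = q ^ 1 * m" using q by auto
    obtain H where H: "subgroup H (G\<lparr>carrier := D\<rparr>)" "card H = q ^ 1"
      using sylow_thm[OF q(1) D.is_group, of 1 m] m D.fin by (auto simp: order_def)
    have HG: "subgroup H G" "H \<subseteq> D" using H(1) D incl_subgroup subgroup.subset[OF H(1)] by auto
    have "\<not> H \<subseteq> {\<one>}"
    proof
      assume "H \<subseteq> {\<one>}"
      then have "card H \<le> 1" using card_mono[of "{\<one>}" H] by simp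
      then show False using H(2) prime_gt_1_nat[OF q(1)] by simp
    qed
    then obtain x where x: "x \<in> H" "x \<noteq> \<one>" by blast
    then obtain k where k: "x [^] (p ^ k :: nat) = \<one>" using el HG by blast
    have xc: "x \<in> carrier G" using x subgroup.mem_carrier[OF HG(1)] by simp
    have "ord x dvd p ^ k" using xc k pow_eq_id by blast
    moreover have "ord x dvd q" using xc pow_card_subgroup[OF HG(1) x(1)] H(2) pow_eq_id by fastforce
    moreover have "coprime (p ^ k) q"
      using \<open>q \<noteq> p\<close> primes_coprime[OF prime_p q(1)] by (simp add: coprime_power_left_iff)
    ultimately have "ord x = 1" by (metis coprime_common_divisor_nat nat_dvd_1_iff_1 is_unit_gcd coprime_def)
    then show False using x xc ord_eq_1 by blast
  qed
  obtain m where m: "card D = p ^ multiplicity p (card D) * m" "\<not> p dvd m"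
    using multiplicity_decompose'[of "card D" p] D0 prime_p not_prime_unit by blast
  have "m = 1"
  proof (rule ccontr)
    assume "m \<noteq> 1"
    then obtain q where "prime q" "q dvd m" using prime_factor_nat by blast
    then show False using only_p[of q] m by (metis dvd_mult)
  qed
  then have "card D = p ^ multiplicity p (card D)" using m by simp
  then show ?thesis using D by (auto simp: psubgroup_def)
qed

text \<open>In general a join of \<open>p\<close>-subgroups is no \<open>p\<close>-group; here each
  of them is normal, hence lies in every Sylow subgroup, and this bounds the join.\<close>

lemma
  shows psubgroup_p_core: "psubgroup G p (p_core p G)"
    and p_core_gconj: "x \<in> p_core p G \<Longrightarrow> g \<in> carrier G \<Longrightarrow> gconj G x g \<in> p_core p G"
    and p_core_subset_sylow: "sylow_in G p (carrier G) T \<Longrightarrow> p_core p G \<subseteq> T"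
proof -
  let ?U = "\<Union>{N. N \<lhd> G \<and> (\<exists>n. card N = p ^ n)}"
  have U: "?U \<subseteq> carrier G" using normal_imp_subgroup subgroup.subset by blast
  have sub: "subgroup (p_core p G) G" using generate_is_subgroup[OF U] by (simp add: p_core_def)
  have car: "subgroup (carrier G) G" by (rule subgroup_self)
  have inT: "p_core p G \<subseteq> T" if T: "sylow_in G p (carrier G) T" for T
    unfolding p_core_def
  proof (rule generate_subgroup_incl[OF _ sylow_inD(3)[OF T]])
    show "?U \<subseteq> T"
    proof
      fix x assume "x \<in> ?U"
      then obtain N n where N: "N \<lhd> G" "card N = p ^ n" "x \<in> N" by blast
      have "psubgroup G p N" using N normal_imp_subgroup by (auto simp: psubgroup_def)
      moreover have "gconj G y k \<in> N" if "k \<in> carrier G" "y \<in> N" for k y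
        using normal.inv_op_closed1[OF N(1) that] by (simp add: gconj_def)
      ultimately have "N \<subseteq> T"
        using sylow_contains_normal[OF T car] normal_imp_subgroup[OF N(1)] subgroup.subset by blast
      then show "x \<in> T" using N by blast
    qed
  qed
  then show "sylow_in G p (carrier G) T \<Longrightarrow> p_core p G \<subseteq> T" .
  obtain T where T: "sylow_in G p (carrier G) T" using sylow_exists_card[OF car] by blast
  show "psubgroup G p (p_core p G)"
    using psubgroup_subset[OF sylow_inD(1)[OF T] sub inT[OF T]] .
  have "p_core p G \<lhd> G"
    unfolding p_core_def
  proof (rule normal_generateI[OF U])
    fix h g assume hg: "h \<in> ?U" "g \<in> carrier G"
    then obtain N n where N: "N \<lhd> G" "card N = p ^ n" "h \<in> N" by blast
    have "g \<otimes> h \<otimes> inv g \<in> N" by (rule normal.inv_op_closed2[OF N(1) hg(2) N(3)])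
    then show "g \<otimes> h \<otimes> inv g \<in> ?U" using N by blast
  qed
  then show "x \<in> p_core p G \<Longrightarrow> g \<in> carrier G \<Longrightarrow> gconj G x g \<in> p_core p G"
    by (simp add: gconj_def normal.inv_op_closed1)
qed

lemma normal_psubgroup_subset_p_core:
  assumes N: "psubgroup G p N" and n: "\<And>g x. g \<in> carrier G \<Longrightarrow> x \<in> N \<Longrightarrow> gconj G x g \<in> N"
  shows "N \<subseteq> p_core p G"
proof -
  have "N \<lhd> G"
  proof (rule normal_invI)
    show "subgroup N G" using N by (rule psubgroup_subgroup)
    fix g x assume gx: "g \<in> carrier G" "x \<in> N"
    then have "gconj G x (inv g) \<in> N" using n by simp
    then show "g \<otimes> x \<otimes> inv g \<in> N" using gx by (simp add: gconj_def)
  qed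
  then have "N \<subseteq> \<Union>{N. N \<lhd> G \<and> (\<exists>n. card N = p ^ n)}" using N by (auto simp: psubgroup_def)
  then show ?thesis by (auto simp: p_core_def intro: generate.incl)
qed

lemma gconj_pow_central:
  assumes "w \<in> carrier G" "x \<in> carrier G" "z \<in> carrier G"
    and "gconj G w x = w \<otimes> z" "gconj G z x = z"
  shows "gconj G w (x [^] (n::nat)) = w \<otimes> z [^] n"
proof (induction n)
  case 0 then show ?case using assms by simp
next
  case (Suc n)
  have zn: "gconj G (z [^] k) x = z [^] k" for k :: nat
    using assms by (induction k) (simp_all add: gconj_mult)
  have "gconj G w (x [^] Suc n) = gconj G (gconj G w (x [^] n)) x"
    using assms by (simp add: gconj_comp)
  also have "\<dots> = gconj G (w \<otimes> z [^] n) x" using Suc by simp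
  also have "\<dots> = (w \<otimes> z) \<otimes> z [^] n" using assms zn by (simp add: gconj_mult)
  also have "\<dots> = w \<otimes> z [^] Suc n" using assms by (simp add: m_assoc flip: nat_pow_Suc2)
  finally show ?case .
qed

text \<open>A coprime action which is trivial on \<open>O\<close> and on \<open>p_core p G / O\<close> is trivial, so the
  centralizer of \<open>O = p_core p G \<inter> C\<close> in \<open>C\<close> consists of \<open>p\<close>-elements.\<close>

lemma characteristic_p_normal:
  assumes ch: "characteristic_p p G" and C: "subgroup C G"
    and n: "\<And>g c. g \<in> carrier G \<Longrightarrow> c \<in> C \<Longrightarrow> gconj G c g \<in> C"
    and x: "x \<in> C" "\<And>z. z \<in> p_core p G \<inter> C \<Longrightarrow> x \<otimes> z = z \<otimes> x"
  shows "x \<in> p_core p G"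
proof -
  let ?O = "p_core p G"
  let ?Z = "?O \<inter> C"
  let ?D = "{x \<in> C. \<forall>z\<in>?Z. gconj G z x = z}"
  have O: "subgroup ?O G" using psubgroup_p_core by (rule psubgroup_subgroup)
  have Z: "subgroup ?Z G" using subgroup_Int[OF O C] .
  have cC: "\<And>c. c \<in> C \<Longrightarrow> c \<in> carrier G" using C by (rule subgroup.mem_carrier)
  have cO: "\<And>c. c \<in> ?O \<Longrightarrow> c \<in> carrier G" using O by (rule subgroup.mem_carrier)
  have D: "subgroup ?D G"
  proof
    show "?D \<subseteq> carrier G" using cC by auto
    show "\<one> \<in> ?D" using subgroup.one_closed[OF C] cC by auto
    show "a \<otimes> b \<in> ?D" if "a \<in> ?D" "b \<in> ?D" for a b
      using that subgroup.m_closed[OF C] cC by (simp flip: gconj_comp)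
    show "inv a \<in> ?D" if a: "a \<in> ?D" for a
    proof -
      have "gconj G z (inv a) = z" if "z \<in> ?Z" for z
      proof -
        have "gconj G (gconj G z a) (inv a) = z" using that a cC by (intro gconj_cancel) auto
        then show ?thesis using a that by auto
      qed
      then show ?thesis using a subgroup.m_inv_closed[OF C] by auto
    qed
  qed
  obtain b where b: "card ?O = p ^ b" using psubgroup_p_core by (auto simp: psubgroup_def)
  obtain c where c: "card ?Z = p ^ c"
    using psubgroup_subset[OF psubgroup_p_core Z] by (auto simp: psubgroup_def)
  have "\<exists>k. y [^] (p ^ k :: nat) = \<one>" if y: "y \<in> ?D" for y
  proof -
    have yc: "y \<in> carrier G" using y cC by simp
    \<comment> \<open>For \<open>w\<close> in \<open>?O\<close> the commutator of \<open>w\<close>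
      and \<open>y\<close> lies in \<open>?O\<close> and, by normality of \<open>C\<close>, in
      \<open>C\<close>; so it lies in \<open>?Z\<close>, which \<open>y\<close> centralizes. Powers
      of \<open>y\<close> therefore multiply \<open>w\<close> by powers of one element of
      \<open>?Z\<close>, and the exponent \<open>card ?Z\<close> kills these.\<close>
    have "y [^] card ?Z \<in> gcentralizer G ?O"
    proof -
      have "gconj G w (y [^] card ?Z) = w" if w: "w \<in> ?O" for w
      proof -
        have wc: "w \<in> carrier G" using w cO by simp
        define z where "z = inv w \<otimes> gconj G w y"
        have "z \<in> ?O" using w p_core_gconj[OF w yc] subgroup.m_closed[OF O] subgroup.m_inv_closed[OF O]
          by (simp add: z_def)
        moreover have "z \<in> C"
        proof -
          have "z = gconj G (inv y) w \<otimes> y" using wc yc by (simp add: z_def gconj_def m_assoc)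
          then show ?thesis using n[OF wc] y subgroup.m_closed[OF C] subgroup.m_inv_closed[OF C] by simp
        qed
        ultimately have z: "z \<in> ?Z" by simp
        have "gconj G w y = w \<otimes> z" using wc yc by (simp add: z_def)
        then have "gconj G w (y [^] card ?Z) = w \<otimes> z [^] card ?Z"
          using gconj_pow_central[of w y z "card ?Z"] wc yc z y cO by auto
        then show ?thesis using pow_card_subgroup[OF Z z] wc by simp
      qed
      then show ?thesis
        using yc cO gconj_eq_self_iff by (auto simp: gcentralizer_def)
    qed
    then have "y [^] card ?Z \<in> ?O" using ch by (auto simp: characteristic_p_def)
    then have "(y [^] card ?Z) [^] card ?O = \<one>" using pow_card_subgroup[OF O] by simp
    then have "y [^] (p ^ (c + b) :: nat) = \<one>" using yc b c by (simp add: nat_pow_pow power_add)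
    then show ?thesis by blast
  qed
  then have "psubgroup G p ?D" by (rule psubgroupI_elements[OF D])
  moreover have "gconj G a g \<in> ?D" if g: "g \<in> carrier G" and a: "a \<in> ?D" for g a
  proof -
    have "gconj G z (gconj G a g) = z" if z: "z \<in> ?Z" for z
    proof -
      have zi: "gconj G z (inv g) \<in> ?Z" using z p_core_gconj n g by simp
      have "gconj G (gconj G (gconj G z (inv g)) g) (gconj G a g) = gconj G (gconj G (gconj G z (inv g)) a) g"
        by (rule gconj_gconj) (use z g a cO cC in auto)
      also have "\<dots> = gconj G (gconj G z (inv g)) g" using zi a by simp
      finally show ?thesis using z g cO by simp
    qed
    then show ?thesis using a n g by simp
  qed
  ultimately have "?D \<subseteq> ?O" by (rule normal_psubgroup_subset_p_core)
  moreover have "x \<in> ?D" using x cC cO by (auto simp: gconj_eq_self_iff)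
  ultimately show ?thesis by blast
qed

text \<open>Since a power of \<open>t\<close> lies in the \<open>p\<close>-group \<open>P\<close>,
  the order of \<open>t\<close> is a power of \<open>p\<close>, and the product of \<open>P\<close>
  with the cyclic group generated by \<open>t\<close> is the required subgroup.\<close>

lemma psubgroup_mult_generate:
  assumes P: "psubgroup G p P" and t: "t \<in> carrier G" "\<And>x. x \<in> P \<Longrightarrow> gconj G x t \<in> P"
    and k: "t [^] (p ^ k :: nat) \<in> P"
  shows "\<exists>H. psubgroup G p H \<and> P \<subseteq> H \<and> t \<in> H \<and> (\<forall>h\<in>H. \<forall>x\<in>P. gconj G x h \<in> P)"
proof -
  have Ps: "subgroup P G" using P by (rule psubgroup_subgroup)
  obtain b where b: "card P = p ^ b" using P by (auto simp: psubgroup_def)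
  have "(t [^] (p ^ k :: nat)) [^] card P = \<one>" using pow_card_subgroup[OF Ps k] .
  then have "t [^] (p ^ (k + b) :: nat) = \<one>" using t b by (simp add: nat_pow_pow power_add)
  then have A: "psubgroup G p (generate G {t})" using psubgroup_generate t by blast
  have PN: "P \<subseteq> carrier G" "finite P" using subgroup.subset[OF Ps] finite_subgroup[OF Ps] by auto
  have N: "subgroup (normalizer G P) G" using PN(1) by (rule normalizer_imp_subgroup)
  have "generate G {t} \<subseteq> normalizer G P"
    using t N by (intro generate_subgroup_incl) (auto simp: mem_normalizer_iff[OF PN])
  then have n: "gconj G x a \<in> P" if "a \<in> generate G {t}" "x \<in> P" for a x
    using that mem_normalizer_iff[OF PN] by blast
  have H: "psubgroup G p (P <#> generate G {t})" using psubgroup_mult[OF A P] n by blast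
  have tg: "t \<in> generate G {t}" by (simp add: generate.incl)
  have "P \<subseteq> P <#> generate G {t}"
  proof
    fix x assume "x \<in> P"
    moreover have "x = x \<otimes> \<one>" using \<open>x \<in> P\<close> PN by auto
    ultimately show "x \<in> P <#> generate G {t}" unfolding mem_set_mult_iff using generate.one by blast
  qed
  moreover have "t \<in> P <#> generate G {t}"
  proof -
    have "t = \<one> \<otimes> t" using t by simp
    then show ?thesis unfolding mem_set_mult_iff using subgroup.one_closed[OF Ps] tg by blast
  qed
  moreover have "gconj G x h \<in> P" if "h \<in> P <#> generate G {t}" "x \<in> P" for h x
  proof -
    obtain a c where h: "h = a \<otimes> c" "a \<in> P" "c \<in> generate G {t}"
      using \<open>h \<in> _\<close> unfolding mem_set_mult_iff by blast
    have "c \<in> carrier G" using h subgroup.mem_carrier[OF psubgroup_subgroup[OF A]] by blast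
    then have "gconj G x h = gconj G (gconj G x a) c" using h that PN(1) by (simp add: gconj_comp subset_iff)
    then show ?thesis using n h that subgroup_gconj_closed[OF Ps] by simp
  qed
  ultimately show ?thesis using H by blast
qed

end

section \<open>Fusion systems\<close>

text \<open>Morphisms are handled as plain functions on a subgroup; only their restriction to that
  subgroup matters.\<close>

definition fmor :: "'a fusion \<Rightarrow> 'a set \<Rightarrow> ('a \<Rightarrow> 'a) \<Rightarrow> bool" where
  "fmor F P f \<longleftrightarrow> restrict f P \<in> fhom F P (carrier (fgrp F))"

context fusion_system
begin

sublocale S: finite_group "fgrp F" p
  using prime_p group_S finite_S by (simp add: finite_group_def finite_group_axioms_def)

abbreviation "SS \<equiv> carrier (fgrp F)"
abbreviation "sgr P \<equiv> subgroup P (fgrp F)"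
abbreviation "cj \<equiv> gconj (fgrp F)"
abbreviation "NS \<equiv> normalizer (fgrp F)"
abbreviation "CS \<equiv> gcentralizer (fgrp F)"

lemma sgr_S: "sgr SS" by (rule S.subgroup_self)

lemma sgr_mem: "sgr P \<Longrightarrow> x \<in> P \<Longrightarrow> x \<in> SS" by (rule subgroup.mem_carrier)

lemma psubgroup_S: "sgr P \<Longrightarrow> psubgroup (fgrp F) p P"
  using S.psubgroup_subset[of SS P] p_group_S subgroup.subset[of P "fgrp F"] sgr_S
  by (auto simp: psubgroup_def order_def)

lemma mem_NS_iff: "sgr P \<Longrightarrow> g \<in> NS P \<longleftrightarrow> g \<in> SS \<and> (\<forall>x\<in>P. cj x g \<in> P)"
  by (rule S.mem_normalizer_iff) (auto simp: subgroup.subset S.finite_subgroup)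

lemma sgr_NS: "sgr P \<Longrightarrow> sgr (NS P)"
  by (rule S.normalizer_imp_subgroup) (rule subgroup.subset)

lemma sub_NS: "sgr P \<Longrightarrow> P \<subseteq> NS P"
  by (auto simp: mem_NS_iff S.subgroup_gconj_closed sgr_mem)

lemma NS_gconj: "sgr P \<Longrightarrow> g \<in> NS P \<Longrightarrow> x \<in> P \<Longrightarrow> cj x g \<in> P"
  by (simp add: mem_NS_iff)

lemma NS_mem: "sgr P \<Longrightarrow> g \<in> NS P \<Longrightarrow> g \<in> SS"
  by (simp add: mem_NS_iff)

lemma mem_CS_iff:
  assumes "P \<subseteq> SS" shows "g \<in> CS P \<longleftrightarrow> g \<in> SS \<and> (\<forall>x\<in>P. cj x g = x)"
proof -
  have "cj x g = x \<longleftrightarrow> g \<otimes>\<^bsub>fgrp F\<^esub> x = x \<otimes>\<^bsub>fgrp F\<^esub> g" if "x \<in> P" "g \<in> SS" for x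
    using that S.gconj_eq_self_iff[of x g] assms by auto
  then show ?thesis by (auto simp: gcentralizer_def)
qed

lemma sgr_CS: assumes P: "P \<subseteq> SS" shows "sgr (CS P)"
proof
  show "CS P \<subseteq> SS" by (auto simp: gcentralizer_def)
  show "\<one>\<^bsub>fgrp F\<^esub> \<in> CS P" using P by (auto simp: gcentralizer_def)
  fix x y assume x: "x \<in> CS P"
  show "x \<otimes>\<^bsub>fgrp F\<^esub> y \<in> CS P" if y: "y \<in> CS P"
    using x y P by (auto simp: mem_CS_iff subset_iff simp flip: S.gconj_comp)
  have "cj a (inv\<^bsub>fgrp F\<^esub> x) = a" if "a \<in> P" for a
  proof -
    have "cj (cj a x) (inv\<^bsub>fgrp F\<^esub> x) = a" using x P that by (intro S.gconj_cancel) (auto simp: mem_CS_iff)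
    then show ?thesis using x P that by (simp add: mem_CS_iff)
  qed
  then show "inv\<^bsub>fgrp F\<^esub> x \<in> CS P" using x P by (simp add: mem_CS_iff)
qed

lemma CS_sub_NS: "sgr P \<Longrightarrow> CS P \<subseteq> NS P"
  using subgroup.subset[of P "fgrp F"] by (auto simp: mem_NS_iff mem_CS_iff)

text \<open>Reduces all hom sets to morphisms into the whole of \<open>S\<close>: enlarging a target
  composes with an inclusion, and shrinking it composes the isomorphism onto the image with an
  inclusion.\<close>

lemma fhom_iff:
  "\<phi> \<in> fhom F P R \<longleftrightarrow> sgr R \<and> \<phi> \<in> extensional P \<and> \<phi> ` P \<subseteq> R \<and> fmor F P \<phi>"
proof
  assume h: "\<phi> \<in> fhom F P R"
  have m: "\<phi> \<in> extensional P" "\<phi> \<in> hom (fgrp F\<lparr>carrier := P\<rparr>) (fgrp F\<lparr>carrier := R\<rparr>)"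
    using maps[OF h] by auto
  have im: "\<phi> ` P \<subseteq> R" using m(2) by (auto simp: hom_def)
  have R: "sgr R" using objects[OF h] by simp
  have "(\<lambda>x\<in>R. cj x \<one>\<^bsub>fgrp F\<^esub>) \<in> fhom F R SS"
    using R sgr_mem[OF R] by (intro inner sgr_S) auto
  from comp[OF h this] have "compose P (\<lambda>x\<in>R. cj x \<one>\<^bsub>fgrp F\<^esub>) \<phi> \<in> fhom F P SS" .
  moreover have "compose P (\<lambda>x\<in>R. cj x \<one>\<^bsub>fgrp F\<^esub>) \<phi> = restrict \<phi> P"
    using im sgr_mem[OF R] by (auto simp: compose_def fun_eq_iff)
  ultimately show "sgr R \<and> \<phi> \<in> extensional P \<and> \<phi> ` P \<subseteq> R \<and> fmor F P \<phi>"
    using R m im by (simp add: fmor_def)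
next
  assume h: "sgr R \<and> \<phi> \<in> extensional P \<and> \<phi> ` P \<subseteq> R \<and> fmor F P \<phi>"
  then have "\<phi> \<in> fhom F P SS" by (auto simp: fmor_def extensional_restrict)
  then have h1: "\<phi> \<in> fhom F P (\<phi> ` P)" using isos by blast
  then have I: "sgr (\<phi> ` P)" using objects by blast
  have "(\<lambda>x\<in>\<phi> ` P. cj x \<one>\<^bsub>fgrp F\<^esub>) \<in> fhom F (\<phi> ` P) R"
    using h I sgr_mem[OF I] by (intro inner) auto
  from comp[OF h1 this] have "compose P (\<lambda>x\<in>\<phi> ` P. cj x \<one>\<^bsub>fgrp F\<^esub>) \<phi> \<in> fhom F P R" .
  moreover have "compose P (\<lambda>x\<in>\<phi> ` P. cj x \<one>\<^bsub>fgrp F\<^esub>) \<phi> = \<phi>"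
    using h sgr_mem[OF I] by (auto simp: compose_def fun_eq_iff extensional_def)
  ultimately show "\<phi> \<in> fhom F P R" by simp
qed

lemma fmor_cong: "(\<And>x. x \<in> P \<Longrightarrow> f x = g x) \<Longrightarrow> fmor F P f \<longleftrightarrow> fmor F P g"
  by (simp add: fmor_def cong: restrict_cong)

lemma fmor_sgr: "fmor F P f \<Longrightarrow> sgr P"
  using objects by (auto simp: fmor_def)

lemma fmor_hom: "fmor F P f \<Longrightarrow> restrict f P \<in> hom (fgrp F\<lparr>carrier := P\<rparr>) (fgrp F)"
  using maps by (fastforce simp: fmor_def)

lemma fmor_closed: "fmor F P f \<Longrightarrow> x \<in> P \<Longrightarrow> f x \<in> SS"
  using fmor_hom[of P f] by (auto simp: hom_def Pi_iff)

lemma fmor_mult: "fmor F P f \<Longrightarrow> x \<in> P \<Longrightarrow> y \<in> P \<Longrightarrow> f (x \<otimes>\<^bsub>fgrp F\<^esub> y) = f x \<otimes>\<^bsub>fgrp F\<^esub> f y"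
  using fmor_hom[of P f] subgroup.m_closed[OF fmor_sgr[of P f]] by (force simp: hom_def)

lemma fmor_inj: "fmor F P f \<Longrightarrow> inj_on f P"
  using maps by (fastforce simp: fmor_def inj_on_def)

lemma fmor_one: assumes f: "fmor F P f" shows "f \<one>\<^bsub>fgrp F\<^esub> = \<one>\<^bsub>fgrp F\<^esub>"
proof -
  have o: "\<one>\<^bsub>fgrp F\<^esub> \<in> P" using fmor_sgr[OF f] by (rule subgroup.one_closed)
  have "f \<one>\<^bsub>fgrp F\<^esub> \<otimes>\<^bsub>fgrp F\<^esub> f \<one>\<^bsub>fgrp F\<^esub> = f \<one>\<^bsub>fgrp F\<^esub>" using fmor_mult[OF f o o] by simp
  then show ?thesis using fmor_closed[OF f o] S.l_cancel_one' by metis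
qed

lemma fmor_m_inv: assumes f: "fmor F P f" and x: "x \<in> P"
  shows "f (inv\<^bsub>fgrp F\<^esub> x) = inv\<^bsub>fgrp F\<^esub> (f x)"
proof -
  have i: "inv\<^bsub>fgrp F\<^esub> x \<in> P" using fmor_sgr[OF f] x by (rule subgroup.m_inv_closed)
  have "f (inv\<^bsub>fgrp F\<^esub> x) \<otimes>\<^bsub>fgrp F\<^esub> f x = \<one>\<^bsub>fgrp F\<^esub>"
    using fmor_mult[OF f i x] fmor_one[OF f] sgr_mem[OF fmor_sgr[OF f] x] by simp
  then show ?thesis using fmor_closed[OF f] i x by (metis S.inv_equality)
qed

lemma fmor_gconj: "fmor F P f \<Longrightarrow> x \<in> P \<Longrightarrow> g \<in> P \<Longrightarrow> f (cj x g) = cj (f x) (f g)"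
  using fmor_sgr[of P f] by (simp add: gconj_def fmor_mult fmor_m_inv subgroup.m_closed subgroup.m_inv_closed)

lemma fmor_conj: "sgr P \<Longrightarrow> g \<in> SS \<Longrightarrow> fmor F P (\<lambda>x. cj x g)"
  using inner[of P SS g] sgr_S sgr_mem by (simp add: fmor_def)

lemma fmor_id: "sgr P \<Longrightarrow> fmor F P (\<lambda>x. x)"
  using fmor_conj[of P "\<one>\<^bsub>fgrp F\<^esub>"] fmor_cong[of P "\<lambda>x. cj x \<one>\<^bsub>fgrp F\<^esub>" "\<lambda>x. x"] sgr_mem by simp

lemma fmor_fhom_image: assumes f: "fmor F P f" shows "restrict f P \<in> fhom F P (f ` P)"
proof -
  have "restrict f P ` P = f ` P" by auto
  then show ?thesis using isos[of "restrict f P" P SS] f by (simp add: fmor_def)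
qed

lemma fmor_image_all: "fmor F P f \<Longrightarrow> sgr (f ` P)"
  using objects fmor_fhom_image by blast

lemma fmor_comp:
  assumes f: "fmor F P f" and g: "fmor F R g" and "f ` P \<subseteq> R"
  shows "fmor F P (\<lambda>x. g (f x))"
proof -
  have "restrict f P \<in> fhom F P R"
    unfolding fhom_iff using fmor_sgr[OF g] assms(3) f fmor_cong[of P "restrict f P" f] by auto
  moreover have "restrict g R \<in> fhom F R SS" using g by (simp add: fmor_def)
  ultimately have "compose P (restrict g R) (restrict f P) \<in> fhom F P SS" by (rule comp)
  moreover have "compose P (restrict g R) (restrict f P) = restrict (\<lambda>x. g (f x)) P"
    using assms(3) by (auto simp: compose_def fun_eq_iff)
  ultimately show ?thesis by (simp add: fmor_def)
qed

lemma fmor_mono: "fmor F P f \<Longrightarrow> sgr P' \<Longrightarrow> P' \<subseteq> P \<Longrightarrow> fmor F P' f"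
  using fmor_comp[OF fmor_id[of P'], of P f] by simp

lemma fmor_image: "fmor F P f \<Longrightarrow> sgr P' \<Longrightarrow> P' \<subseteq> P \<Longrightarrow> sgr (f ` P')"
  using fmor_image_all fmor_mono by blast

lemma fmor_inv:
  assumes f: "fmor F P f" shows "fmor F (f ` P) (inv_into P f)"
proof -
  have "(\<lambda>y\<in>restrict f P ` P. inv_into P (restrict f P) y) \<in> fhom F (restrict f P ` P) P"
    using isos[of "restrict f P" P SS] f unfolding fmor_def by blast
  moreover have r: "restrict f P ` P = f ` P" by auto
  moreover have "inv_into P (restrict f P) y = inv_into P f y" if yP: "y \<in> f ` P" for y
  proof -
    obtain x where x: "x \<in> P" "y = f x" using yP by blast
    have "inj_on (restrict f P) P" using fmor_inj[OF f] by (simp add: inj_on_def)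
    then have "inv_into P (restrict f P) (restrict f P x) = x" using x(1) by (rule inv_into_f_f)
    then show ?thesis using x inv_into_f_f[OF fmor_inj[OF f]] by simp
  qed
  ultimately have "(\<lambda>y\<in>f ` P. inv_into P f y) \<in> fhom F (f ` P) P"
    by (simp cong: restrict_cong)
  then have "fmor F (f ` P) (\<lambda>y\<in>f ` P. inv_into P f y)" by (simp add: fhom_iff)
  then show ?thesis using fmor_cong[of "f ` P" "\<lambda>y\<in>f ` P. inv_into P f y" "inv_into P f"] by simp
qed

lemma fmor_inv_sub:
  assumes f: "fmor F P f" and "sgr P'" "P' \<subseteq> P" shows "fmor F (f ` P') (inv_into P f)"
  using fmor_mono[OF fmor_inv[OF f] fmor_image[OF assms]] assms(3) by blast

lemma fmor_inv_f: "fmor F P f \<Longrightarrow> x \<in> P \<Longrightarrow> inv_into P f (f x) = x"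
  using fmor_inj inv_into_f_f by metis

lemma fmor_inv_image: "fmor F P f \<Longrightarrow> A \<subseteq> P \<Longrightarrow> inv_into P f ` f ` A = A"
  using fmor_inv_f by (force simp: image_image)

lemma fmor_card: "fmor F P f \<Longrightarrow> A \<subseteq> P \<Longrightarrow> card (f ` A) = card A"
  using fmor_inj card_image inj_on_subset by metis

lemma fmor_image_NS:
  assumes f: "fmor F P f" and X: "sgr X" "X \<subseteq> P" shows "f ` (P \<inter> NS X) \<subseteq> NS (f ` X)"
proof -
  have fX: "sgr (f ` X)" using fmor_image[OF assms] .
  show ?thesis
  proof
    fix y assume "y \<in> f ` (P \<inter> NS X)"
    then obtain g where g: "g \<in> P" "g \<in> NS X" "y = f g" by blast
    have "cj (f x) (f g) \<in> f ` X" if "x \<in> X" for x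
      using fmor_gconj[OF f, of x g] NS_gconj[OF X(1) g(2) that] X(2) that g(1) by (metis imageI subsetD)
    then show "y \<in> NS (f ` X)" using g fmor_closed[OF f] by (auto simp: mem_NS_iff[OF fX])
  qed
qed

lemma fmor_image_CS:
  assumes f: "fmor F P f" and X: "X \<subseteq> P" shows "f ` (P \<inter> CS X) \<subseteq> CS (f ` X)"
proof
  fix y assume "y \<in> f ` (P \<inter> CS X)"
  then obtain g where g: "g \<in> P" "g \<in> CS X" "y = f g" by blast
  have "f g \<otimes>\<^bsub>fgrp F\<^esub> f x = f x \<otimes>\<^bsub>fgrp F\<^esub> f g" if "x \<in> X" for x
    using fmor_mult[OF f, of x g] fmor_mult[OF f, of g x] g X that by (auto simp: gcentralizer_def)
  then show "y \<in> CS (f ` X)" using g fmor_closed[OF f] by (auto simp: gcentralizer_def)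
qed

lemma fiso_iff: "a \<in> fiso F P R \<longleftrightarrow> a \<in> extensional P \<and> fmor F P a \<and> a ` P = R"
  using fmor_image_all by (auto simp: fiso_def fhom_iff)

lemma fconjugate_iff: "fconjugate F P R \<longleftrightarrow> (\<exists>f. fmor F P f \<and> f ` P = R)"
proof
  assume "fconjugate F P R" then show "\<exists>f. fmor F P f \<and> f ` P = R" by (auto simp: fconjugate_def fiso_iff)
next
  assume "\<exists>f. fmor F P f \<and> f ` P = R"
  then obtain f where "fmor F P f" "f ` P = R" by blast
  then have "restrict f P \<in> fiso F P R" using fmor_cong[of P "restrict f P" f] by (auto simp: fiso_iff)
  then show "fconjugate F P R" by (auto simp: fconjugate_def)
qed

lemma fconjugateI: "fmor F P f \<Longrightarrow> fconjugate F P (f ` P)"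
  by (auto simp: fconjugate_iff)

lemma fconjugate_sgr: "fconjugate F P R \<Longrightarrow> sgr P \<and> sgr R"
  using fmor_sgr fmor_image_all by (auto simp: fconjugate_iff)

lemma fconjugate_refl: "sgr P \<Longrightarrow> fconjugate F P P"
  using fmor_id[of P] by (force simp: fconjugate_iff)

lemma fconjugate_sym: assumes "fconjugate F P R" shows "fconjugate F R P"
proof -
  obtain f where f: "fmor F P f" "f ` P = R" using assms by (auto simp: fconjugate_iff)
  have "inv_into P f ` R = P" using fmor_inv_image[OF f(1), of P] f(2) by simp
  then show ?thesis using fmor_inv[OF f(1)] f(2) by (auto simp: fconjugate_iff)
qed

lemma fconjugate_trans: assumes "fconjugate F P R" "fconjugate F R T" shows "fconjugate F P T"
proof -
  obtain f g where f: "fmor F P f" "f ` P = R" "fmor F R g" "g ` R = T"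
    using assms by (auto simp: fconjugate_iff)
  have "(\<lambda>x. g (f x)) ` P = T" using f image_image[of g f P] by simp
  then show ?thesis using fmor_comp[OF f(1,3)] f(2) by (auto simp: fconjugate_iff)
qed

lemma fconjugate_card: "fconjugate F P R \<Longrightarrow> card R = card P"
  using fmor_card by (auto simp: fconjugate_iff)

subsection \<open>Automorphism groups\<close>

lemma Aut_F_simps [simp]:
  "carrier (Aut_F F R) = fiso F R R"
  by (simp add: Aut_F_def)

lemma fiso_Bij: "a \<in> fiso F R R \<Longrightarrow> a \<in> Bij R"
  using fmor_inj by (auto simp: fiso_iff Bij_def bij_betw_def)

lemma Aut_F_mult: "a \<in> fiso F R R \<Longrightarrow> b \<in> fiso F R R \<Longrightarrow> a \<otimes>\<^bsub>Aut_F F R\<^esub> b = compose R a b"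
  using fiso_Bij by (simp add: Aut_F_def BijGroup_def)

lemma restrict_fiso: "fmor F P f \<Longrightarrow> f ` P = R \<Longrightarrow> restrict f P \<in> fiso F P R"
  using fmor_cong[of P "restrict f P" f] by (auto simp: fiso_iff)

lemma subgroup_Aut: assumes R: "sgr R" shows "subgroup (fiso F R R) (BijGroup R)"
proof
  show "fiso F R R \<subseteq> carrier (BijGroup R)" using fiso_Bij by (auto simp: BijGroup_def)
  have "\<one>\<^bsub>BijGroup R\<^esub> = restrict (\<lambda>x. x) R" by (simp add: BijGroup_def)
  then show "\<one>\<^bsub>BijGroup R\<^esub> \<in> fiso F R R" using restrict_fiso[OF fmor_id[OF R]] by simp
  fix a assume a: "a \<in> fiso F R R"
  show "a \<otimes>\<^bsub>BijGroup R\<^esub> b \<in> fiso F R R" if b: "b \<in> fiso F R R" for b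
  proof -
    have "a \<otimes>\<^bsub>BijGroup R\<^esub> b = restrict (\<lambda>x. a (b x)) R"
      using fiso_Bij[OF a] fiso_Bij[OF b] by (simp add: BijGroup_def compose_def)
    moreover have "(\<lambda>x. a (b x)) ` R = R" using a b image_image[of a b R] by (simp add: fiso_iff)
    ultimately show ?thesis using fmor_comp[of R b R a] a b restrict_fiso by (simp add: fiso_iff)
  qed
  have "inv\<^bsub>BijGroup R\<^esub> a = restrict (inv_into R a) R" using inv_BijGroup[OF fiso_Bij[OF a]] by simp
  moreover have "inv_into R a ` R = R" using a fmor_inv_image[of R a R] by (simp add: fiso_iff)
  ultimately show "inv\<^bsub>BijGroup R\<^esub> a \<in> fiso F R R"
    using fmor_inv[of R a] a restrict_fiso by (simp add: fiso_iff)
qed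

lemma finite_group_Aut: assumes R: "sgr R" shows "finite_group (Aut_F F R) p"
proof -
  have "finite R" using R by (rule S.finite_subgroup)
  then have "finite (PiE R (\<lambda>_. R))" by (simp add: finite_PiE)
  moreover have "Bij R \<subseteq> PiE R (\<lambda>_. R)"
    by (auto simp: PiE_def Bij_def dest: bij_betwE)
  ultimately have "finite (Bij R)" by (rule finite_subset[rotated])
  then have "finite (fiso F R R)" by (rule finite_subset[rotated]) (auto intro: fiso_Bij)
  moreover have "group (Aut_F F R)"
    unfolding Aut_F_def by (rule group.subgroup_imp_group[OF group_BijGroup subgroup_Aut[OF R]])
  ultimately show ?thesis using prime_p by (simp add: finite_group_def finite_group_axioms_def)
qed

lemma Aut_F_inv: assumes R: "sgr R" and a: "a \<in> fiso F R R"
  shows "inv\<^bsub>Aut_F F R\<^esub> a = restrict (inv_into R a) R"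
  unfolding Aut_F_def
  using group.m_inv_consistent[OF group_BijGroup subgroup_Aut[OF R] a] inv_BijGroup[OF fiso_Bij[OF a]]
  by simp

lemma Aut_F_one: "\<one>\<^bsub>Aut_F F R\<^esub> = restrict (\<lambda>x. x) R"
  by (simp add: Aut_F_def BijGroup_def)

text \<open>\<open>Aut_F\<close> composes left maps, so in \<open>k^-1 a k\<close> the map
  \<open>k\<close> is applied first.\<close>

lemma Aut_F_gconj:
  assumes R: "sgr R" and a: "a \<in> fiso F R R" and k: "k \<in> fiso F R R" and x: "x \<in> R"
  shows "gconj (Aut_F F R) a k x = inv_into R k (a (k x))"
proof -
  interpret A: finite_group "Aut_F F R" p using R by (rule finite_group_Aut)
  have i: "inv\<^bsub>Aut_F F R\<^esub> k \<in> fiso F R R" using A.inv_closed k by simp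
  have ia: "inv\<^bsub>Aut_F F R\<^esub> k \<otimes>\<^bsub>Aut_F F R\<^esub> a \<in> fiso F R R" using A.m_closed i a by simp
  have "k x \<in> R" "a (k x) \<in> R" using a k x by (auto simp: fiso_iff)
  moreover have "gconj (Aut_F F R) a k = compose R (compose R (inv\<^bsub>Aut_F F R\<^esub> k) a) k"
    using Aut_F_mult[OF ia k] Aut_F_mult[OF i a] by (simp add: gconj_def)
  ultimately show ?thesis using x by (simp add: compose_def Aut_F_inv[OF R k])
qed

definition cR :: "'a set \<Rightarrow> 'a \<Rightarrow> 'a \<Rightarrow> 'a" where
  "cR R g = (\<lambda>x\<in>R. cj x g)"

lemma NS_image: assumes R: "sgr R" and g: "g \<in> NS R" shows "(\<lambda>x. cj x g) ` R = R"
proof (rule card_subset_eq[OF S.finite_subgroup[OF R]])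
  show "(\<lambda>x. cj x g) ` R \<subseteq> R" using NS_gconj[OF R g] by auto
  show "card ((\<lambda>x. cj x g) ` R) = card R"
    using S.card_gconj_image[OF subgroup.subset[OF R] NS_mem[OF R g]] .
qed

lemma cR_fiso: "sgr R \<Longrightarrow> g \<in> NS R \<Longrightarrow> cR R g \<in> fiso F R R"
  unfolding cR_def by (intro restrict_fiso fmor_conj NS_image) (auto dest: NS_mem)

lemma Aut_S_eq: "Aut_S F R = cR R ` NS R"
  by (auto simp: Aut_S_def cR_def)

text \<open>The action of \<open>T\<close> on \<open>R'\<close>, carried over to \<open>R\<close>.
  This is the \<open>p\<close>-subgroup that has to be moved into \<open>Aut_S F R\<close> before
  receptivity can extend \<open>f\<close> over \<open>T\<close>.\<close>

lemma psubgroup_transported_conj: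
  assumes f: "fmor F R' f" "f ` R' = R" and T: "sgr T" "T \<subseteq> NS R'"
  shows "psubgroup (Aut_F F R) p ((\<lambda>t. \<lambda>y\<in>R. f (cj (inv_into R' f y) t)) ` T)"
proof -
  have R: "sgr R" "sgr R'" using fmor_sgr fmor_image_all f by auto
  interpret A: finite_group "Aut_F F R" p using R(1) by (rule finite_group_Aut)
  interpret T: finite_group "fgrp F\<lparr>carrier := T\<rparr>" p using S.restrict_finite_group[OF T(1)] .
  let ?h = "\<lambda>t. \<lambda>y\<in>R. f (cj (inv_into R' f y) t)"
  \<comment> \<open>Conjugation acts from the right while \<open>Aut_F\<close> composes left maps,
    so \<open>?h\<close> reverses products; inserting the inverse gives a homomorphism with the same
    image.\<close>
  let ?g = "\<lambda>t. ?h (inv\<^bsub>fgrp F\<^esub> t)"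
  have i: "inv_into R' f y \<in> R'" if "y \<in> R" for y using that f inv_into_into by metis
  have hc: "?h t \<in> fiso F R R" if t: "t \<in> NS R'" for t
  proof (rule restrict_fiso)
    have c: "fmor F R' (\<lambda>x. cj x t)" using fmor_conj[OF R(2)] NS_mem[OF R(2) t] by blast
    have im: "inv_into R' f ` R = R'" using fmor_inv_image[OF f(1), of R'] f(2) by simp
    have "fmor F R (\<lambda>y. cj (inv_into R' f y) t)"
      using fmor_comp[OF fmor_inv[OF f(1)] c] im f(2) by simp
    moreover have im2: "(\<lambda>y. cj (inv_into R' f y) t) ` R = R'"
      using NS_image[OF R(2) t] im image_image[of "\<lambda>x. cj x t" "inv_into R' f" R] by simp
    ultimately show "fmor F R (\<lambda>y. f (cj (inv_into R' f y) t))" using fmor_comp f(1) by blast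
    show "(\<lambda>y. f (cj (inv_into R' f y) t)) ` R = R" using im2 f(2) image_image[of f "\<lambda>y. cj (inv_into R' f y) t" R] by simp
  qed
  have T': "t \<in> NS R'" "inv\<^bsub>fgrp F\<^esub> t \<in> T" "t \<in> SS" if "t \<in> T" for t
    using that T subgroup.m_inv_closed[OF T(1)] sgr_mem by auto
  have "group_hom (fgrp F\<lparr>carrier := T\<rparr>) (Aut_F F R) ?g"
  proof (unfold_locales, rule homI)
    show "?g t \<in> carrier (Aut_F F R)" if "t \<in> carrier (fgrp F\<lparr>carrier := T\<rparr>)" for t
      using that hc T' by simp
    fix s t assume "s \<in> carrier (fgrp F\<lparr>carrier := T\<rparr>)" "t \<in> carrier (fgrp F\<lparr>carrier := T\<rparr>)"
    then have st: "s \<in> T" "t \<in> T" by auto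
    have "?g (s \<otimes>\<^bsub>fgrp F\<^esub> t) = compose R (?g s) (?g t)"
    proof (rule ext)
      fix y show "?g (s \<otimes>\<^bsub>fgrp F\<^esub> t) y = compose R (?g s) (?g t) y"
      proof (cases "y \<in> R")
        case True
        let ?x = "inv_into R' f y"
        have x: "?x \<in> R'" using i True .
        have x1: "cj ?x (inv\<^bsub>fgrp F\<^esub> t) \<in> R'" using NS_gconj[OF R(2)] T' st x by blast
        then have "f (cj ?x (inv\<^bsub>fgrp F\<^esub> t)) \<in> R" using f(2) by blast
        then show ?thesis
          using True x x1 T' st sgr_mem[OF R(2)] f fmor_inv_f[OF f(1)]
          by (simp add: compose_def S.inv_mult_group S.gconj_comp)
      qed (simp add: compose_def)
    qed
    then show "?g (s \<otimes>\<^bsub>fgrp F\<lparr>carrier := T\<rparr>\<^esub> t) = ?g s \<otimes>\<^bsub>Aut_F F R\<^esub> ?g t"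
      using st hc T' by (simp add: Aut_F_mult)
  qed
  then interpret h: group_hom "fgrp F\<lparr>carrier := T\<rparr>" "Aut_F F R" ?g .
  have "psubgroup (fgrp F\<lparr>carrier := T\<rparr>) p T"
    using psubgroup_S[OF T(1)] S.psubgroup_restrict[OF T(1)] by simp
  then have "psubgroup (Aut_F F R) p (?g ` T)" using h.psubgroup_image[OF T.fin prime_p] by simp
  moreover have "?g ` T = ?h ` T"
  proof
    show "?g ` T \<subseteq> ?h ` T" using T'(2) by blast
    show "?h ` T \<subseteq> ?g ` T"
    proof
      fix a assume "a \<in> ?h ` T"
      then obtain t where "t \<in> T" "a = ?h t" by blast
      then have "inv\<^bsub>fgrp F\<^esub> t \<in> T" "a = ?g (inv\<^bsub>fgrp F\<^esub> t)" using T' by auto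
      then show "a \<in> ?g ` T" by blast
    qed
  qed
  ultimately show ?thesis by simp
qed

lemma psubgroup_conj_maps:
  assumes R: "sgr R" and T: "sgr T" "T \<subseteq> NS R"
  shows "psubgroup (Aut_F F R) p (cR R ` T)"
proof -
  have i: "inv_into R (\<lambda>x. x) y = y" if "y \<in> R" for y using fmor_inv_f[OF fmor_id[OF R] that] .
  have "psubgroup (Aut_F F R) p ((\<lambda>t. \<lambda>y\<in>R. cj (inv_into R (\<lambda>x. x) y) t) ` T)"
    using psubgroup_transported_conj[OF fmor_id[OF R] _ T] by simp
  then show ?thesis unfolding cR_def using i by (simp cong: restrict_cong)
qed

lemma sylow_Aut_S:
  assumes "sgr R" "fully_automized p F R"
  shows "sylow_in (Aut_F F R) p (fiso F R R) (Aut_S F R)"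
proof -
  interpret A: finite_group "Aut_F F R" p using assms(1) by (rule finite_group_Aut)
  have "subgroup (Aut_S F R) (Aut_F F R)" "card (Aut_S F R) = p ^ multiplicity p (card (fiso F R R))"
    using assms by (auto simp: fully_automized_def sylow_subgroup_def order_def)
  then show ?thesis using A.sylow_inI_card[of "fiso F R R" "Aut_S F R"] A.subgroup_self
      subgroup.subset[of "Aut_S F R" "Aut_F F R"] by auto
qed

end

lemma inv_into_restrict: "inv_into A (restrict f A) = inv_into A f"
  by (simp add: inv_into_def fun_eq_iff cong: conj_cong)

context fusion_system
begin

subsection \<open>Extension of morphisms\<close>

definition good :: "'a set \<Rightarrow> bool" where
  "good R \<longleftrightarrow> sgr R \<and> fully_automized p F R \<and> receptive F R"

definition Kst :: "'a set \<Rightarrow> 'a set \<Rightarrow> ('a \<Rightarrow> 'a) set" where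
  "Kst R X = {a \<in> fiso F R R. a ` X = X}"

definition Kcs :: "'a set \<Rightarrow> 'a set \<Rightarrow> ('a \<Rightarrow> 'a) set" where
  "Kcs R X = {a \<in> fiso F R R. \<forall>x\<in>X. a x = x}"

text \<open>The part of \<open>Kst R X\<close> induced by elements of \<open>S\<close> that
  normalize both subgroups; it is the intended Sylow subgroup of \<open>Kst R X\<close>.\<close>

definition Tst :: "'a set \<Rightarrow> 'a set \<Rightarrow> ('a \<Rightarrow> 'a) set" where
  "Tst R X = cR R ` (NS R \<inter> NS X)"

lemma saturated_iff:
  "saturated p F \<longleftrightarrow> (\<forall>P. sgr P \<longrightarrow> (\<exists>R. fconjugate F P R \<and> good R))"
  unfolding saturated_def good_def using fusion_system_axioms fconjugate_sgr by meson

text \<open>Hides \<open>extension_group\<close>: it is enough that each element of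
  \<open>T\<close>, after transport along \<open>f\<close>, acts on \<open>R\<close> as conjugation
  by some element of \<open>NS R\<close>.\<close>

lemma receptiveD:
  assumes rec: "receptive F R" and f: "fmor F R' f" "f ` R' = R"
    and T: "\<And>t. t \<in> T \<Longrightarrow> t \<in> NS R' \<and> (\<exists>s\<in>NS R. \<forall>y\<in>R. f (cj (inv_into R' f y) t) = cj y s)"
  shows "\<exists>E g. fmor F E g \<and> R' \<subseteq> E \<and> T \<subseteq> E \<and> (\<forall>x\<in>R'. g x = f x)"
proof -
  let ?f = "restrict f R'"
  let ?E = "extension_group F R' R ?f"
  have R: "sgr R'" "sgr R" using fmor_sgr fmor_image_all f by auto
  have "?f \<in> fiso F R' R" using restrict_fiso f .
  then obtain g where g: "g \<in> fhom F ?E SS" "restrict g R' = ?f"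
    using rec R(1) unfolding receptive_def by blast
  have gE: "fmor F ?E g" using g by (simp add: fhom_iff)
  have i: "inv_into R' f y \<in> R'" if "y \<in> R" for y using that f(2) inv_into_into by metis
  have mem: "t \<in> ?E" if t: "t \<in> NS R'" "\<exists>s\<in>NS R. \<forall>y\<in>R. f (cj (inv_into R' f y) t) = cj y s" for t
  proof -
    obtain s where s: "s \<in> NS R" "\<And>y. y \<in> R \<Longrightarrow> f (cj (inv_into R' f y) t) = cj y s" using t by blast
    have "(\<lambda>y\<in>R. ?f (cj (inv_into R' ?f y) t)) = cR R s"
      using s(2) i NS_gconj[OF R(1) t(1)] by (simp add: cR_def inv_into_restrict cong: restrict_cong)
    then show ?thesis using s t by (auto simp: extension_group_def Aut_S_eq)
  qed
  have "R' \<subseteq> ?E"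
  proof
    fix t assume t: "t \<in> R'"
    have "f (cj (inv_into R' f y) t) = cj y (f t)" if "y \<in> R" for y
      using fmor_gconj[OF f(1) i[OF that] t] f_inv_into_f[of y f R'] that f(2) by simp
    moreover have "f t \<in> NS R" using sub_NS[OF R(2)] f(2) t by blast
    ultimately show "t \<in> ?E" using mem[of t] sub_NS[OF R(1)] t by blast
  qed
  moreover have "T \<subseteq> ?E" using T mem by blast
  moreover have "g x = f x" if "x \<in> R'" for x using fun_cong[OF g(2), of x] that by simp
  ultimately show ?thesis using gE by blast
qed

lemma subgroup_Kst: assumes R: "sgr R" and X: "sgr X" "X \<subseteq> R" shows "subgroup (Kst R X) (Aut_F F R)"
proof -
  interpret A: finite_group "Aut_F F R" p using R by (rule finite_group_Aut)
  show ?thesis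
  proof
    show "Kst R X \<subseteq> carrier (Aut_F F R)" by (auto simp: Kst_def)
    show "\<one>\<^bsub>Aut_F F R\<^esub> \<in> Kst R X"
      using A.one_closed X by (auto simp: Kst_def Aut_F_one image_iff subset_iff)
    show "a \<otimes>\<^bsub>Aut_F F R\<^esub> b \<in> Kst R X" if "a \<in> Kst R X" "b \<in> Kst R X" for a b
    proof -
      have "compose R a b ` X = a ` b ` X" using X by (force simp: compose_def)
      then show ?thesis using that A.m_closed[of a b] by (auto simp: Kst_def Aut_F_mult)
    qed
    show "inv\<^bsub>Aut_F F R\<^esub> a \<in> Kst R X" if "a \<in> Kst R X" for a
    proof -
      have a: "a \<in> fiso F R R" "a ` X = X" using that by (auto simp: Kst_def)
      have "restrict (inv_into R a) R ` X = inv_into R a ` X" using X(2) by (auto simp: image_iff subset_iff)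
      also have "\<dots> = X" using fmor_inv_image[of R a X] a X by (simp add: fiso_iff)
      finally show ?thesis using A.inv_closed[of a] a by (simp add: Kst_def Aut_F_inv[OF R])
    qed
  qed
qed

lemma Kcs_sub_Kst: "Kcs R X \<subseteq> Kst R X"
  by (auto simp: Kcs_def Kst_def image_iff)

lemma
  assumes R: "sgr R" and X: "sgr X" "X \<subseteq> R"
  shows subgroup_Kcs: "subgroup (Kcs R X) (Aut_F F R)"
    and Kcs_normal: "k \<in> Kst R X \<Longrightarrow> c \<in> Kcs R X \<Longrightarrow> gconj (Aut_F F R) c k \<in> Kcs R X"
proof -
  interpret A: finite_group "Aut_F F R" p using R by (rule finite_group_Aut)
  show "subgroup (Kcs R X) (Aut_F F R)"
  proof
    show "Kcs R X \<subseteq> carrier (Aut_F F R)" by (auto simp: Kcs_def)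
    show "\<one>\<^bsub>Aut_F F R\<^esub> \<in> Kcs R X" using A.one_closed X by (auto simp: Kcs_def Aut_F_one)
    show "a \<otimes>\<^bsub>Aut_F F R\<^esub> b \<in> Kcs R X" if "a \<in> Kcs R X" "b \<in> Kcs R X" for a b
      using that A.m_closed[of a b] X by (auto simp: Kcs_def Aut_F_mult compose_def)
    show "inv\<^bsub>Aut_F F R\<^esub> a \<in> Kcs R X" if a: "a \<in> Kcs R X" for a
    proof -
      have "inv_into R a x = x" if x: "x \<in> X" for x
        using fmor_inv_f[of R a x] a x X by (auto simp: Kcs_def fiso_iff)
      then show ?thesis using a A.inv_closed[of a] X by (auto simp: Kcs_def Aut_F_inv[OF R])
    qed
  qed
  assume k: "k \<in> Kst R X" and c: "c \<in> Kcs R X"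
  have kc: "k \<in> fiso F R R" "c \<in> fiso F R R" "k ` X = X" using k c by (auto simp: Kst_def Kcs_def)
  have "gconj (Aut_F F R) c k x = x" if x: "x \<in> X" for x
  proof -
    have "k x \<in> X" using kc x by blast
    then have "c (k x) = k x" using c by (auto simp: Kcs_def)
    then show ?thesis using Aut_F_gconj[OF R kc(2,1), of x] fmor_inv_f[of R k x] kc x X by (auto simp: fiso_iff)
  qed
  then show "gconj (Aut_F F R) c k \<in> Kcs R X" using A.gconj_closed[of c k] kc by (auto simp: Kcs_def)
qed

lemma Tst_sub_Kst:
  assumes "sgr R" "sgr X" "X \<subseteq> R" shows "Tst R X \<subseteq> Kst R X"
proof
  fix a assume "a \<in> Tst R X"
  then obtain s where s: "s \<in> NS R" "s \<in> NS X" "a = cR R s" by (auto simp: Tst_def)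
  have "a ` X = (\<lambda>x. cj x s) ` X" using s assms by (force simp: cR_def)
  then show "a \<in> Kst R X" using s cR_fiso[OF assms(1)] NS_image[OF assms(2)] by (simp add: Kst_def)
qed

lemma psubgroup_Tst:
  assumes R: "sgr R" and X: "sgr X" "X \<subseteq> R" shows "psubgroup (Aut_F F R) p (Tst R X)"
  unfolding Tst_def
  using psubgroup_conj_maps[OF R S.subgroup_Int[OF sgr_NS[OF R] sgr_NS[OF X(1)]]] by blast

text \<open>The transported action of \<open>T\<close> lies in the product of \<open>C\<close> and
  the Sylow subgroup \<open>Tst R X\<close>, so some element of \<open>C\<close> conjugates it into
  \<open>Tst R X\<close> and thus into \<open>Aut_S F R\<close>. Composing \<open>f\<close> with the
  inverse of that element performs this conjugation, and receptivity of \<open>R\<close> then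
  applies; the witness is this inverse.\<close>

lemma extend_modulo:
  assumes R: "good R" and X: "sgr X" "X \<subseteq> R" and syl: "sylow_in (Aut_F F R) p (Kst R X) (Tst R X)"
    and C: "subgroup C (Aut_F F R)" "C \<subseteq> Kst R X"
      "\<And>k c. k \<in> Kst R X \<Longrightarrow> c \<in> C \<Longrightarrow> gconj (Aut_F F R) c k \<in> C"
    and f: "fmor F R' f" "f ` R' = R" and T: "sgr T" "T \<subseteq> NS R'"
    and TC: "\<And>t. t \<in> T \<Longrightarrow> \<exists>c\<in>C. \<exists>s\<in>NS R \<inter> NS X. \<forall>y\<in>R. f (cj (inv_into R' f y) t) = c (cj y s)"
  shows "\<exists>c\<in>C. \<exists>E g. fmor F E g \<and> R' \<subseteq> E \<and> T \<subseteq> E \<and> (\<forall>x\<in>R'. g x = c (f x))"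
proof -
  have Rs: "sgr R" "sgr R'" using fmor_sgr fmor_image_all f by auto
  interpret A: finite_group "Aut_F F R" p using Rs(1) by (rule finite_group_Aut)
  let ?a = "\<lambda>t. \<lambda>y\<in>R. f (cj (inv_into R' f y) t)"
  have psub: "psubgroup (Aut_F F R) p (?a ` T)" by (rule psubgroup_transported_conj[OF f T])
  have "\<exists>c\<in>C. \<exists>b\<in>Tst R X. a = c \<otimes>\<^bsub>Aut_F F R\<^esub> b" if "a \<in> ?a ` T" for a
  proof -
    obtain t where t: "t \<in> T" "a = ?a t" using \<open>a \<in> ?a ` T\<close> by blast
    obtain c s where c: "c \<in> C" "s \<in> NS R" "s \<in> NS X" "\<And>y. y \<in> R \<Longrightarrow> f (cj (inv_into R' f y) t) = c (cj y s)"
      using TC[OF t(1)] by blast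
    have cf: "c \<in> fiso F R R" using c C(2) by (auto simp: Kst_def)
    have "a = c \<otimes>\<^bsub>Aut_F F R\<^esub> cR R s"
      unfolding Aut_F_mult[OF cf cR_fiso[OF Rs(1) c(2)]]
      using t c by (simp add: compose_def cR_def cong: restrict_cong)
    then show ?thesis using c by (auto simp: Tst_def)
  qed
  then obtain c where c: "c \<in> C" "\<And>a. a \<in> ?a ` T \<Longrightarrow> gconj (Aut_F F R) a c \<in> Tst R X"
    using A.sylow_in_conj_normal[OF syl subgroup_Kst[OF Rs(1) X] C psub] by blast
  have cf: "c \<in> fiso F R R" using c C(2) by (auto simp: Kst_def)
  have cF: "fmor F R c" "c ` R = R" using cf by (auto simp: fiso_iff)
  define d where "d = inv\<^bsub>Aut_F F R\<^esub> c"
  have d: "d \<in> C" using c(1) C(1) by (simp add: d_def subgroup.m_inv_closed)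
  have dx: "d x = inv_into R c x" if "x \<in> R" for x using that by (simp add: d_def Aut_F_inv[OF Rs(1) cf])
  have di: "inv_into R c x \<in> R" if "x \<in> R" for x using that cF by (metis inv_into_into)
  let ?g = "\<lambda>x. inv_into R c (f x)"
  have g: "fmor F R' ?g" using fmor_comp[OF f(1) fmor_inv[OF cF(1)]] f(2) cF(2) by simp
  have gR: "?g ` R' = R"
    using image_image[of "inv_into R c" f R'] f(2) fmor_inv_image[OF cF(1), of R] cF(2) by simp
  have gi: "inv_into R' ?g y = inv_into R' f (c y)" if y: "y \<in> R" for y
  proof -
    have "c y \<in> f ` R'" using y cF f by blast
    then have "?g (inv_into R' f (c y)) = y" "inv_into R' f (c y) \<in> R'"
      using fmor_inv_f[OF cF(1) y] by (auto simp: f_inv_into_f inv_into_into)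
    then show ?thesis using fmor_inv_f[OF g] by metis
  qed
  have "\<exists>E h. fmor F E h \<and> R' \<subseteq> E \<and> T \<subseteq> E \<and> (\<forall>x\<in>R'. h x = ?g x)"
  proof (rule receptiveD[OF _ g gR])
    show "receptive F R" using R by (simp add: good_def)
    fix t assume t: "t \<in> T"
    then have "gconj (Aut_F F R) (?a t) c \<in> Tst R X" using c by blast
    then obtain s where s: "s \<in> NS R" "gconj (Aut_F F R) (?a t) c = cR R s" by (auto simp: Tst_def)
    have "?g (cj (inv_into R' ?g y) t) = cj y s" if y: "y \<in> R" for y
    proof -
      have "?a t \<in> carrier (Aut_F F R)"
        using t subgroup.subset[OF A.psubgroup_subgroup[OF psub]] by blast
      then have "gconj (Aut_F F R) (?a t) c y = inv_into R c (?a t (c y))"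
        using Aut_F_gconj[OF Rs(1) _ cf y] by simp
      moreover have "c y \<in> R" using cF y by blast
      ultimately have "cR R s y = inv_into R c (f (cj (inv_into R' f (c y)) t))" using s by simp
      then show ?thesis using y by (simp add: gi cR_def)
    qed
    then show "t \<in> NS R' \<and> (\<exists>s\<in>NS R. \<forall>y\<in>R. ?g (cj (inv_into R' ?g y) t) = cj y s)"
      using s t T by blast
  qed
  then obtain E h where E: "fmor F E h" "R' \<subseteq> E" "T \<subseteq> E" "\<forall>x\<in>R'. h x = ?g x" by blast
  moreover have "?g x = d (f x)" if "x \<in> R'" for x using dx[of "f x"] f(2) that by auto
  ultimately show ?thesis using d by metis
qed

lemma transported_conj_fiso:
  assumes f: "fmor F R' f" "f ` R' = R" and t: "t \<in> NS R'"
  shows "(\<lambda>y\<in>R. f (cj (inv_into R' f y) t)) \<in> fiso F R R"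
proof -
  have R': "sgr R'" using f fmor_sgr by auto
  interpret A: finite_group "Aut_F F R" p using finite_group_Aut fmor_image_all f by blast
  have "psubgroup (Aut_F F R) p ((\<lambda>t. \<lambda>y\<in>R. f (cj (inv_into R' f y) t)) ` NS R')"
    using psubgroup_transported_conj[OF f sgr_NS[OF R']] by simp
  then show ?thesis using t subgroup.subset[OF A.psubgroup_subgroup] by fastforce
qed

text \<open>Here \<open>C\<close> is the full stabilizer, so \<open>T\<close> only has to preserve
  the preimage of \<open>X\<close>; the price is that the correction may move points inside
  \<open>X\<close>.\<close>

lemma extend_Kst:
  assumes R: "good R" and X: "sgr X" "X \<subseteq> R" and syl: "sylow_in (Aut_F F R) p (Kst R X) (Tst R X)"
    and f: "fmor F R' f" "f ` R' = R" and T: "sgr T" "T \<subseteq> NS R'"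
    and TX: "\<And>t x. t \<in> T \<Longrightarrow> x \<in> R' \<Longrightarrow> f x \<in> X \<Longrightarrow> f (cj x t) \<in> X"
  shows "\<exists>c\<in>Kst R X. \<exists>E g. fmor F E g \<and> R' \<subseteq> E \<and> T \<subseteq> E \<and> (\<forall>x\<in>R'. g x = c (f x))"
proof -
  have Rs: "sgr R" "sgr R'" using fmor_sgr fmor_image_all f by auto
  interpret A: finite_group "Aut_F F R" p using Rs(1) by (rule finite_group_Aut)
  have K: "subgroup (Kst R X) (Aut_F F R)" by (rule subgroup_Kst[OF Rs(1) X])
  show ?thesis
  proof (rule extend_modulo[OF R X syl K subset_refl _ f T])
    show "\<And>k c. k \<in> Kst R X \<Longrightarrow> c \<in> Kst R X \<Longrightarrow> gconj (Aut_F F R) c k \<in> Kst R X"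
      using A.subgroup_gconj_closed[OF K] by blast
    fix t assume t: "t \<in> T"
    let ?a = "\<lambda>y\<in>R. f (cj (inv_into R' f y) t)"
    have a: "?a \<in> fiso F R R" using transported_conj_fiso[OF f] t T by blast
    have "?a ` X \<subseteq> X"
    proof
      fix z assume "z \<in> ?a ` X"
      then obtain y where y: "y \<in> X" "z = f (cj (inv_into R' f y) t)" using X(2) by auto
      have "y \<in> f ` R'" using y X f by blast
      then show "z \<in> X" using TX[OF t, of "inv_into R' f y"] y by (simp add: inv_into_into f_inv_into_f)
    qed
    moreover have "card (?a ` X) = card X" using a X by (intro fmor_card[of R]) (auto simp: fiso_iff)
    ultimately have "?a ` X = X" using S.finite_subgroup[OF X(1)] by (simp add: card_subset_eq)
    then have "?a \<in> Kst R X" using a by (simp add: Kst_def)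
    \<comment> \<open>As \<open>C\<close> is all of \<open>Kst R X\<close>, the factor coming from
      \<open>S\<close> can be trivial.\<close>
    moreover have "\<one>\<^bsub>fgrp F\<^esub> \<in> NS R \<inter> NS X"
      using subgroup.one_closed[OF sgr_NS] Rs X by simp
    moreover have "\<forall>y\<in>R. f (cj (inv_into R' f y) t) = ?a (cj y \<one>\<^bsub>fgrp F\<^esub>)"
      using sgr_mem[OF Rs(1)] by simp
    ultimately show "\<exists>c\<in>Kst R X. \<exists>s\<in>NS R \<inter> NS X. \<forall>y\<in>R. f (cj (inv_into R' f y) t) = c (cj y s)" by blast
  qed
qed

text \<open>Here \<open>C\<close> fixes \<open>X\<close> pointwise: if \<open>T\<close> already acts
  on \<open>X\<close> as elements of \<open>S\<close> do, the correction changes no value of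
  \<open>f\<close> that lies in \<open>X\<close>.\<close>

lemma extend_Kcs:
  assumes R: "good R" and X: "sgr X" "X \<subseteq> R" and syl: "sylow_in (Aut_F F R) p (Kst R X) (Tst R X)"
    and f: "fmor F R' f" "f ` R' = R" and T: "sgr T" "T \<subseteq> NS R'"
    and TX: "\<And>t. t \<in> T \<Longrightarrow> \<exists>s\<in>NS R \<inter> NS X. \<forall>x\<in>R'. f x \<in> X \<longrightarrow> f (cj x t) = cj (f x) s"
  shows "\<exists>c\<in>Kcs R X. \<exists>E g. fmor F E g \<and> R' \<subseteq> E \<and> T \<subseteq> E \<and> (\<forall>x\<in>R'. g x = c (f x))"
proof -
  have Rs: "sgr R" "sgr R'" using fmor_sgr fmor_image_all f by auto
  interpret A: finite_group "Aut_F F R" p using Rs(1) by (rule finite_group_Aut)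
  show ?thesis
  proof (rule extend_modulo[OF R X syl subgroup_Kcs[OF Rs(1) X] Kcs_sub_Kst Kcs_normal[OF Rs(1) X] f T])
    fix t assume t: "t \<in> T"
    let ?a = "\<lambda>y\<in>R. f (cj (inv_into R' f y) t)"
    have a: "?a \<in> fiso F R R" using transported_conj_fiso[OF f] t T by blast
    obtain s where s: "s \<in> NS R" "s \<in> NS X" "\<And>x. x \<in> R' \<Longrightarrow> f x \<in> X \<Longrightarrow> f (cj x t) = cj (f x) s"
      using TX[OF t] by blast
    have si: "inv\<^bsub>fgrp F\<^esub> s \<in> NS R" "inv\<^bsub>fgrp F\<^esub> s \<in> NS X"
      using s subgroup.m_inv_closed[OF sgr_NS] Rs X by auto
    have ss: "s \<in> SS" using NS_mem[OF Rs(1) s(1)] .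
    \<comment> \<open>Dividing the transported action of \<open>t\<close> by conjugation with
      \<open>s\<close> leaves an automorphism that is trivial on \<open>X\<close>.\<close>
    let ?c = "?a \<otimes>\<^bsub>Aut_F F R\<^esub> cR R (inv\<^bsub>fgrp F\<^esub> s)"
    have cm: "?c = compose R ?a (cR R (inv\<^bsub>fgrp F\<^esub> s))" using Aut_F_mult[OF a cR_fiso[OF Rs(1) si(1)]] .
    have cf: "?c \<in> fiso F R R" using A.m_closed[of ?a "cR R (inv\<^bsub>fgrp F\<^esub> s)"] a cR_fiso[OF Rs(1) si(1)] by simp
    have "?c x = x" if x: "x \<in> X" for x
    proof -
      have xR: "x \<in> R" "x \<in> SS" using x X sgr_mem[OF X(1)] by auto
      let ?y = "cj x (inv\<^bsub>fgrp F\<^esub> s)"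
      have y: "?y \<in> X" "?y \<in> R" using NS_gconj[OF X(1) si(2) x] X(2) by auto
      then have "?y \<in> f ` R'" using f by blast
      then have "f (cj (inv_into R' f ?y) t) = cj ?y s"
        using s(3)[of "inv_into R' f ?y"] y(1) by (simp add: inv_into_into f_inv_into_f)
      then show ?thesis using xR y ss unfolding cm by (simp add: compose_def cR_def)
    qed
    then have "?c \<in> Kcs R X" using cf by (simp add: Kcs_def)
    moreover have "f (cj (inv_into R' f y) t) = ?c (cj y s)" if y: "y \<in> R" for y
    proof -
      have "cj y s \<in> R" "y \<in> SS" using NS_gconj[OF Rs(1) s(1) y] sgr_mem[OF Rs(1) y] by auto
      then show ?thesis using y ss unfolding cm by (simp add: compose_def cR_def)
    qed
    ultimately show "\<exists>c\<in>Kcs R X. \<exists>s\<in>NS R \<inter> NS X. \<forall>y\<in>R. f (cj (inv_into R' f y) t) = c (cj y s)"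
      using s by blast
  qed
qed

text \<open>A Sylow subgroup of the stabilizer of the image of \<open>X1\<close> need not consist of
  maps induced from \<open>S\<close>, but since \<open>R\<close> is fully automized some
  \<open>k\<close> conjugates it into \<open>Aut_S F R\<close>. Changing the isomorphism
  \<open>f0\<close> by the inverse of \<open>k\<close> re-embeds \<open>X1\<close>
  accordingly.\<close>

lemma exists_sylow_pair:
  assumes R1: "fconjugate F R1 R" and R: "good R" and X: "sgr X1" "X1 \<subseteq> R1"
  shows "\<exists>f. fmor F R1 f \<and> f ` R1 = R \<and> sylow_in (Aut_F F R) p (Kst R (f ` X1)) (Tst R (f ` X1))"
proof -
  have Rs: "sgr R" using R by (simp add: good_def)
  interpret A: finite_group "Aut_F F R" p using Rs by (rule finite_group_Aut)
  obtain f0 where f0: "fmor F R1 f0" "f0 ` R1 = R" using R1 by (auto simp: fconjugate_iff)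
  let ?Y = "f0 ` X1"
  have X0: "sgr ?Y" "?Y \<subseteq> R" using fmor_image[OF f0(1) X] f0(2) X by auto
  obtain B where B: "sylow_in (Aut_F F R) p (Kst R ?Y) B"
    using A.sylow_exists_card[OF subgroup_Kst[OF Rs X0]] by blast
  have B': "psubgroup (Aut_F F R) p B" "B \<subseteq> Kst R ?Y" using sylow_inD[OF B] by auto
  have "\<exists>k\<in>fiso F R R. \<forall>b\<in>B. gconj (Aut_F F R) b k \<in> Aut_S F R"
  proof (rule sylow_inD(4)[OF sylow_Aut_S[OF Rs] B'(1)])
    show "fully_automized p F R" using R by (simp add: good_def)
    show "B \<subseteq> fiso F R R" using B'(2) by (auto simp: Kst_def)
  qed
  then obtain k where k: "k \<in> fiso F R R" "\<forall>b\<in>B. gconj (Aut_F F R) b k \<in> Aut_S F R" by blast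
  have kF: "fmor F R k" "k ` R = R" using k by (auto simp: fiso_iff)
  let ?f = "\<lambda>x. inv_into R k (f0 x)"
  let ?X = "?f ` X1"
  have Xeq: "?X = inv_into R k ` ?Y" by (simp add: image_image)
  have kX: "k ` ?X = ?Y" unfolding Xeq by (rule image_inv_into_cancel[OF kF(2) X0(2)])
  have f: "fmor F R1 ?f" "?f ` R1 = R"
    using fmor_comp[OF f0(1) fmor_inv[OF kF(1)]] f0(2) kF image_image[of "inv_into R k" f0 R1]
      fmor_inv_image[OF kF(1), of R] by simp_all
  have Xs: "sgr ?X" "?X \<subseteq> R" using fmor_image[OF f(1) X] f(2) X by auto
  have conj: "gconj (Aut_F F R) a k \<in> Kst R ?X \<longleftrightarrow> a \<in> Kst R ?Y" if a: "a \<in> fiso F R R" for a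
  proof -
    have "gconj (Aut_F F R) a k ` ?X = (\<lambda>x. inv_into R k (a (k x))) ` ?X"
      using Xs(2) by (intro image_cong refl Aut_F_gconj[OF Rs a k(1)]) auto
    then have "gconj (Aut_F F R) a k ` ?X = inv_into R k ` a ` ?Y"
      unfolding kX[symmetric] by (simp add: image_image)
    moreover have "inv_into R k ` a ` ?Y = inv_into R k ` ?Y \<longleftrightarrow> a ` ?Y = ?Y"
      using a X0(2) kF fmor_inj[OF fmor_inv[OF kF(1)]]
      by (intro inj_on_image_eq_iff) (auto simp: fiso_iff)
    ultimately show ?thesis using A.gconj_closed[of a k] a k by (simp add: Kst_def flip: Xeq)
  qed
  let ?B = "(\<lambda>b. gconj (Aut_F F R) b k) ` B"
  have psB: "psubgroup (Aut_F F R) p ?B" using A.psubgroup_gconj[OF B'(1)] k by simp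
  have KB: "b \<in> fiso F R R \<and> b \<in> Kst R ?Y" if "b \<in> B" for b
  proof -
    have "b \<in> Kst R ?Y" using that B'(2) by blast
    then show ?thesis by (simp add: Kst_def)
  qed
  have "?B \<subseteq> Kst R ?X" using KB conj by blast
  \<comment> \<open>An element of \<open>?B\<close> is conjugation by some \<open>s\<close> in
    \<open>NS R\<close>; that it stabilizes \<open>?X\<close> says that \<open>s\<close> normalizes
    \<open>?X\<close> too. Maximality of a Sylow subgroup later makes this inclusion an
    equality.\<close>
  have "?B \<subseteq> Tst R ?X"
  proof
    fix a assume a: "a \<in> ?B"
    then obtain s where s: "s \<in> NS R" "a = cR R s" using k(2) by (auto simp: Aut_S_eq)
    have "a \<in> Kst R ?X" using a \<open>?B \<subseteq> Kst R ?X\<close> by blast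
    then have aX: "a ` ?X = ?X" by (simp add: Kst_def)
    have "cj x s \<in> ?X" if x: "x \<in> ?X" for x
    proof -
      have "a x \<in> ?X" using x aX by blast
      moreover have "a x = cj x s" using x Xs(2) s(2) by (auto simp: cR_def)
      ultimately show ?thesis by simp
    qed
    then have "s \<in> NS ?X" using NS_mem[OF Rs s(1)] by (simp add: mem_NS_iff[OF Xs(1)])
    then show "a \<in> Tst R ?X" using s by (auto simp: Tst_def)
  qed
  have "card ?B = card B" using A.card_gconj_image[of B k] B'(2) k by (auto simp: Kst_def)
  have "sylow_in (Aut_F F R) p (Kst R ?X) (Tst R ?X)"
  proof -
    have "card (Kst R ?X) = card (Kst R ?Y)"
    proof (rule bij_betw_same_card[symmetric], rule bij_betwI')
      show "gconj (Aut_F F R) a k = gconj (Aut_F F R) b k \<longleftrightarrow> a = b"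
        if "a \<in> Kst R ?Y" "b \<in> Kst R ?Y" for a b
        using that k A.gconj_inj[of a b k] by (simp add: Kst_def)
      show "gconj (Aut_F F R) a k \<in> Kst R ?X" if "a \<in> Kst R ?Y" for a
        using that conj by (simp add: Kst_def)
      show "\<exists>a\<in>Kst R ?Y. b = gconj (Aut_F F R) a k" if b: "b \<in> Kst R ?X" for b
      proof -
        let ?a = "gconj (Aut_F F R) b (inv\<^bsub>Aut_F F R\<^esub> k)"
        have bf: "b \<in> fiso F R R" using b by (simp add: Kst_def)
        have "gconj (Aut_F F R) ?a k = b" using A.gconj_cancel(2)[of b k] bf k by simp
        moreover have "?a \<in> fiso F R R" using A.gconj_closed[of b "inv\<^bsub>Aut_F F R\<^esub> k"] A.inv_closed[of k] bf k by simp
        ultimately show ?thesis using b conj[of ?a] by metis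
      qed
    qed
    then have cB: "card ?B = p ^ multiplicity p (card (Kst R ?X))"
      using A.sylow_in_card[OF subgroup_Kst[OF Rs X0] B] \<open>card ?B = card B\<close> by simp
    have sB: "sylow_in (Aut_F F R) p (Kst R ?X) ?B"
      using A.sylow_inI_card[OF subgroup_Kst[OF Rs Xs] A.psubgroup_subgroup[OF psB] \<open>?B \<subseteq> Kst R ?X\<close> cB] .
    have "Tst R ?X = ?B"
      using A.sylow_in_maximal[OF sB psubgroup_Tst[OF Rs Xs] \<open>?B \<subseteq> Tst R ?X\<close> Tst_sub_Kst[OF Rs Xs]
          subgroup_Kst[OF Rs Xs]] .
    then show ?thesis using sB by simp
  qed
  then show ?thesis using f by blast
qed

end

subsection \<open>Saturation from a generating family\<close>

text \<open>Generation of the fusion system by morphisms between members of \<open>\<Delta>\<close>.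
  Each factor is kept together with the member on which it is defined, so that every intermediate
  image of \<open>P\<close> is known to lie inside a member of \<open>\<Delta>\<close>.\<close>

inductive composite :: "'a fusion \<Rightarrow> 'a set set \<Rightarrow> 'a set \<Rightarrow> ('a \<Rightarrow> 'a) \<Rightarrow> bool"
  for F \<Delta> P where
  id: "composite F \<Delta> P (\<lambda>x. x)"
| step: "composite F \<Delta> P f \<Longrightarrow> R \<in> \<Delta> \<Longrightarrow> fmor F R g \<Longrightarrow> f ` P \<subseteq> R \<Longrightarrow> composite F \<Delta> P (\<lambda>x. g (f x))"

context fusion_system
begin

lemma fmor_psubset: assumes "fmor F R f" "A \<subset> B" "B \<subseteq> R" shows "f ` A \<subset> f ` B"
proof -
  have "f ` A \<noteq> f ` B" using inj_on_image_eq_iff[OF fmor_inj[OF assms(1)], of A B] assms by auto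
  then show ?thesis using assms(2) by auto
qed

lemma composite_fmor: "composite F \<Delta> P f \<Longrightarrow> sgr P \<Longrightarrow> fmor F P f"
  by (induction rule: composite.induct) (auto intro: fmor_id fmor_comp)

text \<open>Evaluating at \<open>f y\<close> removes the inverse of \<open>f\<close> from the
  definition.\<close>

lemma extension_group_iff:
  assumes f: "fmor F Y f" "f ` Y = X"
  shows "t \<in> extension_group F Y X (restrict f Y) \<longleftrightarrow>
    t \<in> NS Y \<and> (\<exists>s\<in>NS X. \<forall>y\<in>Y. f (cj y t) = cj (f y) s)"
proof -
  have Y: "sgr Y" using f fmor_sgr by blast
  have "(\<lambda>x\<in>X. restrict f Y (cj (inv_into Y (restrict f Y) x) t)) = cR X s \<longleftrightarrow>
      (\<forall>y\<in>Y. f (cj y t) = cj (f y) s)" (is "?l = _ \<longleftrightarrow> _") if t: "t \<in> NS Y" for s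
  proof
    assume eq: "?l = cR X s"
    show "\<forall>y\<in>Y. f (cj y t) = cj (f y) s"
    proof
      fix y assume y: "y \<in> Y"
      then have "f y \<in> X" using f by blast
      then show "f (cj y t) = cj (f y) s"
        using fun_cong[OF eq, of "f y"] y NS_gconj[OF Y t y] fmor_inv_f[OF f(1) y]
        by (simp add: cR_def inv_into_restrict)
    qed
  next
    assume *: "\<forall>y\<in>Y. f (cj y t) = cj (f y) s"
    have "restrict f Y (cj (inv_into Y (restrict f Y) x) t) = cj x s" if "x \<in> X" for x
    proof -
      obtain y where y: "y \<in> Y" "x = f y" using f \<open>x \<in> X\<close> by blast
      then show ?thesis using * NS_gconj[OF Y t y(1)] fmor_inv_f[OF f(1) y(1)] by (simp add: inv_into_restrict)
    qed
    then show "?l = cR X s" by (simp add: cR_def cong: restrict_cong)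
  qed
  then show ?thesis by (auto simp: extension_group_def Aut_S_eq image_iff)
qed

lemma sgr_extension_group:
  assumes f: "fmor F Y f" "f ` Y = X"
  shows "sgr (extension_group F Y X (restrict f Y))"
proof -
  have Y: "sgr Y" "sgr X" using f fmor_sgr fmor_image_all by auto
  have cY: "y \<in> SS" if "y \<in> Y" for y using that sgr_mem[OF Y(1)] by simp
  have fX: "f y \<in> X" "f y \<in> SS" if "y \<in> Y" for y using that f sgr_mem[OF Y(2)] by auto
  note NSY = sgr_NS[OF Y(1)] and NSX = sgr_NS[OF Y(2)]
  have m1: "t \<in> SS" if "t \<in> NS Y" for t using that NS_mem[OF Y(1)] by simp
  have m2: "s \<in> SS" if "s \<in> NS X" for s using that NS_mem[OF Y(2)] by simp
  let ?E = "extension_group F Y X (restrict f Y)"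
  show ?thesis
  proof
    show "?E \<subseteq> SS" using m1 by (auto simp: extension_group_iff[OF f])
    show "\<one>\<^bsub>fgrp F\<^esub> \<in> ?E"
      using subgroup.one_closed[OF NSY] subgroup.one_closed[OF NSX] cY fX
      by (auto simp: extension_group_iff[OF f] intro!: bexI[of _ "\<one>\<^bsub>fgrp F\<^esub>"])
    show "t \<otimes>\<^bsub>fgrp F\<^esub> u \<in> ?E" if tu: "t \<in> ?E" "u \<in> ?E" for t u
    proof -
      obtain s r where s: "s \<in> NS X" "\<forall>y\<in>Y. f (cj y t) = cj (f y) s" and r: "r \<in> NS X" "\<forall>y\<in>Y. f (cj y u) = cj (f y) r"
        using tu by (auto simp: extension_group_iff[OF f])
      have t: "t \<in> NS Y" "u \<in> NS Y" using tu by (auto simp: extension_group_iff[OF f])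
      have "f (cj y (t \<otimes>\<^bsub>fgrp F\<^esub> u)) = cj (f y) (s \<otimes>\<^bsub>fgrp F\<^esub> r)" if y: "y \<in> Y" for y
      proof -
        have "f (cj (cj y t) u) = cj (cj (f y) s) r" using s r y NS_gconj[OF Y(1) t(1) y] by simp
        then show ?thesis using y t s r cY fX m1 m2 by (simp add: S.gconj_comp)
      qed
      then show ?thesis
        using subgroup.m_closed[OF NSY t] subgroup.m_closed[OF NSX s(1) r(1)]
        by (auto simp: extension_group_iff[OF f])
    qed
    show "inv\<^bsub>fgrp F\<^esub> t \<in> ?E" if tE: "t \<in> ?E" for t
    proof -
      obtain s where s: "s \<in> NS X" "\<forall>y\<in>Y. f (cj y t) = cj (f y) s"
        using tE by (auto simp: extension_group_iff[OF f])
      have t: "t \<in> NS Y" using tE by (auto simp: extension_group_iff[OF f])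
      have it: "inv\<^bsub>fgrp F\<^esub> t \<in> NS Y" using subgroup.m_inv_closed[OF NSY t] .
      have "f (cj y (inv\<^bsub>fgrp F\<^esub> t)) = cj (f y) (inv\<^bsub>fgrp F\<^esub> s)" if y: "y \<in> Y" for y
      proof -
        let ?y = "cj y (inv\<^bsub>fgrp F\<^esub> t)"
        have y1: "?y \<in> Y" using NS_gconj[OF Y(1) it y] .
        then have "f (cj ?y t) = cj (f ?y) s" using s by blast
        then have "f y = cj (f ?y) s" using y t cY m1 by simp
        then show ?thesis using fX[OF y1] s m2 by simp
      qed
      then show ?thesis
        using it subgroup.m_inv_closed[OF NSX s(1)] by (auto simp: extension_group_iff[OF f])
    qed
  qed
qed

text \<open>Stands in for passing to a fully normalized conjugate: that such a conjugate is the
  image under a map defined on the whole normalizer is a consequence of saturation and cannot be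
  assumed yet.\<close>

definition reach :: "'a set \<Rightarrow> 'a set \<Rightarrow> bool" where
  "reach X Y \<longleftrightarrow> (\<exists>f. fmor F (NS X) f \<and> f ` X = Y) \<and> sgr X"

text \<open>Maximality is demanded only among the subgroups reachable from \<open>X\<close>. That in
  a noncentric class this no longer depends on \<open>X\<close> is what
  \<open>all_terminal_reach\<close> provides.\<close>

definition terminal :: "'a set \<Rightarrow> bool" where
  "terminal X \<longleftrightarrow> sgr X \<and> (\<forall>Y. reach X Y \<longrightarrow> card (NS Y) \<le> card (NS X))"

lemma reach_refl: "sgr X \<Longrightarrow> reach X X"
  using fmor_id[OF sgr_NS] by (force simp: reach_def)

lemma NS_image_NS:
  assumes "sgr X" "fmor F (NS X) f" shows "f ` NS X \<subseteq> NS (f ` X)"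
  using fmor_image_NS[OF assms(2,1)] sub_NS[OF assms(1)] by auto

lemma reach_sgr: "reach X Y \<Longrightarrow> sgr X \<and> sgr Y"
  unfolding reach_def using fmor_image sub_NS by blast

lemma reach_trans: assumes "reach X Y" "reach Y Z" shows "reach X Z"
proof -
  have X: "sgr X" using assms reach_sgr by blast
  obtain f where f: "fmor F (NS X) f" "f ` X = Y" using assms by (auto simp: reach_def)
  obtain g where g: "fmor F (NS Y) g" "g ` Y = Z" using assms by (auto simp: reach_def)
  have "fmor F (NS X) (\<lambda>x. g (f x))" using fmor_comp[OF f(1) g(1)] NS_image_NS[OF X f(1)] f(2) by simp
  moreover have "(\<lambda>x. g (f x)) ` X = Z" using image_image[of g f X] f g by simp
  ultimately show ?thesis using X by (auto simp: reach_def)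
qed

lemma reach_fconjugate: "reach X Y \<Longrightarrow> fconjugate F X Y"
  unfolding reach_def fconjugate_iff using fmor_mono sub_NS by blast

lemma reach_card: assumes "reach X Y" shows "card (NS X) \<le> card (NS Y)"
proof -
  have X: "sgr X" "sgr Y" using assms reach_sgr by blast+
  obtain f where f: "fmor F (NS X) f" "f ` X = Y" using assms by (auto simp: reach_def)
  have "card (NS X) = card (f ` NS X)" using fmor_card[OF f(1)] by simp
  also have "\<dots> \<le> card (NS Y)"
    using NS_image_NS[OF X(1) f(1)] f(2) S.finite_subgroup[OF sgr_NS[OF X(2)]] by (auto intro: card_mono)
  finally show ?thesis .
qed

lemma reach_terminal_exists: assumes X: "sgr X" shows "\<exists>T. reach X T \<and> terminal T"
proof -
  have "Y \<subseteq> SS" if "reach X Y" for Y using reach_sgr[OF that] subgroup.subset by auto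
  then have "{Y. reach X Y} \<subseteq> Pow SS" by auto
  then have "finite {Y. reach X Y}" by (rule finite_subset) simp
  moreover have "{Y. reach X Y} \<noteq> {}" using reach_refl[OF X] by blast
  ultimately have M: "Max ((\<lambda>Y. card (NS Y)) ` {Y. reach X Y}) \<in> (\<lambda>Y. card (NS Y)) ` {Y. reach X Y}"
      "\<And>Y. reach X Y \<Longrightarrow> card (NS Y) \<le> Max ((\<lambda>Y. card (NS Y)) ` {Y. reach X Y})"
    by (auto intro!: Max_in Max_ge)
  from M(1) obtain T where T': "Max ((\<lambda>Y. card (NS Y)) ` {Y. reach X Y}) = card (NS T)" "T \<in> {Y. reach X Y}"
    by (rule imageE)
  then have T: "reach X T" "\<And>Y. reach X Y \<Longrightarrow> card (NS Y) \<le> card (NS T)"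
    using M(2) by simp_all
  then show ?thesis using reach_trans reach_sgr by (metis terminal_def)
qed

lemma terminal_reach_image:
  assumes "terminal X" "sgr X" "fmor F (NS X) f" shows "f ` NS X = NS (f ` X)"
proof -
  have "reach X (f ` X)" using assms by (auto simp: reach_def)
  then have "card (NS (f ` X)) \<le> card (NS X)" "sgr (f ` X)" using assms reach_sgr by (auto simp: terminal_def)
  then show ?thesis
    using NS_image_NS[OF assms(2,3)] fmor_card[OF assms(3), of "NS X"] S.finite_subgroup[OF sgr_NS]
    by (intro card_seteq) auto
qed

text \<open>By terminality the normalizer of \<open>X\<close> is mapped onto that of
  \<open>Y\<close>, so the inverse is defined on all of \<open>NS Y\<close>.\<close>

lemma terminal_reach_sym: assumes "terminal X" "reach X Y" shows "reach Y X"
proof -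
  have X: "sgr X" "sgr Y" using assms reach_sgr by blast+
  obtain f where f: "fmor F (NS X) f" "f ` X = Y" using assms by (auto simp: reach_def)
  have "fmor F (NS Y) (inv_into (NS X) f)"
    using fmor_inv[OF f(1)] terminal_reach_image[OF assms(1) X(1) f(1)] f(2) by simp
  moreover have "inv_into (NS X) f ` Y = X"
    using fmor_inv_image[OF f(1) sub_NS[OF X(1)]] f(2) by simp
  ultimately show ?thesis using X by (auto simp: reach_def)
qed

lemma terminal_reach: "terminal X \<Longrightarrow> reach X Y \<Longrightarrow> terminal Y"
  unfolding terminal_def by (meson order_trans reach_card reach_sgr reach_trans)

lemma normalizer_grows_in:
  assumes "sgr A" "sgr B" "A \<subset> B"
  shows "A \<subset> B \<inter> NS A"
proof -
  obtain b where "b \<in> B - A" "\<forall>a\<in>A. cj a b \<in> A"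
    using S.normalizer_grows[OF psubgroup_S[OF assms(2)] assms(1,3)] by blast
  then have "b \<in> (B \<inter> NS A) - A" using sgr_mem[OF assms(2)] by (auto simp: mem_NS_iff[OF assms(1)])
  then show ?thesis using assms(3) sub_NS[OF assms(1)] by blast
qed

text \<open>\<open>R1\<close> is properly contained in its normalizer inside \<open>NS X1\<close>,
  and \<open>extend_Kst\<close> carries \<open>f\<close> over that larger group up to an
  automorphism stabilizing the image of \<open>X1\<close>. This enlargement drives the inductions on
  the domain below.\<close>

lemma grow_morphism:
  assumes X1: "sgr X1" "X1 \<subseteq> R1" and R1: "sgr R1" "R1 \<subset> NS X1"
    and f: "fmor F R1 f" "f ` R1 = R" and R: "good R" and syl: "sylow_in (Aut_F F R) p (Kst R (f ` X1)) (Tst R (f ` X1))"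
  shows "\<exists>T g c. sgr T \<and> R1 \<subset> T \<and> T \<subseteq> NS X1 \<and> fmor F T g \<and> c \<in> Kst R (f ` X1) \<and>
    (\<forall>x\<in>R1. g x = c (f x)) \<and> g ` X1 = f ` X1"
proof -
  let ?T = "NS X1 \<inter> NS R1"
  have T: "sgr ?T" "R1 \<subset> ?T"
    using S.subgroup_Int[OF sgr_NS[OF X1(1)] sgr_NS[OF R1(1)]] normalizer_grows_in[OF R1(1) sgr_NS[OF X1(1)] R1(2)]
    by auto
  have X: "sgr (f ` X1)" "f ` X1 \<subseteq> R" using fmor_image[OF f(1) X1] f(2) X1 by auto
  have "\<exists>c\<in>Kst R (f ` X1). \<exists>E g. fmor F E g \<and> R1 \<subseteq> E \<and> ?T \<subseteq> E \<and> (\<forall>x\<in>R1. g x = c (f x))"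
  proof (rule extend_Kst[OF R X syl f T(1)])
    show "?T \<subseteq> NS R1" by blast
    fix t x assume t: "t \<in> ?T" "x \<in> R1" "f x \<in> f ` X1"
    then obtain x' where "x' \<in> X1" "f x = f x'" by blast
    then have "x \<in> X1" using fmor_inj[OF f(1)] t X1(2) by (metis inj_onD subsetD)
    then show "f (cj x t) \<in> f ` X1" using NS_gconj[OF X1(1)] t by blast
  qed
  then obtain c E g where g: "c \<in> Kst R (f ` X1)" "fmor F E g" "?T \<subseteq> E" "\<forall>x\<in>R1. g x = c (f x)" by blast
  have "g ` X1 = c ` f ` X1" using g(4) X1(2) by (force simp: image_image)
  also have "\<dots> = f ` X1" using g(1) by (simp add: Kst_def)
  finally have "g ` X1 = f ` X1" .
  moreover have "fmor F ?T g" using fmor_mono[OF g(2) T(1) g(3)] .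
  ultimately show ?thesis using T g by blast
qed

lemma Kst_fmor: "c \<in> Kst R X \<Longrightarrow> fmor F R c \<and> c ` R = R \<and> c ` X = X"
  by (simp add: Kst_def fiso_iff)

end

text \<open>One step of the induction on order. As no conjugate of \<open>P0\<close> lies in
  \<open>\<Delta>\<close>, each factor of a \<open>composite\<close> starting in the class is the
  restriction of a morphism defined on a proper overgroup, and to such overgroups the assumption
  \<open>bigger\<close> applies.\<close>

locale noncentric_class = fusion_system p F for p :: nat and F :: "'a fusion" +
  fixes \<Delta> :: "'a set set" and P0 :: "'a set"
  assumes P0: "sgr P0" "P0 \<notin> \<Delta>"
    and conj_closed: "X \<in> \<Delta> \<Longrightarrow> fconjugate F X Y \<Longrightarrow> Y \<in> \<Delta>"
    and overgroup_closed: "X \<in> \<Delta> \<Longrightarrow> sgr Y \<Longrightarrow> X \<subseteq> Y \<Longrightarrow> Y \<in> \<Delta>"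
    and nonempty: "\<Delta> \<noteq> {}"
    and objects_sgr: "X \<in> \<Delta> \<Longrightarrow> sgr X"
    and generated: "fmor F X f \<Longrightarrow> \<exists>g. composite F \<Delta> X g \<and> (\<forall>x\<in>X. g x = f x)"
    and bigger: "sgr R \<Longrightarrow> card P0 < card R \<Longrightarrow> \<exists>R'. fconjugate F R R' \<and> good R'"
    and noncentric: "\<exists>X. fconjugate F P0 X \<and> \<not> CS X \<subseteq> X"
begin

abbreviation "Cl X \<equiv> fconjugate F P0 X"

lemma Cl_facts: assumes "Cl X" shows "sgr X" "card X = card P0" "X \<notin> \<Delta>"
  using assms fconjugate_sgr fconjugate_card conj_closed[of X P0] fconjugate_sym P0 by blast+

lemma Cl_image: "Cl X \<Longrightarrow> fmor F R f \<Longrightarrow> X \<subseteq> R \<Longrightarrow> Cl (f ` X)"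
  using fconjugate_trans fconjugateI fmor_mono Cl_facts(1) by metis

lemma Cl_reach: "Cl X \<Longrightarrow> reach X Y \<Longrightarrow> Cl Y"
  using fconjugate_trans reach_fconjugate by metis

lemma S_object: "SS \<in> \<Delta>"
  using nonempty overgroup_closed[OF _ sgr_S] objects_sgr subgroup.subset by blast

lemma Cl_proper: assumes "Cl X" shows "X \<subset> NS X"
proof -
  have "X \<noteq> SS" using Cl_facts[OF assms] S_object by auto
  then have "X \<subset> SS" using Cl_facts[OF assms] subgroup.subset by blast
  then show ?thesis using normalizer_grows_in[OF Cl_facts(1)[OF assms] sgr_S] by blast
qed

lemma pair_exists:
  assumes X: "Cl X" "X \<subset> R1" and R1: "sgr R1"
  shows "\<exists>R f. fmor F R1 f \<and> f ` R1 = R \<and> good R \<and> sylow_in (Aut_F F R) p (Kst R (f ` X)) (Tst R (f ` X))"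
proof -
  have "card P0 < card R1"
    using psubset_card_mono[OF S.finite_subgroup[OF R1] X(2)] Cl_facts[OF X(1)] by simp
  then obtain R where "fconjugate F R1 R" "good R" using bigger R1 by blast
  then show ?thesis using exists_sylow_pair[of R1 R X] Cl_facts[OF X(1)] X(2) by blast
qed

text \<open>Induction over growing domains \<open>R1\<close>. If neither \<open>R1\<close> nor its
  image is a full normalizer, both ends are compared with a third subgroup: a terminal
  \<open>T0\<close> reached from the image of \<open>X1\<close> in a good conjugate
  \<open>R0\<close> of \<open>R1\<close>. Both ends map to \<open>T0\<close> from larger domains, so
  they reach it by induction, and reaching is reversible from terminal subgroups.\<close>

lemma terminal_link:
  assumes "Cl X1" "terminal X1" "terminal (f ` X1)" "fmor F R1 f" "X1 \<subset> R1" "R1 \<subseteq> NS X1"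
  shows "reach X1 (f ` X1)"
  using assms
proof (induction "card SS - card R1" arbitrary: R1 X1 f rule: less_induct)
  case less
  let ?Y = "f ` X1"
  let ?R = "f ` R1"
  have X1: "sgr X1" "X1 \<subseteq> R1" using less.prems Cl_facts by auto
  have R1: "sgr R1" using less.prems fmor_sgr by blast
  have Y: "Cl ?Y" "sgr ?Y" using Cl_image[OF less.prems(1,4)] X1 Cl_facts by auto
  have R: "sgr ?R" using fmor_image_all less.prems by blast
  have RN: "?R \<subseteq> NS ?Y" using fmor_image_NS[OF less.prems(4) X1] less.prems(6) by auto
  have YR: "?Y \<subset> ?R"
    using fmor_psubset[OF less.prems(4,5)] by simp
  have cR: "card ?R = card R1" using fmor_card[OF less.prems(4)] by simp
  show ?case
  proof (cases "R1 = NS X1")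
    case True then show ?thesis using less.prems X1 by (auto simp: reach_def)
  next
    case n1: False
    show ?thesis
    proof (cases "?R = NS ?Y")
      case True
      have "fmor F (NS ?Y) (inv_into R1 f)" using fmor_inv[OF less.prems(4)] True by simp
      moreover have "inv_into R1 f ` ?Y = X1" using fmor_inv_image[OF less.prems(4) X1(2)] .
      ultimately have "reach ?Y X1" using Y by (auto simp: reach_def)
      then show ?thesis using terminal_reach_sym less.prems(3) by blast
    next
      case n2: False
      obtain R0 e where e: "fmor F R1 e" "e ` R1 = R0" "good R0"
        "sylow_in (Aut_F F R0) p (Kst R0 (e ` X1)) (Tst R0 (e ` X1))"
        using pair_exists[OF less.prems(1,5) R1] by blast
      let ?X = "e ` X1"
      have X: "Cl ?X" using Cl_image[OF less.prems(1) e(1) X1(2)] .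
      obtain T0 where T0: "reach ?X T0" "terminal T0" using reach_terminal_exists[OF Cl_facts(1)[OF X]] by blast
      obtain h where h: "fmor F (NS ?X) h" "h ` ?X = T0" using T0(1) by (auto simp: reach_def)
      \<comment> \<open>The correction from \<open>Kst\<close> may change the map on
        \<open>X'\<close> but not its image \<open>?X\<close>, and only the image matters for
        reaching \<open>T0\<close>.\<close>
      have key: "reach X' T0"
        if X': "Cl X'" "terminal X'" "X' \<subset> R'" "R' \<subset> NS X'" "fmor F R' e'" "e' ` R' = R0" "e' ` X' = ?X"
          and card: "card R' = card R1" for X' R' e'
      proof -
        have s: "sgr X'" "sgr R'" using X' Cl_facts fmor_sgr by auto
        have sub: "X' \<subseteq> R'" using X'(3) by blast
        have syl: "sylow_in (Aut_F F R0) p (Kst R0 (e' ` X')) (Tst R0 (e' ` X'))"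
          using e(4) unfolding X'(7) .
        obtain T g where g: "sgr T" "R' \<subset> T" "T \<subseteq> NS X'" "fmor F T g" "g ` X' = ?X"
          using grow_morphism[OF s(1) sub s(2) X'(4,5,6) e(3) syl] unfolding X'(7) by (elim exE conjE)
        have XT: "X' \<subset> T" using X' g by blast
        have gT: "g ` T \<subseteq> NS ?X" using fmor_image_NS[OF g(4) s(1)] XT g by auto
        have hg: "fmor F T (\<lambda>x. h (g x))" using fmor_comp[OF g(4) h(1) gT] .
        have im: "(\<lambda>x. h (g x)) ` X' = T0" using image_image[of h g X'] g h by simp
        have "card R1 < card T" using psubset_card_mono[OF S.finite_subgroup[OF g(1)] g(2)] card by simp
        moreover have "card T \<le> card SS" using subgroup.subset[OF g(1)] by (simp add: card_mono)
        ultimately have "card SS - card T < card SS - card R1" by simp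
        then have "reach X' ((\<lambda>x. h (g x)) ` X')"
          using less.hyps[of T X' "\<lambda>x. h (g x)"] X' T0 hg XT g im by simp
        then show ?thesis using im by simp
      qed
      have r1: "reach X1 T0" using key[of X1 R1 e] less.prems e n1 by blast
      have i: "inv_into R1 f ` ?R = R1" "inv_into R1 f ` ?Y = X1"
        using fmor_inv_image[OF less.prems(4)] X1(2) by auto
      have e': "fmor F ?R (\<lambda>x. e (inv_into R1 f x))"
        using fmor_comp[OF fmor_inv[OF less.prems(4)] e(1)] i by simp
      have "(\<lambda>x. e (inv_into R1 f x)) ` ?R = R0" "(\<lambda>x. e (inv_into R1 f x)) ` ?Y = ?X"
        using i e image_image[of e "inv_into R1 f"] by metis+
      then have "reach ?Y T0" using key[of ?Y ?R "\<lambda>x. e (inv_into R1 f x)"] Y less.prems YR RN n2 e' cR by blast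
      then have "reach T0 ?Y" using terminal_reach_sym less.prems by blast
      then show ?thesis using r1 reach_trans by blast
    qed
  qed
qed

text \<open>Every morphism in the class is a composite of restrictions of morphisms between proper
  overgroups; conjugating each factor into terminal subgroups makes it a link.\<close>

lemma chain_induction:
  assumes link: "\<And>T f R. Cl T \<Longrightarrow> terminal T \<Longrightarrow> terminal (f ` T) \<Longrightarrow> fmor F R f \<Longrightarrow> T \<subset> R \<Longrightarrow> R \<subseteq> NS T \<Longrightarrow> Q T f"
    and comp: "\<And>T f g. Cl T \<Longrightarrow> terminal T \<Longrightarrow> terminal (f ` T) \<Longrightarrow> Q T f \<Longrightarrow> Q (f ` T) g \<Longrightarrow> Q T (\<lambda>x. g (f x))"
    and cong: "\<And>T f g. Q T f \<Longrightarrow> (\<And>x. x \<in> T \<Longrightarrow> f x = g x) \<Longrightarrow> Q T g"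
    and X: "Cl X" and f: "fmor F X f"
    and h1: "fmor F (NS X) h1" "terminal (h1 ` X)"
    and h2: "fmor F (NS (f ` X)) h2" "terminal (h2 ` f ` X)"
  shows "Q (h1 ` X) (\<lambda>x. h2 (f (inv_into (NS X) h1 x)))"
proof -
  \<comment> \<open>A single factor \<open>g\<close> with its ends moved to terminal subgroups. It
    is cut down to \<open>R \<inter> NS Y\<close>, which still properly contains \<open>Y\<close>,
    to fit the hypothesis \<open>link\<close>.\<close>
  have link_step: "Q (k1 ` Y) (\<lambda>x. k2 (g (inv_into (NS Y) k1 x)))"
    if Y: "Cl Y" "Y \<subset> R" "sgr R" and g: "fmor F R g" and k1: "fmor F (NS Y) k1" "terminal (k1 ` Y)"
      and k2: "fmor F (NS (g ` Y)) k2" "terminal (k2 ` g ` Y)" for Y R g k1 k2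
  proof -
    have Ys: "sgr Y" "Y \<subseteq> NS Y" using Cl_facts[OF Y(1)] sub_NS by auto
    let ?R = "R \<inter> NS Y"
    have R: "sgr ?R" "Y \<subset> ?R"
      using S.subgroup_Int[OF Y(3) sgr_NS[OF Ys(1)]] normalizer_grows_in[OF Ys(1) Y(3,2)] by auto
    have gR: "g ` ?R \<subseteq> NS (g ` Y)" using fmor_image_NS[OF g Ys(1)] Y by blast
    have i: "inv_into (NS Y) k1 ` k1 ` ?R = ?R" "inv_into (NS Y) k1 ` k1 ` Y = Y"
      using fmor_inv_image[OF k1(1)] Ys by auto
    have 1: "fmor F (k1 ` ?R) (inv_into (NS Y) k1)" using fmor_inv_sub[OF k1(1) R(1)] by blast
    have 2: "fmor F ?R g" using fmor_mono[OF g R(1)] by blast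
    have 3: "fmor F (k1 ` ?R) (\<lambda>x. g (inv_into (NS Y) k1 x))" using fmor_comp[OF 1 2] i(1) by simp
    have "(\<lambda>x. g (inv_into (NS Y) k1 x)) ` k1 ` ?R = g ` ?R"
      using i(1) image_image[of g "inv_into (NS Y) k1" "k1 ` ?R"] by simp
    then have 4: "fmor F (k1 ` ?R) (\<lambda>x. k2 (g (inv_into (NS Y) k1 x)))"
      using fmor_comp[OF 3 k2(1)] gR by simp
    have "(\<lambda>x. k2 (g (inv_into (NS Y) k1 x))) ` k1 ` Y = k2 ` g ` inv_into (NS Y) k1 ` k1 ` Y"
      by (simp add: image_image)
    then have 5: "(\<lambda>x. k2 (g (inv_into (NS Y) k1 x))) ` k1 ` Y = k2 ` g ` Y" using i(2) by simp
    have 6: "k1 ` Y \<subset> k1 ` ?R" using fmor_psubset[OF k1(1) R(2)] by simp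
    have 7: "k1 ` ?R \<subseteq> NS (k1 ` Y)" using NS_image_NS[OF Ys(1) k1(1)] by blast
    show ?thesis
      using link[OF Cl_image[OF Y(1) k1(1) Ys(2)] k1(2) _ 4 6 7] 5 k2(2) by simp
  qed
  have main: "Q (h1 ` X) (\<lambda>x. h2 (f (inv_into (NS X) h1 x)))"
    if "composite F \<Delta> X f" "fmor F (NS (f ` X)) h2" "terminal (h2 ` f ` X)" for f h2
    using that
  proof (induction arbitrary: h2 rule: composite.induct)
    case id
    show ?case
      using link_step[OF X Cl_proper[OF X] sgr_NS[OF Cl_facts(1)[OF X]] fmor_id[OF sgr_NS[OF Cl_facts(1)[OF X]]] h1, of h2] id
      by simp
  next
    case (step f R g)
    let ?Y = "f ` X"
    have fX: "fmor F X f" using composite_fmor[OF step.hyps(1)] Cl_facts[OF X] by blast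
    have Y: "Cl ?Y" using Cl_image[OF X fX] by blast
    have YR: "?Y \<subset> R" using Cl_facts(3)[OF Y] step.hyps by blast
    \<comment> \<open>The intermediate subgroup is made terminal by \<open>k\<close>; the map
      \<open>k\<close> and its inverse cancel between the two factors.\<close>
    obtain T k where k: "terminal T" "fmor F (NS ?Y) k" "k ` ?Y = T"
      using reach_terminal_exists[OF Cl_facts(1)[OF Y]] by (auto simp: reach_def)
    have gY: "(\<lambda>x. g (f x)) ` X = g ` ?Y" by (simp add: image_image)
    have A: "Q (h1 ` X) (\<lambda>x. k (f (inv_into (NS X) h1 x)))" using step.IH k by blast
    have B: "Q (k ` ?Y) (\<lambda>x. h2 (g (inv_into (NS ?Y) k x)))"
      using link_step[OF Y YR objects_sgr[OF step.hyps(2)] step.hyps(3) k(2)] k step.prems gY by simp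
    have i: "inv_into (NS X) h1 x \<in> X" if "x \<in> h1 ` X" for x
      using that fmor_inv_f[OF h1(1)] sub_NS[OF Cl_facts(1)[OF X]] by auto
    have im: "(\<lambda>x. k (f (inv_into (NS X) h1 x))) ` h1 ` X = k ` ?Y"
      using image_image[of "\<lambda>x. k (f x)" "inv_into (NS X) h1" "h1 ` X"] image_image[of k f X]
        fmor_inv_image[OF h1(1) sub_NS[OF Cl_facts(1)[OF X]]] by simp
    have "Q (h1 ` X) (\<lambda>x. (\<lambda>x. h2 (g (inv_into (NS ?Y) k x))) (k (f (inv_into (NS X) h1 x))))"
      using comp[OF Cl_image[OF X h1(1) sub_NS[OF Cl_facts(1)[OF X]]] h1(2) _ A] B im k by simp
    then show ?case
    proof (rule cong)
      fix x assume "x \<in> h1 ` X"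
      then have "f (inv_into (NS X) h1 x) \<in> NS ?Y" using i sub_NS[OF Cl_facts(1)[OF Y]] by blast
      then show "h2 (g (inv_into (NS ?Y) k (k (f (inv_into (NS X) h1 x))))) = h2 (g (f (inv_into (NS X) h1 x)))"
        using fmor_inv_f[OF k(2)] by simp
    qed
  qed
  obtain g where g: "composite F \<Delta> X g" "\<forall>x\<in>X. g x = f x" using generated[OF f] by blast
  have gX: "g ` X = f ` X" using g(2) by (intro image_cong) auto
  have "Q (h1 ` X) (\<lambda>x. h2 (g (inv_into (NS X) h1 x)))" using main[OF g(1)] h2 gX by simp
  then show ?thesis
  proof (rule cong)
    fix x assume "x \<in> h1 ` X"
    then obtain y where "y \<in> X" "x = h1 y" by blast
    then show "h2 (g (inv_into (NS X) h1 x)) = h2 (f (inv_into (NS X) h1 x))"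
      using fmor_inv_f[OF h1(1), of y] sub_NS[OF Cl_facts(1)[OF X]] g(2) by auto
  qed
qed

end

section \<open>Extension of morphisms to the product of a subgroup with its centralizer\<close>

context fusion_system
begin

definition DC :: "'a set \<Rightarrow> 'a set" where
  "DC T = T <#>\<^bsub>fgrp F\<^esub> CS T"

lemma CS_gconj: assumes T: "sgr T" and g: "g \<in> NS T" and c: "c \<in> CS T" shows "cj c g \<in> CS T"
proof -
  have TS: "T \<subseteq> SS" using T by (rule subgroup.subset)
  have gS: "g \<in> SS" "c \<in> SS" using NS_mem[OF T g] c TS by (auto simp: mem_CS_iff)
  have ig: "inv\<^bsub>fgrp F\<^esub> g \<in> NS T" using subgroup.m_inv_closed[OF sgr_NS[OF T] g] .
  have "cj x (cj c g) = x" if x: "x \<in> T" for x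
  proof -
    let ?y = "cj x (inv\<^bsub>fgrp F\<^esub> g)"
    have y: "?y \<in> T" using NS_gconj[OF T ig x] .
    have "cj (cj ?y g) (cj c g) = cj (cj ?y c) g" using y TS gS by (intro S.gconj_gconj) auto
    also have "cj ?y c = ?y" using y c TS by (simp add: mem_CS_iff)
    finally show ?thesis using x TS gS by (simp add: subset_iff)
  qed
  then show ?thesis using gS TS by (simp add: mem_CS_iff)
qed

lemma sgr_mult_CS: assumes "sgr T" "sgr R" "R \<subseteq> NS T" shows "sgr (CS T <#>\<^bsub>fgrp F\<^esub> R)"
  using S.subgroup_mult_normal[OF sgr_S sgr_CS[OF subgroup.subset[OF assms(1)]] assms(2)] CS_gconj[OF assms(1)] assms(3)
  by blast

lemma sub_set_mult:
  assumes "sgr A" "sgr B" shows "A \<subseteq> A <#>\<^bsub>fgrp F\<^esub> B" "B \<subseteq> A <#>\<^bsub>fgrp F\<^esub> B"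
proof -
  have o: "\<one>\<^bsub>fgrp F\<^esub> \<in> A" "\<one>\<^bsub>fgrp F\<^esub> \<in> B" using assms by (auto intro: subgroup.one_closed)
  show "A \<subseteq> A <#>\<^bsub>fgrp F\<^esub> B"
  proof
    fix a assume a: "a \<in> A"
    then have "a = a \<otimes>\<^bsub>fgrp F\<^esub> \<one>\<^bsub>fgrp F\<^esub>" using sgr_mem[OF assms(1)] by simp
    then show "a \<in> A <#>\<^bsub>fgrp F\<^esub> B" using a o unfolding mem_set_mult_iff by blast
  qed
  show "B \<subseteq> A <#>\<^bsub>fgrp F\<^esub> B"
  proof
    fix a assume a: "a \<in> B"
    then have "a = \<one>\<^bsub>fgrp F\<^esub> \<otimes>\<^bsub>fgrp F\<^esub> a" using sgr_mem[OF assms(2)] by simp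
    then show "a \<in> A <#>\<^bsub>fgrp F\<^esub> B" using a o unfolding mem_set_mult_iff by blast
  qed
qed

lemma set_mult_least: "sgr H \<Longrightarrow> A \<subseteq> H \<Longrightarrow> B \<subseteq> H \<Longrightarrow> A <#>\<^bsub>fgrp F\<^esub> B \<subseteq> H"
  using subgroup.m_closed[of H "fgrp F"] by (auto simp: mem_set_mult_iff subset_iff)

lemma sgr_DC: assumes "sgr T" shows "sgr (DC T)"
proof -
  have TS: "T \<subseteq> SS" using assms by (rule subgroup.subset)
  show ?thesis
    unfolding DC_def using TS
    by (intro S.subgroup_mult_normal[OF sgr_S assms sgr_CS[OF TS]]) (simp add: mem_CS_iff)
qed

lemma DC_facts:
  assumes "sgr T" shows "T \<subseteq> DC T" "CS T \<subseteq> DC T" "DC T \<subseteq> NS T"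
  using sub_set_mult[OF assms sgr_CS[OF subgroup.subset[OF assms]]]
    set_mult_least[OF sgr_NS[OF assms] sub_NS[OF assms] CS_sub_NS[OF assms]] by (auto simp: DC_def)

lemma DC_image: assumes "fmor F E f" "DC T \<subseteq> E" "sgr T" shows "f ` DC T \<subseteq> DC (f ` T)"
proof
  fix y assume "y \<in> f ` DC T"
  then obtain z where z: "z \<in> DC T" "y = f z" by blast
  then obtain t c where t: "t \<in> T" "c \<in> CS T" "y = f (t \<otimes>\<^bsub>fgrp F\<^esub> c)"
    unfolding DC_def mem_set_mult_iff by blast
  have E: "T \<subseteq> E" "CS T \<subseteq> E" using DC_facts[OF assms(3)] assms(2) by auto
  then have "y = f t \<otimes>\<^bsub>fgrp F\<^esub> f c" using t fmor_mult[OF assms(1)] by auto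
  moreover have "f c \<in> CS (f ` T)" using fmor_image_CS[OF assms(1) E(1)] t E by auto
  ultimately show "y \<in> DC (f ` T)" unfolding DC_def mem_set_mult_iff using t by blast
qed

text \<open>Requiring the image to be all of \<open>DC\<close> of the image makes the notion stable
  under composition and inversion.\<close>

definition extends_DC :: "'a set \<Rightarrow> ('a \<Rightarrow> 'a) \<Rightarrow> bool" where
  "extends_DC T f \<longleftrightarrow> (\<exists>g. fmor F (DC T) g \<and> g ` DC T = DC (f ` T) \<and> (\<forall>x\<in>T. g x = f x))"

lemma extends_DC_cong:
  assumes "extends_DC T f" "\<And>x. x \<in> T \<Longrightarrow> f x = g x" shows "extends_DC T g"
proof -
  have "f ` T = g ` T" using assms(2) by (intro image_cong) auto
  then show ?thesis using assms by (auto simp: extends_DC_def)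
qed

lemma extends_DC_comp:
  assumes "extends_DC T f" "extends_DC (f ` T) g" shows "extends_DC T (\<lambda>x. g (f x))"
proof -
  obtain f' where f': "fmor F (DC T) f'" "f' ` DC T = DC (f ` T)" "\<forall>x\<in>T. f' x = f x"
    using assms(1) by (auto simp: extends_DC_def)
  obtain g' where g': "fmor F (DC (f ` T)) g'" "g' ` DC (f ` T) = DC (g ` f ` T)" "\<forall>x\<in>f ` T. g' x = g x"
    using assms(2) by (auto simp: extends_DC_def)
  have "fmor F (DC T) (\<lambda>x. g' (f' x))" using fmor_comp[OF f'(1) g'(1)] f'(2) by simp
  moreover have "(\<lambda>x. g' (f' x)) ` DC T = DC ((\<lambda>x. g (f x)) ` T)"
    using f' g' image_image[of g' f'] image_image[of g f] by metis
  ultimately show ?thesis using f' g' unfolding extends_DC_def by (intro exI[of _ "\<lambda>x. g' (f' x)"]) auto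
qed

lemma extends_DC_inv:
  assumes T: "sgr T" and "extends_DC T f" and g: "\<And>x. x \<in> T \<Longrightarrow> g (f x) = x" shows "extends_DC (f ` T) g"
proof -
  obtain f' where f': "fmor F (DC T) f'" "f' ` DC T = DC (f ` T)" "\<forall>x\<in>T. f' x = f x"
    using assms(2) by (auto simp: extends_DC_def)
  let ?i = "inv_into (DC T) f'"
  have "g ` f ` T = T" using g by (force simp: image_image)
  moreover have "fmor F (DC (f ` T)) ?i" using fmor_inv[OF f'(1)] f'(2) by simp
  moreover have "?i ` DC (f ` T) = DC T" using fmor_inv_image[OF f'(1), of "DC T"] f'(2) by simp
  moreover have "?i y = g y" if y: "y \<in> f ` T" for y
  proof -
    obtain x where x: "x \<in> T" "y = f x" using y by blast
    then have "?i (f' x) = x" using fmor_inv_f[OF f'(1)] DC_facts(1)[OF T] by blast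
    then show ?thesis using x f'(3) g by simp
  qed
  ultimately show ?thesis by (auto simp: extends_DC_def)
qed

end

context noncentric_class
begin

text \<open>\<open>chain_induction\<close> for the predicate that \<open>T\<close> reaches its
  image, with links from \<open>terminal_link\<close>; the ends are terminal already, so the outer
  conjugators are identities.\<close>

lemma all_terminal_reach:
  assumes "Cl T1" "terminal T1" "Cl T2" "terminal T2" shows "reach T1 T2"
proof -
  have "fconjugate F T1 T2" using assms fconjugate_trans fconjugate_sym by blast
  then obtain f where f: "fmor F T1 f" "f ` T1 = T2" by (auto simp: fconjugate_iff)
  have T: "sgr T1" "sgr T2" using assms Cl_facts by auto
  have "(\<lambda>T f. reach T (f ` T)) ((\<lambda>x. x) ` T1) (\<lambda>x. (\<lambda>x. x) (f (inv_into (NS T1) (\<lambda>x. x) x)))"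
  proof (rule chain_induction[where Q = "\<lambda>T f. reach T (f ` T)"])
    show "reach T (f ` T)" if "Cl T" "terminal T" "terminal (f ` T)" "fmor F R f" "T \<subset> R" "R \<subseteq> NS T" for T f R
      using terminal_link that by blast
    show "reach T ((\<lambda>x. g (f x)) ` T)" if "reach T (f ` T)" "reach (f ` T) (g ` f ` T)" for T f g
      using reach_trans[OF that] by (simp add: image_image)
    show "reach T (g ` T)" if "reach T (f ` T)" "\<And>x. x \<in> T \<Longrightarrow> f x = g x" for T f g
      using that by (metis image_cong)
    show "fmor F T1 f" by fact
    show "fmor F (NS T1) (\<lambda>x. x)" "fmor F (NS (f ` T1)) (\<lambda>x. x)" using T f fmor_id sgr_NS by auto
  qed (use assms f in auto)
  moreover have "(\<lambda>x. f (inv_into (NS T1) (\<lambda>x. x) x)) ` T1 = f ` T1"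
    using fmor_inv_f[OF fmor_id[OF sgr_NS[OF T(1)]]] sub_NS[OF T(1)] by (intro image_cong) auto
  ultimately show ?thesis using f by simp
qed

lemma Cl_reach_terminal: assumes "Cl X" "Cl T" "terminal T" shows "reach X T"
proof -
  obtain T' where T': "reach X T'" "terminal T'" using reach_terminal_exists Cl_facts(1) assms(1) by blast
  then show ?thesis using all_terminal_reach[OF Cl_reach[OF assms(1) T'(1)] T'(2) assms(2,3)] reach_trans by blast
qed

text \<open>Terminal members of the class reach each other, so \<open>DC\<close> of the image cannot
  be larger than \<open>DC T\<close>, and the inclusion \<open>DC_image\<close> becomes an
  equality.\<close>

lemma DC_image_terminal:
  assumes "Cl T" "terminal T" "terminal (f ` T)" "fmor F E f" "DC T \<subseteq> E"
  shows "f ` DC T = DC (f ` T)"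
proof -
  have le: "card (DC X) \<le> card (DC Y)" if XY: "reach X Y" for X Y
  proof -
    obtain h where h: "fmor F (NS X) h" "h ` X = Y" using XY by (auto simp: reach_def)
    have X: "sgr X" "sgr Y" using reach_sgr XY by auto
    have "card (DC X) = card (h ` DC X)" using fmor_card[OF h(1) DC_facts(3)[OF X(1)]] by simp
    also have "\<dots> \<le> card (DC Y)"
      using DC_image[OF h(1) DC_facts(3)[OF X(1)] X(1)] h(2) S.finite_subgroup[OF sgr_DC[OF X(2)]]
      by (auto intro: card_mono)
    finally show ?thesis .
  qed
  have T: "sgr T" "T \<subseteq> E" using assms Cl_facts DC_facts(1) by blast+
  have fT: "Cl (f ` T)" using Cl_image[OF assms(1,4) T(2)] .
  have "card (DC (f ` T)) \<le> card (DC T)" using le[OF all_terminal_reach[OF fT assms(3,1,2)]] .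
  then show ?thesis
    using DC_image[OF assms(4,5) T(1)] fmor_card[OF assms(4,5)] S.finite_subgroup[OF sgr_DC[OF Cl_facts(1)[OF fT]]]
    by (intro card_seteq) auto
qed

lemma CS_not_sub: assumes T: "Cl T" "terminal T" shows "\<not> CS T \<subseteq> T"
proof -
  obtain X where X: "Cl X" "\<not> CS X \<subseteq> X" using noncentric by blast
  obtain h where h: "fmor F (NS X) h" "h ` X = T" using Cl_reach_terminal[OF X(1) T] by (auto simp: reach_def)
  obtain c where c: "c \<in> CS X" "c \<notin> X" using X by blast
  have Xs: "sgr X" using Cl_facts X by blast
  have "h c \<in> CS T" using fmor_image_CS[OF h(1) sub_NS[OF Xs]] c CS_sub_NS[OF Xs] h(2) by blast
  moreover have "h c \<notin> T"
  proof
    assume "h c \<in> T"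
    then obtain x where "x \<in> X" "h c = h x" using h(2) by auto
    then show False
      using c fmor_inj[OF h(1)] CS_sub_NS[OF Xs] sub_NS[OF Xs] by (metis inj_onD subsetD)
  qed
  ultimately show ?thesis by blast
qed

text \<open>The scheme of \<open>terminal_link\<close>, except that now the maps themselves matter
  and the corrections must be accounted for. Both ends are sent to \<open>T0\<close> by extending
  maps involving corrections \<open>c1\<close> and \<open>c2\<close>; the discrepancy is an
  automorphism of \<open>T0\<close> coming from \<open>Kst R0\<close>, which extends by the claim
  \<open>kk\<close>. On \<open>X1\<close> the map \<open>f\<close> is then a composite of three
  extending maps.\<close>

lemma link_extends_DC:
  assumes "Cl X1" "terminal X1" "terminal (f ` X1)" "fmor F R1 f" "X1 \<subset> R1" "R1 \<subseteq> NS X1"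
  shows "extends_DC X1 f"
  using assms
proof (induction "card SS - card R1" arbitrary: R1 X1 f rule: less_induct)
  case less
  have IH: "extends_DC X' g"
    if "Cl X'" "terminal X'" "terminal (g ` X')" "fmor F R' g" "X' \<subset> R'" "R' \<subseteq> NS X'" "card R1 < card R'" for X' R' g
  proof -
    have "card R' \<le> card SS" using subgroup.subset[OF fmor_sgr[OF that(4)]] by (simp add: card_mono)
    then show ?thesis using less.hyps[OF _ that(1-6)] that(7) by simp
  qed
  let ?Y = "f ` X1"
  let ?R = "f ` R1"
  have X1: "sgr X1" "X1 \<subseteq> R1" using less.prems Cl_facts by auto
  have R1: "sgr R1" using less.prems fmor_sgr by blast
  have Y: "Cl ?Y" "sgr ?Y" using Cl_image[OF less.prems(1,4)] X1 Cl_facts by auto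
  have R: "sgr ?R" using fmor_image_all less.prems by blast
  have RN: "?R \<subseteq> NS ?Y" using fmor_image_NS[OF less.prems(4) X1] less.prems(6) by auto
  have YR: "?Y \<subset> ?R" using fmor_psubset[OF less.prems(4,5)] by simp
  have cR: "card ?R = card R1" using fmor_card[OF less.prems(4)] by simp
  show ?case
  proof (cases "DC X1 \<subseteq> R1")
    case True
    then show ?thesis
      using DC_image_terminal[OF less.prems(1-4) True] fmor_mono[OF less.prems(4) sgr_DC[OF X1(1)] True]
      by (auto simp: extends_DC_def)
  next
    case False
    then have n1: "R1 \<noteq> NS X1" using DC_facts[OF X1(1)] by auto
    have "card (NS ?Y) = card (NS X1)"
      using reach_card all_terminal_reach less.prems Y by (metis le_antisym)
    then have n2: "?R \<noteq> NS ?Y"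
      using cR n1 card_subset_eq[OF S.finite_subgroup[OF sgr_NS[OF X1(1)]] less.prems(6)] by auto
    obtain R0 e where e: "fmor F R1 e" "e ` R1 = R0" "good R0"
      "sylow_in (Aut_F F R0) p (Kst R0 (e ` X1)) (Tst R0 (e ` X1))"
      using pair_exists[OF less.prems(1,5) R1] by blast
    let ?X = "e ` X1"
    have X: "Cl ?X" "sgr ?X" "?X \<subseteq> R0" using Cl_image[OF less.prems(1) e(1) X1(2)] Cl_facts X1 e by auto
    have R0: "sgr R0" "R0 \<subseteq> NS ?X" using fmor_image_all[OF e(1)] e(2) fmor_image_NS[OF e(1) X1] less.prems(6)
      by (simp_all add: Int_absorb2)
    obtain T0 where T0: "reach ?X T0" "terminal T0" using reach_terminal_exists[OF X(2)] by blast
    have T0s: "Cl T0" "sgr T0" using Cl_reach[OF X(1) T0(1)] Cl_facts by auto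
    obtain h where h: "fmor F (NS ?X) h" "h ` ?X = T0" using T0(1) by (auto simp: reach_def)
    have key: "\<exists>c\<in>Kst R0 ?X. extends_DC X' (\<lambda>x. h (c (e' x)))"
      if X': "Cl X'" "terminal X'" "X' \<subset> R'" "R' \<subset> NS X'" "fmor F R' e'" "e' ` R' = R0" "e' ` X' = ?X"
        and card: "card R' = card R1" for X' R' e'
    proof -
      have s: "sgr X'" "sgr R'" using X' Cl_facts fmor_sgr by auto
      have sub: "X' \<subseteq> R'" using X'(3) by blast
      have syl: "sylow_in (Aut_F F R0) p (Kst R0 (e' ` X')) (Tst R0 (e' ` X'))"
        using e(4) unfolding X'(7) .
      obtain T g c where g: "sgr T" "R' \<subset> T" "T \<subseteq> NS X'" "fmor F T g" "g ` X' = ?X" "c \<in> Kst R0 ?X"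
          "\<forall>x\<in>R'. g x = c (e' x)"
        using grow_morphism[OF s(1) sub s(2) X'(4,5,6) e(3) syl] unfolding X'(7) by (elim exE conjE)
      have XT: "X' \<subset> T" using X' g by blast
      have gT: "g ` T \<subseteq> NS ?X" using fmor_image_NS[OF g(4) s(1)] XT g by auto
      have hg: "fmor F T (\<lambda>x. h (g x))" using fmor_comp[OF g(4) h(1) gT] .
      have im: "(\<lambda>x. h (g x)) ` X' = T0" using image_image[of h g X'] g h by simp
      have "card R1 < card T" using psubset_card_mono[OF S.finite_subgroup[OF g(1)] g(2)] card by simp
      then have "extends_DC X' (\<lambda>x. h (g x))" using IH[OF X'(1,2) _ hg XT g(3)] im T0 by simp
      then have "extends_DC X' (\<lambda>x. h (c (e' x)))"
        by (rule extends_DC_cong) (use g(7) sub in auto)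
      then show ?thesis using g(6) by blast
    qed
    obtain c1 where c1: "c1 \<in> Kst R0 ?X" "extends_DC X1 (\<lambda>x. h (c1 (e x)))"
      using key[OF less.prems(1,2,5) _ e(1,2)] less.prems(6) n1 by blast
    have i: "inv_into R1 f ` ?R = R1" "inv_into R1 f ` ?Y = X1"
      using fmor_inv_image[OF less.prems(4)] X1(2) by auto
    have e': "fmor F ?R (\<lambda>x. e (inv_into R1 f x))"
      using fmor_comp[OF fmor_inv[OF less.prems(4)] e(1)] i by simp
    have "(\<lambda>x. e (inv_into R1 f x)) ` ?R = R0" "(\<lambda>x. e (inv_into R1 f x)) ` ?Y = ?X"
      using i e image_image[of e "inv_into R1 f"] by metis+
    then obtain c2 where c2: "c2 \<in> Kst R0 ?X" "extends_DC ?Y (\<lambda>x. h (c2 (e (inv_into R1 f x))))"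
      using key[OF Y(1) less.prems(3) YR _ e'] RN n2 cR by blast
    let ?hi = "inv_into (NS ?X) h"
    let ?RB = "h ` R0"
    have R00: "sgr ?RB" "T0 \<subset> ?RB" "?RB \<subseteq> NS T0" "card ?RB = card R1"
    proof -
      show "sgr ?RB" using fmor_image[OF h(1) R0] .
      have "?X \<subset> R0" using fmor_psubset[OF e(1) less.prems(5)] e(2) by simp
      from fmor_psubset[OF h(1) this R0(2)] show "T0 \<subset> ?RB" unfolding h(2) .
      show "?RB \<subseteq> NS T0" using NS_image_NS[OF X(2) h(1)] h(2) R0(2) by blast
      show "card ?RB = card R1" using fmor_card[OF h(1) R0(2)] fmor_card[OF e(1)] e(2) by auto
    qed
    have hiT: "?hi ` T0 = ?X" "?hi ` ?RB = R0"
      using fmor_inv_image[OF h(1) sub_NS[OF X(2)]] fmor_inv_image[OF h(1) R0(2)] h(2) by simp_all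
    \<comment> \<open>If \<open>DC T0\<close> is not contained in \<open>?RB\<close>, some element
      of \<open>CS T0\<close> normalizes \<open>?RB\<close> without lying in it. Acting trivially on
      \<open>T0\<close>, it meets the hypothesis of \<open>extend_Kcs\<close> with
      \<open>s = 1\<close>, so the domain grows while the map on \<open>T0\<close> is unchanged, and
      the induction hypothesis applies.\<close>
    have kk: "extends_DC T0 (\<lambda>x. h (k (?hi x)))" if k: "k \<in> Kst R0 ?X" for k
    proof -
      have kF: "fmor F R0 k" "k ` R0 = R0" "k ` ?X = ?X" using Kst_fmor[OF k] by auto
      have khi: "fmor F ?RB (\<lambda>x. k (?hi x))"
        using fmor_comp[OF fmor_inv_sub[OF h(1) R0] kF(1)] hiT by simp
      have khim: "(\<lambda>x. k (?hi x)) ` ?RB = R0" "(\<lambda>x. k (?hi x)) ` T0 = ?X"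
        using image_image[of k ?hi] hiT kF by metis+
      have fm: "fmor F ?RB (\<lambda>x. h (k (?hi x)))" using fmor_comp[OF khi h(1)] khim R0(2) by simp
      have im: "(\<lambda>x. h (k (?hi x))) ` T0 = T0" using khim(2) h(2) image_image[of h "\<lambda>x. k (?hi x)" T0] by simp
      show ?thesis
      proof (cases "DC T0 \<subseteq> ?RB")
        case True
        then show ?thesis
          using DC_image_terminal[OF T0s(1) T0(2) _ fm True] fmor_mono[OF fm sgr_DC[OF T0s(2)] True] im T0(2)
          by (auto simp: extends_DC_def)
      next
        case False
        let ?B = "CS T0 <#>\<^bsub>fgrp F\<^esub> ?RB"
        have CT: "sgr (CS T0)" using sgr_CS[OF subgroup.subset[OF T0s(2)]] .
        have B: "sgr ?B" using sgr_mult_CS[OF T0s(2) R00(1,3)] .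
        have "?RB \<subseteq> ?B" "CS T0 \<subseteq> ?B" using sub_set_mult[OF CT R00(1)] by auto
        moreover have "\<not> CS T0 \<subseteq> ?RB"
          using False set_mult_least[OF R00(1)] R00(2) unfolding DC_def by blast
        ultimately have "?RB \<subset> ?B" by blast
        then obtain b where b: "b \<in> ?B" "b \<in> NS ?RB" "b \<notin> ?RB"
          using normalizer_grows_in[OF R00(1) B] by blast
        then obtain c r where cr: "b = c \<otimes>\<^bsub>fgrp F\<^esub> r" "c \<in> CS T0" "r \<in> ?RB"
          unfolding mem_set_mult_iff by blast
        have "c = b \<otimes>\<^bsub>fgrp F\<^esub> inv\<^bsub>fgrp F\<^esub> r"
          using cr sgr_mem[OF CT] sgr_mem[OF R00(1)] by (simp add: S.m_assoc)
        then have "c \<in> NS ?RB"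
          using b(2) sub_NS[OF R00(1)] cr(3) subgroup.m_closed[OF sgr_NS[OF R00(1)]]
            subgroup.m_inv_closed[OF R00(1)] by blast
        moreover have "c \<notin> ?RB" using b(3) cr subgroup.m_closed[OF R00(1)] by blast
        ultimately have c: "c \<in> CS T0 \<inter> NS ?RB" "c \<notin> ?RB" using cr by auto
        let ?D = "CS T0 \<inter> NS ?RB"
        have D: "sgr ?D" using S.subgroup_Int[OF CT sgr_NS[OF R00(1)]] .
        have "\<exists>d\<in>Kcs R0 ?X. \<exists>E g. fmor F E g \<and> ?RB \<subseteq> E \<and> ?D \<subseteq> E \<and> (\<forall>x\<in>?RB. g x = d (k (?hi x)))"
        proof (rule extend_Kcs[OF e(3) X(2,3) e(4) khi khim(1) D])
          show "?D \<subseteq> NS ?RB" by blast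
          fix t assume t: "t \<in> ?D"
          have "k (?hi (cj x t)) = cj (k (?hi x)) \<one>\<^bsub>fgrp F\<^esub>" if x: "x \<in> ?RB" "k (?hi x) \<in> ?X" for x
          proof -
            from x(2) have "k (?hi x) \<in> (\<lambda>x. k (?hi x)) ` T0" unfolding khim(2) .
            then obtain y where y: "k (?hi x) = k (?hi y)" "y \<in> T0" by (rule imageE)
            have "y \<in> ?RB" using y(2) R00(2) by blast
            then have "x = y" using inj_onD[OF fmor_inj[OF khi] y(1) x(1)] by blast
            then have "cj x t = x" using t y subgroup.subset[OF T0s(2)] by (auto simp: mem_CS_iff)
            then show ?thesis using fmor_closed[OF khi x(1)] by simp
          qed
          moreover have "\<one>\<^bsub>fgrp F\<^esub> \<in> NS R0 \<inter> NS ?X"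
            using subgroup.one_closed[OF sgr_NS[OF R0(1)]] subgroup.one_closed[OF sgr_NS[OF X(2)]] by blast
          ultimately show "\<exists>s\<in>NS R0 \<inter> NS ?X. \<forall>x\<in>?RB. k (?hi x) \<in> ?X \<longrightarrow> k (?hi (cj x t)) = cj (k (?hi x)) s"
            by blast
        qed
        then obtain d E g where g: "d \<in> Kcs R0 ?X" "fmor F E g" "?RB \<subseteq> E" "?D \<subseteq> E" "\<forall>x\<in>?RB. g x = d (k (?hi x))"
          by blast
        have gT: "g x = k (?hi x)" if "x \<in> T0" for x
        proof -
          have "k (?hi x) \<in> ?X" using khim(2) that by blast
          then show ?thesis using g(1,5) R00(2) that by (auto simp: Kcs_def)
        qed
        have "g ` T0 = (\<lambda>x. k (?hi x)) ` T0" using gT by (intro image_cong) auto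
        then have gT0: "g ` T0 = ?X" unfolding khim(2) .
        let ?RC = "E \<inter> NS T0"
        have R3: "sgr ?RC" using S.subgroup_Int[OF fmor_sgr[OF g(2)] sgr_NS[OF T0s(2)]] .
        have "c \<in> E" "c \<in> NS T0" using subsetD[OF g(4) c(1)] subsetD[OF CS_sub_NS[OF T0s(2)]] c(1) by auto
        then have sub: "?RB \<subset> ?RC" using Int_greatest[OF g(3) R00(3)] c(2) by (metis IntI psubsetI)
        have T0E: "T0 \<subseteq> E" using R00(2) g(3) by blast
        have "g ` ?RC \<subseteq> NS ?X" using fmor_image_NS[OF g(2) T0s(2) T0E] gT0 by simp
        then have hg: "fmor F ?RC (\<lambda>x. h (g x))" using fmor_comp[OF fmor_mono[OF g(2) R3] h(1)] by blast
        have im3: "(\<lambda>x. h (g x)) ` T0 = T0" using image_image[of h g T0] gT0 h(2) by simp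
        have "card R1 < card ?RC" using psubset_card_mono[OF S.finite_subgroup[OF R3] sub] R00(4) by simp
        moreover have "T0 \<subset> ?RC" using R00(2) sub by blast
        ultimately have "extends_DC T0 (\<lambda>x. h (g x))" using IH[OF T0s(1) T0(2) _ hg] im3 T0(2) by simp
        then show ?thesis by (rule extends_DC_cong) (simp add: gT)
      qed
    qed
    have c1F: "fmor F R0 c1" "c1 ` R0 = R0" "c1 ` ?X = ?X" using Kst_fmor[OF c1(1)] by auto
    have c2F: "fmor F R0 c2" "c2 ` R0 = R0" "c2 ` ?X = ?X" using Kst_fmor[OF c2(1)] by auto
    interpret A: finite_group "Aut_F F R0" p using finite_group_Aut[OF R0(1)] .
    note K = subgroup_Kst[OF R0(1) X(2,3)]
    \<comment> \<open>Chosen so that \<open>?k\<close> after \<open>c1\<close> is \<open>c2\<close>;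
      it converts the extending map on the side of \<open>X1\<close> into one that matches the side
      of \<open>?Y\<close>.\<close>
    let ?k = "c2 \<otimes>\<^bsub>Aut_F F R0\<^esub> inv\<^bsub>Aut_F F R0\<^esub> c1"
    have k: "?k \<in> Kst R0 ?X" using subgroup.m_closed[OF K c2(1) subgroup.m_inv_closed[OF K c1(1)]] .
    have c12: "c1 \<in> fiso F R0 R0" "c2 \<in> fiso F R0 R0" using c1 c2 by (auto simp: Kst_def)
    have kx: "?k (c1 x) = c2 x" if x: "x \<in> R0" for x
    proof -
      have "?k \<otimes>\<^bsub>Aut_F F R0\<^esub> c1 = c2" using c12 A.m_assoc[of c2 "inv\<^bsub>Aut_F F R0\<^esub> c1" c1] A.inv_closed[of c1] by simp
      moreover have "?k \<in> fiso F R0 R0" using k by (simp add: Kst_def)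
      ultimately have "compose R0 ?k c1 = c2" using Aut_F_mult c12 by metis
      then show ?thesis using x by (metis compose_eq)
    qed
    have ee: "extends_DC X1 (\<lambda>x. h (c2 (e x)))"
    proof -
      have c1e: "c1 (e x) \<in> ?X" if "x \<in> X1" for x using that c1F(3) by blast
      have "(\<lambda>x. h (c1 (e x))) ` X1 = h ` c1 ` ?X" by (simp add: image_image)
      then have im: "(\<lambda>x. h (c1 (e x))) ` X1 = T0" using c1F(3) h(2) by simp
      have "extends_DC X1 (\<lambda>x. (\<lambda>x. h (?k (?hi x))) (h (c1 (e x))))"
        by (rule extends_DC_comp[OF c1(2)]) (use kk[OF k] im in simp)
      then show ?thesis
      proof (rule extends_DC_cong)
        fix x assume x: "x \<in> X1"
        have "c1 (e x) \<in> NS ?X" using c1e[OF x] sub_NS[OF X(2)] by blast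
        then have "?hi (h (c1 (e x))) = c1 (e x)" using fmor_inv_f[OF h(1)] by blast
        moreover have "e x \<in> R0" using x X(3) by blast
        ultimately show "h (?k (?hi (h (c1 (e x))))) = h (c2 (e x))" using kx by simp
      qed
    qed
    \<comment> \<open>On \<open>X1\<close> the composite of \<open>?w\<close> with \<open>f\<close>
      is \<open>h c2 e\<close>, so \<open>f\<close> is recovered by following \<open>h c2 e\<close>
      with the inverse of \<open>?w\<close>.\<close>
    let ?w = "\<lambda>x. h (c2 (e (inv_into R1 f x)))"
    have wf: "?w (f x) = h (c2 (e x))" if "x \<in> X1" for x
      using fmor_inv_f[OF less.prems(4)] that X1(2) by auto
    have wi: "fmor F ?R ?w"
    proof -
      have "fmor F ?R (\<lambda>x. c2 (e (inv_into R1 f x)))" using fmor_comp[OF e' c2F(1)] \<open>(\<lambda>x. e (inv_into R1 f x)) ` ?R = R0\<close> by simp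
      moreover have "(\<lambda>x. c2 (e (inv_into R1 f x))) ` ?R = R0"
        using image_image[of c2 "\<lambda>x. e (inv_into R1 f x)" ?R] \<open>(\<lambda>x. e (inv_into R1 f x)) ` ?R = R0\<close> c2F(2) by simp
      ultimately show ?thesis using fmor_comp[OF _ h(1)] R0(2) by blast
    qed
    have "extends_DC (?w ` ?Y) (inv_into ?R ?w)"
      by (rule extends_DC_inv[OF Y(2) c2(2)]) (use fmor_inv_f[OF wi] X1(2) in blast)
    moreover have "?w ` ?Y = (\<lambda>x. h (c2 (e x))) ` X1" using wf by (simp add: image_image)
    ultimately have "extends_DC X1 (\<lambda>x. inv_into ?R ?w (h (c2 (e x))))"
      using extends_DC_comp[OF ee] by simp
    then show ?thesis
    proof (rule extends_DC_cong)
      fix x assume x: "x \<in> X1"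
      then have "inv_into ?R ?w (?w (f x)) = f x" using fmor_inv_f[OF wi] X1(2) by blast
      then show "inv_into ?R ?w (h (c2 (e x))) = f x" using wf[OF x] by simp
    qed
  qed
qed

lemma Aut_extends_DC:
  assumes T: "Cl T" "terminal T" and f: "fmor F T f" "f ` T = T"
  shows "extends_DC T f"
proof -
  have Ts: "sgr T" using T Cl_facts by blast
  have "extends_DC ((\<lambda>x. x) ` T) (\<lambda>x. (\<lambda>x. x) (f (inv_into (NS T) (\<lambda>x. x) x)))"
  proof (rule chain_induction[where Q = extends_DC])
    show "extends_DC T f" if "Cl T" "terminal T" "terminal (f ` T)" "fmor F R f" "T \<subset> R" "R \<subseteq> NS T" for T f R
      using link_extends_DC that by blast
    show "extends_DC T (\<lambda>x. g (f x))" if "extends_DC T f" "extends_DC (f ` T) g" for T f g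
      using extends_DC_comp[OF that] .
    show "extends_DC T g" if "extends_DC T f" "\<And>x. x \<in> T \<Longrightarrow> f x = g x" for T f g
      using extends_DC_cong[OF that] .
    show "fmor F (NS T) (\<lambda>x. x)" "fmor F (NS (f ` T)) (\<lambda>x. x)" using Ts f fmor_id sgr_NS by auto
  qed (use assms f in auto)
  then have "extends_DC T (\<lambda>x. f (inv_into (NS T) (\<lambda>x. x) x))" by simp
  then show ?thesis
    by (rule extends_DC_cong) (use fmor_inv_f[OF fmor_id[OF sgr_NS[OF Ts]]] sub_NS[OF Ts] in auto)
qed

text \<open>Choose a good conjugate \<open>R\<close> of \<open>P C\<^sub>S(P)\<close> with \<open>P\<close> terminal. Since every automorphism of \<open>P\<close>
  extends to \<open>P C\<^sub>S(P)\<close>, the image of \<open>P\<close> in \<open>R\<close> inherits goodness from \<open>R\<close>.\<close>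

lemma exists_good_conjugate: "\<exists>X. Cl X \<and> good X"
proof -
  obtain P where P: "reach P0 P" "terminal P" using reach_terminal_exists P0 by blast
  have CP: "Cl P" "sgr P" using Cl_reach[OF fconjugate_refl[OF P0(1)] P(1)] Cl_facts by auto
  have PD: "P \<subset> DC P" using CS_not_sub[OF CP(1) P(2)] DC_facts[OF CP(2)] by blast
  note D = sgr_DC[OF CP(2)]
  obtain R f where f: "fmor F (DC P) f" "f ` DC P = R" "good R"
    "sylow_in (Aut_F F R) p (Kst R (f ` P)) (Tst R (f ` P))"
    using pair_exists[OF CP(1) PD D] by blast
  let ?X = "f ` P"
  have PD': "P \<subseteq> DC P" using PD by blast
  have X: "Cl ?X" "sgr ?X" "?X \<subseteq> R"
    using Cl_image[OF CP(1) f(1) PD'] Cl_facts image_mono[OF PD', of f] f(2) by auto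
  have DN: "NS P \<subseteq> NS (DC P)"
  proof
    fix g assume g: "g \<in> NS P"
    have "cj x g \<in> DC P" if x: "x \<in> DC P" for x
    proof -
      obtain a c where ac: "a \<in> P" "c \<in> CS P" "x = a \<otimes>\<^bsub>fgrp F\<^esub> c"
        using x unfolding DC_def mem_set_mult_iff by blast
      have "a \<in> SS" "c \<in> SS" "g \<in> SS"
        using ac g NS_mem[OF CP(2)] sgr_mem[OF CP(2)] CS_sub_NS[OF CP(2)] by auto
      then have "cj x g = cj a g \<otimes>\<^bsub>fgrp F\<^esub> cj c g" using ac by (simp add: S.gconj_mult)
      then show ?thesis unfolding DC_def mem_set_mult_iff
        using NS_gconj[OF CP(2) g ac(1)] CS_gconj[OF CP(2) g ac(2)] by blast
    qed
    then show "g \<in> NS (DC P)" using NS_mem[OF CP(2) g] by (simp add: mem_NS_iff[OF D])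
  qed
  have "\<exists>c\<in>Kst R ?X. \<exists>E g. fmor F E g \<and> DC P \<subseteq> E \<and> NS P \<subseteq> E \<and> (\<forall>x\<in>DC P. g x = c (f x))"
  proof (rule extend_Kst[OF f(3) X(2,3) f(4) f(1,2) sgr_NS[OF CP(2)] DN])
    fix t x assume t: "t \<in> NS P" "x \<in> DC P" "f x \<in> ?X"
    then obtain y where "y \<in> P" "f x = f y" by blast
    then have "x \<in> P" using inj_onD[OF fmor_inj[OF f(1)], of x y] t PD' by blast
    then show "f (cj x t) \<in> ?X" using NS_gconj[OF CP(2) t(1)] by blast
  qed
  then obtain c E g where g: "c \<in> Kst R ?X" "fmor F E g" "DC P \<subseteq> E" "NS P \<subseteq> E" "\<forall>x\<in>DC P. g x = c (f x)" by blast
  have gP: "g ` P = ?X" "g ` DC P = R"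
  proof -
    have "g ` A = c ` f ` A" if "A \<subseteq> DC P" for A using g(5) that by (force simp: image_image)
    then show "g ` P = ?X" "g ` DC P = R" using PD' Kst_fmor[OF g(1)] f(2) by auto
  qed
  have gN: "fmor F (NS P) g" using fmor_mono[OF g(2) sgr_NS[OF CP(2)] g(4)] .
  have "reach P ?X" using gN gP CP by (auto simp: reach_def)
  then have tX: "terminal ?X" using terminal_reach[OF P(2)] by blast
  have RD: "R = DC ?X" using DC_image_terminal[OF CP(1) P(2) _ g(2,3)] gP tX by simp
  have Rs: "sgr R" using f(3) by (simp add: good_def)
  have NXR: "NS ?X \<subseteq> NS R"
  proof -
    have "NS ?X = g ` NS P" using terminal_reach_image[OF P(2) CP(2) gN] gP by simp
    also have "\<dots> = g ` (E \<inter> NS P \<inter> NS (DC P))" using g(4) DN by (metis Int_absorb1 Int_absorb2)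
    also have "\<dots> \<subseteq> NS (g ` DC P)" using fmor_image_NS[OF g(2) D g(3)] by blast
    finally show ?thesis using gP by simp
  qed
  interpret A: finite_group "Aut_F F R" p using finite_group_Aut[OF Rs] .
  interpret AX: finite_group "Aut_F F ?X" p using finite_group_Aut[OF X(2)] .
  have K: "subgroup (Kst R ?X) (Aut_F F R)" using subgroup_Kst[OF Rs X(2,3)] .
  interpret AK: finite_group "Aut_F F R\<lparr>carrier := Kst R ?X\<rparr>" p using A.restrict_finite_group[OF K] .
  have res: "restrict a ?X \<in> fiso F ?X ?X" if "a \<in> Kst R ?X" for a
    using Kst_fmor[OF that] by (intro restrict_fiso fmor_mono[OF _ X(2,3)]) auto
  \<comment> \<open>Restriction to \<open>?X\<close> takes \<open>Kst R ?X\<close> onto all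
    automorphisms of \<open>?X\<close>, since these extend to \<open>R = DC ?X\<close>, and takes
    \<open>Tst R ?X\<close> onto \<open>Aut_S F ?X\<close>, since \<open>NS ?X\<close> normalizes
    \<open>R\<close>. Hence the Sylow property passes to \<open>Aut_S F ?X\<close>.\<close>
  interpret r: group_hom "Aut_F F R\<lparr>carrier := Kst R ?X\<rparr>" "Aut_F F ?X" "\<lambda>a. restrict a ?X"
  proof (unfold_locales, rule homI)
    fix a b assume "a \<in> carrier (Aut_F F R\<lparr>carrier := Kst R ?X\<rparr>)" "b \<in> carrier (Aut_F F R\<lparr>carrier := Kst R ?X\<rparr>)"
    then have ab: "a \<in> Kst R ?X" "b \<in> Kst R ?X" by auto
    then have ab': "a \<in> fiso F R R" "b \<in> fiso F R R" by (auto simp: Kst_def)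
    have "b x \<in> ?X" if "x \<in> ?X" for x using Kst_fmor[OF ab(2)] that by blast
    then have "restrict (compose R a b) ?X = compose ?X (restrict a ?X) (restrict b ?X)"
      using X(3) by (auto simp: compose_def fun_eq_iff subset_iff)
    then show "restrict (a \<otimes>\<^bsub>Aut_F F R\<lparr>carrier := Kst R ?X\<rparr>\<^esub> b) ?X = restrict a ?X \<otimes>\<^bsub>Aut_F F ?X\<^esub> restrict b ?X"
      using Aut_F_mult[OF ab'] Aut_F_mult[OF res[OF ab(1)] res[OF ab(2)]] by simp
  qed (use res in auto)
  have imK: "(\<lambda>a. restrict a ?X) ` Kst R ?X = fiso F ?X ?X"
  proof
    show "(\<lambda>a. restrict a ?X) ` Kst R ?X \<subseteq> fiso F ?X ?X" using res by blast
    show "fiso F ?X ?X \<subseteq> (\<lambda>a. restrict a ?X) ` Kst R ?X"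
    proof
      fix a assume a: "a \<in> fiso F ?X ?X"
      then have aF: "fmor F ?X a" "a ` ?X = ?X" "a \<in> extensional ?X" by (auto simp: fiso_iff)
      obtain b where b: "fmor F R b" "b ` R = DC (a ` ?X)" "\<forall>x\<in>?X. b x = a x"
        using Aut_extends_DC[OF X(1) tX aF(1,2)] RD by (auto simp: extends_DC_def)
      have "b ` R = R" using b aF RD by simp
      then have "restrict b R \<in> fiso F R R" using restrict_fiso b by blast
      moreover have "restrict b R ` ?X = a ` ?X" using b(3) X(3) by (intro image_cong) auto
      ultimately have "restrict b R \<in> Kst R ?X" using aF by (simp add: Kst_def)
      moreover have "restrict (restrict b R) ?X = a"
      proof (rule ext)
        fix x show "restrict (restrict b R) ?X x = a x"
          using b(3) X(3) aF(3) by (cases "x \<in> ?X") (auto simp: extensional_def)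
      qed
      ultimately show "a \<in> (\<lambda>a. restrict a ?X) ` Kst R ?X" by blast
    qed
  qed
  have imT: "(\<lambda>a. restrict a ?X) ` Tst R ?X = Aut_S F ?X"
  proof -
    have "Tst R ?X = cR R ` NS ?X" using NXR by (simp add: Tst_def Int_absorb1)
    moreover have "restrict (cR R s) ?X = cR ?X s" for s
      using X(3) by (auto simp: cR_def fun_eq_iff subset_iff)
    ultimately show ?thesis by (simp add: Aut_S_eq image_image)
  qed
  have T: "subgroup (Tst R ?X) (Aut_F F R)" "Tst R ?X \<subseteq> Kst R ?X"
    using A.psubgroup_subgroup[OF psubgroup_Tst[OF Rs X(2,3)]] Tst_sub_Kst[OF Rs X(2,3)] by auto
  have "subgroup (Tst R ?X) (Aut_F F R\<lparr>carrier := Kst R ?X\<rparr>)" using A.subgroup_incl[OF T(1) K T(2)] .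
  from r.sylow_card_image[OF AK.fin prime_p AK.subgroup_self this]
  have "card ((\<lambda>a. restrict a ?X) ` Tst R ?X) = p ^ multiplicity p (card ((\<lambda>a. restrict a ?X) ` Kst R ?X))"
    using A.sylow_in_card[OF K f(4)] T(2) by simp
  then have "card (Aut_S F ?X) = p ^ multiplicity p (order (Aut_F F ?X))"
    using imK imT by (simp add: order_def)
  moreover have "subgroup (Aut_S F ?X) (Aut_F F ?X)"
    using AX.psubgroup_subgroup[OF psubgroup_conj_maps[OF X(2) sgr_NS[OF X(2)]]] by (simp add: Aut_S_eq)
  ultimately have fa: "fully_automized p F ?X" by (simp add: fully_automized_def sylow_subgroup_def)
  have "receptive F ?X"
    unfolding receptive_def
  proof (intro allI impI)
    fix Y \<phi> assume Y: "sgr Y \<and> \<phi> \<in> fiso F Y ?X"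
    let ?E = "extension_group F Y ?X \<phi>"
    have \<phi>: "fmor F Y \<phi>" "\<phi> ` Y = ?X" "restrict \<phi> Y = \<phi>"
      using Y by (auto simp: fiso_iff extensional_restrict)
    have Ys: "sgr Y" using Y by blast
    have Eiff: "t \<in> ?E \<longleftrightarrow> t \<in> NS Y \<and> (\<exists>s\<in>NS ?X. \<forall>y\<in>Y. \<phi> (cj y t) = cj (\<phi> y) s)" for t
      using extension_group_iff[OF \<phi>(1,2), of t] \<phi>(3) by simp
    have E: "sgr ?E" "?E \<subseteq> NS Y" using sgr_extension_group[OF \<phi>(1,2)] \<phi>(3) Eiff by auto
    have YE: "Y \<subseteq> ?E"
    proof
      fix t assume t: "t \<in> Y"
      have "\<phi> t \<in> NS ?X" using t \<phi>(2) sub_NS[OF X(2)] by blast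
      then show "t \<in> ?E" using t sub_NS[OF Ys] fmor_gconj[OF \<phi>(1)] by (auto simp: Eiff)
    qed
    have "fconjugate F Y ?X" using \<phi> by (auto simp: fconjugate_iff)
    then have "Cl Y" using fconjugate_trans[OF X(1) fconjugate_sym] by blast
    \<comment> \<open>\<open>Y\<close> reaches the terminal \<open>?X\<close> with its whole
      normalizer. \<open>\<phi>\<close> differs from \<open>h\<close> by an automorphism of
      \<open>?X\<close>, which extends to \<open>b\<close> on \<open>R\<close>; it remains to extend
      \<open>b\<close> over the image of the extension group by a correction fixing
      \<open>?X\<close> pointwise.\<close>
    then obtain h where h: "fmor F (NS Y) h" "h ` Y = ?X"
      using Cl_reach_terminal[OF _ X(1) tX] unfolding reach_def by blast
    have YN: "Y \<subseteq> NS Y" using sub_NS[OF Ys] .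
    let ?hi = "inv_into (NS Y) h"
    have hi: "fmor F ?X ?hi" "?hi ` ?X = Y"
      using fmor_inv_sub[OF h(1) Ys YN] fmor_inv_image[OF h(1) YN] h(2) by auto
    have a: "fmor F ?X (\<lambda>x. \<phi> (?hi x))" using fmor_comp[OF hi(1) \<phi>(1)] hi(2) by simp
    have aX: "(\<lambda>x. \<phi> (?hi x)) ` ?X = ?X" using hi(2) \<phi>(2) image_image[of \<phi> ?hi ?X] by simp
    obtain b where b: "fmor F R b" "b ` R = DC ?X" "\<forall>x\<in>?X. b x = \<phi> (?hi x)"
      using Aut_extends_DC[OF X(1) tX a aX] RD aX by (auto simp: extends_DC_def)
    have bR: "b ` R = R" using b RD by simp
    let ?T = "h ` ?E"
    have T: "sgr ?T" using fmor_image[OF h(1) E] .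
    have "?T \<subseteq> NS (h ` Y)" by (rule subset_trans[OF image_mono[OF E(2)] NS_image_NS[OF Ys h(1)]])
    then have TN: "?T \<subseteq> NS R" unfolding h(2) using NXR by (rule subset_trans)
    have bh: "b (h y) = \<phi> y" if y: "y \<in> Y" for y
    proof -
      have "h y \<in> ?X" using imageI[OF y, of h] h(2) by simp
      then have "b (h y) = \<phi> (?hi (h y))" using b(3) by blast
      then show ?thesis using fmor_inv_f[OF h(1) subsetD[OF YN y]] by simp
    qed
    have "\<exists>c\<in>Kcs R ?X. \<exists>E' g. fmor F E' g \<and> R \<subseteq> E' \<and> ?T \<subseteq> E' \<and> (\<forall>x\<in>R. g x = c (b x))"
    proof (rule extend_Kcs[OF f(3) X(2,3) f(4) b(1) bR T TN])
      fix t assume "t \<in> ?T"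
      then obtain u where u: "u \<in> ?E" "t = h u" by blast
      then obtain s where s: "s \<in> NS ?X" "\<forall>y\<in>Y. \<phi> (cj y u) = cj (\<phi> y) s" using Eiff by blast
      have "b (cj x t) = cj (b x) s" if x: "x \<in> R" "b x \<in> ?X" for x
      proof -
        have "b ` ?X = (\<lambda>x. \<phi> (?hi x)) ` ?X" using b(3) by (intro image_cong) auto
        then have "b ` ?X = ?X" unfolding aX .
        then have "b x \<in> b ` ?X" using x(2) by simp
        then obtain x' where x': "b x = b x'" "x' \<in> ?X" by (rule imageE)
        have "x' \<in> R" using x'(2) X(3) by (rule subsetD[rotated])
        then have "x \<in> ?X" using inj_onD[OF fmor_inj[OF b(1)] x'(1) x(1)] x'(2) by simp
        then have "x \<in> h ` Y" unfolding h(2) .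
        then obtain y where y: "y \<in> Y" "x = h y" by blast
        have uN: "u \<in> NS Y" using u E by blast
        have "cj x t = h (cj y u)" using fmor_gconj[OF h(1), of y u] y u uN YN by auto
        then show ?thesis using bh[OF NS_gconj[OF Ys uN y(1)]] bh[OF y(1)] s y by simp
      qed
      then show "\<exists>s\<in>NS R \<inter> NS ?X. \<forall>x\<in>R. b x \<in> ?X \<longrightarrow> b (cj x t) = cj (b x) s"
        using s(1) NXR by blast
    qed
    then obtain c E' g where g: "c \<in> Kcs R ?X" "fmor F E' g" "R \<subseteq> E'" "?T \<subseteq> E'" "\<forall>x\<in>R. g x = c (b x)" by blast
    let ?\<psi> = "restrict (\<lambda>x. g (h x)) ?E"
    have "fmor F ?E (\<lambda>x. g (h x))" using fmor_comp[OF fmor_mono[OF h(1) E] g(2,4)] .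
    then have "?\<psi> \<in> fhom F ?E SS" by (simp add: fmor_def)
    moreover have "restrict ?\<psi> Y = \<phi>"
    proof -
      have "g (h y) = \<phi> y" if y: "y \<in> Y" for y
      proof -
        have hy: "h y \<in> ?X" "\<phi> y \<in> ?X"
          using imageI[OF y, of h] imageI[OF y, of \<phi>] h(2) \<phi>(2) by simp_all
        have "h y \<in> R" using subsetD[OF X(3) hy(1)] .
        moreover have "c (\<phi> y) = \<phi> y" using g(1) hy(2) unfolding Kcs_def by blast
        ultimately show ?thesis using g(5) bh[OF y] by simp
      qed
      then have "restrict ?\<psi> Y = restrict \<phi> Y" using YE by (auto simp: fun_eq_iff subset_iff)
      then show ?thesis using \<phi>(3) by simp
    qed
    ultimately show "\<exists>\<psi>\<in>fhom F ?E SS. restrict \<psi> Y = \<phi>" by blast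
  qed
  then show ?thesis using X fa by (auto simp: good_def)
qed

end

text \<open>Downward induction on order: a subgroup outside \<open>\<Delta>\<close> is not centric,
  so some conjugate fails to contain its centralizer and the subgroup satisfies
  \<open>noncentric_class\<close>.\<close>

theorem (in fusion_system) saturated_if_centric_generated:
  assumes conj: "\<And>X Y. X \<in> \<Delta> \<Longrightarrow> fconjugate F X Y \<Longrightarrow> Y \<in> \<Delta>"
    and over: "\<And>X Y. X \<in> \<Delta> \<Longrightarrow> sgr Y \<Longrightarrow> X \<subseteq> Y \<Longrightarrow> Y \<in> \<Delta>"
    and sub: "\<And>X. X \<in> \<Delta> \<Longrightarrow> sgr X"
    and gen: "\<And>X f. fmor F X f \<Longrightarrow> \<exists>g. composite F \<Delta> X g \<and> (\<forall>x\<in>X. g x = f x)"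
    and good: "\<And>X. X \<in> \<Delta> \<Longrightarrow> \<exists>Y. fconjugate F X Y \<and> good Y"
    and centric: "centric_subgroups F \<subseteq> \<Delta>"
  shows "saturated p F"
proof -
  have SSD: "SS \<in> \<Delta>"
  proof -
    have "R = SS" if "fconjugate F SS R" for R
      using fconjugate_card[OF that] fconjugate_sgr[OF that] subgroup.subset[of R "fgrp F"]
      by (intro card_subset_eq) auto
    then have "SS \<in> centric_subgroups F" using sgr_S by (auto simp: centric_subgroups_def gcentralizer_def)
    then show ?thesis using centric by blast
  qed
  have "\<exists>R. fconjugate F P R \<and> good R" if P: "sgr P" for P
    using that
  proof (induction "card SS - card P" arbitrary: P rule: less_induct)
    case less
    show ?case
    proof (cases "P \<in> \<Delta>")
      case True then show ?thesis using good by blast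
    next
      case False
      have bigger: "\<exists>R'. fconjugate F R R' \<and> good R'" if "sgr R" "card P < card R" for R
      proof -
        have "card R \<le> card SS" using subgroup.subset[OF that(1)] by (simp add: card_mono)
        then show ?thesis using less.hyps[of R] that by simp
      qed
      have nc: "\<exists>X. fconjugate F P X \<and> \<not> CS X \<subseteq> X"
      proof (rule ccontr)
        assume "\<not> ?thesis"
        then have "P \<in> centric_subgroups F" using less.prems by (auto simp: centric_subgroups_def)
        then show False using False centric by blast
      qed
      have ne: "\<Delta> \<noteq> {}" using SSD by blast
      interpret noncentric_class p F \<Delta> P
        by (intro noncentric_class.intro[OF fusion_system_axioms] noncentric_class_axioms.intro)
          (fact less.prems False conj over ne sub gen bigger nc)+
      show ?thesis by (rule exists_good_conjugate)
    qed
  qed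
  then show ?thesis by (simp add: saturated_iff)
qed

section \<open>Large subgroups of saturated fusion systems\<close>

context fusion_system
begin

text \<open>\<open>extend_Kst\<close> with \<open>G\<close> in both roles: the stabilizer is the
  whole automorphism group, the condition on \<open>NS X\<close> is automatic, and the correction
  preserves \<open>G\<close>.\<close>

lemma reach_good: assumes G: "good G" "fconjugate F X G" shows "reach X G"
proof -
  have Gs: "sgr G" using G by (simp add: good_def)
  obtain f where f: "fmor F X f" "f ` X = G" using G by (auto simp: fconjugate_iff)
  have Xs: "sgr X" using f fmor_sgr by blast
  have "Kst G G = fiso F G G" unfolding Kst_def using fiso_iff by blast
  moreover have "Tst G G = Aut_S F G" by (simp add: Tst_def Aut_S_eq)
  ultimately have syl: "sylow_in (Aut_F F G) p (Kst G G) (Tst G G)"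
    using sylow_Aut_S[OF Gs] G by (simp add: good_def)
  have "\<exists>c\<in>Kst G G. \<exists>E g. fmor F E g \<and> X \<subseteq> E \<and> NS X \<subseteq> E \<and> (\<forall>x\<in>X. g x = c (f x))"
    by (rule extend_Kst[OF G(1) Gs subset_refl syl f sgr_NS[OF Xs] subset_refl])
      (use NS_gconj[OF Xs] f in blast)
  then obtain c E g where g: "c \<in> Kst G G" "fmor F E g" "NS X \<subseteq> E" "\<forall>x\<in>X. g x = c (f x)" by blast
  have "g ` X = c ` f ` X" using g(4) by (force simp: image_image)
  then have "g ` X = G" using Kst_fmor[OF g(1)] f by simp
  then show ?thesis using fmor_mono[OF g(2) sgr_NS[OF Xs] g(3)] Xs by (auto simp: reach_def)
qed

lemma NS_sub: "sgr P \<Longrightarrow> NS P \<subseteq> SS"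
  using subgroup.subset[OF sgr_NS] .

text \<open>A normal subgroup of \<open>S\<close> is terminal because its normalizer cannot be
  exceeded. So it is reached back from its good conjugate, which every other conjugate
  reaches.\<close>

lemma reach_normal:
  assumes sat: "saturated p F" and R: "NS R = SS" "fconjugate F R' R" shows "reach R' R"
proof -
  have Rs: "sgr R" "sgr R'" using R fconjugate_sgr by auto
  obtain G where G: "fconjugate F R G" "good G" using sat Rs by (auto simp: saturated_iff)
  have "card (NS Y) \<le> card SS" if "reach R Y" for Y
    using NS_sub reach_sgr[OF that] by (intro card_mono) auto
  then have "terminal R" using Rs R by (simp add: terminal_def)
  moreover have "reach R G" using reach_good[OF G(2,1)] .
  ultimately have "reach G R" using terminal_reach_sym by blast
  moreover have "reach R' G" using reach_good[OF G(2) fconjugate_trans[OF R(2) G(1)]] .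
  ultimately show ?thesis using reach_trans by blast
qed

lemma set_mult_absorb:
  assumes "sgr X" "U \<subseteq> X" "sgr U" shows "X <#>\<^bsub>fgrp F\<^esub> U = X"
  using sub_set_mult(1)[OF assms(1,3)] set_mult_least[OF assms(1) subset_refl assms(2)] by blast

lemma sgr_set_mult:
  assumes "sgr X" "sgr T" "X \<subseteq> NS T" shows "sgr (X <#>\<^bsub>fgrp F\<^esub> T)"
proof -
  have "T <#>\<^bsub>fgrp F\<^esub> X = X <#>\<^bsub>fgrp F\<^esub> T"
  proof (rule subset_antisym; rule subsetI)
    note m = sgr_mem[OF assms(1)] sgr_mem[OF assms(2)]
    fix z assume zTX: "z \<in> T <#>\<^bsub>fgrp F\<^esub> X"
    show "z \<in> X <#>\<^bsub>fgrp F\<^esub> T"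
    proof -
      obtain t x where z: "t \<in> T" "x \<in> X" "z = t \<otimes>\<^bsub>fgrp F\<^esub> x" using zTX unfolding mem_set_mult_iff by blast
      then have "z = x \<otimes>\<^bsub>fgrp F\<^esub> cj t x" using m by (simp add: gconj_def S.m_assoc)
      then show ?thesis unfolding mem_set_mult_iff
        using z NS_gconj[OF assms(2) subsetD[OF assms(3) z(2)] z(1)] by blast
    qed
  next
    note m = sgr_mem[OF assms(1)] sgr_mem[OF assms(2)]
    fix z assume zXT: "z \<in> X <#>\<^bsub>fgrp F\<^esub> T"
    show "z \<in> T <#>\<^bsub>fgrp F\<^esub> X"
    proof -
      obtain t x where z: "t \<in> T" "x \<in> X" "z = x \<otimes>\<^bsub>fgrp F\<^esub> t" using zXT unfolding mem_set_mult_iff by blast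
      then have "z = cj t (inv\<^bsub>fgrp F\<^esub> x) \<otimes>\<^bsub>fgrp F\<^esub> x" using m by (simp add: gconj_def S.m_assoc)
      moreover have "inv\<^bsub>fgrp F\<^esub> x \<in> NS T" using subgroup.m_inv_closed[OF assms(1) z(2)] assms(3) by blast
      ultimately show ?thesis unfolding mem_set_mult_iff
        using z NS_gconj[OF assms(2) _ z(1)] by blast
    qed
  qed
  moreover have "sgr (T <#>\<^bsub>fgrp F\<^esub> X)"
    by (rule S.subgroup_mult_normal[OF sgr_S assms(2,1)]) (use NS_gconj[OF assms(2)] assms(3) in blast)
  ultimately show ?thesis by simp
qed

lemma fmor_set_mult_image:
  assumes "fmor F E f" "A \<subseteq> E" "B \<subseteq> E"
  shows "f ` (A <#>\<^bsub>fgrp F\<^esub> B) = f ` A <#>\<^bsub>fgrp F\<^esub> f ` B"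
proof -
  have "f ` (A <#>\<^bsub>fgrp F\<^esub> B) = {f (a \<otimes>\<^bsub>fgrp F\<^esub> b) |a b. a \<in> A \<and> b \<in> B}" by (auto simp: set_mult_def)
  also have "\<dots> = {f a \<otimes>\<^bsub>fgrp F\<^esub> f b |a b. a \<in> A \<and> b \<in> B}"
  proof -
    have "f (a \<otimes>\<^bsub>fgrp F\<^esub> b) = f a \<otimes>\<^bsub>fgrp F\<^esub> f b" if "a \<in> A" "b \<in> B" for a b
      using fmor_mult[OF assms(1)] that assms by auto
    then show ?thesis by metis
  qed
  also have "\<dots> = f ` A <#>\<^bsub>fgrp F\<^esub> f ` B" by (auto simp: set_mult_def)
  finally show ?thesis .
qed

definition centric :: "'a set \<Rightarrow> bool" where
  "centric P \<longleftrightarrow> sgr P \<and> (\<forall>R. fconjugate F P R \<longrightarrow> CS R \<subseteq> R)"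

lemma centric_iff: "P \<in> centric_subgroups F \<longleftrightarrow> centric P"
  by (simp add: centric_subgroups_def centric_def)

text \<open>\<open>f\<close> multiplies each element of \<open>X\<close> by an element of
  \<open>C_S(T) \<le> T\<close>, so it is an automorphism of \<open>p\<close>-power order. In a good
  conjugate of \<open>X\<close> it can be conjugated into \<open>Aut_S\<close>; the inducing element
  centralizes the image of \<open>T\<close>, lies in it by centricity, and pulls back to
  \<open>z\<close>.\<close>

lemma centric_identity:
  assumes sat: "saturated p F" and T: "centric T" "NS T = SS" "T \<subseteq> X"
    and f: "fmor F X f" "\<And>t. t \<in> T \<Longrightarrow> f t = t"
  shows "\<exists>z\<in>T. \<forall>x\<in>X. f x = cj x z"
proof -
  have Ts: "sgr T" "CS T \<subseteq> T" using T fconjugate_refl by (auto simp: centric_def)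
  have TS: "T \<subseteq> SS" using Ts subgroup.subset by blast
  have Xs: "sgr X" using f fmor_sgr by blast
  have Xm: "x \<in> SS" if "x \<in> X" for x using sgr_mem[OF Xs that] .
  have Tm: "x \<in> SS" if "x \<in> T" for x using sgr_mem[OF Ts(1) that] .
  have zx: "\<exists>z\<in>T. f x = z \<otimes>\<^bsub>fgrp F\<^esub> x" if x: "x \<in> X" for x
  proof -
    let ?z = "f x \<otimes>\<^bsub>fgrp F\<^esub> inv\<^bsub>fgrp F\<^esub> x"
    have fx: "f x \<in> SS" "x \<in> SS" using fmor_closed[OF f(1) x] Xm x by auto
    have "cj t ?z = t" if t: "t \<in> T" for t
    proof -
      have tx: "cj t x \<in> T" using NS_gconj[OF Ts(1) _ t, of x] fx T(2) by simp
      have "cj t (f x) = cj (f t) (f x)" using f(2)[OF t] by simp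
      also have "\<dots> = f (cj t x)" using fmor_gconj[OF f(1) _ x, of t] t T(3) by auto
      also have "\<dots> = cj t x" using f(2)[OF tx] .
      finally have "cj (cj t (f x)) (inv\<^bsub>fgrp F\<^esub> x) = t" using fx Tm[OF t] by simp
      then show ?thesis using fx Tm[OF t] by (simp add: S.gconj_comp)
    qed
    then have "?z \<in> T" using fx Ts(2) by (auto simp: mem_CS_iff[OF TS])
    moreover have "f x = ?z \<otimes>\<^bsub>fgrp F\<^esub> x" using fx by (simp add: S.m_assoc)
    ultimately show ?thesis by blast
  qed
  have fX: "f ` X = X"
  proof (rule card_subset_eq[OF S.finite_subgroup[OF Xs]])
    show "f ` X \<subseteq> X" using zx T(3) subgroup.m_closed[OF Xs] by fastforce
    show "card (f ` X) = card X" using fmor_card[OF f(1)] by simp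
  qed
  obtain G where G: "fconjugate F X G" "good G" using sat Xs by (auto simp: saturated_iff)
  have Gs: "sgr G" using G by (simp add: good_def)
  interpret A: finite_group "Aut_F F G" p using finite_group_Aut[OF Gs] .
  obtain c where c: "fmor F X c" "c ` X = G" using G by (auto simp: fconjugate_iff)
  let ?ci = "inv_into X c"
  have ci: "?ci y \<in> X" "c (?ci y) = y" if "y \<in> G" for y
    using that c by (auto simp: inv_into_into f_inv_into_f)
  have ciF: "fmor F G ?ci" "?ci ` G = X" using fmor_inv[OF c(1)] fmor_inv_image[OF c(1), of X] c(2) by auto
  let ?a = "restrict (\<lambda>y. c (f (?ci y))) G"
  have a: "?a \<in> fiso F G G"
  proof (rule restrict_fiso)
    have 1: "fmor F G (\<lambda>y. f (?ci y))" using fmor_comp[OF ciF(1) f(1)] ciF(2) by simp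
    have 2: "(\<lambda>y. f (?ci y)) ` G = X" using image_image[of f ?ci G] ciF(2) fX by simp
    show "fmor F G (\<lambda>y. c (f (?ci y)))" using fmor_comp[OF 1 c(1)] 2 by simp
    show "(\<lambda>y. c (f (?ci y))) ` G = G" using image_image[of c "\<lambda>y. f (?ci y)" G] 2 c(2) by simp
  qed
  \<comment> \<open>Since \<open>f\<close> fixes \<open>z\<close>, its iterates multiply by powers
    of the same \<open>z\<close>, and the exponent \<open>card T\<close> kills them all at
    once.\<close>
  have pow: "(?a [^]\<^bsub>Aut_F F G\<^esub> n) y = c (z [^]\<^bsub>fgrp F\<^esub> n \<otimes>\<^bsub>fgrp F\<^esub> ?ci y)"
    if z: "z \<in> T" "f (?ci y) = z \<otimes>\<^bsub>fgrp F\<^esub> ?ci y" and y: "y \<in> G" for n :: nat and y z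
  proof (induction n)
    case 0 then show ?case using y ci[OF y] Xm by (simp add: Aut_F_one)
  next
    case (Suc n)
    let ?b = "?a [^]\<^bsub>Aut_F F G\<^esub> n"
    have b: "?b \<in> fiso F G G" using A.nat_pow_closed[of ?a n] a by simp
    have zn: "z [^]\<^bsub>fgrp F\<^esub> n \<in> T" using S.subgroup_int_pow_closed[OF Ts(1) z(1), of "int n"] by (simp add: int_pow_int)
    have zX: "z [^]\<^bsub>fgrp F\<^esub> n \<in> X" "?ci y \<in> X" using zn T(3) ci[OF y] by auto
    have znx: "z [^]\<^bsub>fgrp F\<^esub> n \<otimes>\<^bsub>fgrp F\<^esub> ?ci y \<in> X" using subgroup.m_closed[OF Xs zX] .
    have "?a [^]\<^bsub>Aut_F F G\<^esub> Suc n = ?a \<otimes>\<^bsub>Aut_F F G\<^esub> ?b" using A.nat_pow_Suc2[of ?a n] a by simp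
    then have "?a [^]\<^bsub>Aut_F F G\<^esub> Suc n = compose G ?a ?b" using Aut_F_mult[OF a b] by simp
    then have "(?a [^]\<^bsub>Aut_F F G\<^esub> Suc n) y = ?a (?b y)" using y by (simp add: compose_def)
    also have "\<dots> = ?a (c (z [^]\<^bsub>fgrp F\<^esub> n \<otimes>\<^bsub>fgrp F\<^esub> ?ci y))" by (simp only: Suc)
    also have "\<dots> = c (f (z [^]\<^bsub>fgrp F\<^esub> n \<otimes>\<^bsub>fgrp F\<^esub> ?ci y))"
      using znx c(2) fmor_inv_f[OF c(1) znx] by auto
    also have "f (z [^]\<^bsub>fgrp F\<^esub> n \<otimes>\<^bsub>fgrp F\<^esub> ?ci y) = z [^]\<^bsub>fgrp F\<^esub> n \<otimes>\<^bsub>fgrp F\<^esub> (z \<otimes>\<^bsub>fgrp F\<^esub> ?ci y)"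
      using fmor_mult[OF f(1) zX] f(2)[OF zn] z(2) by simp
    finally show ?case using Tm[OF z(1)] Xm[OF zX(2)] by (simp add: S.m_assoc)
  qed
  obtain k where k: "card T = p ^ k" using psubgroup_S[OF Ts(1)] by (auto simp: psubgroup_def)
  have "?a [^]\<^bsub>Aut_F F G\<^esub> (p ^ k :: nat) = \<one>\<^bsub>Aut_F F G\<^esub>"
  proof (rule extensionalityI[of _ G])
    show "?a [^]\<^bsub>Aut_F F G\<^esub> (p ^ k :: nat) \<in> extensional G"
      using A.nat_pow_closed[of ?a "p ^ k"] a by (simp add: fiso_iff)
    show "\<one>\<^bsub>Aut_F F G\<^esub> \<in> extensional G" by (simp add: Aut_F_one)
    fix y assume y: "y \<in> G"
    obtain z where z: "z \<in> T" "f (?ci y) = z \<otimes>\<^bsub>fgrp F\<^esub> ?ci y" using zx[OF ci(1)[OF y]] by blast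
    then show "(?a [^]\<^bsub>Aut_F F G\<^esub> (p ^ k :: nat)) y = \<one>\<^bsub>Aut_F F G\<^esub> y"
      using pow[OF z y, of "p ^ k"] S.pow_card_subgroup[OF Ts(1) z(1)] k ci[OF y] Xm y by (simp add: Aut_F_one)
  qed
  then have gen: "psubgroup (Aut_F F G) p (generate (Aut_F F G) {?a})"
    using A.psubgroup_generate[of ?a k] a by simp
  have "generate (Aut_F F G) {?a} \<subseteq> fiso F G G"
    using A.generate_incl[of "{?a}"] a by simp
  then obtain b where b: "b \<in> fiso F G G" "\<forall>d\<in>generate (Aut_F F G) {?a}. gconj (Aut_F F G) d b \<in> Aut_S F G"
    using sylow_inD(4)[OF sylow_Aut_S[OF Gs] gen] G(2) by (auto simp: good_def)
  then obtain s where s: "s \<in> NS G" "gconj (Aut_F F G) ?a b = cR G s"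
    using generate.incl[of ?a "{?a}" "Aut_F F G"] by (auto simp: Aut_S_eq)
  have bF: "fmor F G b" "b ` G = G" using b by (auto simp: fiso_iff)
  let ?d = "\<lambda>x. inv_into G b (c x)"
  have d: "fmor F X ?d" using fmor_comp[OF c(1) fmor_inv[OF bF(1)]] c(2) bF(2) by simp
  have dG: "?d x \<in> G" "b (?d x) = c x" if "x \<in> X" for x
  proof -
    have "c x \<in> b ` G" using that c(2) bF(2) by blast
    then show "?d x \<in> G" "b (?d x) = c x" by (auto simp: inv_into_into f_inv_into_f)
  qed
  have key: "?d (f x) = cj (?d x) s" if x: "x \<in> X" for x
  proof -
    have "cR G s (?d x) = inv_into G b (?a (b (?d x)))"
      using Aut_F_gconj[OF Gs a b(1) dG(1)[OF x]] s(2) by simp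
    also have "\<dots> = inv_into G b (c (f x))"
      using dG(2)[OF x] x c fmor_inv_f[OF c(1) x] by auto
    finally show ?thesis using dG(1)[OF x] by (simp add: cR_def)
  qed
  have dT: "sgr (?d ` T)" using fmor_image[OF d Ts(1) T(3)] .
  have sS: "s \<in> SS" using NS_mem[OF Gs s(1)] .
  have "cj (?d t) s = ?d t" if "t \<in> T" for t using key[of t] f(2)[OF that] that T(3) by auto
  then have "s \<in> CS (?d ` T)" using sS subgroup.subset[OF dT] by (simp add: mem_CS_iff)
  moreover have "CS (?d ` T) \<subseteq> ?d ` T"
  proof -
    have "fconjugate F T (?d ` T)" using fmor_mono[OF d Ts(1) T(3)] by (rule fconjugateI)
    then show ?thesis using T(1) by (auto simp: centric_def)
  qed
  ultimately obtain z where z: "z \<in> T" "s = ?d z" by blast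
  have zX: "z \<in> X" using z T(3) by blast
  have "f x = cj x z" if x: "x \<in> X" for x
  proof -
    have "?d (f x) = ?d (cj x z)" using key[OF x] z fmor_gconj[OF d x zX] by simp
    moreover have "f x \<in> X" "cj x z \<in> X" using x fX S.subgroup_gconj_closed[OF Xs x zX] by auto
    ultimately show ?thesis using inj_onD[OF fmor_inj[OF d]] by blast
  qed
  then show ?thesis using z by blast
qed

definition ZS :: "'a set" where "ZS = CS SS"

lemma ZS_sgr: "sgr ZS" unfolding ZS_def by (rule sgr_CS) simp

lemma mem_ZS_iff: "z \<in> ZS \<longleftrightarrow> z \<in> SS \<and> (\<forall>x\<in>SS. cj x z = x)"
  by (simp add: ZS_def mem_CS_iff)

lemma ZS_gconj: "z \<in> ZS \<Longrightarrow> x \<in> SS \<Longrightarrow> cj z x = z"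
  using S.gconj_eq_self_iff by (metis mem_ZS_iff)

lemma ZS_sub_CS: "sgr P \<Longrightarrow> ZS \<subseteq> CS P"
  using sgr_mem by (auto simp: mem_ZS_iff mem_CS_iff subgroup.subset)

lemma NS_ZS: "NS ZS = SS"
  using NS_sub[OF ZS_sgr] ZS_gconj by (auto simp: mem_NS_iff[OF ZS_sgr])

lemma ZS_nontrivial: assumes "SS \<noteq> {\<one>\<^bsub>fgrp F\<^esub>}" shows "ZS \<noteq> {\<one>\<^bsub>fgrp F\<^esub>}"
proof -
  obtain z where z: "z \<in> SS" "z \<noteq> \<one>\<^bsub>fgrp F\<^esub>" "\<forall>b\<in>SS. b \<otimes>\<^bsub>fgrp F\<^esub> z = z \<otimes>\<^bsub>fgrp F\<^esub> b"
    using S.psubgroup_center_nontrivial[OF psubgroup_S[OF sgr_S] assms] by blast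
  then have "z \<in> ZS" by (auto simp: ZS_def gcentralizer_def)
  then show ?thesis using z by blast
qed

end

section \<open>Weak closure of a large subgroup in a saturated fusion system\<close>

locale large_fusion = fusion_system p F for p :: nat and F :: "'a fusion" +
  fixes Q :: "'a set"
  assumes sat: "saturated p F" and large: "large_in_fusion F Q"
begin

definition ZQ :: "'a set" where "ZQ = center_of (fgrp F) Q"

lemma Q_sgr: "sgr Q" using large by (simp add: large_in_fusion_def)
lemma Q_centralizer: "CS Q \<subseteq> Q" using large by (simp add: large_in_fusion_def)

lemma ZQ_eq: "ZQ = CS Q" using Q_centralizer by (auto simp: ZQ_def center_of_def)

lemma ZQ_sgr: "sgr ZQ" unfolding ZQ_eq by (rule sgr_CS[OF subgroup.subset[OF Q_sgr]])

lemma ZQ_sub: "ZQ \<subseteq> Q" using Q_centralizer by (simp add: ZQ_eq)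

text \<open>Largeness in the form used below: if the domain contains \<open>U\<close>, multiplying
  it by \<open>U\<close> changes nothing, so a morphism preserving \<open>U\<close> already belongs
  to \<open>normalizer_fusion F U\<close>.\<close>

lemma normalizer_extension:
  assumes U: "sgr U" "U \<subseteq> ZQ" "U \<noteq> {\<one>\<^bsub>fgrp F\<^esub>}" "U \<subseteq> X" "X \<subseteq> NS U" and f: "fmor F X f" "f ` U = U"
  shows "X \<subseteq> NS Q" "\<exists>g. fmor F (X <#>\<^bsub>fgrp F\<^esub> Q) g \<and> g ` Q = Q \<and> (\<forall>x\<in>X. g x = f x)"
proof -
  have X: "sgr X" using f fmor_sgr by blast
  have fX: "sgr (f ` X)" using fmor_image_all f by blast
  have "U \<subseteq> f ` X" using f U by blast
  have absX: "X <#>\<^bsub>fgrp F\<^esub> U = X" "f ` X <#>\<^bsub>fgrp F\<^esub> U = f ` X"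
    using set_mult_absorb[OF X U(4,1)] set_mult_absorb[OF fX \<open>U \<subseteq> f ` X\<close> U(1)] by auto
  have h: "restrict f X \<in> fhom F X (f ` X)" using fmor_fhom_image f by blast
  have fXN: "f ` X \<subseteq> NS U" using fmor_image_NS[OF f(1) U(1,4)] U(5) f(2) by auto
  have "restrict f X \<in> fhom (normalizer_fusion F U) X (f ` X)"
  proof -
    have "restrict f X ` U = f ` U" using U(4) by (intro image_cong) auto
    then have "restrict f X ` U = U" using f(2) by simp
    then have "\<exists>\<psi>\<in>fhom F (X <#>\<^bsub>fgrp F\<^esub> U) (f ` X <#>\<^bsub>fgrp F\<^esub> U). restrict \<psi> X = restrict f X \<and> \<psi> ` U = U"
      unfolding absX using h by (intro bexI[of _ "restrict f X"]) auto
    then show ?thesis unfolding normalizer_fusion_def using h U(5) fXN by simp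
  qed
  moreover have "subfusion (normalizer_fusion F U) (normalizer_fusion F Q)"
    using large U unfolding large_in_fusion_def ZQ_def by blast
  ultimately have "restrict f X \<in> fhom (normalizer_fusion F Q) X (f ` X)" unfolding subfusion_def by blast
  then have r: "X \<subseteq> NS Q" "\<exists>\<psi>\<in>fhom F (X <#>\<^bsub>fgrp F\<^esub> Q) (f ` X <#>\<^bsub>fgrp F\<^esub> Q). restrict \<psi> X = restrict f X \<and> \<psi> ` Q = Q"
    unfolding normalizer_fusion_def by auto
  show "X \<subseteq> NS Q" by (rule r(1))
  obtain \<psi> where p: "\<psi> \<in> fhom F (X <#>\<^bsub>fgrp F\<^esub> Q) (f ` X <#>\<^bsub>fgrp F\<^esub> Q)" "restrict \<psi> X = restrict f X" "\<psi> ` Q = Q"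
    using r(2) by blast
  have "fmor F (X <#>\<^bsub>fgrp F\<^esub> Q) \<psi>" using p(1) by (simp add: fhom_iff)
  moreover have "\<psi> x = f x" if "x \<in> X" for x using fun_cong[OF p(2), of x] that by simp
  ultimately show "\<exists>g. fmor F (X <#>\<^bsub>fgrp F\<^esub> Q) g \<and> g ` Q = Q \<and> (\<forall>x\<in>X. g x = f x)" using p(3) by blast
qed

lemma ZS_sub_ZQ: "ZS \<subseteq> ZQ" using ZS_sub_CS[OF Q_sgr] by (simp add: ZQ_eq)

text \<open>Largeness for \<open>U = Z(S)\<close> and the identity map of \<open>S\<close>. The
  trivial \<open>S\<close> is treated apart, since \<open>Z(S)\<close> is then no admissible
  \<open>U\<close>.\<close>

lemma NS_Q: "NS Q = SS"
proof (cases "SS = {\<one>\<^bsub>fgrp F\<^esub>}")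
  case True
  then show ?thesis using NS_sub[OF Q_sgr] subgroup.one_closed[OF sgr_NS[OF Q_sgr]] by auto
next
  case False
  have "SS \<subseteq> NS Q"
    using normalizer_extension(1)[OF ZS_sgr ZS_sub_ZQ ZS_nontrivial[OF False] _ _ fmor_id[OF sgr_S]]
      NS_ZS subgroup.subset[OF ZS_sgr] by auto
  then show ?thesis using NS_sub[OF Q_sgr] by blast
qed

lemma Q_centric: "centric Q"
proof -
  have "CS R \<subseteq> R" if R: "fconjugate F Q R" for R
  proof -
    have Rs: "sgr R" using R fconjugate_sgr by blast
    have "reach R Q" using reach_normal[OF sat NS_Q fconjugate_sym[OF R]] .
    then obtain h where h: "fmor F (NS R) h" "h ` R = Q" by (auto simp: reach_def)
    show ?thesis
    proof
      fix c assume c: "c \<in> CS R"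
      have cN: "c \<in> NS R" using c CS_sub_NS[OF Rs] by blast
      then have "h c \<in> CS (h ` R)" using fmor_image_CS[OF h(1) sub_NS[OF Rs]] c by blast
      then have "h c \<in> h ` R" using Q_centralizer h(2) by auto
      then obtain r where r: "h c = h r" "r \<in> R" by (rule imageE)
      have "r \<in> NS R" using r(2) sub_NS[OF Rs] by blast
      then show "c \<in> R" using inj_onD[OF fmor_inj[OF h(1)] r(1) cN] r(2) by simp
    qed
  qed
  then show ?thesis using Q_sgr by (simp add: centric_def)
qed

text \<open>Largeness with \<open>U = Z(S)\<close> extends \<open>f\<close> to the product of
  \<open>R\<close> and \<open>Q\<close> with \<open>Q\<close> preserved; there \<open>R\<close> and
  \<open>Q\<close> have the same image under an injective map.\<close>

lemma conj_fixing_center: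
  assumes nt: "SS \<noteq> {\<one>\<^bsub>fgrp F\<^esub>}" and f: "fmor F R f" "f ` R = Q" "f ` ZS = ZS" "ZS \<subseteq> R"
  shows "R = Q"
proof -
  have Rs: "sgr R" using f fmor_sgr by blast
  have "R \<subseteq> NS ZS" using subgroup.subset[OF Rs] by (simp add: NS_ZS)
  then obtain g where g: "fmor F (R <#>\<^bsub>fgrp F\<^esub> Q) g" "g ` Q = Q" "\<forall>x\<in>R. g x = f x"
    using normalizer_extension(2)[OF ZS_sgr ZS_sub_ZQ ZS_nontrivial[OF nt] f(4) _ f(1,3)] by blast
  have "g ` R = f ` R" using g(3) by (intro image_cong) auto
  then have "g ` R = g ` Q" using f(2) g(2) by simp
  then show ?thesis
    using inj_on_image_eq_iff[OF fmor_inj[OF g(1)] sub_set_mult(1)[OF Rs Q_sgr] sub_set_mult(2)[OF Rs Q_sgr]] by blast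
qed

text \<open>Induction over growing \<open>CS V\<close>. If the image \<open>?T\<close> of
  \<open>CS V\<close> is proper in \<open>S\<close>, conjugation by an element of
  \<open>NS ?T\<close> pulls back to an automorphism of \<open>CS V\<close> fixing \<open>V\<close>
  pointwise, so by largeness \<open>NS ?T\<close> normalizes the image \<open>?R\<close> of
  \<open>Q\<close>. A map on \<open>NS ?R\<close> taking \<open>?R\<close> back to \<open>Q\<close>
  sends \<open>Z(S)\<close> to a subgroup of \<open>Z(Q)\<close> with larger centralizer. The
  induction hypothesis there gives an isomorphism from \<open>?R\<close> to \<open>Q\<close>
  preserving \<open>Z(S)\<close>.\<close>

lemma Q_fixed_by_centralizer_map:
  assumes nt: "SS \<noteq> {\<one>\<^bsub>fgrp F\<^esub>}" and V: "sgr V" "V \<subseteq> ZQ" and f: "fmor F (CS V) f" "f ` V = ZS"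
  shows "f ` Q = Q"
  using V f
proof (induction "card SS - card (CS V)" arbitrary: V f rule: less_induct)
  case less
  note V = less.prems(1,2) and f = less.prems(3,4)
  have VS: "V \<subseteq> SS" using V subgroup.subset by blast
  have QC: "Q \<subseteq> CS V"
  proof
    fix q assume q: "q \<in> Q"
    have "q \<otimes>\<^bsub>fgrp F\<^esub> v = v \<otimes>\<^bsub>fgrp F\<^esub> q" if "v \<in> V" for v
      using that V(2) q by (auto simp: ZQ_eq gcentralizer_def)
    then show "q \<in> CS V" using q sgr_mem[OF Q_sgr] by (auto simp: gcentralizer_def)
  qed
  have VQ: "V \<subseteq> Q" "V \<subseteq> CS V" using V ZQ_sub QC by auto
  have Vnt: "V \<noteq> {\<one>\<^bsub>fgrp F\<^esub>}"
    using f(2) ZS_nontrivial[OF nt] fmor_one[OF f(1)] by auto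
  let ?T = "f ` CS V" and ?R = "f ` Q"
  have CV: "sgr (CS V)" using sgr_CS[OF VS] .
  have T: "sgr ?T" and R: "sgr ?R" using fmor_image_all[OF f(1)] fmor_image[OF f(1) Q_sgr QC] by auto
  have ZR: "ZS \<subseteq> ?R" using f(2) VQ(1) by blast
  show ?case
  proof (cases "?T = SS")
    case True
    then have "card (CS V) = card SS" using fmor_card[OF f(1), of "CS V"] by simp
    then have CVS: "CS V = SS" using card_subset_eq[OF S.fin subgroup.subset[OF CV]] by simp
    have "V \<subseteq> ZS"
    proof
      fix v assume v: "v \<in> V"
      have "v \<otimes>\<^bsub>fgrp F\<^esub> x = x \<otimes>\<^bsub>fgrp F\<^esub> v" if "x \<in> SS" for x
      proof -
        have "x \<in> CS V" using CVS that by simp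
        then show ?thesis using v by (simp add: gcentralizer_def)
      qed
      then show "v \<in> ZS" using v VS by (auto simp: ZS_def gcentralizer_def)
    qed
    moreover have "card V = card ZS" using fmor_card[OF f(1) VQ(2)] f(2) by simp
    ultimately have VZ: "V = ZS" using card_subset_eq[OF S.finite_subgroup[OF ZS_sgr]] by blast
    have fS: "fmor F SS f" using f(1) CVS by simp
    have "SS \<subseteq> NS ZS" "ZS \<subseteq> SS" using NS_ZS subgroup.subset[OF ZS_sgr] by auto
    then obtain g where g: "fmor F (SS <#>\<^bsub>fgrp F\<^esub> Q) g" "g ` Q = Q" "\<forall>x\<in>SS. g x = f x"
      using normalizer_extension(2)[OF ZS_sgr ZS_sub_ZQ ZS_nontrivial[OF nt] _ _ fS] f(2) VZ by blast
    have "g ` Q = f ` Q" using g(3) sgr_mem[OF Q_sgr] by (intro image_cong) auto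
    then show ?thesis using g(2) by simp
  next
    case False
    then have "?T \<subset> SS" using subgroup.subset[OF T] by blast
    from normalizer_grows_in[OF T sgr_S this] have TN: "?T \<subset> NS ?T" by blast
    have NR: "NS ?T \<subseteq> NS ?R"
    proof
      fix x assume x: "x \<in> NS ?T"
      have xS: "x \<in> SS" using NS_mem[OF T x] .
      let ?fi = "inv_into (CS V) f"
      let ?g = "\<lambda>y. ?fi (cj (f y) x)"
      have 1: "fmor F (CS V) (\<lambda>y. cj (f y) x)" using fmor_comp[OF f(1) fmor_conj[OF T xS] subset_refl] .
      have 2: "(\<lambda>y. cj (f y) x) ` CS V = ?T" using NS_image[OF T x] by (simp add: image_image)
      have g: "fmor F (CS V) ?g" using fmor_comp[OF 1 fmor_inv[OF f(1)]] 2 by simp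
      have gV: "?g v = v" if v: "v \<in> V" for v
      proof -
        have "f v \<in> ZS" using f(2) v by blast
        then show ?thesis using ZS_gconj[OF _ xS] fmor_inv_f[OF f(1)] VQ v by auto
      qed
      then have "?g ` V = V" by simp
      then obtain h where h: "fmor F (CS V <#>\<^bsub>fgrp F\<^esub> Q) h" "h ` Q = Q" "\<forall>y\<in>CS V. h y = ?g y"
        using normalizer_extension(2)[OF V Vnt VQ(2) CS_sub_NS[OF V(1)] g] by blast
      have gQ: "?g q \<in> Q" if q: "q \<in> Q" for q
      proof -
        have "h q = ?g q" using h(3) q QC by blast
        then show ?thesis using h(2) q by (metis imageI)
      qed
      have "cj y x \<in> ?R" if y: "y \<in> ?R" for y
      proof -
        obtain q where q: "q \<in> Q" "y = f q" using y by blast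
        have "cj (f q) x \<in> ?T" using NS_gconj[OF T x] q QC by blast
        then have "f (?g q) = cj (f q) x" by (simp add: f_inv_into_f)
        then show ?thesis using gQ[OF q(1)] q(2) by (metis imageI)
      qed
      then show "x \<in> NS ?R" using xS by (simp add: mem_NS_iff[OF R])
    qed
    have "fconjugate F Q ?R" using fconjugateI[OF fmor_mono[OF f(1) Q_sgr QC]] .
    then have "reach ?R Q" using reach_normal[OF sat NS_Q fconjugate_sym] by blast
    then obtain h where h: "fmor F (NS ?R) h" "h ` ?R = Q" by (auto simp: reach_def)
    have RN: "?R \<subseteq> NS ?R" using sub_NS[OF R] .
    have ZN: "ZS \<subseteq> NS ?R" using ZR RN by blast
    let ?V = "h ` ZS"
    have V': "sgr ?V" "?V \<subseteq> ZQ"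
    proof -
      show "sgr ?V" using fmor_image[OF h(1) ZS_sgr ZN] .
      have "ZS \<subseteq> CS ?R" using ZS_sub_CS[OF R] .
      then have "?V \<subseteq> CS (h ` ?R)" using fmor_image_CS[OF h(1) RN] ZN by blast
      then show "?V \<subseteq> ZQ" using h(2) by (simp add: ZQ_eq)
    qed
    have V'S: "?V \<subseteq> SS" using subgroup.subset[OF V'(1)] .
    have "h ` NS ?T \<subseteq> CS ?V"
    proof -
      have "NS ?T \<subseteq> CS ZS"
        using NS_mem[OF T] ZS_gconj subgroup.subset[OF ZS_sgr] by (auto simp: mem_CS_iff)
      then show ?thesis using fmor_image_CS[OF h(1) ZN] NR by blast
    qed
    then have "card (h ` NS ?T) \<le> card (CS ?V)" using S.finite_subgroup[OF sgr_CS[OF V'S]] by (rule card_mono[rotated])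
    moreover have "card (h ` NS ?T) = card (NS ?T)" using fmor_card[OF h(1) NR] .
    moreover have "card ?T < card (NS ?T)" using psubset_card_mono[OF S.finite_subgroup[OF sgr_NS[OF T]] TN] .
    moreover have "card ?T = card (CS V)" using fmor_card[OF f(1)] by simp
    ultimately have big: "card (CS V) < card (CS ?V)" by simp
    have le: "card (CS ?V) \<le> card SS" using subgroup.subset[OF sgr_CS[OF V'S]] by (simp add: card_mono)
    have "fconjugate F ZS ?V" using fconjugateI[OF fmor_mono[OF h(1) ZS_sgr ZN]] .
    then have "reach ?V ZS" using reach_normal[OF sat NS_ZS fconjugate_sym] by blast
    then obtain k where k: "fmor F (NS ?V) k" "k ` ?V = ZS" by (auto simp: reach_def)
    have kC: "fmor F (CS ?V) k" using fmor_mono[OF k(1) sgr_CS[OF V'S] CS_sub_NS[OF V'(1)]] .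
    have kQ: "k ` Q = Q" using less.hyps[OF _ V' kC k(2)] big le by simp
    have QN: "Q \<subseteq> CS ?V"
    proof
      fix q assume q: "q \<in> Q"
      have "q \<otimes>\<^bsub>fgrp F\<^esub> v = v \<otimes>\<^bsub>fgrp F\<^esub> q" if "v \<in> ?V" for v
        using subsetD[OF V'(2) that] q by (auto simp: ZQ_eq gcentralizer_def)
      then show "q \<in> CS ?V" using q sgr_mem[OF Q_sgr] by (auto simp: gcentralizer_def)
    qed
    have "fmor F ?R (\<lambda>x. k (h x))"
      using fmor_comp[OF fmor_mono[OF h(1) R RN] kC] h(2) QN by simp
    moreover have "(\<lambda>x. k (h x)) ` ?R = Q" "(\<lambda>x. k (h x)) ` ZS = ZS"
      using image_image[of k h ?R] image_image[of k h ZS] h(2) kQ k(2) by simp_all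
    ultimately show ?thesis using conj_fixing_center[OF nt _ _ _ ZR] by blast
  qed
qed

text \<open>The conjugate \<open>?R\<close> is taken back to \<open>Q\<close> by \<open>h\<close>,
  which may displace \<open>Z(S)\<close>; a second map \<open>k\<close> returns it and preserves
  \<open>Q\<close> by \<open>Q_fixed_by_centralizer_map\<close>. Now
  \<open>conj_fixing_center\<close> applies to the composite.\<close>

lemma Q_weakly_closed:
  assumes "fmor F X f" "Q \<subseteq> X" shows "f ` Q = Q"
proof (cases "SS = {\<one>\<^bsub>fgrp F\<^esub>}")
  case True
  have f: "fmor F Q f" using fmor_mono[OF assms(1) Q_sgr assms(2)] .
  have "H = {\<one>\<^bsub>fgrp F\<^esub>}" if "sgr H" for H
    using subgroup.subset[OF that] subgroup.one_closed[OF that] True by auto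
  then show ?thesis using Q_sgr fmor_image_all[OF f] by metis
next
  case nt: False
  have f: "fmor F Q f" using fmor_mono[OF assms(1) Q_sgr assms(2)] .
  let ?R = "f ` Q"
  have R: "sgr ?R" using fmor_image_all[OF f] .
  have c: "fconjugate F Q ?R" using fconjugateI[OF f] .
  then have "reach ?R Q" using reach_normal[OF sat NS_Q fconjugate_sym] by blast
  then obtain h where h: "fmor F (NS ?R) h" "h ` ?R = Q" by (auto simp: reach_def)
  have ZC: "ZS \<subseteq> CS ?R" using ZS_sub_CS[OF R] .
  moreover have "CS ?R \<subseteq> ?R" using c Q_centric by (simp add: centric_def)
  ultimately have ZR: "ZS \<subseteq> ?R" by (rule subset_trans)
  have RN: "?R \<subseteq> NS ?R" using sub_NS[OF R] .
  have ZN: "ZS \<subseteq> NS ?R" using ZR RN by (rule subset_trans)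
  let ?V = "h ` ZS"
  have V: "sgr ?V" "?V \<subseteq> ZQ"
  proof -
    show "sgr ?V" using fmor_image[OF h(1) ZS_sgr ZN] .
    have "?V \<subseteq> CS (h ` ?R)" using fmor_image_CS[OF h(1) RN] ZC ZN by blast
    then show "?V \<subseteq> ZQ" using h(2) by (simp add: ZQ_eq)
  qed
  have VS: "?V \<subseteq> SS" using subgroup.subset[OF V(1)] .
  have "fconjugate F ZS ?V" using fconjugateI[OF fmor_mono[OF h(1) ZS_sgr ZN]] .
  then have "reach ?V ZS" using reach_normal[OF sat NS_ZS fconjugate_sym] by blast
  then obtain k where k: "fmor F (NS ?V) k" "k ` ?V = ZS" by (auto simp: reach_def)
  have kC: "fmor F (CS ?V) k" using fmor_mono[OF k(1) sgr_CS[OF VS] CS_sub_NS[OF V(1)]] .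
  have kQ: "k ` Q = Q" using Q_fixed_by_centralizer_map[OF nt V kC k(2)] .
  have QN: "Q \<subseteq> NS ?V"
  proof
    fix q assume q: "q \<in> Q"
    have "q \<otimes>\<^bsub>fgrp F\<^esub> v = v \<otimes>\<^bsub>fgrp F\<^esub> q" if "v \<in> ?V" for v
      using subsetD[OF V(2) that] q by (auto simp: ZQ_eq gcentralizer_def)
    then have "q \<in> CS ?V" using q sgr_mem[OF Q_sgr] by (auto simp: gcentralizer_def)
    then show "q \<in> NS ?V" using CS_sub_NS[OF V(1)] by blast
  qed
  have "fmor F ?R (\<lambda>x. k (h x))"
    using fmor_comp[OF fmor_mono[OF h(1) R RN] k(1)] h(2) QN by simp
  moreover have "(\<lambda>x. k (h x)) ` ?R = Q" "(\<lambda>x. k (h x)) ` ZS = ZS"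
    using image_image[of k h ?R] image_image[of k h ZS] h(2) kQ k(2) by simp_all
  ultimately show ?thesis using conj_fixing_center[OF nt _ _ _ ZR] by blast
qed

text \<open>The largest such \<open>T\<close> is \<open>O\<^sub>p\<close> of \<open>N\<^sub>F(Q)\<close>; maximality makes it radical.\<close>

definition ext_normal :: "'a set \<Rightarrow> bool" where
  "ext_normal T \<longleftrightarrow> sgr T \<and> Q \<subseteq> T \<and>
     (\<forall>X f. Q \<subseteq> X \<longrightarrow> fmor F X f \<longrightarrow>
        (\<exists>g. fmor F (X <#>\<^bsub>fgrp F\<^esub> T) g \<and> g ` T = T \<and> (\<forall>x\<in>X. g x = f x)))"

lemma ext_normalD:
  assumes "ext_normal T" "Q \<subseteq> X" "fmor F X f"
  shows "\<exists>g. fmor F (X <#>\<^bsub>fgrp F\<^esub> T) g \<and> g ` T = T \<and> (\<forall>x\<in>X. g x = f x)"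
  using assms by (simp add: ext_normal_def)

lemma ext_normal_Q: "ext_normal Q"
proof -
  have "\<exists>g. fmor F (X <#>\<^bsub>fgrp F\<^esub> Q) g \<and> g ` Q = Q \<and> (\<forall>x\<in>X. g x = f x)"
    if "Q \<subseteq> X" "fmor F X f" for X f
    using Q_weakly_closed[OF that(2,1)] set_mult_absorb[OF fmor_sgr[OF that(2)] that(1) Q_sgr] that(2) by auto
  then show ?thesis using Q_sgr by (simp add: ext_normal_def)
qed

text \<open>Conjugation by an element of \<open>S\<close>, as a morphism on all of \<open>S\<close>,
  extends to itself and so must preserve \<open>T\<close>.\<close>

lemma ext_normal_NS: assumes T: "ext_normal T" shows "NS T = SS"
proof -
  have Ts: "sgr T" "Q \<subseteq> T" using T by (auto simp: ext_normal_def)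
  have "s \<in> NS T" if s: "s \<in> SS" for s
  proof -
    obtain g where g: "fmor F (SS <#>\<^bsub>fgrp F\<^esub> T) g" "g ` T = T" "\<forall>x\<in>SS. g x = cj x s"
      using ext_normalD[OF T subgroup.subset[OF Q_sgr] fmor_conj[OF sgr_S s]] by blast
    have "cj x s \<in> T" if x: "x \<in> T" for x
    proof -
      have "g x \<in> T" using imageI[OF x, of g] g(2) by simp
      moreover have "g x = cj x s" using g(3) sgr_mem[OF Ts(1) x] by blast
      ultimately show ?thesis by simp
    qed
    then show ?thesis using s by (simp add: mem_NS_iff[OF Ts(1)])
  qed
  then show ?thesis using NS_sub[OF Ts(1)] by blast
qed

lemma ext_normal_weakly_closed:
  assumes T: "ext_normal T" and f: "fmor F X f" "T \<subseteq> X" shows "f ` T = T"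
proof -
  have Ts: "sgr T" "Q \<subseteq> T" using T by (auto simp: ext_normal_def)
  have fT: "fmor F T f" using fmor_mono[OF f(1) Ts(1) f(2)] .
  obtain g where g: "g ` T = T" "\<forall>x\<in>T. g x = f x"
    using ext_normalD[OF T Ts(2) fT] by blast
  have "f ` T = g ` T" using g(2) by (intro image_cong) auto
  then show ?thesis using g(1) by simp
qed

text \<open>By weak closure every conjugate of \<open>T\<close> contains \<open>Q\<close>, so its
  centralizer lies in \<open>CS Q\<close> and hence in \<open>Q\<close>.\<close>

lemma over_Q_centric: assumes T: "sgr T" "Q \<subseteq> T" shows "centric T"
proof -
  have "CS R \<subseteq> R" if TR: "fconjugate F T R" for R
  proof -
    obtain f where f: "fmor F T f" "f ` T = R" using TR by (auto simp: fconjugate_iff)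
    have "Q \<subseteq> R" using Q_weakly_closed[OF f(1) T(2)] f(2) T(2) by blast
    moreover from this have "CS R \<subseteq> CS Q" by (auto simp: gcentralizer_def)
    ultimately show ?thesis using Q_centralizer by blast
  qed
  then show ?thesis using T by (simp add: centric_def)
qed

text \<open>By weak closure the good conjugate provided by saturation is \<open>T\<close>
  itself.\<close>

lemma ext_normal_good: assumes T: "ext_normal T" shows "good T"
proof -
  have "sgr T" using T by (simp add: ext_normal_def)
  then obtain G where G: "fconjugate F T G" "good G" using sat by (auto simp: saturated_iff)
  then obtain f where f: "fmor F T f" "f ` T = G" by (auto simp: fconjugate_iff)
  then show ?thesis using ext_normal_weakly_closed[OF T f(1)] G(2) by simp
qed

lemma Inn_eq: "Inn F T = cR T ` T"
  by (auto simp: Inn_def cR_def)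

text \<open>The larger subgroup \<open>?U\<close> consists of the elements of \<open>S\<close> that
  induce on \<open>T\<close> an automorphism in the \<open>p\<close>-core. As the core is normal in
  \<open>Aut_F F T\<close>, \<open>?U\<close> lies in the extension group of each automorphism of
  \<open>T\<close> considered here and is preserved by the resulting extension.\<close>

lemma ext_normal_enlarge:
  assumes T: "ext_normal T" and rad: "p_core p (Aut_F F T) \<noteq> Inn F T"
  shows "\<exists>T1. ext_normal T1 \<and> card T < card T1"
proof -
  have Ts: "sgr T" "Q \<subseteq> T" using T by (auto simp: ext_normal_def)
  have NT: "NS T = SS" using ext_normal_NS[OF T] .
  interpret A: finite_group "Aut_F F T" p using finite_group_Aut[OF Ts(1)] .
  let ?O = "p_core p (Aut_F F T)"
  have Os: "subgroup ?O (Aut_F F T)" using A.psubgroup_subgroup[OF A.psubgroup_p_core] .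
  have Of: "?O \<subseteq> fiso F T T" using subgroup.subset[OF Os] by simp
  have gT: "good T" using ext_normal_good[OF T] .
  have OS: "?O \<subseteq> cR T ` SS"
    using A.p_core_subset_sylow[of "Aut_S F T"] sylow_Aut_S[OF Ts(1)] gT NT by (simp add: good_def Aut_S_eq)
  have cRf: "cR T s \<in> fiso F T T" if "s \<in> SS" for s using cR_fiso[OF Ts(1)] NT that by blast
  have Inn: "cR T ` T \<subseteq> ?O"
  proof (rule A.normal_psubgroup_subset_p_core)
    show "psubgroup (Aut_F F T) p (cR T ` T)" using psubgroup_conj_maps[OF Ts(1) Ts(1) sub_NS[OF Ts(1)]] .
    fix a b assume a: "a \<in> carrier (Aut_F F T)" and b: "b \<in> cR T ` T"
    then obtain t where t: "t \<in> T" "b = cR T t" by blast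
    have af: "a \<in> fiso F T T" "fmor F T a" "a ` T = T" using a by (auto simp: fiso_iff)
    have tS: "t \<in> SS" using sgr_mem[OF Ts(1) t(1)] .
    have ai: "fmor F T (inv_into T a)" "inv_into T a t \<in> T" using fmor_inv[OF af(2)] af(3) t inv_into_into[of t a T] by auto
    have "gconj (Aut_F F T) b a = cR T (inv_into T a t)"
    proof (rule extensionalityI[of _ T])
      show "gconj (Aut_F F T) b a \<in> extensional T"
        using A.gconj_closed[of b a] a cRf[OF tS] t by (simp add: fiso_iff)
      show "cR T (inv_into T a t) \<in> extensional T" by (simp add: cR_def)
      fix x assume x: "x \<in> T"
      have ax: "a x \<in> T" using x af(3) by blast
      have "gconj (Aut_F F T) b a x = inv_into T a (cj (a x) t)"
        using Aut_F_gconj[OF Ts(1) _ af(1) x, of b] cRf[OF tS] t ax by (simp add: cR_def)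
      also have "\<dots> = cj (inv_into T a (a x)) (inv_into T a t)"
        using fmor_gconj[OF ai(1) ax t(1)] .
      finally show "gconj (Aut_F F T) b a x = cR T (inv_into T a t) x"
        using fmor_inv_f[OF af(2) x] x by (simp add: cR_def)
    qed
    then show "gconj (Aut_F F T) b a \<in> cR T ` T" using ai(2) by blast
  qed
  let ?U = "{s \<in> SS. cR T s \<in> ?O}"
  have mult: "cR T (s \<otimes>\<^bsub>fgrp F\<^esub> t) = cR T t \<otimes>\<^bsub>Aut_F F T\<^esub> cR T s" if st: "s \<in> SS" "t \<in> SS" for s t
  proof -
    have "cj x s \<in> T" if "x \<in> T" for x using NS_gconj[OF Ts(1) _ that, of s] NT st by simp
    then show ?thesis
      unfolding Aut_F_mult[OF cRf[OF st(2)] cRf[OF st(1)]]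
      using st sgr_mem[OF Ts(1)] by (auto simp: compose_def cR_def S.gconj_comp fun_eq_iff)
  qed
  have U: "sgr ?U"
  proof
    show "?U \<subseteq> SS" by auto
    have "cR T \<one>\<^bsub>fgrp F\<^esub> = \<one>\<^bsub>Aut_F F T\<^esub>"
      using sgr_mem[OF Ts(1)] by (auto simp: cR_def Aut_F_one fun_eq_iff)
    then show "\<one>\<^bsub>fgrp F\<^esub> \<in> ?U" using subgroup.one_closed[OF Os] by simp
    show "s \<otimes>\<^bsub>fgrp F\<^esub> t \<in> ?U" if "s \<in> ?U" "t \<in> ?U" for s t
      using that mult subgroup.m_closed[OF Os] by simp
    show "inv\<^bsub>fgrp F\<^esub> s \<in> ?U" if s: "s \<in> ?U" for s
    proof -
      have "cR T (inv\<^bsub>fgrp F\<^esub> s) \<otimes>\<^bsub>Aut_F F T\<^esub> cR T s = \<one>\<^bsub>Aut_F F T\<^esub>"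
        using mult[of s "inv\<^bsub>fgrp F\<^esub> s"] s \<open>cR T \<one>\<^bsub>fgrp F\<^esub> = \<one>\<^bsub>Aut_F F T\<^esub>\<close> by simp
      then have "inv\<^bsub>Aut_F F T\<^esub> (cR T s) = cR T (inv\<^bsub>fgrp F\<^esub> s)"
        using A.inv_equality[of "cR T (inv\<^bsub>fgrp F\<^esub> s)" "cR T s"] cRf s by simp
      then show ?thesis using subgroup.m_inv_closed[OF Os] s by force
    qed
  qed
  have TU: "T \<subseteq> ?U" using Inn sgr_mem[OF Ts(1)] by auto
  have "T \<noteq> ?U"
  proof
    assume TU': "T = ?U"
    have "?O \<subseteq> cR T ` T"
    proof
      fix a assume a: "a \<in> ?O"
      then obtain s where "s \<in> SS" "a = cR T s" using OS by blast
      then have "s \<in> ?U" "a = cR T s" using a by auto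
      then show "a \<in> cR T ` T" using TU' by blast
    qed
    then show False using rad Inn by (simp add: Inn_eq)
  qed
  then have "T \<subset> ?U" using TU by blast
  then have cU: "card T < card ?U" using psubset_card_mono[OF S.finite_subgroup[OF U]] by blast
  have centT: "centric T" using over_Q_centric[OF Ts] .
  have "\<exists>g. fmor F (X <#>\<^bsub>fgrp F\<^esub> ?U) g \<and> g ` ?U = ?U \<and> (\<forall>x\<in>X. g x = f x)"
    if X: "Q \<subseteq> X" "fmor F X f" for X f
  proof -
    have Xs: "sgr X" using fmor_sgr[OF X(2)] .
    let ?XT = "X <#>\<^bsub>fgrp F\<^esub> T"
    obtain g where g: "fmor F ?XT g" "g ` T = T" "\<forall>x\<in>X. g x = f x" using ext_normalD[OF T X] by blast
    have XT: "sgr ?XT" "X \<subseteq> ?XT" "T \<subseteq> ?XT" using fmor_sgr[OF g(1)] sub_set_mult[OF Xs Ts(1)] by auto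
    have gT: "fmor F T g" using fmor_mono[OF g(1) Ts(1) XT(3)] .
    have gi: "inv_into T g y \<in> T" "g (inv_into T g y) = y" if "y \<in> T" for y
      using that g(2) by (auto simp: inv_into_into f_inv_into_f)
    have rec: "receptive F T" using gT gT ext_normal_good[OF T] by (simp add: good_def)
    let ?b = "restrict g T"
    have b: "?b \<in> fiso F T T" using restrict_fiso[OF gT g(2)] .
    let ?bi = "inv\<^bsub>Aut_F F T\<^esub> ?b"
    have bi: "?bi \<in> fiso F T T" "\<And>y. y \<in> T \<Longrightarrow> ?bi y = inv_into T g y"
      using A.inv_closed[of ?b] b by (auto simp: Aut_F_inv[OF Ts(1) b] inv_into_restrict)
    have tr: "\<exists>s\<in>SS. cR T s \<in> ?O \<and> (\<forall>y\<in>T. g (cj (inv_into T g y) t) = cj y s)" if t: "t \<in> ?U" for t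
    proof -
      have tS: "t \<in> SS" "cR T t \<in> ?O" using t by auto
      have gO: "gconj (Aut_F F T) (cR T t) ?bi \<in> ?O" using A.p_core_gconj[OF tS(2)] bi(1) by simp
      from subsetD[OF OS gO] obtain s where s0: "gconj (Aut_F F T) (cR T t) ?bi = cR T s" "s \<in> SS"
        by (rule imageE)
      then have s: "s \<in> SS" "gconj (Aut_F F T) (cR T t) ?bi = cR T s" "cR T s \<in> ?O"
        using gO by simp_all
      have "g (cj (inv_into T g y) t) = cj y s" if y: "y \<in> T" for y
      proof -
        have biy: "?bi y = inv_into T g y" "inv_into T g y \<in> T" using bi(2) gi y by auto
        let ?w = "cj (inv_into T g y) t"
        have w: "?w \<in> T" using NS_gconj[OF Ts(1) _ biy(2), of t] NT tS by simp
        have biF: "fmor F T ?bi" using bi(1) by (simp add: fiso_iff)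
        have "cR T s y = inv_into T ?bi (cR T t (?bi y))"
          using Aut_F_gconj[OF Ts(1) _ bi(1) y, of "cR T t"] cRf[OF tS(1)] s(2) by simp
        also have "cR T t (?bi y) = ?w" using biy by (simp add: cR_def)
        also have "inv_into T ?bi ?w = g ?w"
        proof -
          have gw: "g ?w \<in> T" using w g(2) by blast
          have "?bi (g ?w) = ?w" using bi(2)[OF gw] fmor_inv_f[OF gT w] by simp
          then show ?thesis using fmor_inv_f[OF biF gw] by simp
        qed
        finally show ?thesis using y by (simp add: cR_def)
      qed
      then show ?thesis using s by blast
    qed
    \<comment> \<open>Elements of \<open>X\<close> belong to the extension group because
      \<open>g\<close> is defined on them, elements of \<open>?U\<close> because of
      \<open>tr\<close>.\<close>
    have "\<exists>E h. fmor F E h \<and> T \<subseteq> E \<and> X \<union> ?U \<subseteq> E \<and> (\<forall>x\<in>T. h x = g x)"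
    proof (rule receptiveD[OF rec gT g(2)])
      fix t assume "t \<in> X \<union> ?U"
      then consider "t \<in> X" | "t \<in> ?U" by blast
      then show "t \<in> NS T \<and> (\<exists>s\<in>NS T. \<forall>y\<in>T. g (cj (inv_into T g y) t) = cj y s)"
      proof cases
        case 1
        have "g (cj (inv_into T g y) t) = cj y (g t)" if y: "y \<in> T" for y
          using fmor_gconj[OF g(1), of "inv_into T g y" t] gi[OF y] XT 1 by auto
        moreover have "g t \<in> NS T" using fmor_closed[OF g(1), of t] 1 XT NT by blast
        ultimately show ?thesis using 1 sgr_mem[OF Xs] NT by blast
      next
        case 2
        then show ?thesis using tr[OF 2] NT by auto
      qed
    qed
    then obtain E h where h: "fmor F E h" "T \<subseteq> E" "X \<union> ?U \<subseteq> E" "\<forall>x\<in>T. h x = g x" by blast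
    have Es: "sgr E" using fmor_sgr[OF h(1)] .
    have UE: "?U \<subseteq> E" "X \<subseteq> E" using h(3) by auto
    have hU: "h ` ?U = ?U"
    proof (rule card_subset_eq[OF S.finite_subgroup[OF U]])
      show "card (h ` ?U) = card ?U" using fmor_card[OF h(1) UE(1)] .
      show "h ` ?U \<subseteq> ?U"
      proof
        fix u assume "u \<in> h ` ?U"
        then obtain t where t: "u = h t" "t \<in> ?U" by (rule imageE)
        have tE: "t \<in> E" using UE(1) t(2) by (rule subsetD)
        have uS: "u \<in> SS" using fmor_closed[OF h(1) tE] t(1) by simp
        obtain s where s: "s \<in> SS" "cR T s \<in> ?O" "\<forall>y\<in>T. g (cj (inv_into T g y) t) = cj y s" using tr[OF t(2)] by blast
        have "cj y u = cj y s" if y: "y \<in> T" for y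
        proof -
          let ?x = "inv_into T g y"
          have x: "?x \<in> T" "g ?x = y" "?x \<in> E" using gi[OF y] h(2) by auto
          have xt: "cj ?x t \<in> T" using NS_gconj[OF Ts(1) _ x(1), of t] NT t(2) by simp
          have "cj y u = cj (h ?x) (h t)" using h(4) x t(1) by simp
          also have "\<dots> = h (cj ?x t)" using fmor_gconj[OF h(1) x(3) tE] by simp
          also have "\<dots> = g (cj ?x t)" using h(4) xt by blast
          finally show ?thesis using s(3) y by simp
        qed
        then have "cR T u = cR T s" by (simp add: cR_def cong: restrict_cong)
        then show "u \<in> ?U" using s(2) uS by simp
      qed
    qed
    have XTE: "?XT \<subseteq> E" using set_mult_least[OF Es UE(2) h(2)] .
    let ?Y = "h ` ?XT"
    have hXT: "fmor F ?XT h" using fmor_mono[OF h(1) XT(1) XTE] .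
    have hT: "h ` T = T" using h(4) g(2) by (metis (no_types, lifting) image_cong)
    have TY: "T \<subseteq> ?Y" using hT XT(3) by blast
    \<comment> \<open>\<open>h\<close> and \<open>g\<close> agree on \<open>T\<close> but perhaps
      not on \<open>X\<close>. The comparison map \<open>?th\<close> fixes \<open>T\<close>
      pointwise, so \<open>centric_identity\<close> makes it conjugation by some \<open>z\<close> in
      \<open>T\<close>; following \<open>h\<close> by this conjugation restores the prescribed
      values on \<open>X\<close> and still preserves \<open>?U\<close>.\<close>
    let ?th = "\<lambda>y. g (inv_into ?XT h y)"
    have imi: "inv_into ?XT h ` ?Y = ?XT" using fmor_inv_image[OF hXT subset_refl] .
    have th: "fmor F ?Y ?th" using fmor_comp[OF fmor_inv[OF hXT] g(1)] imi by simp
    have thT: "?th t = t" if t: "t \<in> T" for t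
    proof -
      obtain x where x: "t = h x" "x \<in> T" using t hT by (metis imageE)
      have "inv_into ?XT h t = x" using fmor_inv_f[OF hXT] x XT(3) by blast
      then show ?thesis using x h(4) by simp
    qed
    obtain z where z: "z \<in> T" "\<forall>y\<in>?Y. ?th y = cj y z"
      using centric_identity[OF sat centT NT TY th thT] by blast
    have zU: "z \<in> ?U" using TU z(1) by (rule subsetD)
    have zS: "z \<in> SS" using sgr_mem[OF Ts(1) z(1)] .
    let ?k = "\<lambda>x. cj (h x) z"
    have XU: "X <#>\<^bsub>fgrp F\<^esub> ?U \<subseteq> E" using set_mult_least[OF Es UE(2,1)] .
    have XUs: "sgr (X <#>\<^bsub>fgrp F\<^esub> ?U)"
    proof (rule sgr_set_mult[OF Xs U])
      show "X \<subseteq> NS ?U"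
      proof
        fix x assume x: "x \<in> X"
        have xS: "x \<in> SS" using sgr_mem[OF Xs x] .
        have "cj t x \<in> ?U" if t: "t \<in> ?U" for t
        proof -
          have tS: "t \<in> SS" "cR T t \<in> ?O" using t by auto
          have "cR T (cj t x) = gconj (Aut_F F T) (cR T t) (cR T (inv\<^bsub>fgrp F\<^esub> x))"
          proof -
            have ix: "inv\<^bsub>Aut_F F T\<^esub> (cR T (inv\<^bsub>fgrp F\<^esub> x)) = cR T x"
            proof (rule A.inv_equality)
              have "cR T x \<otimes>\<^bsub>Aut_F F T\<^esub> cR T (inv\<^bsub>fgrp F\<^esub> x) = cR T (inv\<^bsub>fgrp F\<^esub> x \<otimes>\<^bsub>fgrp F\<^esub> x)"
                using mult[of "inv\<^bsub>fgrp F\<^esub> x" x] xS by simp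
              also have "\<dots> = \<one>\<^bsub>Aut_F F T\<^esub>"
                using xS sgr_mem[OF Ts(1)] by (auto simp: cR_def Aut_F_one fun_eq_iff)
              finally show "cR T x \<otimes>\<^bsub>Aut_F F T\<^esub> cR T (inv\<^bsub>fgrp F\<^esub> x) = \<one>\<^bsub>Aut_F F T\<^esub>" .
            qed (use cRf xS in auto)
            have "cR T (cj t x) = cR T x \<otimes>\<^bsub>Aut_F F T\<^esub> (cR T t \<otimes>\<^bsub>Aut_F F T\<^esub> cR T (inv\<^bsub>fgrp F\<^esub> x))"
              using mult xS tS by (simp add: gconj_def)
            then show ?thesis
              using ix A.m_assoc[of "cR T x" "cR T t" "cR T (inv\<^bsub>fgrp F\<^esub> x)"] cRf xS tS by (simp add: gconj_def)
          qed
          then have "cR T (cj t x) \<in> ?O" using A.p_core_gconj[OF tS(2)] cRf xS by simp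
          then show ?thesis using tS xS by simp
        qed
        then show "x \<in> NS ?U" using xS by (simp add: mem_NS_iff[OF U])
      qed
    qed
    have k: "fmor F (X <#>\<^bsub>fgrp F\<^esub> ?U) ?k"
      using fmor_comp[OF fmor_mono[OF h(1) XUs XU] fmor_conj[OF sgr_S zS]] fmor_closed[OF h(1)] XU by blast
    have "?k ` ?U = (\<lambda>x. cj x z) ` h ` ?U" by (simp add: image_image)
    also have "\<dots> = ?U" using hU NS_image[OF U subsetD[OF sub_NS[OF U] zU]] by simp
    finally have kU: "?k ` ?U = ?U" .
    have "?k x = f x" if x: "x \<in> X" for x
    proof -
      have xXT: "x \<in> ?XT" using XT(2) x by (rule subsetD)
      have "?k x = ?th (h x)" using bspec[OF z(2) imageI[OF xXT, of h]] by simp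
      also have "\<dots> = g x" using fmor_inv_f[OF hXT xXT] by simp
      finally show ?thesis using g(3) x by simp
    qed
    then show ?thesis using k kU by blast
  qed
  moreover have "Q \<subseteq> ?U" using Ts(2) TU by (rule subset_trans)
  ultimately have "ext_normal ?U" using U by (simp add: ext_normal_def)
  then show ?thesis using cU by blast
qed

lemma exists_radical_ext_normal:
  "\<exists>T. ext_normal T \<and> T \<in> centric_radical_subgroups p F"
proof -
  have "finite {card T |T. ext_normal T}"
  proof (rule finite_subset)
    show "{card T |T. ext_normal T} \<subseteq> {..card SS}"
      using subgroup.subset by (auto simp: ext_normal_def intro!: card_mono)
  qed simp
  note fin = this
  have "Max {card T |T. ext_normal T} \<in> {card T |T. ext_normal T}"
    by (rule Max_in[OF fin]) (use ext_normal_Q in blast)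
  then obtain T where T0: "ext_normal T" "Max {card T |T. ext_normal T} = card T" by blast
  have T: "ext_normal T" "card T' \<le> card T" if "ext_normal T'" for T'
    using T0 Max_ge[OF fin, of "card T'"] that by auto
  have "p_core p (Aut_F F T) = Inn F T" using ext_normal_enlarge[OF T0(1)] T(2) not_le by metis
  moreover have "centric T" using over_Q_centric T0(1) by (simp add: ext_normal_def)
  ultimately show ?thesis using T0(1) by (auto simp: centric_radical_subgroups_def centric_iff)
qed

lemma Q_sub_NS: assumes "sgr V" "V \<subseteq> ZQ" shows "Q \<subseteq> NS V" "Q \<subseteq> CS V"
proof -
  show "Q \<subseteq> CS V"
  proof
    fix q assume q: "q \<in> Q"
    have "q \<otimes>\<^bsub>fgrp F\<^esub> v = v \<otimes>\<^bsub>fgrp F\<^esub> q" if "v \<in> V" for v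
      using subsetD[OF assms(2) that] q by (auto simp: ZQ_eq gcentralizer_def)
    then show "q \<in> CS V" using q sgr_mem[OF Q_sgr] by (auto simp: gcentralizer_def)
  qed
  then show "Q \<subseteq> NS V" using CS_sub_NS[OF assms(1)] by blast
qed

lemma maps_into_ZQ:
  assumes f: "fmor F X f" "Q \<subseteq> X" and V: "V \<subseteq> ZQ" shows "f ` V \<subseteq> ZQ"
proof -
  have QX: "Q \<subseteq> X" by fact
  have "f ` V \<subseteq> CS (f ` Q)" using fmor_image_CS[OF f] V ZQ_sub QX unfolding ZQ_eq by blast
  then show ?thesis using Q_weakly_closed[OF f] by (simp add: ZQ_eq)
qed

text \<open>A good conjugate of \<open>V\<close> lies in \<open>Z(Q)\<close>: it is reached from
  \<open>V\<close> by a map on \<open>NS V\<close>, which contains \<open>Q\<close>, and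
  \<open>Q\<close> is weakly closed.\<close>

lemma reach_into_ZQ:
  assumes V: "sgr V" "V \<subseteq> ZQ" and V1: "fconjugate F V V1"
  shows "\<exists>f. fmor F (NS V1) f \<and> f ` V1 \<subseteq> ZQ"
proof -
  obtain G where G: "fconjugate F V G" "good G" using sat V(1) unfolding saturated_iff by blast
  obtain h where h: "fmor F (NS V) h" "h ` V = G" using reach_good[OF G(2,1)] by (auto simp: reach_def)
  have GZ: "G \<subseteq> ZQ" using maps_into_ZQ[OF h(1) Q_sub_NS(1)[OF V] V(2)] h(2) by simp
  have "reach V1 G" using reach_good[OF G(2) fconjugate_trans[OF fconjugate_sym[OF V1] G(1)]] .
  then show ?thesis using GZ by (auto simp: reach_def)
qed

text \<open>Largeness concerns morphisms preserving a subgroup, whereas \<open>f\<close> may move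
  \<open>V\<close> to another subgroup of \<open>Z(Q)\<close>. Both are sent to one good conjugate
  \<open>G\<close> in \<open>Z(Q)\<close>, where \<open>f\<close> becomes a morphism preserving
  \<open>G\<close>; once this is extended over \<open>Q\<close>, the two auxiliary maps are
  undone.\<close>

lemma extend_over_Q:
  assumes V: "sgr V" "V \<subseteq> ZQ" "V \<noteq> {\<one>\<^bsub>fgrp F\<^esub>}" "V \<subseteq> X" "X \<subseteq> NS V"
    and f: "fmor F X f" "f ` V \<subseteq> ZQ"
  shows "\<exists>g. fmor F (X <#>\<^bsub>fgrp F\<^esub> Q) g \<and> (\<forall>x\<in>X. g x = f x)"
proof -
  have Xs: "sgr X" using fmor_sgr[OF f(1)] .
  obtain G where G: "fconjugate F V G" "good G" using sat V(1) unfolding saturated_iff by blast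
  have Gs: "sgr G" using G by (simp add: good_def)
  obtain h where h: "fmor F (NS V) h" "h ` V = G" using reach_good[OF G(2,1)] by (auto simp: reach_def)
  have GZ: "G \<subseteq> ZQ" using maps_into_ZQ[OF h(1) Q_sub_NS(1)[OF V(1,2)] V(2)] h(2) by simp
  let ?W = "f ` V"
  have W: "sgr ?W" using fmor_image[OF f(1) V(1,4)] .
  have "fconjugate F V ?W" using fconjugateI[OF fmor_mono[OF f(1) V(1,4)]] .
  then have "reach ?W G" using reach_good[OF G(2) fconjugate_trans[OF fconjugate_sym G(1)]] by blast
  then obtain k where k: "fmor F (NS ?W) k" "k ` ?W = G" by (auto simp: reach_def)
  have Gnt: "G \<noteq> {\<one>\<^bsub>fgrp F\<^esub>}"
  proof
    assume "G = {\<one>\<^bsub>fgrp F\<^esub>}"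
    then have "card V = 1" using fconjugate_card[OF G(1)] by simp
    then obtain v where "V = {v}" by (rule card_1_singletonE)
    then show False using V(3) subgroup.one_closed[OF V(1)] by auto
  qed
  let ?hi = "inv_into (NS V) h"
  let ?Y = "h ` X"
  have Y: "sgr ?Y" "?hi ` ?Y = X" "?hi ` G = V"
    using fmor_image[OF h(1) Xs V(5)] fmor_inv_image[OF h(1)] V(5) sub_NS[OF V(1)] h(2) by auto
  have fXN: "f ` X \<subseteq> NS ?W" using fmor_image_NS[OF f(1) V(1,4)] V(5) by (simp add: Int_absorb2)
  have 1: "fmor F ?Y (\<lambda>y. f (?hi y))" using fmor_comp[OF fmor_inv_sub[OF h(1) Xs V(5)] f(1)] Y(2) by simp
  have 2: "(\<lambda>y. f (?hi y)) ` ?Y = f ` X" using image_image[of f ?hi ?Y] Y(2) by simp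
  have 3: "fmor F ?Y (\<lambda>y. k (f (?hi y)))" using fmor_comp[OF 1 k(1)] 2 fXN by simp
  have 4: "(\<lambda>y. k (f (?hi y))) ` G = G"
    using image_image[of "\<lambda>y. k (f y)" ?hi G] image_image[of k f V] Y(3) k(2) by simp
  have GY: "G \<subseteq> ?Y" using h(2) V(4) by blast
  have "?Y \<subseteq> NS G" using NS_image_NS[OF V(1) h(1)] V(5) h(2) by blast
  then obtain g where g: "fmor F (?Y <#>\<^bsub>fgrp F\<^esub> Q) g" "g ` Q = Q" "\<forall>y\<in>?Y. g y = k (f (?hi y))"
    using normalizer_extension(2)[OF Gs GZ Gnt GY _ 3 4] by blast
  have QV: "Q \<subseteq> NS V" using Q_sub_NS(1)[OF V(1,2)] .
  have XQN: "X <#>\<^bsub>fgrp F\<^esub> Q \<subseteq> NS V" using set_mult_least[OF sgr_NS[OF V(1)] V(5) QV] .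
  have XQ: "sgr (X <#>\<^bsub>fgrp F\<^esub> Q)"
    by (rule sgr_set_mult[OF Xs Q_sgr]) (use NS_Q subgroup.subset[OF Xs] in simp)
  have hXQ: "h ` (X <#>\<^bsub>fgrp F\<^esub> Q) = ?Y <#>\<^bsub>fgrp F\<^esub> Q"
    using fmor_set_mult_image[OF h(1) V(5) QV] Q_weakly_closed[OF h(1) QV] by simp
  \<comment> \<open>Undoing \<open>k\<close> requires the image of the extension to lie in the image
    of \<open>NS ?W\<close>; weak closure of \<open>Q\<close> identifies it.\<close>
  have gYQ: "g ` (?Y <#>\<^bsub>fgrp F\<^esub> Q) = k ` (f ` X <#>\<^bsub>fgrp F\<^esub> Q)"
  proof -
    have QW: "Q \<subseteq> NS ?W" using Q_sub_NS(1)[OF W f(2)] .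
    have "g ` (?Y <#>\<^bsub>fgrp F\<^esub> Q) = g ` ?Y <#>\<^bsub>fgrp F\<^esub> Q"
      using fmor_set_mult_image[OF g(1) sub_set_mult[OF Y(1) Q_sgr]] g(2) by simp
    also have "g ` ?Y = (\<lambda>y. k (f (?hi y))) ` ?Y" using g(3) by (intro image_cong) auto
    also have "\<dots> = k ` f ` X" using image_image[of k "\<lambda>y. f (?hi y)" ?Y] 2 by simp
    also have "k ` f ` X <#>\<^bsub>fgrp F\<^esub> Q = k ` (f ` X <#>\<^bsub>fgrp F\<^esub> Q)"
      using fmor_set_mult_image[OF k(1) fXN QW] Q_weakly_closed[OF k(1) QW] by simp
    finally show ?thesis .
  qed
  have fQN: "f ` X <#>\<^bsub>fgrp F\<^esub> Q \<subseteq> NS ?W"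
    using set_mult_least[OF sgr_NS[OF W] fXN Q_sub_NS(1)[OF W f(2)]] .
  let ?ki = "inv_into (NS ?W) k"
  have hm: "fmor F (X <#>\<^bsub>fgrp F\<^esub> Q) h" using fmor_mono[OF h(1) XQ XQN] .
  have gh: "fmor F (X <#>\<^bsub>fgrp F\<^esub> Q) (\<lambda>x. g (h x))" using fmor_comp[OF hm g(1)] hXQ by simp
  have "(\<lambda>x. g (h x)) ` (X <#>\<^bsub>fgrp F\<^esub> Q) = k ` (f ` X <#>\<^bsub>fgrp F\<^esub> Q)"
    using image_image[of g h "X <#>\<^bsub>fgrp F\<^esub> Q"] hXQ gYQ by simp
  with image_mono[OF fQN, of k]
  have ghim: "(\<lambda>x. g (h x)) ` (X <#>\<^bsub>fgrp F\<^esub> Q) \<subseteq> k ` NS ?W" by simp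
  have "fmor F (X <#>\<^bsub>fgrp F\<^esub> Q) (\<lambda>x. ?ki (g (h x)))" using fmor_comp[OF gh fmor_inv[OF k(1)] ghim] .
  moreover have "?ki (g (h x)) = f x" if x: "x \<in> X" for x
  proof -
    have "h x \<in> ?Y" using x by blast
    then have "g (h x) = k (f (?hi (h x)))" using g(3) by blast
    also have "?hi (h x) = x" using fmor_inv_f[OF h(1)] x V(5) by blast
    finally show ?thesis using fmor_inv_f[OF k(1)] fXN x by auto
  qed
  ultimately show ?thesis by blast
qed

end

section \<open>Localities\<close>

subsection \<open>Partial groups\<close>

context partial_group
begin

lemma nil_dom: "[] \<in> wdom L"
  using nonempty dom_single dom_append[of "[_]" "[]"] by fastforce

lemma dom_lists: "w \<in> wdom L \<Longrightarrow> w \<in> lists (carrier L)"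
  using dom_words by blast

lemma dom_appendD: "u @ v \<in> wdom L \<Longrightarrow> u \<in> wdom L" "u @ v \<in> wdom L \<Longrightarrow> v \<in> wdom L"
  using dom_append by blast+

lemma word_inv_append: "word_inv L (u @ v) = word_inv L v @ word_inv L u"
  by (simp add: word_inv_def)

lemma word_inv_Cons: "word_inv L (f # w) = word_inv L w @ [pinv L f]"
  by (simp add: word_inv_def)

lemma word_inv_Nil [simp]: "word_inv L [] = []"
  by (simp add: word_inv_def)

lemma word_inv_word_inv: "w \<in> lists (carrier L) \<Longrightarrow> word_inv L (word_inv L w) = w"
  by (induction w) (auto simp: word_inv_Cons word_inv_append inv_inv)

lemma word_inv_lists: "w \<in> lists (carrier L) \<Longrightarrow> word_inv L w \<in> lists (carrier L)"
  by (induction w) (auto simp: word_inv_Cons inv_closed)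

lemma word_inv_dom: assumes "w \<in> wdom L" shows "word_inv L w \<in> wdom L"
  using prod_inv[OF assms] dom_appendD by blast

lemma word_inv_right: assumes "w \<in> wdom L"
  shows "w @ word_inv L w \<in> wdom L" "wprod L (w @ word_inv L w) = wprod L []"
  using prod_inv[OF word_inv_dom[OF assms]] word_inv_word_inv[OF dom_lists[OF assms]] by auto

lemma prod_one_insert: assumes "u @ v \<in> wdom L"
  shows "u @ [wprod L []] @ v \<in> wdom L" "wprod L (u @ [wprod L []] @ v) = wprod L (u @ v)"
  using prod_append[of u "[]" v] assms by auto

lemma prod_two: assumes "u @ v \<in> wdom L"
  shows "[wprod L u, wprod L v] \<in> wdom L" "wprod L [wprod L u, wprod L v] = wprod L (u @ v)"
proof -
  have 1: "[wprod L u] @ v \<in> wdom L" "wprod L ([wprod L u] @ v) = wprod L (u @ v)"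
    using prod_append[of "[]" u v] assms by auto
  then show "[wprod L u, wprod L v] \<in> wdom L" "wprod L [wprod L u, wprod L v] = wprod L (u @ v)"
    using prod_append[of "[wprod L u]" v "[]"] by auto
qed

text \<open>Appending the inverse word puts \<open>[a, b, pinv L b]\<close> into the domain, where
  it can be bracketed in both ways.\<close>

lemma pinv_unique: assumes "[a, b] \<in> wdom L" "wprod L [a, b] = wprod L []" shows "a = pinv L b"
proof -
  have c: "a \<in> carrier L" "b \<in> carrier L" using dom_lists[OF assms(1)] by auto
  have "[a, b] @ word_inv L [a, b] \<in> wdom L" using word_inv_right[OF assms(1)] by blast
  then have "[a, b, pinv L b] @ [pinv L a] \<in> wdom L" by (simp add: word_inv_def)
  then have d: "[a, b, pinv L b] \<in> wdom L" using dom_appendD by blast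
  have bb: "wprod L [b, pinv L b] = wprod L []"
    using word_inv_right(2)[OF dom_single[OF c(2)]] by (simp add: word_inv_def)
  have "wprod L [a, b, pinv L b] = wprod L ([wprod L []] @ [pinv L b])"
    using prod_append[of "[]" "[a, b]" "[pinv L b]"] d assms by simp
  also have "\<dots> = pinv L b"
    using prod_one_insert(2)[of "[]" "[pinv L b]"] dom_single prod_single inv_closed c by simp
  finally have 1: "wprod L [a, b, pinv L b] = pinv L b" .
  have "wprod L [a, b, pinv L b] = wprod L ([a] @ [wprod L []])"
    using prod_append[of "[a]" "[b, pinv L b]" "[]"] d bb by simp
  also have "\<dots> = a"
    using prod_one_insert(2)[of "[a]" "[]"] dom_single prod_single c by simp
  finally show ?thesis using 1 by simp
qed

lemma wprod_word_inv: assumes "w \<in> wdom L" shows "wprod L (word_inv L w) = pinv L (wprod L w)"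
  using prod_two[of "word_inv L w" w] prod_inv[OF assms] by (intro pinv_unique) auto

lemma prod_inv_right: "g \<in> carrier L \<Longrightarrow> [g, pinv L g] \<in> wdom L \<and> wprod L [g, pinv L g] = wprod L []"
  using word_inv_right[OF dom_single, of g] by (simp add: word_inv_def)

lemma prod_inv_left: "g \<in> carrier L \<Longrightarrow> [pinv L g, g] \<in> wdom L \<and> wprod L [pinv L g, g] = wprod L []"
  using prod_inv[OF dom_single, of g] by (simp add: word_inv_def)

lemma prod_cancel:
  assumes "u @ [g, pinv L g] @ v \<in> wdom L" "u @ v \<in> wdom L" "g \<in> carrier L"
  shows "wprod L (u @ [g, pinv L g] @ v) = wprod L (u @ v)"
  using prod_append[OF assms(1)] prod_inv_right[OF assms(3)] prod_one_insert[OF assms(2)] by simp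

lemma prod_cancel':
  assumes "u @ [pinv L g, g] @ v \<in> wdom L" "u @ v \<in> wdom L" "g \<in> carrier L"
  shows "wprod L (u @ [pinv L g, g] @ v) = wprod L (u @ v)"
  using prod_append[OF assms(1)] prod_inv_left[OF assms(3)] prod_one_insert[OF assms(2)] by simp

text \<open>All words needed for the cancellations are parts of a word joined with its own inverse,
  which the axioms put into the domain.\<close>

lemma pconj_pinv:
  assumes g: "g \<in> carrier L" and x: "x \<in> conj_dom L g"
  shows "pconj L x g \<in> conj_dom L (pinv L g)" "pconj L (pconj L x g) (pinv L g) = x"
proof -
  let ?w = "[pinv L g, x, g]"
  have w: "?w \<in> wdom L" and xc: "x \<in> carrier L" using x by (auto simp: conj_dom_def)
  have "word_inv L ?w @ ?w \<in> wdom L" using prod_inv[OF w] by blast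
  then have "[pinv L g, pinv L x] @ (g # ?w) \<in> wdom L" by (simp add: word_inv_def inv_inv g)
  then have z: "g # ?w \<in> wdom L" using dom_appendD by blast
  have "(g # ?w) @ word_inv L (g # ?w) \<in> wdom L" using word_inv_right[OF z] by blast
  then have "([g] @ ?w @ [pinv L g]) @ [pinv L x, g, pinv L g] \<in> wdom L" by (simp add: word_inv_def inv_inv g)
  then have z2: "[g] @ ?w @ [pinv L g] \<in> wdom L" using dom_appendD by blast
  have p: "[g, pconj L x g, pinv L g] \<in> wdom L" "wprod L [g, pconj L x g, pinv L g] = wprod L ([g] @ ?w @ [pinv L g])"
    using prod_append[OF z2] by (simp_all add: pconj_def)
  have pc: "pconj L x g \<in> carrier L" using prod_closed[OF w] by (simp add: pconj_def)
  show "pconj L x g \<in> conj_dom L (pinv L g)" using p pc by (simp add: conj_dom_def inv_inv g)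
  have e1: "wprod L ([] @ [g, pinv L g] @ [x, g, pinv L g]) = wprod L ([] @ [x, g, pinv L g])"
    using z2 dom_appendD(2)[of "[g, pinv L g]" "[x, g, pinv L g]"] by (intro prod_cancel) (auto simp: g)
  have e2: "wprod L ([x] @ [g, pinv L g] @ []) = wprod L ([x] @ [])"
    using z2 dom_appendD(2)[of "[g, pinv L g]" "[x, g, pinv L g]"] dom_single[OF xc]
    by (intro prod_cancel) (auto simp: g)
  show "pconj L (pconj L x g) (pinv L g) = x"
    using p(2) e1 e2 prod_single[OF xc] by (simp add: pconj_def inv_inv g)
qed

lemma pconj_set_pinv:
  assumes "g \<in> carrier L" "X \<subseteq> conj_dom L g"
  shows "pconj_set L X g \<subseteq> conj_dom L (pinv L g)" "pconj_set L (pconj_set L X g) (pinv L g) = X"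
  using pconj_pinv[OF assms(1)] assms(2) by (force simp: pconj_set_def image_image)+

lemma pconj_inj: "g \<in> carrier L \<Longrightarrow> inj_on (\<lambda>x. pconj L x g) (conj_dom L g)"
  by (rule inj_on_inverseI[where g = "\<lambda>x. pconj L x (pinv L g)"]) (rule pconj_pinv(2))

lemma one_pconj:
  assumes "g \<in> carrier L"
  shows "wprod L [] \<in> conj_dom L g" "pconj L (wprod L []) g = wprod L []"
  using prod_one_insert[of "[pinv L g]" "[g]"] prod_inv_left[OF assms] prod_closed[OF nil_dom]
  by (auto simp: conj_dom_def pconj_def)

lemma pconj_one:
  assumes "x \<in> carrier L"
  shows "x \<in> conj_dom L (wprod L [])" "pconj L x (wprod L []) = x"
proof -
  have o: "wprod L [] \<in> carrier L" using prod_closed[OF nil_dom] .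
  have "[wprod L [], wprod L []] \<in> wdom L" "wprod L [wprod L [], wprod L []] = wprod L []"
    using prod_two[of "[]" "[]"] nil_dom by auto
  then have i: "pinv L (wprod L []) = wprod L []" using pinv_unique by metis
  have 1: "[x] @ [wprod L []] @ [] \<in> wdom L" "wprod L ([x] @ [wprod L []] @ []) = x"
    using prod_one_insert[of "[x]" "[]"] dom_single[OF assms] prod_single[OF assms] by auto
  then have 2: "[] @ [wprod L []] @ [x, wprod L []] \<in> wdom L" "wprod L ([] @ [wprod L []] @ [x, wprod L []]) = x"
    using prod_one_insert[of "[]" "[x, wprod L []]"] by auto
  show "x \<in> conj_dom L (wprod L [])" "pconj L x (wprod L []) = x"
    using 2 assms i by (auto simp: conj_dom_def pconj_def)
qed

lemma partial_subgroupD: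
  assumes "partial_subgroup L H"
  shows "H \<subseteq> carrier L" "\<And>w. w \<in> lists H \<Longrightarrow> w \<in> wdom L" "\<And>w. w \<in> lists H \<Longrightarrow> wprod L w \<in> H"
    "\<And>x. x \<in> H \<Longrightarrow> pinv L x \<in> H" "wprod L [] \<in> H"
proof -
  show "H \<subseteq> carrier L" "\<And>w. w \<in> lists H \<Longrightarrow> w \<in> wdom L" "\<And>x. x \<in> H \<Longrightarrow> pinv L x \<in> H"
    and *: "\<And>w. w \<in> lists H \<Longrightarrow> wprod L w \<in> H"
    using assms unfolding partial_subgroup_def by blast+
  show "wprod L [] \<in> H" using *[of "[]"] by simp
qed

lemma grp_on_simps [simp]:
  "carrier (grp_on L H) = H" "\<one>\<^bsub>grp_on L H\<^esub> = wprod L []"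
  "x \<in> H \<Longrightarrow> y \<in> H \<Longrightarrow> x \<otimes>\<^bsub>grp_on L H\<^esub> y = wprod L [x, y]"
  by (auto simp: grp_on_def)

lemma group_grp_on: assumes H: "partial_subgroup L H" shows "group (grp_on L H)"
proof (rule groupI)
  note D = partial_subgroupD[OF H]
  show "x \<otimes>\<^bsub>grp_on L H\<^esub> y \<in> carrier (grp_on L H)" if "x \<in> carrier (grp_on L H)" "y \<in> carrier (grp_on L H)" for x y
    using that D(3)[of "[x, y]"] by simp
  show "\<one>\<^bsub>grp_on L H\<^esub> \<in> carrier (grp_on L H)" using D(5) by simp
  show "x \<otimes>\<^bsub>grp_on L H\<^esub> y \<otimes>\<^bsub>grp_on L H\<^esub> z = x \<otimes>\<^bsub>grp_on L H\<^esub> (y \<otimes>\<^bsub>grp_on L H\<^esub> z)"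
    if "x \<in> carrier (grp_on L H)" "y \<in> carrier (grp_on L H)" "z \<in> carrier (grp_on L H)" for x y z
  proof -
    have h: "x \<in> H" "y \<in> H" "z \<in> H" using that by auto
    have w: "[x, y, z] \<in> wdom L" "wprod L [x, y] \<in> H" "wprod L [y, z] \<in> H" using D h by auto
    have "wprod L [wprod L [x, y], z] = wprod L [x, y, z]" using prod_append[of "[]" "[x, y]" "[z]"] w by simp
    moreover have "wprod L [x, wprod L [y, z]] = wprod L [x, y, z]" using prod_append[of "[x]" "[y, z]" "[]"] w by simp
    ultimately show ?thesis using h w by simp
  qed
  show "\<one>\<^bsub>grp_on L H\<^esub> \<otimes>\<^bsub>grp_on L H\<^esub> x = x" if "x \<in> carrier (grp_on L H)" for x
  proof -
    have x: "x \<in> H" "x \<in> carrier L" using that D by auto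
    show ?thesis using prod_one_insert[of "[]" "[x]"] x dom_single prod_single D(5) by simp
  qed
  show "\<exists>y\<in>carrier (grp_on L H). y \<otimes>\<^bsub>grp_on L H\<^esub> x = \<one>\<^bsub>grp_on L H\<^esub>" if "x \<in> carrier (grp_on L H)" for x
    using that D prod_inv_left by (intro bexI[of _ "pinv L x"]) auto
qed

lemma inv_grp_on: assumes H: "partial_subgroup L H" and x: "x \<in> H"
  shows "inv\<^bsub>grp_on L H\<^esub> x = pinv L x"
proof -
  interpret group "grp_on L H" using H by (rule group_grp_on)
  have "pinv L x \<in> H" "x \<in> carrier L" using partial_subgroupD[OF H] x by auto
  then show ?thesis using x prod_inv_left by (intro inv_equality) auto
qed

lemma gconj_grp_on: assumes H: "partial_subgroup L H" and x: "x \<in> H" "g \<in> H"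
  shows "gconj (grp_on L H) x g = pconj L x g" "x \<in> conj_dom L g"
proof -
  note D = partial_subgroupD[OF H]
  have i: "pinv L g \<in> H" "wprod L [pinv L g, x] \<in> H" "[pinv L g, x, g] \<in> wdom L" using D x by auto
  have "wprod L [wprod L [pinv L g, x], g] = wprod L [pinv L g, x, g]"
    using prod_append[of "[]" "[pinv L g, x]" "[g]"] i by simp
  then show "gconj (grp_on L H) x g = pconj L x g"
    using i x by (simp add: gconj_def inv_grp_on[OF H] pconj_def)
  show "x \<in> conj_dom L g" using i x D(1) by (auto simp: conj_dom_def)
qed

lemma partial_subgroup_subset:
  assumes H: "partial_subgroup L H" and K: "subgroup K (grp_on L H)" shows "partial_subgroup L K"
proof -
  note D = partial_subgroupD[OF H]
  have KH: "K \<subseteq> H" using subgroup.subset[OF K] by simp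
  have "wprod L w \<in> K" if "w \<in> lists K" for w
    using that
  proof (induction w)
    case Nil then show ?case using subgroup.one_closed[OF K] by simp
  next
    case (Cons x w)
    have xw: "x \<in> K" "w \<in> lists K" using Cons by auto
    have "[x] @ w \<in> wdom L" using D(2)[of "x # w"] xw KH by auto
    then have "wprod L (x # w) = wprod L [x, wprod L w]"
      using prod_append[of "[x]" w "[]"] by simp
    also have "\<dots> = x \<otimes>\<^bsub>grp_on L H\<^esub> wprod L w" using xw(1) Cons.IH KH by (simp add: subset_iff)
    finally show ?case using subgroup.m_closed[OF K xw(1)] Cons xw by simp
  qed
  moreover have "pinv L x \<in> K" if "x \<in> K" for x
    using subgroup.m_inv_closed[OF K that] inv_grp_on[OF H, of x] that KH by auto
  moreover have "K \<noteq> {}" using subgroup.one_closed[OF K] by auto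
  moreover have "lists K \<subseteq> wdom L" using D(2) KH by (auto simp: in_lists_conv_set)
  ultimately show ?thesis using KH D(1) unfolding partial_subgroup_def by blast
qed

end

subsection \<open>Conjugation along objects\<close>

context locality
begin

abbreviation "cset P f \<equiv> pconj_set L P f"

text \<open>The condition \<open>dom_iff\<close> as an induction principle. The end objects are
  exposed because words are shown to lie in the domain by joining chains at a common object.\<close>

inductive chain :: "'a set \<Rightarrow> 'a list \<Rightarrow> 'a set \<Rightarrow> bool" where
  chain_Nil: "P \<in> \<Delta> \<Longrightarrow> chain P [] P"
| chain_Cons: "P \<in> \<Delta> \<Longrightarrow> f \<in> carrier L \<Longrightarrow> P \<subseteq> conj_dom L f \<Longrightarrow> chain (cset P f) w R \<Longrightarrow> chain P (f # w) R"

lemma chain_objects: "chain P w R \<Longrightarrow> P \<in> \<Delta> \<and> R \<in> \<Delta>"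
  by (induction rule: chain.induct) auto

lemma chain_lists: "chain P w R \<Longrightarrow> w \<in> lists (carrier L)"
  by (induction rule: chain.induct) auto

lemma chain_Nil_iff: "chain P [] R \<longleftrightarrow> P \<in> \<Delta> \<and> P = R"
  by (auto elim: chain.cases intro: chain_Nil)

lemma chain_Cons_iff: "chain P (f # w) R \<longleftrightarrow>
    P \<in> \<Delta> \<and> f \<in> carrier L \<and> P \<subseteq> conj_dom L f \<and> chain (cset P f) w R"
  by (auto elim: chain.cases intro: chain_Cons)

lemma chain_append: "chain P (u @ v) R \<longleftrightarrow> (\<exists>T. chain P u T \<and> chain T v R)"
proof (induction u arbitrary: P)
  case Nil then show ?case using chain_objects by (auto simp: chain_Nil_iff)
next
  case (Cons f u) then show ?case by (auto simp: chain_Cons_iff)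
qed

lemma chain_single: "chain P [f] R \<longleftrightarrow> P \<in> \<Delta> \<and> f \<in> carrier L \<and> P \<subseteq> conj_dom L f \<and> cset P f = R \<and> R \<in> \<Delta>"
  by (auto simp: chain_Cons_iff chain_Nil_iff)

lemma chain_dom: assumes "chain P w R" shows "w \<in> wdom L"
proof -
  have "\<exists>Ps. length Ps = Suc (length w) \<and> Ps ! 0 = P \<and> set Ps \<subseteq> \<Delta> \<and>
     (\<forall>i<length w. Ps ! i \<subseteq> conj_dom L (w ! i) \<and> cset (Ps ! i) (w ! i) = Ps ! Suc i)"
    using assms
  proof (induction rule: chain.induct)
    case (chain_Nil P) then show ?case by (intro exI[of _ "[P]"]) auto
  next
    case (chain_Cons P f w R)
    then obtain Ps where Ps: "length Ps = Suc (length w)" "Ps ! 0 = cset P f" "set Ps \<subseteq> \<Delta>"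
      "\<forall>i<length w. Ps ! i \<subseteq> conj_dom L (w ! i) \<and> cset (Ps ! i) (w ! i) = Ps ! Suc i" by blast
    then show ?case using chain_Cons(1,2,3)
      by (intro exI[of _ "P # Ps"]) (auto simp: nth_Cons split: nat.split)
  qed
  then show ?thesis using dom_iff[OF chain_lists[OF assms]] by blast
qed

lemma dom_chain: assumes "w \<in> wdom L" shows "\<exists>P R. chain P w R"
proof -
  have wl: "w \<in> lists (carrier L)" using dom_lists assms .
  obtain Ps where "length Ps = Suc (length w)" "set Ps \<subseteq> \<Delta>"
     "\<forall>i<length w. Ps ! i \<subseteq> conj_dom L (w ! i) \<and> cset (Ps ! i) (w ! i) = Ps ! Suc i"
    using dom_iff[OF wl] assms by blast
  then have "\<exists>R. chain (Ps ! 0) w R" using wl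
  proof (induction w arbitrary: Ps)
    case Nil
    then show ?case using nth_mem[of 0 Ps] by (auto simp: chain_Nil_iff)
  next
    case (Cons f w)
    obtain P Qs where Ps: "Ps = P # Qs" using Cons(2) by (cases Ps) auto
    have "\<forall>i<length w. Qs ! i \<subseteq> conj_dom L (w ! i) \<and> cset (Qs ! i) (w ! i) = Qs ! Suc i"
      using Cons(4) Ps by fastforce
    then have "\<exists>R. chain (Qs ! 0) w R" using Cons.prems Ps by (intro Cons.IH) auto
    then obtain R where "chain (Qs ! 0) w R" by blast
    moreover have "P \<subseteq> conj_dom L f" "cset P f = Qs ! 0" using Cons(4) Ps by fastforce+
    ultimately show ?case using Cons Ps by (auto simp: chain_Cons_iff)
  qed
  then show ?thesis by blast
qed

lemma chain_inv_single: assumes "chain P [g] R" shows "chain R [pinv L g] P"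
  using assms pconj_set_pinv[of g P] by (auto simp: chain_single inv_closed)

lemma chain_inv: "chain P w R \<Longrightarrow> chain R (word_inv L w) P"
proof (induction rule: chain.induct)
  case (chain_Nil P) then show ?case by (simp add: chain.chain_Nil)
next
  case (chain_Cons P f w R)
  have "chain P [f] (cset P f)" using chain_Cons chain_objects by (auto simp: chain_single)
  then show ?case using chain_Cons.IH chain_inv_single by (auto simp: word_inv_Cons chain_append)
qed

text \<open>Conjugation along the word and by its product agree because the long word
  \<open>w^-1 x w\<close> lies in the domain: it is carried by the chain run backwards, a step
  preserving \<open>P\<close>, and the chain itself.\<close>

lemma chain_prod: assumes "chain P w R"
  shows "chain P [wprod L w] R" "\<And>x. chain P [x] P \<Longrightarrow> x \<in> conj_dom L (wprod L w) \<and> pconj L x (wprod L w) = wprod L (word_inv L w @ [x] @ w)"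
proof -
  have wd: "w \<in> wdom L" using chain_dom assms .
  show 2: "x \<in> conj_dom L (wprod L w) \<and> pconj L x (wprod L w) = wprod L (word_inv L w @ [x] @ w)"
    if x: "chain P [x] P" for x
  proof -
    have "chain R (word_inv L w @ [x] @ w) R"
      unfolding chain_append using chain_inv[OF assms] x assms by blast
    then have d: "word_inv L w @ [x] @ w \<in> wdom L" by (rule chain_dom)
    have 1: "[pinv L (wprod L w)] @ [x] @ w \<in> wdom L"
       "wprod L ([pinv L (wprod L w)] @ [x] @ w) = wprod L (word_inv L w @ [x] @ w)"
      using prod_append[of "[]" "word_inv L w" "[x] @ w"] d wprod_word_inv[OF wd] by auto
    have "[pinv L (wprod L w), x, wprod L w] \<in> wdom L"
       "wprod L [pinv L (wprod L w), x, wprod L w] = wprod L (word_inv L w @ [x] @ w)"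
      using prod_append[of "[pinv L (wprod L w), x]" w "[]"] 1 by auto
    then show ?thesis using x by (auto simp: conj_dom_def pconj_def chain_single)
  qed
  have PS: "subgroup P (grp_on L S)" if "P \<in> \<Delta>" for P using objects that .
  have Sp: "partial_subgroup L S" using S_p_subgroup by (simp add: p_subgroup_def)
  \<comment> \<open>Elements of an object preserve it, so the second claim applies to each of
    them.\<close>
  have self: "chain P [x] P" if "P \<in> \<Delta>" "x \<in> P" for P x
  proof -
    interpret finite_group "grp_on L S" p
      using group_grp_on[OF Sp] prime_p finite_subset[OF partial_subgroupD(1)[OF Sp] finite_L]
      by (simp add: finite_group_def finite_group_axioms_def)
    have xS: "x \<in> S" "P \<subseteq> S" using that subgroup.subset[OF PS[OF that(1)]] by auto
    have d: "P \<subseteq> conj_dom L x" using gconj_grp_on(2)[OF Sp] xS by blast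
    have "gconj (grp_on L S) y x = pconj L y x" if "y \<in> P" for y
      using gconj_grp_on(1)[OF Sp] that xS by blast
    then have "cset P x = (\<lambda>y. gconj (grp_on L S) y x) ` P" by (auto simp: pconj_set_def)
    moreover have "(\<lambda>y. gconj (grp_on L S) y x) ` P = P"
    proof (rule card_subset_eq)
      show "finite P" using finite_subgroup[OF PS[OF that(1)]] .
      show "(\<lambda>y. gconj (grp_on L S) y x) ` P \<subseteq> P" using subgroup_gconj_closed[OF PS[OF that(1)]] that(2) by blast
      show "card ((\<lambda>y. gconj (grp_on L S) y x) ` P) = card P" using card_gconj_image[of P x] xS by simp
    qed
    ultimately show ?thesis using that d xS partial_subgroupD(1)[OF Sp] by (auto simp: chain_single)
  qed
  have it: "chain P w R \<Longrightarrow> (\<lambda>x. wprod L (word_inv L w @ [x] @ w)) ` P = R" for P w R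
  proof (induction rule: chain.induct)
    case (chain_Nil P)
    have "wprod L [x] = x" if "x \<in> P" for x
      using prod_single that subgroup.subset[OF PS[OF chain_Nil]] partial_subgroupD(1)[OF Sp] by auto
    then show ?case by simp
  next
    case (chain_Cons P f w R)
    have Pf: "chain P [f] (cset P f)" using chain_Cons chain_objects by (auto simp: chain_single)
    have "wprod L (word_inv L (f # w) @ [x] @ f # w) = wprod L (word_inv L w @ [pconj L x f] @ w)" if x: "x \<in> P" for x
    proof -
      have "chain R (word_inv L w @ ([pinv L f] @ [x] @ [f]) @ w) R"
        using chain_inv[OF chain_Cons(4)] chain_inv_single[OF Pf] self[OF chain_Cons(1) x] Pf chain_Cons(4)
        by (auto simp: chain_append simp del: append_Cons append_Nil)
      then have "word_inv L w @ [pinv L f, x, f] @ w \<in> wdom L" using chain_dom by fastforce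
      from prod_append[OF this] show ?thesis by (simp add: word_inv_Cons pconj_def)
    qed
    then have "(\<lambda>x. wprod L (word_inv L (f # w) @ [x] @ f # w)) ` P =
        (\<lambda>x. wprod L (word_inv L w @ [x] @ w)) ` cset P f"
      by (simp add: pconj_set_def image_image)
    then show ?case using chain_Cons.IH by simp
  qed
  have Pd: "P \<in> \<Delta>" "R \<in> \<Delta>" using chain_objects assms by auto
  have "P \<subseteq> conj_dom L (wprod L w)" using 2 self[OF Pd(1)] by blast
  moreover have "cset P (wprod L w) = (\<lambda>x. wprod L (word_inv L w @ [x] @ w)) ` P"
    unfolding pconj_set_def using 2 self[OF Pd(1)] by (intro image_cong) auto
  ultimately show "chain P [wprod L w] R"
    using it[OF assms] Pd prod_closed[OF wd] by (simp add: chain_single)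
qed

lemma S_partial: "partial_subgroup L S" using S_p_subgroup by (simp add: p_subgroup_def)

lemma S_carrier: "S \<subseteq> carrier L" using partial_subgroupD(1)[OF S_partial] .

lemma finite_group_on: "partial_subgroup L H \<Longrightarrow> finite_group (grp_on L H) p"
  using group_grp_on prime_p finite_subset[OF partial_subgroupD(1) finite_L]
  by (simp add: finite_group_def finite_group_axioms_def)

sublocale S: finite_group "grp_on L S" p
  by (rule finite_group_on[OF S_partial])

abbreviation "sub P \<equiv> subgroup P (grp_on L S)"

lemma sub_S: "sub P \<Longrightarrow> P \<subseteq> S" using subgroup.subset by fastforce

lemma S_pconj: "x \<in> S \<Longrightarrow> s \<in> S \<Longrightarrow> pconj L x s = gconj (grp_on L S) x s"
  "x \<in> S \<Longrightarrow> s \<in> S \<Longrightarrow> x \<in> conj_dom L s"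
  using gconj_grp_on[OF S_partial] by auto

lemma S_chain: assumes P: "P \<in> \<Delta>" and s: "s \<in> S" shows "chain P [s] (cset P s)"
proof -
  have PS: "P \<subseteq> S" using sub_S objects P by blast
  have "cset P s = (\<lambda>x. gconj (grp_on L S) x s) ` P"
    unfolding pconj_set_def using S_pconj(1) s PS by (intro image_cong) auto
  then have "sub (cset P s)" using S.subgroup_gconj_image[OF objects[OF P]] s by simp
  moreover have "P \<subseteq> conj_dom L s" using S_pconj(2) s PS by blast
  ultimately show ?thesis using conj_closed[OF P] s S_carrier P by (auto simp: chain_single)
qed

lemma S_object: "S \<in> \<Delta>"
  using objects_nonempty overgroup_closed[OF _ S.subgroup_self] sub_S objects by fastforce

text \<open>Rests on \<open>g = x^-1 g x^g\<close>: conjugating successively by these three elements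
  takes the conjugate of \<open>P\<close> by \<open>x\<close> back to \<open>P\<close>, on to
  \<open>R\<close> and then to a conjugate of \<open>R\<close>, and the product of the word is
  \<open>g\<close>.\<close>

lemma S_sub_chain_conj:
  assumes P: "chain P [g] R" and x: "x \<in> S_sub L S g"
  shows "\<exists>R'. chain (cset P x) [g] R'"
proof -
  have g: "g \<in> carrier L" using P by (simp add: chain_single)
  have xS: "x \<in> S" "[pinv L g, x, g] \<in> wdom L" "pconj L x g \<in> S" "x \<in> carrier L"
    using x S_carrier by (auto simp: S_sub_def conj_dom_def)
  let ?f = "pconj L x g"
  obtain A B where "chain A [pinv L g, x, g] B" using dom_chain xS by blast
  then obtain A1 A2 where A: "chain A [pinv L g] A1" "chain A1 [x] A2" "chain A2 [g] B"
    using chain_append[of A "[pinv L g]" "[x, g]" B] chain_append[of _ "[x]" "[g]" B] by auto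
  have A1: "chain A1 [g] A" using chain_inv_single[OF A(1)] by (simp add: inv_inv g)
  have A2: "chain A2 [pinv L x] A1" using chain_inv_single[OF A(2)] .
  have "chain A2 ([pinv L x] @ [g] @ [pinv L g] @ [x] @ [g]) B"
    using A A1 A2 unfolding chain_append by blast
  then have d5: "[pinv L x] @ [g] @ [pinv L g] @ [x] @ [g] \<in> wdom L" by (rule chain_dom)
  have "chain A2 ([pinv L x] @ [x] @ [g]) B" using A A2 unfolding chain_append by blast
  then have d3: "[pinv L x] @ [x] @ [g] \<in> wdom L" by (rule chain_dom)
  have "wprod L [pinv L x, g, ?f] = wprod L ([pinv L x, g] @ [pinv L g, x, g] @ [])"
    using prod_append[of "[pinv L x, g]" "[pinv L g, x, g]" "[]"] d5 by (simp add: pconj_def)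
  also have "\<dots> = wprod L ([pinv L x] @ [g, pinv L g] @ [x, g])" by simp
  also have "\<dots> = wprod L ([pinv L x] @ [x, g])" using prod_cancel[of "[pinv L x]" g "[x, g]"] d5 d3 g by simp
  also have "\<dots> = wprod L ([] @ [g])" using prod_cancel'[of "[]" x "[g]"] d3 dom_single[OF g] xS by simp
  finally have prod: "wprod L [pinv L x, g, ?f] = g" using prod_single[OF g] by simp
  have "P \<in> \<Delta>" "R \<in> \<Delta>" using P chain_objects by blast+
  then have "chain (cset P x) [pinv L x] P" "chain R [?f] (cset R ?f)"
    using chain_inv_single S_chain xS by blast+
  then have "chain (cset P x) ([pinv L x] @ [g] @ [?f]) (cset R ?f)"
    using P unfolding chain_append by blast
  then have "chain (cset P x) [wprod L ([pinv L x] @ [g] @ [?f])] (cset R ?f)" by (rule chain_prod(1))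
  then show ?thesis using prod by auto
qed

text \<open>The domain conditions for \<open>x\<close> and \<open>y\<close> may come from unrelated
  chains. Shifting a chain for \<open>g\<close> first by \<open>x\<close> and then by
  \<open>y\<close> gives one chain that carries the whole word
  \<open>g^-1 x g g^-1 y g\<close>.\<close>

lemma S_sub_mult:
  assumes g: "g \<in> carrier L" and x: "x \<in> S_sub L S g" and y: "y \<in> S_sub L S g"
  shows "wprod L [x, y] \<in> S_sub L S g" "pconj L (wprod L [x, y]) g = wprod L [pconj L x g, pconj L y g]"
proof -
  have xy: "x \<in> S" "y \<in> S" "pconj L x g \<in> S" "pconj L y g \<in> S" "x \<in> carrier L" "y \<in> carrier L"
    using x y S_carrier by (auto simp: S_sub_def)
  obtain P R where P: "chain P [g] R" using dom_chain dom_single[OF g] by blast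
  obtain R1 where P1: "chain (cset P x) [g] R1" using S_sub_chain_conj[OF P x] by blast
  obtain R2 where P2: "chain (cset (cset P x) y) [g] R2" using S_sub_chain_conj[OF P1 y] by blast
  have Pd: "P \<in> \<Delta>" "cset P x \<in> \<Delta>" using chain_objects P P1 by blast+
  have c: "chain R [pinv L g] P" "chain P [x] (cset P x)" "chain R1 [pinv L g] (cset P x)"
     "chain (cset P x) [y] (cset (cset P x) y)"
    using chain_inv_single P P1 S_chain Pd xy by blast+
  have "chain R ([pinv L g] @ [x] @ [g] @ [pinv L g] @ [y] @ [g]) R2"
    using c P1 P2 unfolding chain_append by blast
  then have d6: "[pinv L g, x, g, pinv L g, y, g] \<in> wdom L" using chain_dom by fastforce
  have "chain R ([pinv L g] @ [x] @ [y] @ [g]) R2" using c P2 unfolding chain_append by blast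
  then have d4: "[pinv L g, x, y, g] \<in> wdom L" using chain_dom by fastforce
  have e: "[pinv L g, wprod L [x, y], g] \<in> wdom L" "wprod L [pinv L g, wprod L [x, y], g] = wprod L [pinv L g, x, y, g]"
    using prod_append[of "[pinv L g]" "[x, y]" "[g]"] d4 by auto
  have "wprod L [pinv L g, x, g, pinv L g, y, g] = wprod L ([pinv L g, x, g] @ [pconj L y g])"
    "[pinv L g, x, g] @ [pconj L y g] \<in> wdom L"
    using prod_append[of "[pinv L g, x, g]" "[pinv L g, y, g]" "[]"] d6 by (auto simp: pconj_def)
  moreover from this(2) have "wprod L ([pinv L g, x, g] @ [pconj L y g]) = wprod L [pconj L x g, pconj L y g]"
    using prod_append[of "[]" "[pinv L g, x, g]" "[pconj L y g]"] by (simp add: pconj_def)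
  moreover have "wprod L [pinv L g, x, g, pinv L g, y, g] = wprod L [pinv L g, x, y, g]"
    using prod_cancel[of "[pinv L g, x]" g "[y, g]"] d6 d4 g by simp
  ultimately show eq: "pconj L (wprod L [x, y]) g = wprod L [pconj L x g, pconj L y g]"
    using e by (simp add: pconj_def)
  have "wprod L [x, y] \<in> S" "wprod L [pconj L x g, pconj L y g] \<in> S"
    using partial_subgroupD(3)[OF S_partial] xy by auto
  then show "wprod L [x, y] \<in> S_sub L S g"
    using eq e S_carrier by (auto simp: S_sub_def conj_dom_def)
qed

lemma S_sub_inv:
  assumes g: "g \<in> carrier L" and x: "x \<in> S_sub L S g"
  shows "pinv L x \<in> S_sub L S g" "pconj L (pinv L x) g = pinv L (pconj L x g)"
proof -
  have d: "[pinv L g, x, g] \<in> wdom L" "x \<in> S" "pconj L x g \<in> S" using x by (auto simp: S_sub_def conj_dom_def)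
  have w: "word_inv L [pinv L g, x, g] = [pinv L g, pinv L x, g]" by (simp add: word_inv_def inv_inv g)
  show eq: "pconj L (pinv L x) g = pinv L (pconj L x g)"
    using wprod_word_inv[OF d(1)] w by (simp add: pconj_def)
  have "pinv L x \<in> S" "pinv L (pconj L x g) \<in> S" using partial_subgroupD(4)[OF S_partial] d by auto
  then show "pinv L x \<in> S_sub L S g"
    using eq word_inv_dom[OF d(1)] w S_carrier by (auto simp: S_sub_def conj_dom_def)
qed

lemma sub_S_sub: assumes g: "g \<in> carrier L" shows "sub (S_sub L S g)"
proof
  have sS: "S_sub L S g \<subseteq> S" by (auto simp: S_sub_def)
  show "S_sub L S g \<subseteq> carrier (grp_on L S)" using sS by simp
  show "\<one>\<^bsub>grp_on L S\<^esub> \<in> S_sub L S g"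
    using one_pconj[OF g] partial_subgroupD(5)[OF S_partial] by (simp add: S_sub_def)
  show "x \<otimes>\<^bsub>grp_on L S\<^esub> y \<in> S_sub L S g" if "x \<in> S_sub L S g" "y \<in> S_sub L S g" for x y
    using S_sub_mult(1)[OF g that] subsetD[OF sS that(1)] subsetD[OF sS that(2)] by simp
  show "inv\<^bsub>grp_on L S\<^esub> x \<in> S_sub L S g" if "x \<in> S_sub L S g" for x
    using S_sub_inv(1)[OF g that] that sS inv_grp_on[OF S_partial] by auto
qed

lemma sub_cset:
  assumes g: "g \<in> carrier L" and P: "sub P" "P \<subseteq> S_sub L S g" shows "sub (cset P g)"
proof
  have PS: "\<And>x. x \<in> P \<Longrightarrow> pconj L x g \<in> S" "P \<subseteq> S" using P by (auto simp: S_sub_def)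
  show "cset P g \<subseteq> carrier (grp_on L S)" using PS by (auto simp: pconj_set_def)
  have "wprod L [] \<in> P" using subgroup.one_closed[OF P(1)] by simp
  then show "\<one>\<^bsub>grp_on L S\<^esub> \<in> cset P g" using one_pconj(2)[OF g] by (force simp: pconj_set_def)
  show "a \<otimes>\<^bsub>grp_on L S\<^esub> b \<in> cset P g" if "a \<in> cset P g" "b \<in> cset P g" for a b
  proof -
    obtain x y where xy: "x \<in> P" "y \<in> P" "a = pconj L x g" "b = pconj L y g" using \<open>a \<in> _\<close> \<open>b \<in> _\<close> by (auto simp: pconj_set_def)
    have "x \<otimes>\<^bsub>grp_on L S\<^esub> y \<in> P" using subgroup.m_closed[OF P(1)] xy by blast
    moreover have "x \<otimes>\<^bsub>grp_on L S\<^esub> y = wprod L [x, y]" using xy(1,2) PS(2) by (simp add: subset_iff)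
    moreover have "pconj L (wprod L [x, y]) g = a \<otimes>\<^bsub>grp_on L S\<^esub> b"
      using S_sub_mult(2)[OF g, of x y] xy P PS by auto
    ultimately show ?thesis by (force simp: pconj_set_def)
  qed
  show "inv\<^bsub>grp_on L S\<^esub> a \<in> cset P g" if "a \<in> cset P g" for a
  proof -
    obtain x where x: "x \<in> P" "a = pconj L x g" using \<open>a \<in> _\<close> by (auto simp: pconj_set_def)
    have "inv\<^bsub>grp_on L S\<^esub> x \<in> P" using subgroup.m_inv_closed[OF P(1)] x by blast
    moreover have "inv\<^bsub>grp_on L S\<^esub> x = pinv L x" using x PS inv_grp_on[OF S_partial] by auto
    moreover have "pconj L (pinv L x) g = inv\<^bsub>grp_on L S\<^esub> a"
      using S_sub_inv(2)[OF g, of x] x P PS inv_grp_on[OF S_partial] by auto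
    ultimately show ?thesis by (force simp: pconj_set_def)
  qed
qed

lemma chain_S_sub: "chain P [g] R \<Longrightarrow> P \<subseteq> S_sub L S g"
  using sub_S[OF objects, of P] sub_S[OF objects, of R] by (force simp: chain_single S_sub_def pconj_set_def)

lemma S_sub_object: assumes "g \<in> carrier L" shows "S_sub L S g \<in> \<Delta>"
proof -
  obtain P R where P: "chain P [g] R" using dom_chain dom_single[OF assms] by blast
  then show ?thesis using overgroup_closed[OF _ sub_S_sub[OF assms]] chain_S_sub chain_objects by blast
qed

lemma chainI: assumes "P \<in> \<Delta>" "g \<in> carrier L" "P \<subseteq> S_sub L S g" shows "chain P [g] (cset P g)"
proof -
  have "P \<subseteq> conj_dom L g" using assms(3) by (auto simp: S_sub_def)
  then show ?thesis
    using conj_closed[OF assms(1,2) _ sub_cset[OF assms(2) objects[OF assms(1)] assms(3)]] assms(1,2)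
    by (simp add: chain_single)
qed

subsection \<open>The fusion system of a locality\<close>

text \<open>Conjugation letter by letter rather than by a product, because composites of conjugation
  maps arise also from words outside the domain.\<close>

fun cw :: "'a list \<Rightarrow> 'a \<Rightarrow> 'a" where
  "cw [] x = x"
| "cw (g # w) x = cw w (pconj L x g)"

fun Sw :: "'a list \<Rightarrow> 'a set" where
  "Sw [] = S"
| "Sw (g # w) = {x \<in> S_sub L S g. pconj L x g \<in> Sw w}"

lemma cw_append: "cw (u @ v) x = cw v (cw u x)"
  by (induction u arbitrary: x) auto

lemma Sw_sub: "Sw w \<subseteq> S"
  by (cases w) (auto simp: S_sub_def)

lemma cw_closed: "x \<in> Sw w \<Longrightarrow> cw w x \<in> S"
  by (induction w arbitrary: x) auto

lemma Sw_append: "x \<in> Sw (u @ v) \<longleftrightarrow> x \<in> Sw u \<and> cw u x \<in> Sw v"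
  using Sw_sub by (induction u arbitrary: x) auto

lemma Sw_mult:
  assumes "w \<in> lists (carrier L)" "x \<in> Sw w" "y \<in> Sw w"
  shows "x \<otimes>\<^bsub>grp_on L S\<^esub> y \<in> Sw w" "cw w (x \<otimes>\<^bsub>grp_on L S\<^esub> y) = cw w x \<otimes>\<^bsub>grp_on L S\<^esub> cw w y"
proof -
  have "x \<otimes>\<^bsub>grp_on L S\<^esub> y \<in> Sw w \<and> cw w (x \<otimes>\<^bsub>grp_on L S\<^esub> y) = cw w x \<otimes>\<^bsub>grp_on L S\<^esub> cw w y"
    using assms
  proof (induction w arbitrary: x y)
    case Nil then show ?case using S.m_closed by simp
  next
    case (Cons g w)
    have "g \<in> carrier L" using Cons.hyps(1) by simp
    then have xy: "x \<in> S_sub L S g" "y \<in> S_sub L S g" "g \<in> carrier L" "x \<in> S" "y \<in> S" "pconj L x g \<in> S" "pconj L y g \<in> S"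
      using Cons.prems by (auto simp: S_sub_def)
    have "x \<otimes>\<^bsub>grp_on L S\<^esub> y \<in> S_sub L S g" "pconj L (x \<otimes>\<^bsub>grp_on L S\<^esub> y) g = pconj L x g \<otimes>\<^bsub>grp_on L S\<^esub> pconj L y g"
      using S_sub_mult[OF xy(3,1,2)] xy by auto
    then show ?case using Cons by auto
  qed
  then show "x \<otimes>\<^bsub>grp_on L S\<^esub> y \<in> Sw w" "cw w (x \<otimes>\<^bsub>grp_on L S\<^esub> y) = cw w x \<otimes>\<^bsub>grp_on L S\<^esub> cw w y" by auto
qed

lemma Sw_word_inv:
  assumes "w \<in> lists (carrier L)" "x \<in> Sw w"
  shows "cw w x \<in> Sw (word_inv L w)" "cw (word_inv L w) (cw w x) = x"
proof -
  have "cw w x \<in> Sw (word_inv L w) \<and> cw (word_inv L w) (cw w x) = x"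
    using assms
  proof (induction w arbitrary: x)
    case Nil then show ?case by simp
  next
    case (Cons g w)
    have "g \<in> carrier L" using Cons.hyps(1) by simp
    then have g: "g \<in> carrier L" "x \<in> conj_dom L g" "x \<in> S" "pconj L x g \<in> S" "pconj L x g \<in> Sw w"
      using Cons.prems by (auto simp: S_sub_def)
    have "pconj L x g \<in> Sw [pinv L g]" "cw [pinv L g] (pconj L x g) = x"
      using pconj_pinv[OF g(1,2)] g by (auto simp: S_sub_def)
    then show ?case using Cons.IH[OF g(5)] Cons.prems by (auto simp: word_inv_Cons Sw_append cw_append)
  qed
  then show "cw w x \<in> Sw (word_inv L w)" "cw (word_inv L w) (cw w x) = x" by auto
qed

text \<open>A concrete form of the generated fusion system: conjugation along arbitrary words on
  subgroups whose successive conjugates stay in \<open>S\<close>. Concatenated words give composites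
  and inverse words give inverses.\<close>

definition word_fusion :: "'a fusion" where
  "word_fusion = \<lparr>fgrp = grp_on L S, fhom = (\<lambda>P R. {\<phi>. sub P \<and> sub R \<and> \<phi> \<in> extensional P \<and> \<phi> ` P \<subseteq> R \<and>
     (\<exists>w\<in>lists (carrier L). P \<subseteq> Sw w \<and> (\<forall>x\<in>P. \<phi> x = cw w x))})\<rparr>"

lemma word_fusion_iff: "\<phi> \<in> fhom word_fusion P R \<longleftrightarrow> sub P \<and> sub R \<and> \<phi> \<in> extensional P \<and> \<phi> ` P \<subseteq> R \<and>
     (\<exists>w\<in>lists (carrier L). P \<subseteq> Sw w \<and> (\<forall>x\<in>P. \<phi> x = cw w x))"
  by (simp add: word_fusion_def)

lemma fgrp_word_fusion [simp]: "fgrp word_fusion = grp_on L S"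
  by (simp add: word_fusion_def)

lemma word_image_sub:
  assumes w: "w \<in> lists (carrier L)" and P: "sub P" "P \<subseteq> Sw w" shows "sub (cw w ` P)"
  using P
proof -
  interpret PG: group "grp_on L S\<lparr>carrier := P\<rparr>" using S.subgroup_imp_group[OF P(1)] .
  interpret h: group_hom "grp_on L S\<lparr>carrier := P\<rparr>" "grp_on L S" "cw w"
    by unfold_locales (use Sw_mult(2)[OF w] cw_closed P in \<open>auto simp: hom_def subset_iff\<close>)
  show ?thesis using h.img_is_subgroup by simp
qed

lemma fusion_system_word_fusion: "fusion_system p word_fusion"
proof (rule fusion_system.intro)
  show "prime p" by (rule prime_p)
  show "group (fgrp word_fusion)" using S.is_group by simp
  show "finite (carrier (fgrp word_fusion))" using S.fin by simp
  show "\<exists>n. order (fgrp word_fusion) = p ^ n" using S_p_subgroup by (simp add: p_subgroup_def order_def)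
  show "subgroup P (fgrp word_fusion) \<and> subgroup R (fgrp word_fusion)" if "\<phi> \<in> fhom word_fusion P R" for \<phi> P R
    using that by (simp add: word_fusion_iff)
  show "\<phi> \<in> extensional P \<and> \<phi> \<in> hom (fgrp word_fusion\<lparr>carrier := P\<rparr>) (fgrp word_fusion\<lparr>carrier := R\<rparr>) \<and> inj_on \<phi> P"
    if h: "\<phi> \<in> fhom word_fusion P R" for \<phi> P R
  proof -
    obtain w where w: "w \<in> lists (carrier L)" "P \<subseteq> Sw w" "\<forall>x\<in>P. \<phi> x = cw w x" "sub P" "\<phi> ` P \<subseteq> R" "\<phi> \<in> extensional P"
      using h unfolding word_fusion_iff by blast
    have "\<phi> (x \<otimes>\<^bsub>grp_on L S\<^esub> y) = \<phi> x \<otimes>\<^bsub>grp_on L S\<^esub> \<phi> y" if "x \<in> P" "y \<in> P" for x y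
      using Sw_mult(2)[OF w(1), of x y] w that subgroup.m_closed[OF w(4) that] by auto
    then have "\<phi> \<in> hom (fgrp word_fusion\<lparr>carrier := P\<rparr>) (fgrp word_fusion\<lparr>carrier := R\<rparr>)"
      using w(5) by (auto simp: hom_def)
    moreover have "inj_on \<phi> P"
      by (rule inj_on_inverseI[where g = "cw (word_inv L w)"]) (use Sw_word_inv(2)[OF w(1)] w in auto)
    ultimately show ?thesis using w by blast
  qed
  show "(\<lambda>x\<in>P. gconj (fgrp word_fusion) x g) \<in> fhom word_fusion P R"
    if h: "subgroup P (fgrp word_fusion)" "subgroup R (fgrp word_fusion)" "g \<in> carrier (fgrp word_fusion)"
      "\<forall>x\<in>P. gconj (fgrp word_fusion) x g \<in> R" for P R g
  proof -
    have P: "sub P" "sub R" "g \<in> S" "\<forall>x\<in>P. gconj (grp_on L S) x g \<in> R" "P \<subseteq> S" "R \<subseteq> S" using h sub_S by auto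
    have "P \<subseteq> Sw [g]" using P S_pconj S.gconj_closed by (auto simp: S_sub_def)
    moreover have "\<forall>x\<in>P. gconj (grp_on L S) x g = cw [g] x" using S_pconj P by auto
    ultimately show ?thesis unfolding word_fusion_iff
      using P S_carrier by (intro conjI bexI[of _ "[g]"]) auto
  qed
  show "compose P \<psi> \<phi> \<in> fhom word_fusion P T"
    if h: "\<phi> \<in> fhom word_fusion P R" "\<psi> \<in> fhom word_fusion R T" for \<phi> \<psi> P R T
  proof -
    obtain w where w: "w \<in> lists (carrier L)" "P \<subseteq> Sw w" "\<forall>x\<in>P. \<phi> x = cw w x" "sub P" "\<phi> ` P \<subseteq> R"
      using h unfolding word_fusion_iff by blast
    obtain v where v: "v \<in> lists (carrier L)" "R \<subseteq> Sw v" "\<forall>x\<in>R. \<psi> x = cw v x" "sub T" "\<psi> ` R \<subseteq> T"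
      using h unfolding word_fusion_iff by blast
    have \<phi>R: "\<phi> x \<in> R" "\<phi> x = cw w x" "x \<in> Sw w" if "x \<in> P" for x using that w by auto
    have \<psi>T: "\<psi> x \<in> T" "\<psi> x = cw v x" "x \<in> Sw v" if "x \<in> R" for x using that v by auto
    have "P \<subseteq> Sw (w @ v)"
    proof
      fix x assume "x \<in> P"
      then show "x \<in> Sw (w @ v)" using \<phi>R[of x] \<psi>T(3)[of "\<phi> x"] by (simp add: Sw_append)
    qed
    moreover have "\<forall>x\<in>P. compose P \<psi> \<phi> x = cw (w @ v) x"
      using \<phi>R(1,2) \<psi>T(2) by (simp add: compose_def cw_append)
    moreover have "compose P \<psi> \<phi> ` P \<subseteq> T" using \<phi>R(1) \<psi>T(1) by (auto simp: compose_def)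
    ultimately show ?thesis unfolding word_fusion_iff
      using w v by (intro conjI bexI[of _ "w @ v"]) auto
  qed
  show "\<phi> \<in> fhom word_fusion P (\<phi> ` P) \<and> (\<lambda>y\<in>\<phi> ` P. inv_into P \<phi> y) \<in> fhom word_fusion (\<phi> ` P) P"
    if h: "\<phi> \<in> fhom word_fusion P R" for \<phi> P R
  proof -
    obtain w where w: "w \<in> lists (carrier L)" "P \<subseteq> Sw w" "\<forall>x\<in>P. \<phi> x = cw w x" "sub P" "\<phi> ` P \<subseteq> R" "\<phi> \<in> extensional P"
      using h unfolding word_fusion_iff by blast
    have im: "\<phi> ` P = cw w ` P" using w(3) by (intro image_cong) auto
    have s: "sub (\<phi> ` P)" unfolding im using word_image_sub[OF w(1,4,2)] .
    have inv: "inv_into P \<phi> y \<in> P" "\<phi> (inv_into P \<phi> y) = y" if "y \<in> \<phi> ` P" for y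
      using that by (auto simp: inv_into_into f_inv_into_f)
    have eq: "y \<in> Sw (word_inv L w)" "inv_into P \<phi> y = cw (word_inv L w) y" if y: "y \<in> \<phi> ` P" for y
    proof -
      let ?x = "inv_into P \<phi> y"
      have x: "?x \<in> P" "cw w ?x = y" "?x \<in> Sw w" using inv[OF y] w by auto
      show "y \<in> Sw (word_inv L w)" "?x = cw (word_inv L w) y"
        using Sw_word_inv[OF w(1) x(3)] x(2) by auto
    qed
    have 1: "\<phi> \<in> fhom word_fusion P (\<phi> ` P)"
      unfolding word_fusion_iff using w s by blast
    have "(\<lambda>y\<in>\<phi> ` P. inv_into P \<phi> y) \<in> fhom word_fusion (\<phi> ` P) P"
      unfolding word_fusion_iff
    proof (intro conjI bexI[of _ "word_inv L w"])
      show "(\<lambda>y\<in>\<phi> ` P. inv_into P \<phi> y) ` \<phi> ` P \<subseteq> P" using inv(1) by auto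
      show "\<phi> ` P \<subseteq> Sw (word_inv L w)" using eq(1) by blast
      show "\<forall>x\<in>\<phi> ` P. (\<lambda>y\<in>\<phi> ` P. inv_into P \<phi> y) x = cw (word_inv L w) x" using eq(2) by simp
      show "word_inv L w \<in> lists (carrier L)" using word_inv_lists w(1) .
    qed (use s w in auto)
    then show ?thesis using 1 by blast
  qed
qed

text \<open>\<open>word_fusion\<close> is one of the systems being intersected, and each of those
  systems contains every word map as a composite of its generators.\<close>

lemma locality_fusion_eq: "locality_fusion p L S = word_fusion"
proof -
  interpret W: fusion_system p word_fusion by (rule fusion_system_word_fusion)
  have gen: "(\<lambda>x\<in>S_sub L S g. pconj L x g) \<in> fhom word_fusion (S_sub L S g) S" if g: "g \<in> carrier L" for g
    unfolding word_fusion_iff using sub_S_sub[OF g] S.subgroup_self g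
    by (intro conjI bexI[of _ "[g]"]) (auto simp: S_sub_def)
  have "fhom word_fusion P R = \<Inter>{fhom E P R | E. fusion_system p E \<and> fgrp E = grp_on L S \<and>
        (\<forall>g\<in>carrier L. (\<lambda>x\<in>S_sub L S g. pconj L x g) \<in> fhom E (S_sub L S g) S)}" for P R
  proof
    show "\<Inter>{fhom E P R | E. fusion_system p E \<and> fgrp E = grp_on L S \<and>
        (\<forall>g\<in>carrier L. (\<lambda>x\<in>S_sub L S g. pconj L x g) \<in> fhom E (S_sub L S g) S)} \<subseteq> fhom word_fusion P R"
      using gen fusion_system_word_fusion by (intro Inter_lower) auto
    show "fhom word_fusion P R \<subseteq> \<Inter>{fhom E P R | E. fusion_system p E \<and> fgrp E = grp_on L S \<and>
        (\<forall>g\<in>carrier L. (\<lambda>x\<in>S_sub L S g. pconj L x g) \<in> fhom E (S_sub L S g) S)}"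
    proof (intro subsetI InterI)
      fix \<phi> X assume \<phi>: "\<phi> \<in> fhom word_fusion P R" and "X \<in> {fhom E P R | E. fusion_system p E \<and> fgrp E = grp_on L S \<and>
        (\<forall>g\<in>carrier L. (\<lambda>x\<in>S_sub L S g. pconj L x g) \<in> fhom E (S_sub L S g) S)}"
      then obtain E where E: "X = fhom E P R" "fusion_system p E" "fgrp E = grp_on L S"
        "\<forall>g\<in>carrier L. (\<lambda>x\<in>S_sub L S g. pconj L x g) \<in> fhom E (S_sub L S g) S" by blast
      interpret E: fusion_system p E by (rule E(2))
      have step: "fmor E (S_sub L S g) (\<lambda>x. pconj L x g)" if "g \<in> carrier L" for g
        using E(4) that E(3) by (simp add: fmor_def)
      have word: "fmor E P (cw w)" if "w \<in> lists (carrier L)" "sub P" "P \<subseteq> Sw w" for w P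
        using that
      proof (induction w arbitrary: P)
        case Nil then show ?case using E.fmor_id[of P] E(3) by simp
      next
        case (Cons g w)
        have "g \<in> carrier L" using Cons.hyps(1) by simp
        then have P: "P \<subseteq> S_sub L S g" "g \<in> carrier L" using Cons.prems by auto
        have 1: "fmor E P (\<lambda>x. pconj L x g)" using E.fmor_mono[OF step[OF P(2)] _ P(1)] Cons.prems E(3) by simp
        have "sub ((\<lambda>x. pconj L x g) ` P)" using E.fmor_image_all[OF 1] E(3) by simp
        moreover have "(\<lambda>x. pconj L x g) ` P \<subseteq> Sw w" using Cons.prems by auto
        ultimately have "fmor E ((\<lambda>x. pconj L x g) ` P) (cw w)" using Cons by auto
        from E.fmor_comp[OF 1 this] show ?case by simp
      qed
      obtain w where w: "w \<in> lists (carrier L)" "P \<subseteq> Sw w" "\<forall>x\<in>P. \<phi> x = cw w x" "sub P" "sub R" "\<phi> ` P \<subseteq> R" "\<phi> \<in> extensional P"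
        using \<phi> unfolding word_fusion_iff by blast
      have "fmor E P \<phi>" using word[OF w(1,4,2)] E.fmor_cong[of P \<phi> "cw w"] w(3) by simp
      then show "\<phi> \<in> X" using E w by (simp add: E.fhom_iff)
    qed
  qed
  then show ?thesis unfolding locality_fusion_def word_fusion_def
    by (simp add: fun_eq_iff word_fusion_def)
qed

abbreviation "F \<equiv> locality_fusion p L S"

sublocale F: fusion_system p F
  rewrites "fgrp F = grp_on L S" and "carrier (grp_on L S) = S"
proof -
  show "fusion_system p F" by (simp add: locality_fusion_eq fusion_system_word_fusion)
qed (simp_all add: locality_fusion_def)

lemma fmor_iff: "fmor F P f \<longleftrightarrow> sub P \<and> (\<exists>w\<in>lists (carrier L). P \<subseteq> Sw w \<and> (\<forall>x\<in>P. f x = cw w x))"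
proof -
  have "f x \<in> S" if "P \<subseteq> Sw w" "\<forall>x\<in>P. f x = cw w x" "x \<in> P" for w x using that cw_closed by auto
  then show ?thesis using S.subgroup_self
    by (auto simp: fmor_def locality_fusion_eq word_fusion_iff)
qed

end

subsection \<open>Normalizers of objects\<close>

context locality
begin

abbreviation "NS \<equiv> normalizer (grp_on L S)"
abbreviation "CS \<equiv> gcentralizer (grp_on L S)"
abbreviation "NL \<equiv> pnormalizer L"
abbreviation "CL \<equiv> pcentralizer L"
abbreviation "GL P \<equiv> grp_on L (pnormalizer L P)"

lemma finite_S [simp]: "finite S"
  using S.fin by simp

lemma mem_NL_iff: "P \<in> \<Delta> \<Longrightarrow> x \<in> NL P \<longleftrightarrow> chain P [x] P"
  by (auto simp: pnormalizer_def chain_single)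

lemma NL_carrier: "NL X \<subseteq> carrier L"
  by (auto simp: pnormalizer_def)

lemma NL_partial: assumes P: "P \<in> \<Delta>" shows "partial_subgroup L (NL P)"
proof -
  have ch: "chain P w P" if "w \<in> lists (NL P)" for w
    using that
  proof (induction w)
    case Nil then show ?case using P by (simp add: chain_Nil)
  next
    case (Cons x w)
    have "chain P ([x] @ w) P" unfolding chain_append using Cons mem_NL_iff[OF P] by blast
    then show ?case by simp
  qed
  have "pinv L x \<in> NL P" if "x \<in> NL P" for x
    using that chain_inv_single by (auto simp: mem_NL_iff[OF P])
  moreover have "w \<in> wdom L \<and> wprod L w \<in> NL P" if "w \<in> lists (NL P)" for w
    using chain_dom[OF ch[OF that]] chain_prod(1)[OF ch[OF that]] by (simp add: mem_NL_iff[OF P])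
  moreover from this[of "[]"] have "NL P \<noteq> {}" by auto
  ultimately show ?thesis using NL_carrier unfolding partial_subgroup_def by blast
qed

lemma finite_group_GL: "P \<in> \<Delta> \<Longrightarrow> finite_group (GL P) p"
  by (rule finite_group_on[OF NL_partial])

lemma chain_conj:
  assumes g: "chain P [g] R" and x: "x \<in> NL P"
  shows "x \<in> conj_dom L g" "pconj L x g \<in> NL R"
proof -
  have P: "P \<in> \<Delta>" "R \<in> \<Delta>" using chain_objects g by blast+
  have "chain R ([pinv L g] @ [x] @ [g]) R"
    unfolding chain_append using chain_inv_single[OF g] x g mem_NL_iff[OF P(1)] by blast
  then have c: "chain R [pinv L g, x, g] R" by simp
  then show "x \<in> conj_dom L g" using chain_dom subsetD[OF NL_carrier x] by (auto simp: conj_dom_def)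
  show "pconj L x g \<in> NL R" using chain_prod(1)[OF c] by (simp add: mem_NL_iff[OF P(2)] pconj_def)
qed

lemma chain_comp:
  assumes g: "chain P [g] R" and h: "chain R [h] T"
  shows "chain P [wprod L [g, h]] T" "x \<in> NL P \<Longrightarrow> pconj L x (wprod L [g, h]) = pconj L (pconj L x g) h"
proof -
  have P: "P \<in> \<Delta>" using chain_objects g by blast
  have c: "chain P ([g] @ [h]) T" unfolding chain_append using g h by blast
  then show "chain P [wprod L [g, h]] T" using chain_prod(1) by fastforce
  assume x: "x \<in> NL P"
  then have xc: "chain P [x] P" using mem_NL_iff[OF P] by blast
  have "pconj L x (wprod L [g, h]) = wprod L ([pinv L h] @ [pinv L g, x, g] @ [h])"
    using chain_prod(2)[OF c xc] by (simp add: word_inv_def)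
  moreover have "chain T ([pinv L h] @ ([pinv L g] @ [x] @ [g]) @ [h]) T"
    unfolding chain_append using chain_inv_single[OF g] chain_inv_single[OF h] xc g h by blast
  then have "[pinv L h] @ [pinv L g, x, g] @ [h] \<in> wdom L" using chain_dom by fastforce
  ultimately show "pconj L x (wprod L [g, h]) = pconj L (pconj L x g) h"
    using prod_append[of "[pinv L h]" "[pinv L g, x, g]" "[h]"] by (simp add: pconj_def)
qed

lemma chain_conj_mult:
  assumes g: "chain P [g] R" and x: "x \<in> NL P" "y \<in> NL P"
  shows "pconj L (wprod L [x, y]) g = wprod L [pconj L x g, pconj L y g]"
proof -
  have P: "P \<in> \<Delta>" and gc: "g \<in> carrier L" using g by (auto simp: chain_single)
  have xc: "chain P [x] P" "chain P [y] P" using x mem_NL_iff[OF P] by auto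
  note gi = chain_inv_single[OF g]
  have "chain R ([pinv L g] @ [x] @ [g] @ [pinv L g] @ [y] @ [g]) R"
    unfolding chain_append using gi xc g by blast
  then have d6: "[pinv L g, x, g, pinv L g, y, g] \<in> wdom L" using chain_dom by fastforce
  have "chain R ([pinv L g] @ [x] @ [y] @ [g]) R" unfolding chain_append using gi xc g by blast
  then have d4: "[pinv L g, x, y, g] \<in> wdom L" using chain_dom by fastforce
  have "wprod L [pinv L g, x, g, pinv L g, y, g] = wprod L [pconj L x g, pconj L y g]"
    using prod_two(2)[of "[pinv L g, x, g]" "[pinv L g, y, g]"] d6 by (simp add: pconj_def)
  moreover have "wprod L [pinv L g, x, g, pinv L g, y, g] = wprod L [pinv L g, x, y, g]"
    using prod_cancel[of "[pinv L g, x]" g "[y, g]"] d6 d4 gc by simp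
  moreover have "wprod L [pinv L g, wprod L [x, y], g] = wprod L [pinv L g, x, y, g]"
    using prod_append[of "[pinv L g]" "[x, y]" "[g]"] d4 by simp
  ultimately show ?thesis by (simp add: pconj_def)
qed

lemma chain_group_hom:
  assumes g: "chain P [g] R" shows "group_hom (GL P) (GL R) (\<lambda>x. pconj L x g)"
proof -
  have P: "P \<in> \<Delta>" "R \<in> \<Delta>" using chain_objects g by blast+
  interpret GP: finite_group "GL P" p using finite_group_GL[OF P(1)] .
  interpret GR: finite_group "GL R" p using finite_group_GL[OF P(2)] .
  show ?thesis
    by unfold_locales (use chain_conj[OF g] chain_conj_mult[OF g] in \<open>auto simp: hom_def\<close>)
qed

lemma chain_conj_back: assumes "chain P [g] R" "x \<in> NL P" shows "pconj L (pconj L x g) (pinv L g) = x"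
  using chain_conj(1)[OF assms] pconj_pinv(2) assms(1) by (simp add: chain_single)

lemma chain_conj_inj: "chain P [g] R \<Longrightarrow> inj_on (\<lambda>x. pconj L x g) (NL P)"
  by (rule inj_on_inverseI[where g = "\<lambda>x. pconj L x (pinv L g)"]) (rule chain_conj_back)

lemma GL_gconj: assumes P: "P \<in> \<Delta>" and x: "x \<in> NL P" "g \<in> NL P" shows "gconj (GL P) x g = pconj L x g"
  using gconj_grp_on(1)[OF NL_partial[OF P] x] .

lemma NS_eq: assumes P: "sub P" shows "NS P = S \<inter> NL P"
proof -
  have PS: "P \<subseteq> S" using sub_S[OF P] .
  have eq: "cset P g = (\<lambda>x. gconj (grp_on L S) x g) ` P" if "g \<in> S" for g
    unfolding pconj_set_def using S_pconj(1) that PS by (intro image_cong) auto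
  have "g \<in> NL P \<longleftrightarrow> g \<in> NS P" if g: "g \<in> S" for g
  proof -
    have "P \<subseteq> conj_dom L g" using S_pconj(2) g PS by blast
    then have "g \<in> NL P \<longleftrightarrow> (\<lambda>x. gconj (grp_on L S) x g) ` P = P"
      using eq[OF g] g S_carrier by (auto simp: pnormalizer_def)
    also have "\<dots> \<longleftrightarrow> g \<in> NS P"
      using F.NS_image[OF P, of g] F.mem_NS_iff[OF P, of g] g by auto
    finally show ?thesis .
  qed
  moreover have "NS P \<subseteq> S" using F.NS_sub[OF P] .
  ultimately show ?thesis by blast
qed

lemma CS_eq: assumes P: "sub P" shows "CS P = S \<inter> CL P"
proof -
  have PS: "P \<subseteq> S" using sub_S[OF P] .
  have "g \<in> CL P \<longleftrightarrow> (\<forall>x\<in>P. gconj (grp_on L S) x g = x)" if g: "g \<in> S" for g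
  proof -
    have "P \<subseteq> conj_dom L g" using S_pconj(2) g PS by blast
    moreover have "pconj L x g = gconj (grp_on L S) x g" if "x \<in> P" for x using S_pconj(1) g PS that by blast
    ultimately show ?thesis using g S_carrier by (auto simp: pcentralizer_def)
  qed
  then show ?thesis using F.mem_CS_iff[OF PS] by auto
qed

lemma CL_sub_NL: "CL X \<subseteq> NL X"
  by (auto simp: pcentralizer_def pnormalizer_def pconj_set_def)

lemma obj_sub_NL: "P \<in> \<Delta> \<Longrightarrow> P \<subseteq> NL P"
  using F.sub_NS[OF objects] NS_eq[OF objects] by blast

text \<open>Both group structures come from the product of the partial group, so being a subgroup
  does not depend on the surrounding group.\<close>

lemma sub_of_S: assumes "partial_subgroup L H" "K \<subseteq> H" "K \<subseteq> S"
  shows "subgroup K (grp_on L H) \<longleftrightarrow> sub K"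
proof -
  have gen: "subgroup K (grp_on L H2)" if H: "partial_subgroup L H1" "partial_subgroup L H2" "K \<subseteq> H1" "K \<subseteq> H2"
    "subgroup K (grp_on L H1)" for H1 H2
  proof
    show "K \<subseteq> carrier (grp_on L H2)" using H by simp
    show "\<one>\<^bsub>grp_on L H2\<^esub> \<in> K" using subgroup.one_closed[OF H(5)] by simp
    show "x \<otimes>\<^bsub>grp_on L H2\<^esub> y \<in> K" if "x \<in> K" "y \<in> K" for x y
      using subgroup.m_closed[OF H(5) that] that H(3,4) by (simp add: subset_iff)
    show "inv\<^bsub>grp_on L H2\<^esub> x \<in> K" if "x \<in> K" for x
      using subgroup.m_inv_closed[OF H(5) that] that H inv_grp_on by (simp add: subset_iff)
  qed
  show ?thesis using gen[OF assms(1) S_partial assms(2,3)] gen[OF S_partial assms(1) assms(3,2)] by blast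
qed

lemma psub_GL: assumes P: "P \<in> \<Delta>" and K: "sub K" "K \<subseteq> NL P" shows "psubgroup (GL P) p K"
  using F.psubgroup_S[OF K(1)] sub_of_S[OF NL_partial[OF P] K(2) sub_S[OF K(1)]] by (simp add: psubgroup_def)

lemma psub_GL_NS: assumes P: "P \<in> \<Delta>" shows "psubgroup (GL P) p (NS P)"
  using psub_GL[OF P F.sgr_NS[OF objects[OF P]]] NS_eq[OF objects[OF P]] by blast

lemma chain_psub_image:
  assumes g: "chain P [g] R" and K: "psubgroup (GL P) p K" shows "psubgroup (GL R) p ((\<lambda>x. pconj L x g) ` K)"
proof -
  have P: "P \<in> \<Delta>" using chain_objects g by blast
  interpret GP: finite_group "GL P" p using finite_group_GL[OF P] .
  interpret h: group_hom "GL P" "GL R" "\<lambda>x. pconj L x g" using chain_group_hom[OF g] .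
  show ?thesis using h.psubgroup_image[OF GP.fin prime_p K] .
qed

lemma chain_word: "w \<in> lists (carrier L) \<Longrightarrow> P \<in> \<Delta> \<Longrightarrow> P \<subseteq> Sw w \<Longrightarrow> chain P w (cw w ` P)"
proof (induction arbitrary: P rule: lists.induct)
  case Nil then show ?case by (simp add: chain_Nil)
next
  case (Cons g w)
  have "P \<subseteq> S_sub L S g" using Cons.prems by auto
  then have g: "chain P [g] (cset P g)" using chainI Cons by blast
  then have gP: "cset P g \<in> \<Delta>" using chain_objects by blast
  have "cset P g \<subseteq> Sw w" using Cons.prems by (auto simp: pconj_set_def)
  then have "chain (cset P g) w (cw w ` cset P g)" using Cons.IH gP by blast
  moreover have "cw w ` cset P g = cw (g # w) ` P" by (simp add: pconj_set_def image_image)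
  ultimately have "chain P ([g] @ w) (cw (g # w) ` P)" unfolding chain_append using g by metis
  then show ?case by simp
qed

lemma chain_cw: "chain P w R \<Longrightarrow> x \<in> NL P \<Longrightarrow> pconj L x (wprod L w) = cw w x"
proof (induction arbitrary: x rule: chain.induct)
  case (chain_Nil P)
  then show ?case using pconj_one(2) NL_carrier by auto
next
  case (chain_Cons P f w R)
  have f: "chain P [f] (cset P f)" using chain_Cons chain_objects by (auto simp: chain_single)
  have w: "chain (cset P f) [wprod L w] R" using chain_prod(1)[OF chain_Cons(4)] .
  have "chain P ([f] @ w) R" unfolding chain_append using f chain_Cons(4) by blast
  then have d: "[f] @ w \<in> wdom L" by (rule chain_dom)
  have "wprod L (f # w) = wprod L [f, wprod L w]" using prod_append[of "[f]" w "[]"] d by simp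
  then have "pconj L x (wprod L (f # w)) = pconj L (pconj L x f) (wprod L w)"
    using chain_comp(2)[OF f w chain_Cons.prems] by simp
  then show ?case using chain_Cons.IH[OF chain_conj(2)[OF f chain_Cons.prems]] by simp
qed

text \<open>Starting from an object, a word map runs along a chain; hence the word lies in the
  domain and its product induces the same map.\<close>

lemma object_morphism:
  assumes P: "P \<in> \<Delta>" and f: "fmor F P f"
  shows "\<exists>g. chain P [g] (f ` P) \<and> (\<forall>x\<in>P. f x = pconj L x g)"
proof -
  obtain w where w: "w \<in> lists (carrier L)" "P \<subseteq> Sw w" "\<forall>x\<in>P. f x = cw w x" using f by (auto simp: fmor_iff)
  have im: "f ` P = cw w ` P" using w(3) by (intro image_cong) auto
  have c: "chain P w (f ` P)" unfolding im using chain_word[OF w(1) P w(2)] .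
  have "f x = pconj L x (wprod L w)" if x: "x \<in> P" for x
    using chain_cw[OF c subsetD[OF obj_sub_NL[OF P] x]] w(3) x by simp
  then show ?thesis using chain_prod(1)[OF c] by blast
qed

lemma S_sub_fmor: assumes "g \<in> carrier L" shows "fmor F (S_sub L S g) (\<lambda>x. pconj L x g)"
  unfolding fmor_iff using sub_S_sub[OF assms] assms
  by (intro conjI bexI[of _ "[g]"]) (auto simp: S_sub_def)

lemma chain_fmor: assumes "chain P [g] R" shows "fmor F P (\<lambda>x. pconj L x g)" "(\<lambda>x. pconj L x g) ` P = R"
proof -
  have g: "g \<in> carrier L" "P \<in> \<Delta>" using assms by (auto simp: chain_single)
  show "fmor F P (\<lambda>x. pconj L x g)" using F.fmor_mono[OF S_sub_fmor[OF g(1)] objects[OF g(2)] chain_S_sub[OF assms]] .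
  show "(\<lambda>x. pconj L x g) ` P = R" using assms by (auto simp: chain_single pconj_set_def)
qed

lemma object_fconjugate_iff: "P \<in> \<Delta> \<Longrightarrow> fconjugate F P R \<longleftrightarrow> (\<exists>g. chain P [g] R)"
  using object_morphism chain_fmor unfolding F.fconjugate_iff by metis

lemma object_fconjugate: "P \<in> \<Delta> \<Longrightarrow> fconjugate F P R \<Longrightarrow> R \<in> \<Delta>"
  using object_fconjugate_iff chain_objects by blast

subsection \<open>Saturation at objects\<close>

definition fully_normalized :: "'a set \<Rightarrow> bool" where
  "fully_normalized P \<longleftrightarrow> P \<in> \<Delta> \<and> sylow_in (GL P) p (NL P) (NS P)"

text \<open>If a \<open>p\<close>-subgroup of \<open>NL P\<close> properly contained \<open>NS P\<close>, one could conjugate it into \<open>S\<close>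
  through the normalizer of the larger object \<open>NS P\<close>, which would enlarge \<open>NS P\<close>.\<close>

lemma sylow_normalizer:
  assumes "P \<in> \<Delta>" "\<And>R. fconjugate F P R \<Longrightarrow> card (NS R) \<le> card (NS P)"
  shows "fully_normalized P"
  using assms
proof (induction "card S - card P" arbitrary: P rule: less_induct)
  case less
  note P = less.prems(1)
  have Ps: "sub P" using objects[OF P] .
  interpret GP: finite_group "GL P" p using finite_group_GL[OF P] .
  have NLs: "subgroup (NL P) (GL P)" using GP.subgroup_self by simp
  let ?T = "NS P"
  have T: "psubgroup (GL P) p ?T" "sub ?T" "?T \<subseteq> NL P" "P \<subseteq> ?T" "?T \<subseteq> S"
    using psub_GL_NS[OF P] F.sgr_NS[OF Ps] NS_eq[OF Ps] F.sub_NS[OF Ps] F.NS_sub[OF Ps] by auto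
  have TD: "?T \<in> \<Delta>" using overgroup_closed[OF P T(2,4)] .
  obtain A where A: "sylow_in (GL P) p (NL P) A" "?T \<subseteq> A"
    using GP.sylow_in_extends[OF NLs T(1,3)] by blast
  have Ap: "psubgroup (GL P) p A" "A \<subseteq> NL P" using sylow_inD[OF A(1)] by auto
  have "A = ?T"
  proof (rule ccontr)
    assume "A \<noteq> ?T"
    then have TA: "?T \<subset> A" using A(2) by blast
    obtain b where b: "b \<in> A - ?T" "\<forall>a\<in>?T. gconj (GL P) a b \<in> ?T"
      using GP.normalizer_grows[OF Ap(1) GP.psubgroup_subgroup[OF T(1)] TA] by blast
    have Tfin: "?T \<subseteq> carrier (GL P)" "finite ?T" using T(3) finite_subset[OF T(5) finite_S] by simp_all
    have Nsub: "subgroup (normalizer (GL P) ?T) (GL P)" using GP.normalizer_imp_subgroup[OF Tfin(1)] .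
    let ?A1 = "A \<inter> normalizer (GL P) ?T"
    have A1s: "subgroup ?A1 (GL P)" using GP.subgroup_Int[OF GP.psubgroup_subgroup[OF Ap(1)] Nsub] .
    have A1p: "psubgroup (GL P) p ?A1" using GP.psubgroup_subset[OF Ap(1) A1s] by blast
    have bA: "b \<in> ?A1" using b Ap(2) by (auto simp: GP.mem_normalizer_iff[OF Tfin])
    have TA1: "?T \<subseteq> ?A1"
      using A(2) T(3) GP.subgroup_gconj_closed[OF GP.psubgroup_subgroup[OF T(1)]]
      by (auto simp: GP.mem_normalizer_iff[OF Tfin])
    have A1pp: "partial_subgroup L ?A1" using partial_subgroup_subset[OF NL_partial[OF P] A1s] .
    have big: "card ?T < card ?A1"
    proof (rule psubset_card_mono)
      show "finite ?A1" using GP.finite_subgroup[OF A1s] .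
      show "?T \<subset> ?A1" using TA1 bA b(1) by blast
    qed
    show False
    proof (cases "?T = S")
      case True
      \<comment> \<open>If \<open>NS P\<close> is all of \<open>S\<close>, the larger
        \<open>p\<close>-subgroup contradicts the maximality of \<open>S\<close> in
        \<open>L\<close>.\<close>
      have "p_subgroup p L ?A1" using A1pp A1p by (simp add: p_subgroup_def psubgroup_def)
      then have "?A1 = S" using S_maximal TA1 True by metis
      then show False using big True by simp
    next
      case False
      have PT: "P \<noteq> ?T"
      proof
        assume eq: "P = ?T"
        have "P \<subset> S" using eq False T(5) by blast
        then show False using F.normalizer_grows_in[OF Ps S.subgroup_self] eq by auto
      qed
      then have cPT: "card P < card ?T" using psubset_card_mono[OF Tfin(2)] T(4) by blast
      have cTS: "card ?T \<le> card S" using T(5) by (simp add: card_mono)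
      have fin: "finite {card (NS R) |R. fconjugate F ?T R}"
      proof (rule finite_subset[of _ "{..card S}"])
        show "{card (NS R) |R. fconjugate F ?T R} \<subseteq> {..card S}"
          using F.fconjugate_sgr F.NS_sub by (auto intro!: card_mono)
      qed simp
      have ne: "{card (NS R) |R. fconjugate F ?T R} \<noteq> {}" using F.fconjugate_refl[OF T(2)] by blast
      obtain R where R: "fconjugate F ?T R" "card (NS R) = Max {card (NS R) |R. fconjugate F ?T R}"
        using Max_in[OF fin ne] by auto
      have Rmax: "card (NS R') \<le> card (NS R)" if "fconjugate F R R'" for R'
        unfolding R(2) by (rule Max_ge[OF fin]) (use F.fconjugate_trans[OF R(1) that] in blast)
      have RD: "R \<in> \<Delta>" using object_fconjugate[OF TD R(1)] .
      \<comment> \<open>\<open>R\<close> is a conjugate of \<open>NS P\<close> with normalizer of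
        maximal order, and \<open>NS P\<close> is larger than \<open>P\<close>, so the induction
        hypothesis applies to \<open>R\<close>.\<close>
      have fnR: "fully_normalized R"
        using less.hyps[OF _ RD Rmax] cPT cTS F.fconjugate_card[OF R(1)] by simp
      obtain g where g: "chain ?T [g] R" using R(1) object_fconjugate_iff[OF TD] by blast
      have A1T: "?A1 \<subseteq> NL ?T"
      proof
        fix a assume a: "a \<in> ?A1"
        then have aN: "a \<in> NL P" "\<forall>x\<in>?T. gconj (GL P) x a \<in> ?T"
          using Ap(2) by (auto simp: GP.mem_normalizer_iff[OF Tfin])
        have eq: "gconj (GL P) x a = pconj L x a" "x \<in> conj_dom L a" if "x \<in> ?T" for x
          using gconj_grp_on[OF NL_partial[OF P] subsetD[OF T(3) that] aN(1)] by auto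
        have "cset ?T a = (\<lambda>x. gconj (GL P) x a) ` ?T" unfolding pconj_set_def using eq(1) by (intro image_cong) auto
        also have "\<dots> = ?T"
          using aN GP.card_gconj_image[OF Tfin(1), of a] by (intro card_subset_eq[OF Tfin(2)]) auto
        finally show "a \<in> NL ?T" using aN(1) NL_carrier eq(2) by (auto simp: pnormalizer_def)
      qed
      have "psubgroup (GL ?T) p ?A1"
      proof -
        have "subgroup ?A1 (GL ?T)"
        proof
          show "?A1 \<subseteq> carrier (GL ?T)" using A1T by simp
          show "\<one>\<^bsub>GL ?T\<^esub> \<in> ?A1" using subgroup.one_closed[OF A1s] by simp
          show "x \<otimes>\<^bsub>GL ?T\<^esub> y \<in> ?A1" if xy: "x \<in> ?A1" "y \<in> ?A1" for x y
          proof -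
            have "x \<otimes>\<^bsub>GL ?T\<^esub> y = wprod L [x, y]" using subsetD[OF A1T] xy by simp
            moreover have "x \<otimes>\<^bsub>GL P\<^esub> y = wprod L [x, y]"
              using grp_on_simps(3)[of x "NL P" y] subsetD[OF Ap(2)] xy by blast
            ultimately show ?thesis using subgroup.m_closed[OF A1s xy] by simp
          qed
          show "inv\<^bsub>GL ?T\<^esub> x \<in> ?A1" if x: "x \<in> ?A1" for x
          proof -
            have "inv\<^bsub>GL ?T\<^esub> x = pinv L x" using inv_grp_on[OF NL_partial[OF TD]] subsetD[OF A1T x] by simp
            moreover have "inv\<^bsub>GL P\<^esub> x = pinv L x" using inv_grp_on[OF NL_partial[OF P]] subsetD[OF Ap(2)] x by blast
            ultimately show ?thesis using subgroup.m_inv_closed[OF A1s x] by simp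
          qed
        qed
        then show ?thesis using A1p by (simp add: psubgroup_def)
      qed
      then have im: "psubgroup (GL R) p ((\<lambda>x. pconj L x g) ` ?A1)" using chain_psub_image[OF g] by blast
      have imN: "(\<lambda>x. pconj L x g) ` ?A1 \<subseteq> NL R" using chain_conj(2)[OF g] A1T by blast
      obtain k where k: "k \<in> NL R" "\<forall>a\<in>(\<lambda>x. pconj L x g) ` ?A1. gconj (GL R) a k \<in> NS R"
        using sylow_inD(4)[OF _ im imN] fnR unfolding fully_normalized_def by blast
      have kc: "chain R [k] R" using k(1) mem_NL_iff[OF RD] by blast
      define m where "m = wprod L [g, k]"
      have m: "chain ?T [m] R" unfolding m_def using chain_comp(1)[OF g kc] .
      have mA: "pconj L a m \<in> NS R" if a: "a \<in> ?A1" for a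
      proof -
        have "pconj L a m = pconj L (pconj L a g) k" unfolding m_def using chain_comp(2)[OF g kc] A1T a by blast
        also have "\<dots> = gconj (GL R) (pconj L a g) k" using GL_gconj[OF RD _ k(1)] imN a by auto
        finally show ?thesis using k(2) a by auto
      qed
      have mc: "m \<in> carrier L" using m by (simp add: chain_single)
      have A1m: "a \<in> conj_dom L m" if "a \<in> ?A1" for a using chain_conj(1)[OF m] A1T that by blast
      \<comment> \<open>\<open>m\<close> takes \<open>?A1\<close> into \<open>S\<close>, and the
        conjugated elements normalize the conjugate of \<open>P\<close>; its normalizer in
        \<open>S\<close> would then be larger than that of \<open>P\<close>.\<close>
      let ?P = "cset P m"
      have PT': "P \<subseteq> S_sub L S m" using T(4) chain_S_sub[OF m] by blast
      have Pm: "chain P [m] ?P" using chainI[OF P mc PT'] .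
      then have P'D: "?P \<in> \<Delta>" "fconjugate F P ?P" using chain_objects object_fconjugate_iff[OF P] by blast+
      have "(\<lambda>x. pconj L x m) ` ?A1 \<subseteq> NS ?P"
      proof
        fix b assume "b \<in> (\<lambda>x. pconj L x m) ` ?A1"
        then obtain a where a: "a \<in> ?A1" "b = pconj L a m" by blast
        have "b \<in> S" using mA[OF a(1)] a(2) F.NS_sub[OF objects[OF RD]] by blast
        moreover have "b \<in> NL ?P" using chain_conj(2)[OF Pm] a Ap(2) by blast
        ultimately show "b \<in> NS ?P" using NS_eq[OF objects[OF P'D(1)]] by blast
      qed
      moreover have "finite (NS ?P)" using finite_subset[OF F.NS_sub[OF objects[OF P'D(1)]] finite_S] .
      ultimately have "card ((\<lambda>x. pconj L x m) ` ?A1) \<le> card (NS ?P)" by (rule card_mono[rotated])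
      moreover have "card ((\<lambda>x. pconj L x m) ` ?A1) = card ?A1"
        by (rule card_image[OF inj_on_subset[OF pconj_inj[OF mc]]]) (use A1m in blast)
      ultimately show False using big less.prems(2)[OF P'D(2)] by simp
    qed
  qed
  then show ?case using A P by (simp add: fully_normalized_def)
qed

text \<open>Take a conjugate whose normalizer in \<open>S\<close> is largest. Its Sylow property
  allows the conjugating element to be adjusted inside \<open>NL R\<close> until it carries
  \<open>NS P\<close> into \<open>S\<close>.\<close>

lemma exists_fully_normalized:
  assumes P: "P \<in> \<Delta>"
  shows "\<exists>g R. chain P [g] R \<and> fully_normalized R \<and> NS P \<subseteq> S_sub L S g"
proof -
  have Ps: "sub P" using objects[OF P] .
  have fin: "finite {card (NS R) |R. fconjugate F P R}"
  proof (rule finite_subset[of _ "{..card S}"])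
    show "{card (NS R) |R. fconjugate F P R} \<subseteq> {..card S}"
      using F.fconjugate_sgr F.NS_sub by (auto intro!: card_mono)
  qed simp
  have ne: "{card (NS R) |R. fconjugate F P R} \<noteq> {}" using F.fconjugate_refl[OF Ps] by blast
  obtain R where R: "fconjugate F P R" "card (NS R) = Max {card (NS R) |R. fconjugate F P R}"
    using Max_in[OF fin ne] by auto
  have Rmax: "card (NS R') \<le> card (NS R)" if "fconjugate F R R'" for R'
    unfolding R(2) by (rule Max_ge[OF fin]) (use F.fconjugate_trans[OF R(1) that] in blast)
  have RD: "R \<in> \<Delta>" using object_fconjugate[OF P R(1)] .
  have fnR: "fully_normalized R" using sylow_normalizer[OF RD Rmax] .
  obtain g where g: "chain P [g] R" using R(1) object_fconjugate_iff[OF P] by blast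
  have NP: "NS P \<subseteq> NL P" using NS_eq[OF Ps] by blast
  have im: "psubgroup (GL R) p ((\<lambda>x. pconj L x g) ` NS P)" using chain_psub_image[OF g psub_GL_NS[OF P]] .
  have imN: "(\<lambda>x. pconj L x g) ` NS P \<subseteq> NL R" using chain_conj(2)[OF g] NP by blast
  obtain k where k: "k \<in> NL R" "\<forall>a\<in>(\<lambda>x. pconj L x g) ` NS P. gconj (GL R) a k \<in> NS R"
    using sylow_inD(4)[OF _ im imN] fnR unfolding fully_normalized_def by blast
  have kc: "chain R [k] R" using k(1) mem_NL_iff[OF RD] by blast
  define m where "m = wprod L [g, k]"
  have m: "chain P [m] R" unfolding m_def using chain_comp(1)[OF g kc] .
  have "a \<in> S_sub L S m" if a: "a \<in> NS P" for a
  proof -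
    have "pconj L a m = pconj L (pconj L a g) k" unfolding m_def using chain_comp(2)[OF g kc] NP a by blast
    also have "\<dots> = gconj (GL R) (pconj L a g) k" using GL_gconj[OF RD _ k(1)] imN a by auto
    finally have "pconj L a m \<in> S" using k(2) a F.NS_sub[OF objects[OF RD]] by auto
    moreover have "a \<in> conj_dom L m" using chain_conj(1)[OF m] NP a by blast
    ultimately show ?thesis using a F.NS_sub[OF Ps] by (auto simp: S_sub_def)
  qed
  then show ?thesis using m fnR by blast
qed

lemma
  assumes P: "P \<in> \<Delta>"
  shows subgroup_CL: "subgroup (CL P) (GL P)"
    and CL_normal: "k \<in> NL P \<Longrightarrow> c \<in> CL P \<Longrightarrow> gconj (GL P) c k \<in> CL P"
    and mem_CL_iff: "c \<in> NL P \<Longrightarrow> c \<in> CL P \<longleftrightarrow> (\<forall>x\<in>P. gconj (GL P) x c = x)"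
proof -
  interpret GP: finite_group "GL P" p using finite_group_GL[OF P] .
  have PN: "x \<in> NL P" if "x \<in> P" for x using obj_sub_NL[OF P] that by blast
  have iff: "c \<in> CL P \<longleftrightarrow> c \<in> NL P \<and> (\<forall>x\<in>P. gconj (GL P) x c = x)" for c
    using CL_sub_NL[of P] GL_gconj[OF P PN] by (auto simp: pcentralizer_def pnormalizer_def)
  then show "c \<in> NL P \<Longrightarrow> c \<in> CL P \<longleftrightarrow> (\<forall>x\<in>P. gconj (GL P) x c = x)" by blast
  show "subgroup (CL P) (GL P)"
  proof
    show "CL P \<subseteq> carrier (GL P)" using CL_sub_NL[of P] by simp
    show "\<one>\<^bsub>GL P\<^esub> \<in> CL P" using GP.one_closed PN GP.gconj_one by (simp add: iff)
    show "a \<otimes>\<^bsub>GL P\<^esub> b \<in> CL P" if "a \<in> CL P" "b \<in> CL P" for a b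
    proof -
      have ab: "a \<in> NL P" "b \<in> NL P" "\<forall>x\<in>P. gconj (GL P) x a = x" "\<forall>x\<in>P. gconj (GL P) x b = x"
        using that iff by blast+
      have "gconj (GL P) x (a \<otimes>\<^bsub>GL P\<^esub> b) = x" if "x \<in> P" for x
        using GP.gconj_comp[of x a b] ab PN[OF that] that by simp
      then show ?thesis using iff GP.m_closed[of a b] ab by auto
    qed
    show "inv\<^bsub>GL P\<^esub> a \<in> CL P" if a: "a \<in> CL P" for a
    proof -
      have aN: "a \<in> NL P" "\<forall>x\<in>P. gconj (GL P) x a = x" using a iff by blast+
      have "gconj (GL P) x (inv\<^bsub>GL P\<^esub> a) = x" if "x \<in> P" for x
        using GP.gconj_cancel(1)[of x a] aN PN[OF that] that by simp
      then show ?thesis using iff GP.inv_closed[of a] aN by auto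
    qed
  qed
  assume k: "k \<in> NL P" and c: "c \<in> CL P"
  have cN: "c \<in> NL P" "\<forall>x\<in>P. gconj (GL P) x c = x" using c iff by blast+
  have ik: "inv\<^bsub>GL P\<^esub> k \<in> NL P" using GP.inv_closed[of k] k by simp
  have "gconj (GL P) x (gconj (GL P) c k) = x" if x: "x \<in> P" for x
  proof -
    let ?y = "gconj (GL P) x (inv\<^bsub>GL P\<^esub> k)"
    have "?y = pconj L x (inv\<^bsub>GL P\<^esub> k)" using GL_gconj[OF P PN[OF x] ik] .
    then have y: "?y \<in> P" using ik x by (auto simp: pnormalizer_def pconj_set_def)
    have "gconj (GL P) (gconj (GL P) ?y k) (gconj (GL P) c k) = gconj (GL P) (gconj (GL P) ?y c) k"
      using PN[OF y] k cN by (intro GP.gconj_gconj) auto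
    also have "gconj (GL P) ?y c = ?y" using cN y by blast
    finally show ?thesis using GP.gconj_cancel(2)[of x k] PN[OF x] k by simp
  qed
  then show "gconj (GL P) c k \<in> CL P" using iff GP.gconj_closed[of c k] cN k by auto
qed

text \<open>Automorphisms of an object are conjugations by elements of \<open>NL P\<close>, so the
  Sylow property passes from \<open>NL P\<close> to \<open>Aut_F F P\<close>. For receptivity, the
  extension group carried into \<open>NL P\<close> lies in the product of \<open>CL P\<close> and
  \<open>NS P\<close>; an element of \<open>CL P\<close> conjugates it into \<open>NS P\<close>
  without changing the given isomorphism.\<close>

lemma fully_normalized_good: assumes fn: "fully_normalized P" shows "F.good P"
proof -
  have P: "P \<in> \<Delta>" and syl: "sylow_in (GL P) p (NL P) (NS P)" using fn by (auto simp: fully_normalized_def)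
  have Ps: "sub P" using objects[OF P] .
  interpret GP: finite_group "GL P" p using finite_group_GL[OF P] .
  interpret AP: finite_group "Aut_F F P" p using F.finite_group_Aut[OF Ps] .
  have NLs: "subgroup (NL P) (GL P)" using GP.subgroup_self by simp
  have PN: "x \<in> NL P" if "x \<in> P" for x using obj_sub_NL[OF P] that by blast
  let ?c = "\<lambda>h. restrict (\<lambda>x. pconj L x h) P"
  have c: "?c h \<in> fiso F P P" if "h \<in> NL P" for h
  proof -
    have "chain P [h] P" using that mem_NL_iff[OF P] by blast
    from F.restrict_fiso[OF chain_fmor[OF this]] show ?thesis .
  qed
  have ci: "?c (inv\<^bsub>GL P\<^esub> h) \<in> fiso F P P" if "h \<in> NL P" for h using c GP.inv_closed[of h] that by simp
  \<comment> \<open>As before, the inverse compensates for the order of composition in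
    \<open>Aut_F\<close>.\<close>
  interpret r: group_hom "GL P" "Aut_F F P" "\<lambda>h. ?c (inv\<^bsub>GL P\<^esub> h)"
  proof (unfold_locales, rule homI)
    fix a b assume "a \<in> carrier (GL P)" "b \<in> carrier (GL P)"
    then have ab: "a \<in> NL P" "b \<in> NL P" "inv\<^bsub>GL P\<^esub> a \<in> NL P" "inv\<^bsub>GL P\<^esub> b \<in> NL P"
      using GP.inv_closed by auto
    have "?c (inv\<^bsub>GL P\<^esub> (a \<otimes>\<^bsub>GL P\<^esub> b)) = compose P (?c (inv\<^bsub>GL P\<^esub> a)) (?c (inv\<^bsub>GL P\<^esub> b))"
    proof
      fix x show "?c (inv\<^bsub>GL P\<^esub> (a \<otimes>\<^bsub>GL P\<^esub> b)) x = compose P (?c (inv\<^bsub>GL P\<^esub> a)) (?c (inv\<^bsub>GL P\<^esub> b)) x"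
      proof (cases "x \<in> P")
        case True
        have y: "pconj L x (inv\<^bsub>GL P\<^esub> b) \<in> P" using ab(4) True by (auto simp: pnormalizer_def pconj_set_def)
        have i: "inv\<^bsub>GL P\<^esub> (a \<otimes>\<^bsub>GL P\<^esub> b) = inv\<^bsub>GL P\<^esub> b \<otimes>\<^bsub>GL P\<^esub> inv\<^bsub>GL P\<^esub> a" "inv\<^bsub>GL P\<^esub> (a \<otimes>\<^bsub>GL P\<^esub> b) \<in> NL P"
          using GP.inv_mult_group[of a b] GP.inv_closed[of "a \<otimes>\<^bsub>GL P\<^esub> b"] GP.m_closed[of a b] ab by auto
        have "pconj L x (inv\<^bsub>GL P\<^esub> (a \<otimes>\<^bsub>GL P\<^esub> b)) = gconj (GL P) x (inv\<^bsub>GL P\<^esub> (a \<otimes>\<^bsub>GL P\<^esub> b))"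
          using GL_gconj[OF P PN[OF True] i(2)] by simp
        also have "\<dots> = gconj (GL P) (gconj (GL P) x (inv\<^bsub>GL P\<^esub> b)) (inv\<^bsub>GL P\<^esub> a)"
          unfolding i(1) using GP.gconj_comp[of x "inv\<^bsub>GL P\<^esub> b" "inv\<^bsub>GL P\<^esub> a"] ab PN[OF True] by simp
        also have "\<dots> = pconj L (pconj L x (inv\<^bsub>GL P\<^esub> b)) (inv\<^bsub>GL P\<^esub> a)"
          using GL_gconj[OF P PN[OF True] ab(4)] GL_gconj[OF P PN[OF y] ab(3)] by simp
        finally show ?thesis using True y by (simp add: compose_def)
      qed (simp add: compose_def)
    qed
    then show "?c (inv\<^bsub>GL P\<^esub> (a \<otimes>\<^bsub>GL P\<^esub> b)) = ?c (inv\<^bsub>GL P\<^esub> a) \<otimes>\<^bsub>Aut_F F P\<^esub> ?c (inv\<^bsub>GL P\<^esub> b)"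
      using F.Aut_F_mult[OF ci[OF ab(1)] ci[OF ab(2)]] by simp
  qed (use ci in auto)
  have inv_image: "(\<lambda>h. ?c (inv\<^bsub>GL P\<^esub> h)) ` K = ?c ` K" if K: "subgroup K (GL P)" for K
  proof
    show "(\<lambda>h. ?c (inv\<^bsub>GL P\<^esub> h)) ` K \<subseteq> ?c ` K" using subgroup.m_inv_closed[OF K] by blast
    show "?c ` K \<subseteq> (\<lambda>h. ?c (inv\<^bsub>GL P\<^esub> h)) ` K"
    proof
      fix a assume "a \<in> ?c ` K"
      then obtain h where h: "h \<in> K" "a = ?c h" by blast
      then have "a = ?c (inv\<^bsub>GL P\<^esub> (inv\<^bsub>GL P\<^esub> h))" using subgroup.mem_carrier[OF K h(1)] by simp
      then show "a \<in> (\<lambda>h. ?c (inv\<^bsub>GL P\<^esub> h)) ` K" using subgroup.m_inv_closed[OF K h(1)] by blast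
    qed
  qed
  have imN: "?c ` NL P = fiso F P P"
  proof
    show "?c ` NL P \<subseteq> fiso F P P" using c by blast
    show "fiso F P P \<subseteq> ?c ` NL P"
    proof
      fix a assume "a \<in> fiso F P P"
      then have a: "fmor F P a" "a ` P = P" "a \<in> extensional P" by (auto simp: F.fiso_iff)
      obtain g where g: "chain P [g] (a ` P)" "\<forall>x\<in>P. a x = pconj L x g" using object_morphism[OF P a(1)] by blast
      have "g \<in> NL P" using g(1) a(2) mem_NL_iff[OF P] by simp
      moreover have "a = ?c g" using g(2) a(3) by (auto simp: fun_eq_iff extensional_def)
      ultimately show "a \<in> ?c ` NL P" by blast
    qed
  qed
  have imS: "?c ` NS P = Aut_S F P"
  proof -
    have "?c s = F.cR P s" if "s \<in> NS P" for s
    proof -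
      have "s \<in> S" using that F.NS_sub[OF Ps] by blast
      then show ?thesis using S_pconj(1) sub_S[OF Ps] by (auto simp: F.cR_def fun_eq_iff)
    qed
    then show ?thesis unfolding F.Aut_S_eq by (intro image_cong) auto
  qed
  have NSs: "subgroup (NS P) (GL P)" "NS P \<subseteq> NL P" using sylow_inD[OF syl] by auto
  have "card (NS P) = p ^ multiplicity p (card (NL P))" using GP.sylow_in_card[OF NLs syl] .
  from r.sylow_card_image[OF GP.fin prime_p NLs NSs this]
  have "card (Aut_S F P) = p ^ multiplicity p (order (Aut_F F P))"
    using inv_image[OF NSs(1)] inv_image[OF NLs] imN imS by (simp add: order_def)
  moreover have "subgroup (Aut_S F P) (Aut_F F P)"
    using r.subgroup_img_is_subgroup[OF NSs(1)] inv_image[OF NSs(1)] imS by simp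
  ultimately have fa: "fully_automized p F P" by (simp add: fully_automized_def sylow_subgroup_def)
  have "receptive F P"
    unfolding receptive_def
  proof (intro allI impI)
    fix Y \<phi> assume Y: "subgroup Y (fgrp F) \<and> \<phi> \<in> fiso F Y P"
    let ?E = "extension_group F Y P \<phi>"
    have \<phi>: "fmor F Y \<phi>" "\<phi> ` Y = P" "restrict \<phi> Y = \<phi>"
      using Y by (auto simp: F.fiso_iff extensional_restrict)
    have Ys: "sub Y" using F.fmor_sgr[OF \<phi>(1)] .
    have "fconjugate F P Y" using F.fconjugate_sym[of Y P] F.fconjugateI[OF \<phi>(1)] \<phi>(2) by simp
    then have YD: "Y \<in> \<Delta>" using object_fconjugate[OF P] by blast
    obtain g where g: "chain Y [g] P" "\<forall>y\<in>Y. \<phi> y = pconj L y g" using object_morphism[OF YD \<phi>(1)] \<phi>(2) by auto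
    have Eiff: "t \<in> ?E \<longleftrightarrow> t \<in> NS Y \<and> (\<exists>s\<in>NS P. \<forall>y\<in>Y. \<phi> (gconj (grp_on L S) y t) = gconj (grp_on L S) (\<phi> y) s)" for t
      using F.extension_group_iff[OF \<phi>(1,2), of t] \<phi>(3) by simp
    have E: "sub ?E" "?E \<subseteq> NS Y" using F.sgr_extension_group[OF \<phi>(1,2)] \<phi>(3) Eiff by auto
    have EN: "?E \<subseteq> NL Y" using E(2) NS_eq[OF Ys] by blast
    have Ep: "psubgroup (GL P) p ((\<lambda>x. pconj L x g) ` ?E)"
      using chain_psub_image[OF g(1) psub_GL[OF YD E(1) EN]] .
    have "\<exists>c\<in>CL P. \<forall>a\<in>(\<lambda>x. pconj L x g) ` ?E. gconj (GL P) a c \<in> NS P"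
    proof (rule GP.sylow_in_conj_normal[OF syl NLs subgroup_CL[OF P] CL_sub_NL CL_normal[OF P] Ep])
      fix a assume "a \<in> (\<lambda>x. pconj L x g) ` ?E"
      then obtain t where t: "t \<in> ?E" "a = pconj L t g" by blast
      have aN: "a \<in> NL P" using chain_conj(2)[OF g(1)] t EN by blast
      obtain s where s: "s \<in> NS P" "\<forall>y\<in>Y. \<phi> (gconj (grp_on L S) y t) = gconj (grp_on L S) (\<phi> y) s"
        using t Eiff by blast
      have sN: "s \<in> NL P" "s \<in> S" using s NSs(2) F.NS_sub[OF Ps] by blast+
      have tN: "t \<in> NL Y" "t \<in> S" using t(1) EN E(2) F.NS_sub[OF Ys] by blast+
      interpret GY: finite_group "GL Y" p using finite_group_GL[OF YD] .
      interpret h: group_hom "GL Y" "GL P" "\<lambda>x. pconj L x g" using chain_group_hom[OF g(1)] .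
      have as: "gconj (GL P) x a = gconj (GL P) x s" if x: "x \<in> P" for x
      proof -
        have "x \<in> \<phi> ` Y" using x \<phi>(2) by simp
        then obtain y where y: "x = \<phi> y" "y \<in> Y" by (rule imageE)
        have yN: "y \<in> NL Y" "y \<in> S" using obj_sub_NL[OF YD] sub_S[OF Ys] y(2) by blast+
        have yt: "gconj (GL Y) y t = gconj (grp_on L S) y t"
          using GL_gconj[OF YD yN(1) tN(1)] S_pconj(1)[OF yN(2) tN(2)] by simp
        have ytY: "gconj (grp_on L S) y t \<in> Y" using F.NS_gconj[OF Ys subsetD[OF E(2) t(1)] y(2)] .
        have xS: "x \<in> S" using x sub_S[OF Ps] by blast
        have "gconj (GL P) x a = gconj (GL P) (pconj L y g) (pconj L t g)" using g(2) y t(2) by simp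
        also have "\<dots> = pconj L (gconj (GL Y) y t) g"
          using yN(1) tN(1) h.hom_mult[of "inv\<^bsub>GL Y\<^esub> t" y] h.hom_mult[of "inv\<^bsub>GL Y\<^esub> t \<otimes>\<^bsub>GL Y\<^esub> y" t] h.hom_inv[of t]
            GY.inv_closed[of t] GY.m_closed[of "inv\<^bsub>GL Y\<^esub> t" y]
          unfolding gconj_def by (simp del: grp_on_simps(3))
        also have "\<dots> = \<phi> (gconj (grp_on L S) y t)" using g(2) ytY yt by simp
        also have "\<dots> = gconj (grp_on L S) x s" using s(2) y by simp
        also have "\<dots> = gconj (GL P) x s" using GL_gconj[OF P PN[OF x] sN(1)] S_pconj(1)[OF xS sN(2)] by simp
        finally show ?thesis .
      qed
      let ?d = "a \<otimes>\<^bsub>GL P\<^esub> inv\<^bsub>GL P\<^esub> s"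
      have si: "inv\<^bsub>GL P\<^esub> s \<in> NL P" using GP.inv_closed[of s] sN by simp
      have dN: "?d \<in> NL P" using GP.m_closed[of a "inv\<^bsub>GL P\<^esub> s"] aN si by (simp del: grp_on_simps(3))
      have "gconj (GL P) x ?d = x" if x: "x \<in> P" for x
      proof -
        have "gconj (GL P) x ?d = gconj (GL P) (gconj (GL P) x a) (inv\<^bsub>GL P\<^esub> s)"
          using GP.gconj_comp[of x a "inv\<^bsub>GL P\<^esub> s"] PN[OF x] aN si by (simp del: grp_on_simps(3))
        then show ?thesis using as[OF x] GP.gconj_cancel(1)[of x s] PN[OF x] sN by simp
      qed
      then have "?d \<in> CL P" using mem_CL_iff[OF P dN] by blast
      moreover have "a = ?d \<otimes>\<^bsub>GL P\<^esub> s"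
        using GP.m_assoc[of a "inv\<^bsub>GL P\<^esub> s" s] GP.l_inv[of s] GP.r_one[of a] aN sN si
        by (simp del: grp_on_simps(2,3))
      ultimately show "\<exists>c\<in>CL P. \<exists>t\<in>NS P. a = c \<otimes>\<^bsub>GL P\<^esub> t" using s by blast
    qed
    then obtain c where c: "c \<in> CL P" "\<And>t. t \<in> ?E \<Longrightarrow> gconj (GL P) (pconj L t g) c \<in> NS P" by blast
    have cN: "c \<in> NL P" using c CL_sub_NL by blast
    have cc: "chain P [c] P" using cN mem_NL_iff[OF P] by blast
    define m where "m = wprod L [g, c]"
    have m: "chain Y [m] P" unfolding m_def using chain_comp(1)[OF g(1) cc] .
    have mc: "m \<in> carrier L" using m by (simp add: chain_single)
    have mE: "pconj L t m = gconj (GL P) (pconj L t g) c" if "t \<in> NL Y" for t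
      unfolding m_def using chain_comp(2)[OF g(1) cc that] GL_gconj[OF P chain_conj(2)[OF g(1) that] cN] by simp
    have "?E \<subseteq> S_sub L S m"
    proof
      fix t assume t: "t \<in> ?E"
      have tN: "t \<in> NL Y" "t \<in> S" using t EN E(2) F.NS_sub[OF Ys] by blast+
      have "pconj L t m \<in> S" using mE[OF tN(1)] c(2)[OF t] F.NS_sub[OF Ps] by auto
      then show "t \<in> S_sub L S m" using tN chain_conj(1)[OF m tN(1)] by (simp add: S_sub_def)
    qed
    then have fE: "fmor F ?E (\<lambda>x. pconj L x m)" using F.fmor_mono[OF S_sub_fmor[OF mc] E(1)] by blast
    let ?\<psi> = "restrict (\<lambda>x. pconj L x m) ?E"
    have "?\<psi> \<in> fhom F ?E (carrier (fgrp F))" using fE by (simp add: fmor_def)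
    moreover have "restrict ?\<psi> Y = \<phi>"
    proof -
      have YE: "Y \<subseteq> ?E"
      proof
        fix t assume t: "t \<in> Y"
        have "\<phi> t \<in> P" using t \<phi>(2) by blast
        then have "\<phi> t \<in> NS P" using F.sub_NS[OF Ps] by blast
        then show "t \<in> ?E" using t F.sub_NS[OF Ys] F.fmor_gconj[OF \<phi>(1)] by (auto simp: Eiff)
      qed
      have "pconj L y m = \<phi> y" if y: "y \<in> Y" for y
      proof -
        have "\<phi> y \<in> P" using y \<phi>(2) by blast
        then have "gconj (GL P) (\<phi> y) c = \<phi> y" using c(1) mem_CL_iff[OF P cN] by blast
        then show ?thesis using mE[of y] obj_sub_NL[OF YD] y g(2) by auto
      qed
      then have "restrict ?\<psi> Y = restrict \<phi> Y" using YE by (auto simp: fun_eq_iff subset_iff)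
      then show ?thesis using \<phi>(3) by simp
    qed
    ultimately show "\<exists>\<psi>\<in>fhom F ?E (carrier (fgrp F)). restrict \<psi> Y = \<phi>" by blast
  qed
  then show ?thesis using Ps fa by (simp add: F.good_def)
qed

lemma saturated_if_centric:
  assumes "centric_subgroups F \<subseteq> \<Delta>" shows "saturated p F"
proof (rule F.saturated_if_centric_generated[where \<Delta> = \<Delta>])
  show "\<exists>g. composite F \<Delta> X g \<and> (\<forall>x\<in>X. g x = f x)" if f: "fmor F X f" for X f
  proof -
    obtain w where w: "w \<in> lists (carrier L)" "X \<subseteq> Sw w" "\<forall>x\<in>X. f x = cw w x" using f unfolding fmor_iff by blast
    have gen: "composite F \<Delta> X (\<lambda>x. cw w (f x))"
      if "w \<in> lists (carrier L)" "composite F \<Delta> X f" "f ` X \<subseteq> Sw w" for w f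
      using that
    proof (induction arbitrary: f rule: lists.induct)
      case Nil then show ?case by simp
    next
      case (Cons g w)
      have "composite F \<Delta> X (\<lambda>x. pconj L (f x) g)"
      proof (rule composite.step[OF Cons.prems(1)])
        show "S_sub L S g \<in> \<Delta>" using S_sub_object[OF Cons.hyps(1)] .
        show "fmor F (S_sub L S g) (\<lambda>x. pconj L x g)" using S_sub_fmor[OF Cons.hyps(1)] .
        show "f ` X \<subseteq> S_sub L S g" using Cons.prems(2) by auto
      qed
      moreover have "(\<lambda>x. pconj L (f x) g) ` X \<subseteq> Sw w" using Cons.prems(2) by auto
      ultimately show ?case using Cons.IH[of "\<lambda>x. pconj L (f x) g"] by simp
    qed
    have "composite F \<Delta> X (\<lambda>x. cw w x)" using gen[OF w(1) composite.id] w(2) by simp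
    then show ?thesis using w(3) by auto
  qed
  show "\<exists>Y. fconjugate F X Y \<and> F.good Y" if "X \<in> \<Delta>" for X
    using exists_fully_normalized[OF that] fully_normalized_good object_fconjugate_iff[OF that] by blast
qed (fact object_fconjugate overgroup_closed objects assms)+

end

section \<open>Large subgroups in localities\<close>

context locality
begin

lemma fgrp_F [simp]: "fgrp F = grp_on L S"
  by (simp add: locality_fusion_def)

lemma replete_centric:
  assumes Q: "sub Q" and rep: "replete L \<Delta> S Q" shows "centric_subgroups F \<subseteq> \<Delta>"
proof
  fix P assume "P \<in> centric_subgroups F"
  then have c: "F.centric P" using F.centric_iff by blast
  then have P: "sub P" "CS P \<subseteq> P" using F.fconjugate_refl unfolding F.centric_def by blast+
  show "P \<in> \<Delta>"
  proof (cases "S = {\<one>\<^bsub>grp_on L S\<^esub>}")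
    case True
    have "\<one>\<^bsub>grp_on L S\<^esub> \<in> P" using subgroup.one_closed[OF P(1)] .
    then have "P = S" using equalityD1[OF True] sub_S[OF P(1)] by blast
    then show ?thesis using S_object by simp
  next
    case False
    have "F.ZS \<noteq> {\<one>\<^bsub>grp_on L S\<^esub>}" using F.ZS_nontrivial False by blast
    moreover have "Q \<subseteq> NS F.ZS" using sub_S[OF Q] F.NS_ZS by blast
    ultimately have "F.ZS \<in> \<Delta>" using rep F.ZS_sgr unfolding replete_def by blast
    moreover have "F.ZS \<subseteq> P" using F.ZS_sub_CS[OF P(1)] P(2) by blast
    ultimately show ?thesis using overgroup_closed P(1) by blast
  qed
qed

lemma conj_object_normalizer:
  assumes "chain E [g] (f ` E)" "\<forall>x\<in>E. f x = pconj L x g" "U \<subseteq> E" "f ` U = U"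
  shows "g \<in> NL U"
proof -
  have "pconj_set L U g = f ` U" unfolding pconj_set_def using assms(2,3) by (intro image_cong) auto
  then show ?thesis using assms by (auto simp: pnormalizer_def chain_single)
qed

text \<open>\<open>Q\<close> centralizes \<open>U\<close>, so repleteness makes \<open>U\<close> an
  object. A morphism defined above \<open>U\<close> and preserving it is then conjugation by one
  element of \<open>NL U\<close>, and largeness in the locality makes the same element act on
  \<open>Q\<close>.\<close>

theorem large_in_fusionI:
  assumes lg: "large_in_locality L S Q" and rep: "replete L \<Delta> S Q"
  shows "large_in_fusion F Q"
proof -
  have Q: "sub Q" "CL Q \<subseteq> Q" using lg unfolding large_in_locality_def by blast+
  have QS: "Q \<subseteq> S" using sub_S[OF Q(1)] .
  have CSQ: "CS Q \<subseteq> Q" using CS_eq[OF Q(1)] Q(2) by blast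
  have "subfusion (normalizer_fusion F U) (normalizer_fusion F Q)"
    if U: "sub U" "U \<subseteq> center_of (grp_on L S) Q" "U \<noteq> {\<one>\<^bsub>grp_on L S\<^esub>}" for U
  proof -
    have UQ: "U \<subseteq> CS Q" using U(2) by (auto simp: center_of_def)
    have NLU: "NL U \<subseteq> NL Q" using lg U unfolding large_in_locality_def by blast
    have "Q \<subseteq> CS U"
    proof
      fix q assume q: "q \<in> Q"
      have "q \<otimes>\<^bsub>grp_on L S\<^esub> u = u \<otimes>\<^bsub>grp_on L S\<^esub> q" if "u \<in> U" for u
        using subsetD[OF UQ that] q unfolding gcentralizer_def by simp
      then show "q \<in> CS U" using q QS unfolding gcentralizer_def by auto
    qed
    then have "Q \<subseteq> NS U" using F.CS_sub_NS[OF U(1)] by blast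
    then have UD: "U \<in> \<Delta>" using rep U unfolding replete_def by blast
    have NSU: "NS U \<subseteq> NS Q" using NS_eq[OF U(1)] NS_eq[OF Q(1)] NLU by blast
    have "\<phi> \<in> fhom (normalizer_fusion F Q) X Y" if \<phi>: "\<phi> \<in> fhom (normalizer_fusion F U) X Y" for \<phi> X Y
    proof -
      have n: "\<phi> \<in> fhom F X Y" "X \<subseteq> NS U" "Y \<subseteq> NS U"
        "\<exists>\<psi>\<in>fhom F (X <#>\<^bsub>grp_on L S\<^esub> U) (Y <#>\<^bsub>grp_on L S\<^esub> U). restrict \<psi> X = \<phi> \<and> \<psi> ` U = U"
        using \<phi> by (simp_all add: normalizer_fusion_def)
      obtain \<psi> where h: "\<psi> \<in> fhom F (X <#>\<^bsub>grp_on L S\<^esub> U) (Y <#>\<^bsub>grp_on L S\<^esub> U)"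
        "restrict \<psi> X = \<phi> \<and> \<psi> ` U = U"
        using n(4) by (rule bexE)
      note \<psi> = n(1-3) h(1) conjunct1[OF h(2)] conjunct2[OF h(2)]
      have XY: "sub X" "sub Y" "\<phi> ` X \<subseteq> Y" using \<psi>(1)[unfolded F.fhom_iff] F.fmor_sgr[of X \<phi>] by simp_all
      let ?E = "X <#>\<^bsub>grp_on L S\<^esub> U"
      have E: "sub ?E" "fmor F ?E \<psi>" using \<psi>(4)[unfolded F.fhom_iff] F.fmor_sgr[of ?E \<psi>] by simp_all
      have XE: "X \<subseteq> ?E" "U \<subseteq> ?E" using F.sub_set_mult[OF XY(1) U(1)] by blast+
      have ED: "?E \<in> \<Delta>" using overgroup_closed[OF UD E(1) XE(2)] .
      obtain g where g: "chain ?E [g] (\<psi> ` ?E)" "\<forall>x\<in>?E. \<psi> x = pconj L x g"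
        using object_morphism[OF ED E(2)] by blast
      have gQ: "g \<in> NL Q" using NLU conj_object_normalizer[OF g XE(2) \<psi>(6)] by blast
      then have gc: "g \<in> carrier L" "(\<lambda>x. pconj L x g) ` Q = Q" "Q \<subseteq> conj_dom L g"
        by (auto simp: pnormalizer_def pconj_set_def)
      have QE: "Q \<subseteq> S_sub L S g" using gc QS unfolding S_sub_def by blast
      have XS: "X \<subseteq> S_sub L S g" using chain_S_sub[OF g(1)] XE by blast
      let ?X = "X <#>\<^bsub>grp_on L S\<^esub> Q" and ?Y = "Y <#>\<^bsub>grp_on L S\<^esub> Q"
      have XN: "X \<subseteq> NS Q" "Y \<subseteq> NS Q" using NSU \<psi> by blast+
      have s: "sub ?X" "sub ?Y" using F.sgr_set_mult[OF XY(1) Q(1) XN(1)] F.sgr_set_mult[OF XY(2) Q(1) XN(2)] by simp_all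
      have XQE: "?X \<subseteq> S_sub L S g" using F.set_mult_least[OF sub_S_sub[OF gc(1)] XS QE] .
      have fE: "fmor F ?X (\<lambda>x. pconj L x g)" using F.fmor_mono[OF S_sub_fmor[OF gc(1)] s(1) XQE] .
      have val: "pconj L x g = \<phi> x" if "x \<in> X" for x
      proof -
        have "x \<in> ?E" using that XE by blast
        then have "pconj L x g = \<psi> x" using g(2) by simp
        then show ?thesis using fun_cong[OF \<psi>(5), of x] that by simp
      qed
      have "(\<lambda>x. pconj L x g) ` X = \<phi> ` X" using val by (intro image_cong) auto
      then have im: "(\<lambda>x. pconj L x g) ` X \<subseteq> Y" using XY(3) by simp
      have "(\<lambda>x. pconj L x g) ` ?X = (\<lambda>x. pconj L x g) ` X <#>\<^bsub>grp_on L S\<^esub> Q"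
        using F.fmor_set_mult_image[OF S_sub_fmor[OF gc(1)] XS QE] gc(2) by simp
      also have "\<dots> \<subseteq> ?Y" using im unfolding set_mult_def by blast
      finally have imE: "(\<lambda>x. pconj L x g) ` ?X \<subseteq> ?Y" .
      let ?h = "restrict (\<lambda>x. pconj L x g) ?X"
      have "?h \<in> fhom F ?X ?Y" unfolding F.fhom_iff
        using imE fE s F.fmor_cong[of ?X ?h "\<lambda>x. pconj L x g"] by (auto simp: image_subset_iff)
      moreover have "restrict ?h X = \<phi>"
      proof -
        have XX: "X \<subseteq> ?X" using F.sub_set_mult[OF XY(1) Q(1)] by blast
        have "restrict ?h X = restrict \<phi> X" using XX val by (auto simp: fun_eq_iff)
        then show ?thesis using \<psi>(5) by auto
      qed
      moreover have "?h ` Q = Q"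
      proof -
        have "Q \<subseteq> ?X" using F.sub_set_mult[OF XY(1) Q(1)] by blast
        then have "?h ` Q = (\<lambda>x. pconj L x g) ` Q" by (intro image_cong) auto
        then show ?thesis using gc(2) by simp
      qed
      ultimately have "\<exists>\<psi>\<in>fhom F ?X ?Y. restrict \<psi> X = \<phi> \<and> \<psi> ` Q = Q" by (intro bexI[of _ ?h] conjI)
      then show ?thesis using \<psi>(1) XN by (simp add: normalizer_fusion_def)
    qed
    moreover have "carrier (fgrp (normalizer_fusion F U)) \<subseteq> carrier (fgrp (normalizer_fusion F Q))"
      using NSU by (simp add: normalizer_fusion_def)
    ultimately show ?thesis unfolding subfusion_def by blast
  qed
  then show ?thesis using Q(1) CSQ by (simp add: large_in_fusion_def)
qed

section \<open>Centralizers of objects\<close>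

lemma chain_gconj:
  assumes g: "chain P [g] R" and x: "x \<in> NL P" "y \<in> NL P"
  shows "pconj L (gconj (GL P) x y) g = gconj (GL R) (pconj L x g) (pconj L y g)"
proof -
  have P: "P \<in> \<Delta>" using chain_objects g by blast
  interpret GP: finite_group "GL P" p using finite_group_GL[OF P] .
  interpret h: group_hom "GL P" "GL R" "\<lambda>x. pconj L x g" using chain_group_hom[OF g] .
  have c: "x \<in> carrier (GL P)" "y \<in> carrier (GL P)" "inv\<^bsub>GL P\<^esub> y \<in> carrier (GL P)"
    using x GP.inv_closed[of y] by simp_all
  show ?thesis
    using h.hom_mult[OF GP.m_closed[OF c(3,1)] c(2)] h.hom_mult[OF c(3,1)] h.hom_inv[OF c(2)]
    unfolding gconj_def by (simp del: grp_on_simps)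
qed

lemma chain_CL: assumes g: "chain P [g] R" and c: "c \<in> CL P" shows "pconj L c g \<in> CL R"
proof -
  have P: "P \<in> \<Delta>" "R \<in> \<Delta>" using chain_objects g by blast+
  have cN: "c \<in> NL P" using c CL_sub_NL by blast
  have "gconj (GL R) x (pconj L c g) = x" if x: "x \<in> R" for x
  proof -
    obtain y where y: "y \<in> P" "x = pconj L y g" using x chain_fmor(2)[OF g] by blast
    have "gconj (GL P) y c = y" using c y mem_CL_iff[OF P(1) cN] by blast
    then show ?thesis using chain_gconj[OF g _ cN, of y] y subsetD[OF obj_sub_NL[OF P(1)] y(1)] by simp
  qed
  then show ?thesis using mem_CL_iff[OF P(2) chain_conj(2)[OF g cN]] by blast
qed

lemma card_CL: assumes g: "chain P [g] R" shows "card (CL P) = card (CL R)"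
proof -
  have le: "card (CL A) \<le> card (CL B)" if "chain A [h] B" for A B h
  proof (rule card_inj_on_le)
    show "inj_on (\<lambda>x. pconj L x h) (CL A)" using inj_on_subset[OF chain_conj_inj[OF that] CL_sub_NL] .
    show "(\<lambda>x. pconj L x h) ` CL A \<subseteq> CL B" using chain_CL[OF that] by blast
    show "finite (CL B)" using finite_subset[OF subset_trans[OF CL_sub_NL NL_carrier] finite_L] .
  qed
  show ?thesis using le[OF g] le[OF chain_inv_single[OF g]] by (rule le_antisym)
qed

lemma CS_sylow: assumes "fully_normalized P" shows "sylow_in (GL P) p (CL P) (CS P)"
proof -
  have P: "P \<in> \<Delta>" and syl: "sylow_in (GL P) p (NL P) (NS P)" using assms by (auto simp: fully_normalized_def)
  interpret GP: finite_group "GL P" p using finite_group_GL[OF P] .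
  have "subgroup (NL P) (GL P)" using GP.subgroup_self by simp
  then have "sylow_in (GL P) p (CL P) (NS P \<inter> CL P)"
    using GP.sylow_in_normal[OF syl _ subgroup_CL[OF P] CL_sub_NL CL_normal[OF P]] by blast
  moreover have "NS P \<inter> CL P = CS P"
    using NS_eq[OF objects[OF P]] CS_eq[OF objects[OF P]] CL_sub_NL by blast
  ultimately show ?thesis by simp
qed

lemma core_centralizer:
  assumes P: "P \<in> \<Delta>" and syl: "sylow_in (GL P) p (CL P) (CS P)"
  shows "subgroup (p_core p (GL P) \<inter> CL P) (GL P)" "p_core p (GL P) \<inter> CL P \<subseteq> CS P"
proof -
  interpret GP: finite_group "GL P" p using finite_group_GL[OF P] .
  note core = GP.psubgroup_p_core
  show D: "subgroup (p_core p (GL P) \<inter> CL P) (GL P)"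
    using GP.subgroup_Int[OF GP.psubgroup_subgroup[OF core] subgroup_CL[OF P]] .
  show "p_core p (GL P) \<inter> CL P \<subseteq> CS P"
  proof (rule GP.sylow_contains_normal[OF syl subgroup_CL[OF P] GP.psubgroup_subset[OF core D]])
    fix k x assume "k \<in> CL P" "x \<in> p_core p (GL P) \<inter> CL P"
    then show "gconj (GL P) x k \<in> p_core p (GL P) \<inter> CL P"
      using GP.p_core_gconj[of x k] CL_normal[OF P, of k x] subsetD[OF CL_sub_NL, of k P] by auto
  qed blast+
qed

text \<open>For a fully normalized conjugate \<open>R\<close>, the intersection of the
  \<open>p\<close>-core with \<open>CL R\<close> lies in \<open>CS R\<close>, hence in
  \<open>R\<close>, so \<open>CL R\<close> centralizes it. Then
  \<open>characteristic_p_normal\<close> pushes \<open>CL R\<close> into the core and so into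
  \<open>R\<close>; the result is carried back to \<open>P\<close>.\<close>

lemma centric_object_centralizer:
  assumes ch: "objective_characteristic_p p L \<Delta>" and P: "P \<in> \<Delta>" and c: "F.centric P"
  shows "CL P \<subseteq> P"
proof
  obtain g R where g: "chain P [g] R" "fully_normalized R" using exists_fully_normalized[OF P] by blast
  have R: "R \<in> \<Delta>" using chain_objects g(1) by blast
  interpret GR: finite_group "GL R" p using finite_group_GL[OF R] .
  have "fconjugate F P R" using object_fconjugate_iff[OF P] g(1) by blast
  then have CSR: "CS R \<subseteq> R" using c unfolding F.centric_def by blast
  note D = core_centralizer[OF R CS_sylow[OF g(2)]]
  have CLR: "CL R \<subseteq> R"
  proof
    fix x assume x: "x \<in> CL R"
    have xN: "x \<in> NL R" using x CL_sub_NL by blast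
    have "x \<in> p_core p (GL R)"
    proof (rule GR.characteristic_p_normal[OF _ subgroup_CL[OF R] _ x])
      show "characteristic_p p (GL R)" using ch R by (simp add: objective_characteristic_p_def)
      show "gconj (GL R) c g \<in> CL R" if "g \<in> carrier (GL R)" "c \<in> CL R" for g c
        using CL_normal[OF R _ that(2)] that(1) by simp
      fix z assume z: "z \<in> p_core p (GL R) \<inter> CL R"
      then have zR: "z \<in> R" using D(2) CSR by blast
      then have "gconj (GL R) z x = z" using mem_CL_iff[OF R xN] x by blast
      then show "x \<otimes>\<^bsub>GL R\<^esub> z = z \<otimes>\<^bsub>GL R\<^esub> x"
        using GR.gconj_eq_self_iff[of z x] xN subsetD[OF obj_sub_NL[OF R] zR] by simp
    qed
    then show "x \<in> R" using x D(2) CSR by blast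
  qed
  fix x assume x: "x \<in> CL P"
  then have "pconj L x g \<in> (\<lambda>x. pconj L x g) ` P"
    using chain_CL[OF g(1)] CLR chain_fmor(2)[OF g(1)] by blast
  then obtain y where y: "pconj L x g = pconj L y g" "y \<in> P" by (rule imageE)
  have "x \<in> NL P" "y \<in> NL P" using x CL_sub_NL subsetD[OF obj_sub_NL[OF P] y(2)] by blast+
  then show "x \<in> P" using inj_onD[OF chain_conj_inj[OF g(1)] y(1)] y(2) by blast
qed

end

section \<open>From largeness in the fusion system to largeness in a linking locality\<close>

locale large_linking = locality p L \<Delta> S
  for p :: nat and L :: "'a pgroup" and \<Delta> :: "'a set set" and S :: "'a set" +
  fixes Q :: "'a set"
  assumes link: "linking_locality p L \<Delta> S" and Q_large: "large_in_fusion (locality_fusion p L S) Q"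
begin

sublocale LF: large_fusion p F Q
  rewrites "fgrp F = grp_on L S" and "carrier (grp_on L S) = S"
proof -
  show "large_fusion p F Q"
    by unfold_locales (use link Q_large in \<open>simp_all add: linking_locality_def\<close>)
qed simp_all

lemma char_p: "objective_characteristic_p p L \<Delta>"
  using link by (simp add: linking_locality_def)

text \<open>\<open>Q\<close> itself need not be an object, so \<open>NL Q\<close> is replaced by the group \<open>NL T\<close>.\<close>

definition T :: "'a set" where
  "T = (SOME T. LF.ext_normal T \<and> T \<in> centric_radical_subgroups p F)"

lemma T_normal: "LF.ext_normal T" and T_object: "T \<in> \<Delta>"
proof -
  have "LF.ext_normal T \<and> T \<in> centric_radical_subgroups p F"
    unfolding T_def by (rule someI_ex) (rule LF.exists_radical_ext_normal)
  then show "LF.ext_normal T" "T \<in> \<Delta>" using link unfolding linking_locality_def by blast+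
qed

abbreviation "M \<equiv> NL T"
abbreviation "cM \<equiv> gconj (GL T)"

sublocale M: finite_group "GL T" p
  by (rule finite_group_GL[OF T_object])

lemma Q_T: "Q \<subseteq> T" and NS_T: "NS T = S" and T_sub: "sub T"
  using T_normal LF.ext_normal_NS objects[OF T_object] unfolding LF.ext_normal_def by auto

lemma S_M: "S \<subseteq> M"
  using NS_eq[OF T_sub] NS_T by blast

lemma M_closed: "m \<in> M \<Longrightarrow> inv\<^bsub>GL T\<^esub> m \<in> M" "m \<in> M \<Longrightarrow> k \<in> M \<Longrightarrow> m \<otimes>\<^bsub>GL T\<^esub> k \<in> M"
    "x \<in> M \<Longrightarrow> m \<in> M \<Longrightarrow> cM x m \<in> M"
  using M.inv_closed[of m] M.m_closed[of m k] M.gconj_closed[of x m] by simp_all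

lemma M_pconj: "x \<in> M \<Longrightarrow> m \<in> M \<Longrightarrow> pconj L x m = cM x m"
  by (rule GL_gconj[OF T_object, symmetric])

lemma S_cM: "x \<in> S \<Longrightarrow> s \<in> S \<Longrightarrow> cM x s = gconj (grp_on L S) x s"
  using M_pconj S_pconj(1) S_M by (metis subsetD)

lemma cM_comp: "x \<in> M \<Longrightarrow> m \<in> M \<Longrightarrow> k \<in> M \<Longrightarrow> cM x (m \<otimes>\<^bsub>GL T\<^esub> k) = cM (cM x m) k"
  using M.gconj_comp[of x m k] by simp

text \<open>By weak closure \<open>T\<close> is its own fully normalized conjugate, and its
  normalizer in \<open>S\<close> is \<open>S\<close>.\<close>

lemma sylow_S: "sylow_in (GL T) p M S"
proof -
  obtain g R where g: "chain T [g] R" "fully_normalized R" using exists_fully_normalized[OF T_object] by blast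
  have "R = T"
    using LF.ext_normal_weakly_closed[OF T_normal chain_fmor(1)[OF g(1)] subset_refl] chain_fmor(2)[OF g(1)] by simp
  then show ?thesis using g(2) NS_T by (simp add: fully_normalized_def)
qed

lemma M_S_sub: assumes "m \<in> M" "X \<subseteq> S" "\<And>x. x \<in> X \<Longrightarrow> cM x m \<in> S" shows "X \<subseteq> S_sub L S m"
proof
  fix x assume x: "x \<in> X"
  have xM: "x \<in> M" using x assms(2) S_M by blast
  show "x \<in> S_sub L S m"
    using gconj_grp_on[OF NL_partial[OF T_object] xM assms(1)] assms(3)[OF x] subsetD[OF assms(2) x]
    by (simp add: S_sub_def)
qed

lemma M_fmor: assumes m: "m \<in> M" and X: "sub X" "\<And>x. x \<in> X \<Longrightarrow> cM x m \<in> S" shows "fmor F X (\<lambda>x. cM x m)"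
proof -
  have mc: "m \<in> carrier L" using subsetD[OF NL_carrier m] .
  have "fmor F X (\<lambda>x. pconj L x m)"
    using F.fmor_mono[OF S_sub_fmor[OF mc] X(1) M_S_sub[OF m sub_S[OF X(1)] X(2)]] .
  moreover have "pconj L x m = cM x m" if "x \<in> X" for x
    using M_pconj[OF _ m, of x] that sub_S[OF X(1)] S_M by blast
  ultimately show ?thesis using F.fmor_cong[of X "\<lambda>x. pconj L x m" "\<lambda>x. cM x m"] by simp
qed

text \<open>An element of \<open>M\<close> induces a morphism on \<open>T\<close>, which contains
  the weakly closed subgroup \<open>Q\<close>.\<close>

lemma M_Q:
  assumes m: "m \<in> M"
  shows "m \<in> NL Q" "\<And>z. z \<in> LF.ZQ \<Longrightarrow> cM z m \<in> LF.ZQ"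
proof -
  have c: "chain T [m] T" using mem_NL_iff[OF T_object] m by blast
  note f = chain_fmor(1)[OF c]
  have im: "(\<lambda>x. pconj L x m) ` Q = Q" using LF.Q_weakly_closed[OF f Q_T] .
  moreover have "Q \<subseteq> conj_dom L m" "m \<in> carrier L" using c Q_T by (auto simp: chain_single)
  ultimately show "m \<in> NL Q" by (simp add: pnormalizer_def pconj_set_def)
  fix z assume z: "z \<in> LF.ZQ"
  then have "pconj L z m \<in> LF.ZQ" using LF.maps_into_ZQ[OF f Q_T subset_refl] by blast
  moreover have "z \<in> M" using z LF.ZQ_sub sub_S[OF LF.Q_sgr] S_M by blast
  ultimately show "cM z m \<in> LF.ZQ" using M_pconj[OF _ m] by simp
qed

lemma ZQ_S: "LF.ZQ \<subseteq> S" using LF.ZQ_sub sub_S[OF LF.Q_sgr] by blast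

text \<open>\<open>S\<close> lies in \<open>M\<close>, and \<open>M\<close> preserves
  \<open>Z(Q)\<close>.\<close>

lemma NS_Int_ZQ: assumes R: "sub R" shows "NS R \<subseteq> NS (R \<inter> LF.ZQ)"
proof
  fix g assume g: "g \<in> NS R"
  have s: "sub (R \<inter> LF.ZQ)" using S.subgroup_Int[OF R LF.ZQ_sgr] .
  have gS: "g \<in> S" using g F.NS_sub[OF R] by blast
  have "gconj (grp_on L S) x g \<in> R \<inter> LF.ZQ" if x: "x \<in> R \<inter> LF.ZQ" for x
  proof -
    have "gconj (grp_on L S) x g \<in> R" using F.NS_gconj[OF R g] x by blast
    moreover have "cM x g \<in> LF.ZQ" using M_Q(2) gS S_M x by blast
    ultimately show ?thesis using S_cM[OF _ gS, of x] x ZQ_S by auto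
  qed
  then show "g \<in> NS (R \<inter> LF.ZQ)" using F.mem_NS_iff[OF s] gS by blast
qed

text \<open>\<open>h\<close> extends over \<open>Q\<close> by \<open>extend_over_Q\<close>, and
  further over \<open>T\<close> with \<open>T\<close> preserved. The final domain contains
  \<open>T\<close> and so is an object; the extension is therefore conjugation by a single element,
  and this element normalizes \<open>T\<close>.\<close>

lemma realize:
  assumes V: "sub V" "V \<subseteq> LF.ZQ" "V \<noteq> {\<one>\<^bsub>grp_on L S\<^esub>}" "V \<subseteq> X" "X \<subseteq> NS V"
    and h: "fmor F X h" "h ` V \<subseteq> LF.ZQ"
  shows "\<exists>m\<in>M. \<forall>x\<in>X. h x = cM x m"
proof -
  obtain g where g: "fmor F (X <#>\<^bsub>grp_on L S\<^esub> Q) g" "\<forall>x\<in>X. g x = h x"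
    using LF.extend_over_Q[OF V h] by blast
  have Xs: "sub X" using F.fmor_sgr[OF h(1)] .
  let ?X = "X <#>\<^bsub>grp_on L S\<^esub> Q"
  have X1: "sub ?X" "X \<subseteq> ?X" "Q \<subseteq> ?X" using F.fmor_sgr[OF g(1)] F.sub_set_mult[OF Xs LF.Q_sgr] by simp_all
  let ?E = "?X <#>\<^bsub>grp_on L S\<^esub> T"
  obtain k where k: "fmor F ?E k" "k ` T = T" "\<forall>x\<in>?X. k x = g x"
    using LF.ext_normalD[OF T_normal X1(3) g(1)] by blast
  have E: "sub ?E" "?X \<subseteq> ?E" "T \<subseteq> ?E" using F.fmor_sgr[OF k(1)] F.sub_set_mult[OF X1(1) T_sub] by simp_all
  have ED: "?E \<in> \<Delta>" using overgroup_closed[OF T_object E(1,3)] .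
  obtain m where m: "chain ?E [m] (k ` ?E)" "\<forall>x\<in>?E. k x = pconj L x m" using object_morphism[OF ED k(1)] by blast
  have mM: "m \<in> M" using conj_object_normalizer[OF m E(3) k(2)] .
  have "h x = cM x m" if x: "x \<in> X" for x
  proof -
    have "x \<in> ?X" "x \<in> ?E" "x \<in> M" using x X1(2) E(2) sub_S[OF Xs] S_M by blast+
    then have "h x = pconj L x m" using g(2) k(3) m(2) x by metis
    then show ?thesis using M_pconj[OF \<open>x \<in> M\<close> mM] by simp
  qed
  then show ?thesis using mM by blast
qed

lemma sub_M: "sub R \<Longrightarrow> R \<subseteq> M" using sub_S S_M by blast

lemma NS_M: assumes R: "sub R" shows "NS R = S \<inter> normalizer (GL T) R"
proof -
  have Rc: "R \<subseteq> carrier (GL T)" "finite R" using sub_M[OF R] finite_subset[OF sub_S[OF R] finite_S] by simp_all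
  have "g \<in> NS R \<longleftrightarrow> g \<in> normalizer (GL T) R" if g: "g \<in> S" for g
  proof -
    have "cM x g = gconj (grp_on L S) x g" if "x \<in> R" for x using S_cM[OF _ g] sub_S[OF R] that by blast
    then show ?thesis using F.mem_NS_iff[OF R, of g] M.mem_normalizer_iff[OF Rc, of g] g S_M by auto
  qed
  then show ?thesis using F.NS_sub[OF R] by blast
qed

lemma M_image_sub:
  assumes R: "sub R" and m: "m \<in> M" and RS: "\<And>x. x \<in> R \<Longrightarrow> cM x m \<in> S" shows "sub ((\<lambda>x. cM x m) ` R)"
  using F.fmor_image_all[OF M_fmor[OF m R RS]] .

text \<open>A Sylow subgroup of the normalizer of \<open>R\<close> in \<open>M\<close>, chosen above
  \<open>NS R\<close>, is conjugated into \<open>S\<close>. It then lies in the normalizer in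
  \<open>S\<close> of the conjugate of \<open>R\<close>, which by comparison of orders is
  Sylow.\<close>

lemma exists_sylow_conj:
  assumes R: "sub R"
  shows "\<exists>a\<in>M. (\<forall>x\<in>NS R. cM x a \<in> S) \<and>
    sylow_in (GL T) p (normalizer (GL T) ((\<lambda>x. cM x a) ` R)) (NS ((\<lambda>x. cM x a) ` R))"
proof -
  have Rc: "R \<subseteq> carrier (GL T)" using sub_M[OF R] by simp
  let ?N = "normalizer (GL T) R"
  have N: "subgroup ?N (GL T)" using M.normalizer_imp_subgroup[OF Rc] .
  have NR: "psubgroup (GL T) p (NS R)" "NS R \<subseteq> ?N"
    using psub_GL[OF T_object F.sgr_NS[OF R] sub_M[OF F.sgr_NS[OF R]]] NS_M[OF R] by auto
  obtain A where A: "sylow_in (GL T) p ?N A" "NS R \<subseteq> A" using M.sylow_in_extends[OF N NR] by blast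
  have Ap: "psubgroup (GL T) p A" "A \<subseteq> ?N" "A \<subseteq> M"
    using sylow_inD(1,2)[OF A(1)] subgroup.subset[OF sylow_inD(3)[OF A(1)]] by auto
  obtain a where a: "a \<in> M" "\<forall>x\<in>A. cM x a \<in> S" using sylow_inD(4)[OF sylow_S Ap(1,3)] by blast
  have ac: "a \<in> carrier (GL T)" using a by simp
  let ?R = "(\<lambda>x. cM x a) ` R"
  have NRS: "cM x a \<in> S" if "x \<in> NS R" for x using a A that by blast
  have R2: "sub ?R" using M_image_sub[OF R a(1)] NRS F.sub_NS[OF R] by blast
  have R2c: "?R \<subseteq> carrier (GL T)" using sub_M[OF R2] by simp
  let ?N2 = "normalizer (GL T) ?R"
  have N2: "subgroup ?N2 (GL T)" using M.normalizer_imp_subgroup[OF R2c] .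
  have N2im: "(\<lambda>x. cM x a) ` ?N = ?N2" using M.normalizer_gconj[OF Rc ac] .
  have cN2: "card ?N2 = card ?N" using M.card_gconj_image[OF subgroup.subset[OF N] ac] N2im by simp
  have NS2: "psubgroup (GL T) p (NS ?R)" "NS ?R \<subseteq> ?N2"
    using psub_GL[OF T_object F.sgr_NS[OF R2] sub_M[OF F.sgr_NS[OF R2]]] NS_M[OF R2] by auto
  obtain B where B: "sylow_in (GL T) p ?N2 B" "NS ?R \<subseteq> B" using M.sylow_in_extends[OF N2 NS2] by blast
  have "(\<lambda>x. cM x a) ` A \<subseteq> NS ?R" using a(2) Ap(2) N2im NS_M[OF R2] by blast
  then have "card A \<le> card (NS ?R)"
    using M.card_gconj_image[of A a] Ap(3) ac card_mono[OF finite_subset[OF F.NS_sub[OF R2] finite_S]] by (metis M.subgroup_self sub_M grp_on_simps(1))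
  moreover have "card A = card B"
    using M.sylow_in_card[OF N A(1)] M.sylow_in_card[OF N2 B(1)] cN2 by simp
  ultimately have "NS ?R = B"
    using card_seteq[OF M.finite_subgroup[OF sylow_inD(3)[OF B(1)]] B(2)] by simp
  then show ?thesis using a(1) NRS B(1) by blast
qed

text \<open>The element of \<open>M\<close> inducing \<open>h\<close> on \<open>R\<close> is first corrected by an element centralizing the
  image of \<open>R\<close>, so that it maps \<open>Y\<close> into \<open>S\<close>; the remaining discrepancy is a morphism fixing the
  image of \<open>R\<close> pointwise, hence normalizing a nontrivial subgroup of \<open>ZQ\<close>.\<close>

lemma agree_step:
  assumes R: "sub R" "R \<subseteq> Y" "Y \<subseteq> NS R" and h: "fmor F Y h"
    and m: "m \<in> M" "\<And>x. x \<in> R \<Longrightarrow> h x = cM x m" and u: "u \<in> R" "u \<in> LF.ZQ" "u \<noteq> \<one>\<^bsub>grp_on L S\<^esub>"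
  shows "\<exists>m\<in>M. \<forall>y\<in>Y. h y = cM y m"
proof -
  have Y: "sub Y" using F.fmor_sgr[OF h] .
  have YM: "y \<in> M" "y \<in> S" if "y \<in> Y" for y using that sub_M[OF Y] sub_S[OF Y] by blast+
  have hS: "h y \<in> S" "h y \<in> M" if "y \<in> Y" for y using F.fmor_closed[OF h that] S_M by auto
  let ?R1 = "h ` R"
  have R1: "sub ?R1" using F.fmor_image[OF h R(1,2)] .
  \<comment> \<open>Replaces the image of \<open>R\<close> by an \<open>M\<close>-conjugate with the
    Sylow property that \<open>sylow_in_conj_normal\<close> requires.\<close>
  obtain a where a: "a \<in> M" "\<forall>x\<in>NS ?R1. cM x a \<in> S"
    "sylow_in (GL T) p (normalizer (GL T) ((\<lambda>x. cM x a) ` ?R1)) (NS ((\<lambda>x. cM x a) ` ?R1))"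
    using exists_sylow_conj[OF R1] by blast
  let ?R2 = "(\<lambda>x. cM x a) ` ?R1"
  have hN: "h y \<in> NS ?R1" if "y \<in> Y" for y using F.fmor_image_NS[OF h R(1,2)] that R(3) by blast
  have R2: "sub ?R2" using M_image_sub[OF R1 a(1)] a(2) F.sub_NS[OF R1] by blast
  have R2c: "?R2 \<subseteq> carrier (GL T)" "finite ?R2"
    using sub_M[OF R2] finite_subset[OF sub_S[OF R2] finite_S] by simp_all
  let ?N2 = "normalizer (GL T) ?R2"
  have N2: "subgroup ?N2 (GL T)" using M.normalizer_imp_subgroup[OF R2c(1)] .
  define n where "n = m \<otimes>\<^bsub>GL T\<^esub> a"
  have n: "n \<in> M" unfolding n_def using M_closed m a by blast
  have nR: "cM r n = cM (h r) a" if "r \<in> R" for r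
    unfolding n_def using cM_comp[OF YM(1) m(1) a(1)] m(2) that R(2) by auto
  have conjR: "cM r y \<in> R" "cM r y = gconj (grp_on L S) r y" if "r \<in> R" "y \<in> Y" for r y
  proof -
    have rS: "r \<in> S" "y \<in> S" using that YM R(2) by blast+
    show e: "cM r y = gconj (grp_on L S) r y" using S_cM[OF rS] .
    show "cM r y \<in> R" unfolding e using F.NS_gconj[OF R(1) subsetD[OF R(3) that(2)] that(1)] .
  qed
  have hgconj: "cM (h r) (h y) = h (cM r y)" if "r \<in> R" "y \<in> Y" for r y
  proof -
    have rY: "r \<in> Y" using that R(2) by blast
    have "h (gconj (grp_on L S) r y) = gconj (grp_on L S) (h r) (h y)" using F.fmor_gconj[OF h rY that(2)] .
    then show ?thesis using S_cM[OF hS(1)[OF rY] hS(1)[OF that(2)]] conjR(2)[OF that] by simp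
  qed
  \<comment> \<open>On \<open>R\<close> conjugation by \<open>n\<close> agrees with \<open>h\<close>
    followed by \<open>a\<close>. Hence the two images of an element \<open>y\<close> of
    \<open>Y\<close> act alike on \<open>?R2\<close>, that is, they differ by an element of the
    centralizer \<open>C\<close>.\<close>
  have mixed: "cM x (cM y n) = cM x (cM (h y) a)" if x: "x \<in> ?R2" and y: "y \<in> Y" for x y
  proof -
    obtain r where r: "r \<in> R" "x = cM (h r) a" using x by blast
    have rY: "r \<in> Y" using r R(2) by blast
    have "cM x (cM y n) = cM (cM r n) (cM y n)" using nR r by simp
    also have "\<dots> = cM (cM r y) n" using M.gconj_gconj[of r n y] YM(1)[OF rY] YM(1)[OF y] n by simp
    also have "\<dots> = cM (h (cM r y)) a" using nR conjR(1)[OF r(1) y] by simp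
    also have "\<dots> = cM (cM (h r) (h y)) a" using hgconj[OF r(1) y] by simp
    also have "\<dots> = cM x (cM (h y) a)"
      using M.gconj_gconj[of "h r" a "h y"] hS(2)[OF rY] hS(2)[OF y] a(1) r(2) by simp
    finally show ?thesis .
  qed
  have sN: "cM (h y) a \<in> NS ?R2" if y: "y \<in> Y" for y
  proof -
    have "cM x (cM (h y) a) \<in> ?R2" if x: "x \<in> ?R2" for x
    proof -
      obtain r where r: "r \<in> R" "x = cM (h r) a" using x by blast
      have rY: "r \<in> Y" using r R(2) by blast
      have "cM x (cM (h y) a) = cM (h (cM r y)) a"
        using M.gconj_gconj[of "h r" a "h y"] hS(2)[OF rY] hS(2)[OF y] a(1) r(2) hgconj[OF r(1) y] by simp
      then show ?thesis using conjR(1)[OF r(1) y] by blast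
    qed
    moreover have "cM (h y) a \<in> S" using a(2) hN[OF y] by blast
    ultimately show ?thesis using NS_M[OF R2] M.mem_normalizer_iff[OF R2c] S_M by auto
  qed
  define C where "C = {c \<in> carrier (GL T). \<forall>x\<in>?R2. cM x c = x}"
  have C: "subgroup C (GL T)" "C \<subseteq> ?N2" "\<And>k c. k \<in> ?N2 \<Longrightarrow> c \<in> C \<Longrightarrow> cM c k \<in> C"
    unfolding C_def
    using M.subgroup_fixing[OF R2c(1)] M.fixing_sub_normalizer[OF R2c(1)] M.fixing_normal[OF R2c(1)] by blast+
  have nc: "n \<in> carrier (GL T)" using n by simp
  have Yp: "psubgroup (GL T) p ((\<lambda>y. cM y n) ` Y)"
    using M.psubgroup_gconj[OF psub_GL[OF T_object Y sub_M[OF Y]] nc] .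
  have "\<exists>c\<in>C. \<forall>b\<in>(\<lambda>y. cM y n) ` Y. cM b c \<in> NS ?R2"
  proof (rule M.sylow_in_conj_normal[OF a(3) N2 C Yp])
    fix b assume "b \<in> (\<lambda>y. cM y n) ` Y"
    then obtain y where y: "y \<in> Y" "b = cM y n" by blast
    let ?s = "cM (h y) a"
    have s: "?s \<in> M" "inv\<^bsub>GL T\<^esub> ?s \<in> M" using M_closed hS(2)[OF y(1)] a(1) by blast+
    have bM: "b \<in> M" using M_closed YM(1)[OF y(1)] n y(2) by blast
    have "cM x (b \<otimes>\<^bsub>GL T\<^esub> inv\<^bsub>GL T\<^esub> ?s) = x" if x: "x \<in> ?R2" for x
    proof -
      have xM: "x \<in> M" using x sub_M[OF R2] by blast
      have "cM x (b \<otimes>\<^bsub>GL T\<^esub> inv\<^bsub>GL T\<^esub> ?s) = cM (cM x ?s) (inv\<^bsub>GL T\<^esub> ?s)"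
        using cM_comp[OF xM bM s(2)] mixed[OF x y(1)] y(2) by simp
      then show ?thesis using M.gconj_cancel(1)[of x ?s] xM s(1) by simp
    qed
    then have "b \<otimes>\<^bsub>GL T\<^esub> inv\<^bsub>GL T\<^esub> ?s \<in> C" unfolding C_def using M_closed(2)[OF bM s(2)] by simp
    moreover have "b = (b \<otimes>\<^bsub>GL T\<^esub> inv\<^bsub>GL T\<^esub> ?s) \<otimes>\<^bsub>GL T\<^esub> ?s"
      using M.m_assoc[of b "inv\<^bsub>GL T\<^esub> ?s" ?s] M.l_inv[of ?s] M.r_one[of b] bM s by (simp del: grp_on_simps(2,3))
    ultimately show "\<exists>c\<in>C. \<exists>t\<in>NS ?R2. b = c \<otimes>\<^bsub>GL T\<^esub> t" using sN[OF y(1)] by blast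
  qed
  then obtain c where c: "c \<in> C" "\<And>y. y \<in> Y \<Longrightarrow> cM (cM y n) c \<in> NS ?R2" by blast
  have cc: "c \<in> M" "\<And>x. x \<in> ?R2 \<Longrightarrow> cM x c = x" using c(1) by (auto simp: C_def)
  define k where "k = n \<otimes>\<^bsub>GL T\<^esub> c"
  have k: "k \<in> M" unfolding k_def using M_closed n cc by blast
  have kN: "cM y k \<in> NS ?R2" if "y \<in> Y" for y
    unfolding k_def using cM_comp[OF YM(1)[OF that] n cc(1)] c(2)[OF that] by simp
  have kS: "cM y k \<in> S" if "y \<in> Y" for y using kN[OF that] F.NS_sub[OF R2] by blast
  have fk: "fmor F Y (\<lambda>y. cM y k)" using M_fmor[OF k Y kS] .
  let ?k = "\<lambda>y. cM y k" and ?ki = "inv_into Y (\<lambda>y. cM y k)"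
  let ?h = "\<lambda>z. cM (h (?ki z)) a"
  have ki: "fmor F (?k ` Y) ?ki" "?ki ` ?k ` Y = Y"
    using F.fmor_inv[OF fk] F.fmor_inv_image[OF fk subset_refl] by auto
  have f1: "fmor F (?k ` Y) (\<lambda>z. h (?ki z))" using F.fmor_comp[OF ki(1) h] ki(2) by simp
  have hY: "fmor F (h ` Y) (\<lambda>x. cM x a)"
    by (rule M_fmor[OF a(1) F.fmor_image_all[OF h]]) (use a(2) hN in blast)
  have "(\<lambda>z. h (?ki z)) ` ?k ` Y = h ` ?ki ` ?k ` Y" by (simp only: image_image)
  then have f2: "fmor F (?k ` Y) ?h" using F.fmor_comp[OF f1 hY] ki(2) by simp
  have hk: "?h (?k y) = cM (h y) a" if "y \<in> Y" for y using F.fmor_inv_f[OF fk that] by simp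
  have R2k: "x \<in> ?k ` Y \<and> ?h x = x" if x: "x \<in> ?R2" for x
  proof -
    obtain r where r: "r \<in> R" "x = cM (h r) a" using x by blast
    have rY: "r \<in> Y" using r R(2) by blast
    have "?k r = cM (cM r n) c" unfolding k_def using cM_comp[OF YM(1)[OF rY] n cc(1)] .
    also have "\<dots> = x" using nR[OF r(1)] r(2) cc(2)[OF x] by simp
    finally have e: "?k r = x" .
    have "x \<in> ?k ` Y" using e rY by (rule image_eqI[OF sym])
    then show ?thesis using hk[OF rY] r(2) e by simp
  qed
  \<comment> \<open>Nontrivial because \<open>M\<close> preserves \<open>Z(Q)\<close>: the conjugate
    of \<open>u\<close> by \<open>n\<close> lies in it.\<close>
  let ?V = "?R2 \<inter> LF.ZQ"
  have V: "sub ?V" using S.subgroup_Int[OF R2 LF.ZQ_sgr] .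
  have Vnt: "?V \<noteq> {\<one>\<^bsub>grp_on L S\<^esub>}"
  proof
    assume eq: "?V = {\<one>\<^bsub>grp_on L S\<^esub>}"
    have uY: "u \<in> M" "u \<in> Y" using u(1) R(2) YM by blast+
    have "cM u n \<in> ?R2" using nR[OF u(1)] u(1) by blast
    then have "cM u n \<in> ?V" using M_Q(2)[OF n u(2)] by blast
    then have "cM u n = \<one>\<^bsub>GL T\<^esub>" using eq by simp
    moreover have "cM \<one>\<^bsub>GL T\<^esub> n = \<one>\<^bsub>GL T\<^esub>" using M.one_gconj[OF nc] .
    ultimately have "u = \<one>\<^bsub>GL T\<^esub>" using M.gconj_inj[of u "\<one>\<^bsub>GL T\<^esub>" n] uY nc M.one_closed by (simp del: grp_on_simps(2))
    then show False using u(3) by simp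
  qed
  have Vk: "?V \<subseteq> ?k ` Y" using R2k by blast
  have "?k ` Y \<subseteq> NS ?R2" using kN by blast
  then have kV: "?k ` Y \<subseteq> NS ?V" using NS_Int_ZQ[OF R2] by (rule subset_trans)
  have "?h ` ?V \<subseteq> LF.ZQ"
  proof (rule image_subsetI)
    fix x assume "x \<in> ?V"
    then show "?h x \<in> LF.ZQ" using R2k[of x] by simp
  qed
  then obtain l where l: "l \<in> M" "\<forall>z\<in>?k ` Y. ?h z = cM z l"
    using realize[OF V Int_lower2 Vnt Vk kV f2] by blast
  have ia: "inv\<^bsub>GL T\<^esub> a \<in> M" using M_closed a(1) by blast
  have kl: "k \<otimes>\<^bsub>GL T\<^esub> l \<in> M" using M_closed k l by blast
  have "h y = cM y (k \<otimes>\<^bsub>GL T\<^esub> l \<otimes>\<^bsub>GL T\<^esub> inv\<^bsub>GL T\<^esub> a)" if y: "y \<in> Y" for y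
  proof -
    have "cM (h y) a = cM (?k y) l" using l(2) hk[OF y] y by auto
    also have "\<dots> = cM y (k \<otimes>\<^bsub>GL T\<^esub> l)" using cM_comp[OF YM(1)[OF y] k l(1)] by simp
    finally have e: "cM (h y) a = cM y (k \<otimes>\<^bsub>GL T\<^esub> l)" .
    have "h y = cM (cM (h y) a) (inv\<^bsub>GL T\<^esub> a)" using M.gconj_cancel(1)[of "h y" a] hS(2)[OF y] a(1) by simp
    then show ?thesis using cM_comp[OF YM(1)[OF y] kl ia] e by simp
  qed
  then show ?thesis using M_closed(2)[OF kl ia] by blast
qed

text \<open>On \<open>U\<close> itself the matching element comes from \<open>realize\<close>. A
  maximal subgroup between \<open>U\<close> and \<open>S_f\<close> with a matching element must be
  \<open>S_f\<close>, since otherwise \<open>agree_step\<close> enlarges it inside its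
  normalizer.\<close>

lemma agree_normalizer:
  assumes U: "sub U" "U \<subseteq> LF.ZQ" "U \<noteq> {\<one>\<^bsub>grp_on L S\<^esub>}" and f: "f \<in> NL U"
  shows "U \<subseteq> S_sub L S f" "\<exists>m\<in>M. \<forall>x\<in>S_sub L S f. pconj L x f = cM x m"
proof -
  have fc: "f \<in> carrier L" "U \<subseteq> conj_dom L f" "(\<lambda>x. pconj L x f) ` U = U"
    using f by (auto simp: pnormalizer_def pconj_set_def)
  let ?P = "S_sub L S f"
  show UP: "U \<subseteq> ?P" using fc sub_S[OF U(1)] unfolding S_sub_def by blast
  have P: "sub ?P" "fmor F ?P (\<lambda>x. pconj L x f)" using sub_S_sub S_sub_fmor fc by blast+
  define X where "X = {R. sub R \<and> U \<subseteq> R \<and> R \<subseteq> ?P \<and> (\<exists>m\<in>M. \<forall>x\<in>R. pconj L x f = cM x m)}"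
  have "\<exists>m\<in>M. \<forall>x\<in>U. pconj L x f = cM x m"
    using realize[OF U subset_refl F.sub_NS[OF U(1)] F.fmor_mono[OF P(2) U(1) UP]] fc(3) U(2) by simp
  then have "U \<in> X" using U(1) UP unfolding X_def by blast
  moreover have "finite X"
    by (rule finite_subset[of _ "Pow S"]) (use sub_S in \<open>auto simp: X_def\<close>)
  ultimately obtain R where RX: "R \<in> X" "\<And>R'. R' \<in> X \<Longrightarrow> R \<subseteq> R' \<Longrightarrow> R = R'"
    using finite_has_maximal[of X] by blast
  obtain m where R: "sub R" "U \<subseteq> R" "R \<subseteq> ?P" and m: "m \<in> M" "\<forall>x\<in>R. pconj L x f = cM x m"
    using RX(1) unfolding X_def by blast
  have "R = ?P"
  proof (rule ccontr)
    assume "R \<noteq> ?P"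
    then have "R \<subset> ?P" using R(3) by blast
    then have grow: "R \<subset> ?P \<inter> NS R" using F.normalizer_grows_in[OF R(1) P(1)] by blast
    let ?Y = "?P \<inter> NS R"
    have Y: "sub ?Y" using S.subgroup_Int[OF P(1) F.sgr_NS[OF R(1)]] .
    obtain u where u: "u \<in> U" "u \<noteq> \<one>\<^bsub>grp_on L S\<^esub>" using U(3) subgroup.one_closed[OF U(1)] by blast
    have "\<exists>m\<in>M. \<forall>y\<in>?Y. pconj L y f = cM y m"
    proof (rule agree_step[OF R(1) _ _ F.fmor_mono[OF P(2) Y] m(1)])
      show "u \<in> R" "u \<in> LF.ZQ" "u \<noteq> \<one>\<^bsub>grp_on L S\<^esub>" using u R(2) U(2) by blast+
      show "R \<subseteq> ?Y" using grow by blast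
    qed (use m(2) in blast)+
    then have "?Y \<in> X" using Y grow R(2) unfolding X_def by blast
    then show False using RX(2)[of ?Y] grow by blast
  qed
  then show "\<exists>m\<in>M. \<forall>x\<in>?P. pconj L x f = cM x m" using m by blast
qed

text \<open>\<open>C\<^sub>S(P)\<close> is a Sylow subgroup of \<open>CL P\<close>, hence contains \<open>O\<^sub>p(N\<^sub>L(P)) \<inter> CL P\<close>; a given
  \<open>c\<close> then agrees on the product of \<open>P\<close> with that subgroup with an element of \<open>M\<close>.\<close>

lemma CL_sub_M_maximal:
  assumes P: "P \<in> \<Delta>" and nt: "P \<inter> LF.ZQ \<noteq> {\<one>\<^bsub>grp_on L S\<^esub>}"
    and max: "\<And>a. a \<in> M \<Longrightarrow> (\<And>x. x \<in> P \<Longrightarrow> cM x a \<in> S) \<Longrightarrow> card (CS ((\<lambda>x. cM x a) ` P)) \<le> card (CS P)"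
  shows "CL P \<subseteq> M"
proof
  have Ps: "sub P" using objects[OF P] .
  have PM: "x \<in> M" if "x \<in> P" for x using that sub_M[OF Ps] by blast
  let ?V = "P \<inter> LF.ZQ"
  have V: "sub ?V" using S.subgroup_Int[OF Ps LF.ZQ_sgr] .
  have PV: "P \<subseteq> NS ?V" using F.sub_NS[OF Ps] NS_Int_ZQ[OF Ps] by (rule subset_trans)
  have anti: "CS B \<subseteq> CS A" if "A \<subseteq> B" for A B using that by (auto simp: gcentralizer_def)
  obtain g R where g: "chain P [g] R" "fully_normalized R" using exists_fully_normalized[OF P] by blast
  have R: "R \<in> \<Delta>" "sub R" using chain_objects[of P "[g]" R] g(1) objects by blast+
  interpret GP: finite_group "GL P" p using finite_group_GL[OF P] .
  interpret GR: finite_group "GL R" p using finite_group_GL[OF R(1)] .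
  note cg = chain_fmor[OF g(1)]
  let ?V3 = "(\<lambda>x. pconj L x g) ` ?V"
  have gV: "fmor F ?V (\<lambda>x. pconj L x g)" using F.fmor_mono[OF cg(1) V Int_lower1] .
  have V3: "sub ?V3" using F.fmor_image_all[OF gV] .
  have "fconjugate F ?V ?V3" using F.fconjugateI[OF gV] .
  \<comment> \<open>The fully normalized \<open>R\<close> need not be conjugate to \<open>P\<close>
    under \<open>M\<close>. Moving it on by \<open>h\<close> so that the image of \<open>?V\<close>
    returns to \<open>Z(Q)\<close> makes the composite realizable in \<open>M\<close>, and the
    maximality of \<open>card (CS P)\<close> then bounds \<open>card (CS R)\<close>.\<close>
  then obtain h where h: "fmor F (NS ?V3) h" "h ` ?V3 \<subseteq> LF.ZQ"
    using LF.reach_into_ZQ[OF V Int_lower2] by blast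
  have "(\<lambda>x. pconj L x g) ` (P \<inter> NS ?V) \<subseteq> NS ?V3" using F.fmor_image_NS[OF cg(1) V Int_lower1] .
  moreover have "P \<inter> NS ?V = P" using PV by blast
  ultimately have RV: "R \<subseteq> NS ?V3" using cg(2) by simp
  have "?V3 \<subseteq> R" using cg(2) by blast
  then have CRV: "CS R \<subseteq> NS ?V3" using anti F.CS_sub_NS[OF V3] by blast
  let ?h = "\<lambda>x. h (pconj L x g)"
  have fh: "fmor F P ?h" using F.fmor_comp[OF cg(1) h(1)] cg(2) RV by simp
  have "?h ` ?V \<subseteq> LF.ZQ" using h(2) by blast
  then obtain b where b: "b \<in> M" "\<forall>x\<in>P. ?h x = cM x b"
    using realize[OF V Int_lower2 nt Int_lower1 PV fh] by blast
  have im: "(\<lambda>x. cM x b) ` P = h ` R"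
  proof -
    have "(\<lambda>x. cM x b) ` P = ?h ` P" using b(2) by (intro image_cong) auto
    also have "\<dots> = h ` (\<lambda>x. pconj L x g) ` P" by (simp only: image_image)
    finally show ?thesis using cg(2) by simp
  qed
  have bS: "cM x b \<in> S" if "x \<in> P" for x using b(2) F.fmor_closed[OF fh that] that by simp
  have hR: "sub (h ` R)" using F.fmor_image[OF h(1) R(2) RV] .
  have "h ` (NS ?V3 \<inter> CS R) \<subseteq> CS (h ` R)" using F.fmor_image_CS[OF h(1) RV] .
  then have hC: "h ` CS R \<subseteq> CS (h ` R)" using CRV by (simp add: Int_absorb1)
  have fin: "finite (CS (h ` R))"
    by (rule finite_subset[OF _ finite_S]) (auto simp: gcentralizer_def)
  have "card (CS R) = card (h ` CS R)" using F.fmor_card[OF h(1) CRV] by simp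
  also have "\<dots> \<le> card (CS (h ` R))" using card_mono[OF fin hC] .
  also have "\<dots> \<le> card (CS P)" using max[OF b(1) bS] im by simp
  finally have le: "card (CS R) \<le> card (CS P)" .
  have CSP: "psubgroup (GL P) p (CS P)" "CS P \<subseteq> CL P" "sub (CS P)"
  proof -
    show s: "sub (CS P)" using F.sgr_CS[OF sub_S[OF Ps]] .
    show c: "CS P \<subseteq> CL P" using CS_eq[OF Ps] by blast
    show "psubgroup (GL P) p (CS P)" using psub_GL[OF P s] c CL_sub_NL by blast
  qed
  obtain B where B: "sylow_in (GL P) p (CL P) B" "CS P \<subseteq> B"
    using GP.sylow_in_extends[OF subgroup_CL[OF P] CSP(1,2)] by blast
  have "card B = card (CS R)"
    using GP.sylow_in_card[OF subgroup_CL[OF P] B(1)] GR.sylow_in_card[OF subgroup_CL[OF R(1)] CS_sylow[OF g(2)]]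
      card_CL[OF g(1)] by simp
  then have "CS P = B"
    using card_seteq[OF GP.finite_subgroup[OF sylow_inD(3)[OF B(1)]] B(2)] le by simp
  then have syl: "sylow_in (GL P) p (CL P) (CS P)" using B(1) by simp
  let ?D = "p_core p (GL P) \<inter> CL P"
  note D = core_centralizer[OF P syl]
  have DS: "?D \<subseteq> S" using D(2) sub_S[OF CSP(3)] by (rule subset_trans)
  have Ds: "sub ?D" using D(1) sub_of_S[OF NL_partial[OF P] _ DS] CL_sub_NL by blast
  have DN: "?D \<subseteq> NS P" using D(2) F.CS_sub_NS[OF Ps] by (rule subset_trans)
  let ?W = "?D <#>\<^bsub>grp_on L S\<^esub> P"
  have W: "sub ?W" "?D \<subseteq> ?W" "P \<subseteq> ?W"
    using F.sgr_set_mult[OF Ds Ps DN] F.sub_set_mult[OF Ds Ps] by simp_all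
  have "?D \<subseteq> CS ?V" using D(2) anti[OF Int_lower1, of P "LF.ZQ"] by (rule subset_trans)
  then have "?D \<subseteq> NS ?V" using F.CS_sub_NS[OF V] by (rule subset_trans)
  then have WV: "?W \<subseteq> NS ?V" using F.set_mult_least[OF F.sgr_NS[OF V] _ PV] by blast
  fix c assume c: "c \<in> CL P"
  have cN: "c \<in> NL P" using c CL_sub_NL by blast
  have cc: "chain P [c] P" using cN mem_NL_iff[OF P] by blast
  have ccar: "c \<in> carrier L" using subsetD[OF NL_carrier cN] .
  have cP: "pconj L x c = x" if "x \<in> P" for x using c that by (simp add: pcentralizer_def)
  have DNL: "x \<in> NL P" if "x \<in> ?D" for x using that CL_sub_NL by blast
  have "?D \<subseteq> S_sub L S c"
  proof
    fix x assume x: "x \<in> ?D"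
    have "gconj (GL P) x c \<in> ?D" using GP.p_core_gconj[of x c] CL_normal[OF P cN] x cN by simp
    then have "pconj L x c \<in> S" using GL_gconj[OF P DNL[OF x] cN] DS by auto
    then show "x \<in> S_sub L S c" using chain_conj(1)[OF cc DNL[OF x]] x DS by (auto simp: S_sub_def)
  qed
  then have WS: "?W \<subseteq> S_sub L S c" using F.set_mult_least[OF sub_S_sub[OF ccar] _ chain_S_sub[OF cc]] by blast
  have fc: "fmor F ?W (\<lambda>x. pconj L x c)" using F.fmor_mono[OF S_sub_fmor[OF ccar] W(1) WS] .
  have "(\<lambda>x. pconj L x c) ` ?V \<subseteq> LF.ZQ" using cP by auto
  moreover have "?V \<subseteq> ?W" using W(3) by blast
  ultimately obtain m where m: "m \<in> M" "\<forall>x\<in>?W. pconj L x c = cM x m"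
    using realize[OF V Int_lower2 nt _ WV fc] by blast
  have mp: "pconj L x m = pconj L x c" if "x \<in> ?W" for x
    using m that M_pconj[OF _ m(1), of x] sub_M[OF W(1)] by auto
  have mP: "pconj L x m = x" if "x \<in> P" for x using mp[of x] cP[OF that] that W(3) by auto
  have "P \<subseteq> S_sub L S m"
    by (rule M_S_sub[OF m(1) sub_S[OF Ps]]) (use mP M_pconj[OF PM m(1)] sub_S[OF Ps] in auto)
  then have "chain P [m] (pconj_set L P m)" using chainI[OF P subsetD[OF NL_carrier m(1)]] by blast
  moreover have "pconj_set L P m = P" using mP by (simp add: pconj_set_def)
  ultimately have mN: "m \<in> NL P" using mem_NL_iff[OF P] by simp
  \<comment> \<open>\<open>?d\<close> acts trivially on \<open>P\<close> and on \<open>?D\<close>,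
    so \<open>characteristic_p_normal\<close> puts it into the \<open>p\<close>-core; with
    \<open>CL P\<close> the core intersects in \<open>?D\<close>, a subgroup of \<open>S\<close> and
    thus of \<open>M\<close>.\<close>
  let ?d = "c \<otimes>\<^bsub>GL P\<^esub> inv\<^bsub>GL P\<^esub> m"
  have im: "inv\<^bsub>GL P\<^esub> m \<in> NL P" using GP.inv_closed[of m] mN by simp
  have dN: "?d \<in> NL P" using GP.m_closed[of c "inv\<^bsub>GL P\<^esub> m"] cN im by (simp del: grp_on_simps(3))
  have fix_d: "gconj (GL P) x ?d = x" if x: "x \<in> ?W" "x \<in> NL P" for x
  proof -
    have "gconj (GL P) x ?d = gconj (GL P) (gconj (GL P) x c) (inv\<^bsub>GL P\<^esub> m)"
      using GP.gconj_comp[of x c "inv\<^bsub>GL P\<^esub> m"] x(2) cN im by (simp del: grp_on_simps(3))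
    also have "gconj (GL P) x c = gconj (GL P) x m"
      using GL_gconj[OF P x(2) cN] GL_gconj[OF P x(2) mN] mp[OF x(1)] by simp
    finally show ?thesis using GP.gconj_cancel(1)[of x m] x(2) mN by simp
  qed
  have dC: "?d \<in> CL P" using mem_CL_iff[OF P dN] fix_d W(3) obj_sub_NL[OF P] by blast
  have "?d \<in> p_core p (GL P)"
  proof (rule GP.characteristic_p_normal[OF _ subgroup_CL[OF P] _ dC])
    show "characteristic_p p (GL P)" using char_p P by (simp add: objective_characteristic_p_def)
    show "gconj (GL P) c g \<in> CL P" if "g \<in> carrier (GL P)" "c \<in> CL P" for g c
      using CL_normal[OF P _ that(2)] that(1) by simp
    fix z assume z: "z \<in> ?D"
    have "gconj (GL P) z ?d = z" using fix_d[OF subsetD[OF W(2) z] DNL[OF z]] .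
    then show "?d \<otimes>\<^bsub>GL P\<^esub> z = z \<otimes>\<^bsub>GL P\<^esub> ?d"
      using GP.gconj_eq_self_iff[of z ?d] DNL[OF z] dN by (simp del: grp_on_simps(3))
  qed
  then have dM: "?d \<in> M" using dC DS S_M by blast
  have "c = ?d \<otimes>\<^bsub>GL P\<^esub> m"
    using GP.m_assoc[of c "inv\<^bsub>GL P\<^esub> m" m] GP.l_inv[of m] GP.r_one[of c] cN mN im by (simp del: grp_on_simps(2,3))
  also have "\<dots> = wprod L [?d, m]" using grp_on_simps(3)[OF dN mN] .
  also have "\<dots> = ?d \<otimes>\<^bsub>GL T\<^esub> m" using grp_on_simps(3)[OF dM m(1)] by simp
  finally show "c \<in> M" using M_closed(2)[OF dM m(1)] by simp
qed

text \<open>The maximality assumption is met by a suitable conjugate of \<open>P\<close> under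
  \<open>M\<close>, and conjugating back by an element of \<open>M\<close> returns the conclusion to
  \<open>P\<close>.\<close>

lemma CL_sub_M:
  assumes P: "P \<in> \<Delta>" and nt: "P \<inter> LF.ZQ \<noteq> {\<one>\<^bsub>grp_on L S\<^esub>}" shows "CL P \<subseteq> M"
proof -
  have Ps: "sub P" using objects[OF P] .
  have PM: "x \<in> M" if "x \<in> P" for x using that sub_M[OF Ps] by blast
  let ?I = "\<lambda>a. (\<lambda>x. cM x a) ` P"
  define X where "X = {card (CS (?I a)) |a. a \<in> M \<and> ?I a \<subseteq> S}"
  have fin: "finite X"
  proof (rule finite_subset[of _ "{..card S}"])
    have "CS A \<subseteq> S" for A by (auto simp: gcentralizer_def)
    then show "X \<subseteq> {..card S}" by (auto simp: X_def intro!: card_mono)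
  qed simp
  have one: "\<one>\<^bsub>GL T\<^esub> \<in> M" using M.one_closed by simp
  have "cM x \<one>\<^bsub>GL T\<^esub> = x" if "x \<in> P" for x using M.gconj_one[of x] PM[OF that] by simp
  then have "?I \<one>\<^bsub>GL T\<^esub> = P" by simp
  then have "X \<noteq> {}" using one sub_S[OF Ps] unfolding X_def by blast
  moreover have "\<exists>a. a \<in> M \<and> ?I a \<subseteq> S \<and> card (CS (?I a)) = y" if "y \<in> X" for y
    using that unfolding X_def by blast
  ultimately obtain a where a: "a \<in> M" "?I a \<subseteq> S" "card (CS (?I a)) = Max X" using Max_in[OF fin] by metis
  have c: "chain P [a] (?I a)"
  proof -
    have "P \<subseteq> S_sub L S a" by (rule M_S_sub[OF a(1) sub_S[OF Ps]]) (use a(2) in blast)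
    then have "chain P [a] (pconj_set L P a)" using chainI[OF P subsetD[OF NL_carrier a(1)]] by blast
    moreover have "pconj_set L P a = ?I a"
      unfolding pconj_set_def using M_pconj[OF PM a(1)] by (intro image_cong) auto
    ultimately show ?thesis by simp
  qed
  have "CL (?I a) \<subseteq> M"
  proof (rule CL_sub_M_maximal)
    show "?I a \<in> \<Delta>" using chain_objects[OF c] by blast
    show "?I a \<inter> LF.ZQ \<noteq> {\<one>\<^bsub>grp_on L S\<^esub>}"
    proof
      assume eq: "?I a \<inter> LF.ZQ = {\<one>\<^bsub>grp_on L S\<^esub>}"
      have "\<one>\<^bsub>grp_on L S\<^esub> \<in> P \<inter> LF.ZQ" using subgroup.one_closed[OF Ps] subgroup.one_closed[OF LF.ZQ_sgr] by blast
      then obtain u where u: "u \<in> P" "u \<in> LF.ZQ" "u \<noteq> \<one>\<^bsub>grp_on L S\<^esub>" using nt by blast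
      have "cM u a = \<one>\<^bsub>GL T\<^esub>" using eq M_Q(2)[OF a(1) u(2)] u(1) by auto
      then have "cM u a = cM \<one>\<^bsub>GL T\<^esub> a" using M.one_gconj[of a] a(1) by simp
      then have "u = \<one>\<^bsub>GL T\<^esub>" using M.gconj_inj[of u "\<one>\<^bsub>GL T\<^esub>" a] PM[OF u(1)] a(1) M.one_closed by (simp del: grp_on_simps(2))
      then show False using u(3) by simp
    qed
    fix b assume b: "b \<in> M" "\<And>x. x \<in> ?I a \<Longrightarrow> cM x b \<in> S"
    have ab: "a \<otimes>\<^bsub>GL T\<^esub> b \<in> M" using M_closed a b by blast
    have "(\<lambda>x. cM x b) ` ?I a = ?I (a \<otimes>\<^bsub>GL T\<^esub> b)"
      unfolding image_image using cM_comp[OF PM a(1) b(1)] by (intro image_cong) auto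
    moreover have "(\<lambda>x. cM x b) ` ?I a \<subseteq> S" using b(2) by blast
    ultimately have "card (CS ((\<lambda>x. cM x b) ` ?I a)) \<in> X" using ab unfolding X_def by auto
    then show "card (CS ((\<lambda>x. cM x b) ` ?I a)) \<le> card (CS (?I a))" using a(3) Max_ge[OF fin] by simp
  qed
  show ?thesis
  proof
    fix x assume x: "x \<in> CL P"
    have xN: "x \<in> NL P" using x CL_sub_NL by blast
    have "pconj L x a \<in> M" using chain_CL[OF c x] \<open>CL (?I a) \<subseteq> M\<close> by blast
    moreover have "x = pconj L (pconj L x a) (pinv L a)" using chain_conj_back[OF c xN] by simp
    moreover have "pinv L a \<in> M" using M_closed(1)[OF a(1)] inv_grp_on[OF NL_partial[OF T_object] a(1)] by simp
    ultimately show "x \<in> M" using M_pconj M_closed(3) by metis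
  qed
qed

text \<open>The product of \<open>f\<close> with the inverse of the matching element
  \<open>m\<close> centralizes \<open>S_f\<close>, and \<open>S_f\<close> meets \<open>Z(Q)\<close>
  nontrivially because it contains \<open>U\<close>.\<close>

lemma normalizer_sub_M:
  assumes U: "sub U" "U \<subseteq> LF.ZQ" "U \<noteq> {\<one>\<^bsub>grp_on L S\<^esub>}" shows "NL U \<subseteq> M"
proof
  fix f assume f: "f \<in> NL U"
  have fc: "f \<in> carrier L" using subsetD[OF NL_carrier f] .
  let ?P = "S_sub L S f"
  have P: "?P \<in> \<Delta>" "sub ?P" using S_sub_object sub_S_sub fc by blast+
  obtain m where m: "m \<in> M" "\<forall>x\<in>?P. pconj L x f = cM x m" using agree_normalizer(2)[OF U f] by blast
  have PM: "x \<in> M" if "x \<in> ?P" for x using that sub_M[OF P(2)] by blast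
  have mc: "m \<in> carrier L" using subsetD[OF NL_carrier m(1)] .
  let ?R = "pconj_set L ?P f"
  have fch: "chain ?P [f] ?R" using chainI[OF P(1) fc subset_refl] .
  have mp: "pconj L x m = pconj L x f" if "x \<in> ?P" for x using m M_pconj[OF PM m(1)] that by auto
  have "?P \<subseteq> S_sub L S m"
  proof (rule M_S_sub[OF m(1) sub_S[OF P(2)]])
    fix x assume x: "x \<in> ?P"
    then have "pconj L x f \<in> S" by (simp add: S_sub_def)
    then show "cM x m \<in> S" using bspec[OF m(2) x] by simp
  qed
  then have "chain ?P [m] (pconj_set L ?P m)" using chainI[OF P(1) mc] by blast
  moreover have "pconj_set L ?P m = ?R" unfolding pconj_set_def using mp by (intro image_cong) auto
  ultimately have mch: "chain ?P [m] ?R" by simp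
  have ich: "chain ?R [pinv L m] ?P" using chain_inv_single[OF mch] .
  let ?c = "wprod L [f, pinv L m]"
  have cc: "chain ?P [?c] ?P" using chain_comp(1)[OF fch ich] .
  have cN: "?c \<in> NL ?P" using cc mem_NL_iff[OF P(1)] by blast
  have "pconj L x ?c = x" if x: "x \<in> ?P" for x
  proof -
    have xN: "x \<in> NL ?P" using subsetD[OF obj_sub_NL[OF P(1)] x] .
    show ?thesis using chain_comp(2)[OF fch ich xN] mp[OF x] chain_conj_back[OF mch xN] by simp
  qed
  then have "?c \<in> CL ?P" using cc by (simp add: pcentralizer_def chain_single)
  moreover have "?P \<inter> LF.ZQ \<noteq> {\<one>\<^bsub>grp_on L S\<^esub>}"
    using agree_normalizer(1)[OF U f] U(2,3) subgroup.one_closed[OF U(1)] by blast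
  ultimately have cM: "?c \<in> M" using CL_sub_M[OF P(1)] by blast
  have "chain ?P ([f] @ [pinv L m] @ [m]) ?R" unfolding chain_append using fch ich mch by blast
  then have d: "[f, pinv L m, m] \<in> wdom L" using chain_dom by fastforce
  have "wprod L [?c, m] = wprod L [f, pinv L m, m]" using prod_append[of "[]" "[f, pinv L m]" "[m]"] d by simp
  also have "\<dots> = f" using prod_cancel'[of "[f]" m "[]"] d mc dom_single[OF fc] prod_single[OF fc] by simp
  finally have "f = ?c \<otimes>\<^bsub>GL T\<^esub> m" using grp_on_simps(3)[OF cM m(1)] by simp
  then show "f \<in> M" using M_closed(2)[OF cM m(1)] by simp
qed

text \<open>As \<open>Q\<close> need not be an object, the argument takes place in the normalizer of
  \<open>S_f\<close>, which contains \<open>Q\<close>. There \<open>f\<close> acts trivially modulo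
  \<open>Q\<close>, so its power with exponent \<open>card Q\<close> centralizes the centric object
  \<open>S_f\<close> and lies in it. Hence \<open>f\<close> belongs to a \<open>p\<close>-subgroup
  and can be conjugated into \<open>S\<close> by a map preserving \<open>Q\<close>, where
  \<open>C_S(Q) \<le> Q\<close> applies.\<close>

lemma centralizer_sub_Q: "CL Q \<subseteq> Q"
proof
  have Qs: "sub Q" "Q \<subseteq> S" using LF.Q_sgr sub_S by blast+
  fix f assume f: "f \<in> CL Q"
  have fc: "f \<in> carrier L" "Q \<subseteq> conj_dom L f" "\<And>q. q \<in> Q \<Longrightarrow> pconj L q f = q"
    using f by (auto simp: pcentralizer_def)
  let ?P = "S_sub L S f"
  have P: "?P \<in> \<Delta>" "sub ?P" using S_sub_object sub_S_sub fc(1) by blast+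
  have QP: "Q \<subseteq> ?P" using fc Qs(2) by (auto simp: S_sub_def)
  note fm = S_sub_fmor[OF fc(1)]
  have PS: "x \<in> S" "pconj L x f \<in> S" if "x \<in> ?P" for x using that by (auto simp: S_sub_def)
  have z: "\<exists>z\<in>Q. pconj L x f = x \<otimes>\<^bsub>grp_on L S\<^esub> z" if x: "x \<in> ?P" for x
  proof -
    let ?z = "inv\<^bsub>grp_on L S\<^esub> x \<otimes>\<^bsub>grp_on L S\<^esub> pconj L x f"
    note xS = PS[OF x]
    have ix: "inv\<^bsub>grp_on L S\<^esub> x \<in> S" using S.inv_closed[of x] xS by simp
    have zS: "?z \<in> S" using S.m_closed[of "inv\<^bsub>grp_on L S\<^esub> x" "pconj L x f"] ix xS by simp
    have "gconj (grp_on L S) q ?z = q" if q: "q \<in> Q" for q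
    proof -
      let ?q = "gconj (grp_on L S) q (inv\<^bsub>grp_on L S\<^esub> x)"
      have qS: "q \<in> S" using q Qs by blast
      have qQ: "?q \<in> Q" using F.NS_gconj[OF Qs(1) _ q] LF.NS_Q ix by simp
      have "gconj (grp_on L S) q ?z = gconj (grp_on L S) ?q (pconj L x f)"
        using S.gconj_comp[of q "inv\<^bsub>grp_on L S\<^esub> x" "pconj L x f"] qS ix xS by simp
      also have "\<dots> = gconj (grp_on L S) (pconj L ?q f) (pconj L x f)" using fc(3)[OF qQ] by simp
      also have "\<dots> = pconj L (gconj (grp_on L S) ?q x) f"
        using F.fmor_gconj[OF fm subsetD[OF QP qQ] x] by simp
      also have "gconj (grp_on L S) ?q x = q" using S.gconj_cancel(2)[of q x] qS xS by simp
      finally show ?thesis using fc(3)[OF q] by simp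
    qed
    then have "?z \<in> CS Q" using F.mem_CS_iff[OF Qs(2)] zS by blast
    then have "?z \<in> Q" using LF.Q_centralizer by blast
    moreover have "pconj L x f = x \<otimes>\<^bsub>grp_on L S\<^esub> ?z"
      using S.inv_cancel_left(2)[of x "pconj L x f"] xS by (simp del: grp_on_simps(3))
    ultimately show ?thesis by blast
  qed
  have Pcl: "pconj L x f \<in> ?P" if x: "x \<in> ?P" for x
  proof -
    obtain z where "z \<in> Q" "pconj L x f = x \<otimes>\<^bsub>grp_on L S\<^esub> z" using z[OF x] by blast
    then show ?thesis using subgroup.m_closed[OF P(2) x subsetD[OF QP]] by simp
  qed
  have "pconj_set L ?P f = ?P"
    unfolding pconj_set_def
    by (rule card_subset_eq[OF finite_subset[OF sub_S[OF P(2)] finite_S]])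
      (use Pcl F.fmor_card[OF fm subset_refl] in auto)
  then have fch: "chain ?P [f] ?P" using chainI[OF P(1) fc(1) subset_refl] by simp
  have fN: "f \<in> NL ?P" using fch mem_NL_iff[OF P(1)] by blast
  interpret GP: finite_group "GL ?P" p using finite_group_GL[OF P(1)] .
  have PN: "x \<in> NL ?P" if "x \<in> ?P" for x using subsetD[OF obj_sub_NL[OF P(1)] that] .
  have QG: "subgroup Q (GL ?P)" using sub_of_S[OF NL_partial[OF P(1)] _ Qs(2)] Qs(1) QP PN by blast
  obtain k where k: "card Q = p ^ k" using F.psubgroup_S[OF Qs(1)] by (auto simp: psubgroup_def)
  let ?fk = "f [^]\<^bsub>GL ?P\<^esub> (p ^ k :: nat)"
  have fkN: "?fk \<in> NL ?P" using GP.nat_pow_closed[of f "p ^ k"] fN by simp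
  have "gconj (GL ?P) x ?fk = x" if x: "x \<in> ?P" for x
  proof -
    obtain z where z: "z \<in> Q" "pconj L x f = x \<otimes>\<^bsub>grp_on L S\<^esub> z" using z[OF x] by blast
    have zN: "z \<in> NL ?P" "z \<in> S" using z(1) QP PN Qs(2) by blast+
    have "gconj (GL ?P) x f = x \<otimes>\<^bsub>GL ?P\<^esub> z"
      using GL_gconj[OF P(1) PN[OF x] fN] z(2) grp_on_simps(3)[OF PN[OF x] zN(1)] grp_on_simps(3)[OF PS(1)[OF x] zN(2)]
      by simp
    moreover have "gconj (GL ?P) z f = z" using GL_gconj[OF P(1) zN(1) fN] fc(3)[OF z(1)] by simp
    ultimately have "gconj (GL ?P) x ?fk = x \<otimes>\<^bsub>GL ?P\<^esub> z [^]\<^bsub>GL ?P\<^esub> (p ^ k :: nat)"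
      using GP.gconj_pow_central[of x f z] PN[OF x] fN zN(1) by (simp del: grp_on_simps(3))
    also have "z [^]\<^bsub>GL ?P\<^esub> (p ^ k :: nat) = \<one>\<^bsub>GL ?P\<^esub>" using GP.pow_card_subgroup[OF QG z(1)] k by simp
    finally show ?thesis using GP.r_one[of x] PN[OF x] by (simp del: grp_on_simps(2,3))
  qed
  then have "?fk \<in> CL ?P" using mem_CL_iff[OF P(1) fkN] by blast
  then have fkP: "?fk \<in> ?P"
    using centric_object_centralizer[OF char_p P(1) LF.over_Q_centric[OF P(2) QP]] by blast
  have Pp: "psubgroup (GL ?P) p ?P" using psub_GL[OF P(1,2) obj_sub_NL[OF P(1)]] .
  obtain H where H: "psubgroup (GL ?P) p H" "f \<in> H"
    using GP.psubgroup_mult_generate[OF Pp _ _ fkP] fN Pcl GL_gconj[OF P(1) PN fN] by auto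
  have HN: "H \<subseteq> NL ?P" using subgroup.subset[OF GP.psubgroup_subgroup[OF H(1)]] by simp
  obtain g R where g: "chain ?P [g] R" "fully_normalized R" using exists_fully_normalized[OF P(1)] by blast
  have R: "R \<in> \<Delta>" using chain_objects g(1) by blast
  have imp: "psubgroup (GL R) p ((\<lambda>x. pconj L x g) ` H)" using chain_psub_image[OF g(1) H(1)] .
  have imN: "(\<lambda>x. pconj L x g) ` H \<subseteq> NL R" using chain_conj(2)[OF g(1)] HN by blast
  obtain l where l: "l \<in> NL R" "\<forall>a\<in>(\<lambda>x. pconj L x g) ` H. gconj (GL R) a l \<in> NS R"
    using sylow_inD(4)[OF _ imp imN] g(2) unfolding fully_normalized_def by blast
  have lc: "chain R [l] R" using l(1) mem_NL_iff[OF R] by blast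
  define m where "m = wprod L [g, l]"
  have m: "chain ?P [m] R" unfolding m_def using chain_comp(1)[OF g(1) lc] .
  have "pconj L f m = gconj (GL R) (pconj L f g) l"
    unfolding m_def using chain_comp(2)[OF g(1) lc fN] GL_gconj[OF R chain_conj(2)[OF g(1) fN] l(1)] by simp
  then have "pconj L f m \<in> NS R" using l(2) H(2) by simp
  then have fS: "pconj L f m \<in> S" using F.NS_sub[OF objects[OF R]] by blast
  note mf = chain_fmor[OF m]
  have Qm: "(\<lambda>x. pconj L x m) ` Q = Q" using LF.Q_weakly_closed[OF mf(1) QP] .
  have "gconj (grp_on L S) q (pconj L f m) = q" if q: "q \<in> Q" for q
  proof -
    have "q \<in> (\<lambda>x. pconj L x m) ` Q" using q Qm by simp
    then obtain r where r: "q = pconj L r m" "r \<in> Q" by (rule imageE)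
    have rN: "r \<in> NL ?P" using r(2) QP PN by blast
    have "gconj (grp_on L S) q (pconj L f m) = pconj L q (pconj L f m)" using S_pconj(1)[OF _ fS] q Qs(2) by auto
    also have "\<dots> = gconj (GL R) q (pconj L f m)"
      using GL_gconj[OF R chain_conj(2)[OF m rN] chain_conj(2)[OF m fN]] r(1) by simp
    also have "\<dots> = pconj L (gconj (GL ?P) r f) m" using chain_gconj[OF m rN fN] r(1) by simp
    also have "gconj (GL ?P) r f = r" using GL_gconj[OF P(1) rN fN] fc(3)[OF r(2)] by simp
    finally show ?thesis using r(1) by simp
  qed
  then have "pconj L f m \<in> CS Q" using F.mem_CS_iff[OF Qs(2)] fS by blast
  then have "pconj L f m \<in> (\<lambda>x. pconj L x m) ` Q" using LF.Q_centralizer Qm by blast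
  then obtain q where q: "pconj L f m = pconj L q m" "q \<in> Q" by (rule imageE)
  have "q \<in> NL ?P" using q(2) QP PN by blast
  then have "f = q" using inj_onD[OF chain_conj_inj[OF m] q(1) fN] by blast
  then show "f \<in> Q" using q(2) by simp
qed

theorem large_in_localityI: "large_in_locality L S Q"
proof -
  have "NL U \<subseteq> NL Q" if "sub U" "U \<subseteq> center_of (grp_on L S) Q" "U \<noteq> {\<one>\<^bsub>grp_on L S\<^esub>}" for U
    using normalizer_sub_M[OF that(1) _ that(3)] that(2) M_Q(1) LF.ZQ_def by auto
  then show ?thesis using LF.Q_sgr centralizer_sub_Q unfolding large_in_locality_def by blast
qed

end

lemma large_in_linking_locality:
  assumes "linking_locality p L \<Delta> S" "large_in_fusion (locality_fusion p L S) Q"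
  shows "large_in_locality L S Q"
proof -
  have "locality p L \<Delta> S" using assms(1) by (simp add: linking_locality_def)
  then interpret large_linking p L \<Delta> S Q
    using assms by (simp add: large_linking_def large_linking_axioms_def)
  show ?thesis by (rule large_in_localityI)
qed

theorem lemma4p10:
  fixes p :: nat and L :: "'a pgroup" and \<Delta> :: "'a set set" and S Q :: "'a set" and F :: "'a fusion"
  assumes "locality_over p L \<Delta> S F"
    and "subgroup Q (grp_on L S)"
  shows
    "(large_in_locality L S Q \<and> replete L \<Delta> S Q \<longrightarrow>
        large_in_fusion F Q \<and> centric_subgroups F \<subseteq> \<Delta> \<and> saturated p F) \<and>
     (replete L \<Delta> S Q \<and> objective_characteristic_p p L \<Delta> \<longrightarrow>
        (large_in_locality L S Q \<longleftrightarrow> large_in_fusion F Q) \<and>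
        (large_in_locality L S Q \<longrightarrow>
           saturated p F \<and> linking_locality p L \<Delta> S \<and> locality_over p L \<Delta> S F)) \<and>
     (saturated p F \<and> large_in_fusion F Q \<longrightarrow>
        (\<forall>(L' :: 'a pgroup) \<Delta>'. linking_locality p L' \<Delta>' S \<and> locality_over p L' \<Delta>' S F \<longrightarrow>
           large_in_locality L' S Q))"
proof -
  have loc: "locality p L \<Delta> S" and F: "F = locality_fusion p L S"
    using assms(1) by (simp_all add: locality_over_def)
  interpret locality p L \<Delta> S by (rule loc)
  have centric: "centric_subgroups F \<subseteq> \<Delta>" "saturated p F" if "replete L \<Delta> S Q"
    using replete_centric[OF assms(2) that] saturated_if_centric unfolding F by simp_all
  \<comment> \<open>Centric radical subgroups are in particular centric, hence objects; this lets
    (c) be applied to the given locality itself.\<close>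
  have link: "linking_locality p L \<Delta> S" if "replete L \<Delta> S Q" "objective_characteristic_p p L \<Delta>"
    using centric[OF that(1)] that(2) loc
    by (auto simp: linking_locality_def F centric_radical_subgroups_def)
  have "large_in_fusion F Q" if "large_in_locality L S Q" "replete L \<Delta> S Q"
    using large_in_fusionI[OF that] by (simp add: F)
  moreover have "large_in_locality L S Q"
    if "replete L \<Delta> S Q" "objective_characteristic_p p L \<Delta>" "large_in_fusion F Q"
    using large_in_linking_locality[OF link] that by (simp add: F)
  moreover have "large_in_locality L' S Q"
    if "large_in_fusion F Q" "linking_locality p L' \<Delta>' S" "locality_over p L' \<Delta>' S F" for L' :: "'a pgroup" and \<Delta>'
    using large_in_linking_locality[OF that(2)] that(1,3) by (simp add: locality_over_def)
  ultimately show ?thesis using centric link assms(1) by blast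
qed

end
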